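(* Let $N\ge 1$ and let $\Omega\subset\mathbb{R}^N$ be open and bounded. Let $K:\mathbb{R}^N\times\mathbb{R}^N\to[0,\infty)$ and $J:\mathbb{R}^N\to[0,\infty)$ be measurable, with $J$ not a.e. equal to zero, such that (1) $K(x,y)=K(y,x)$ for all $x,y\in\mathbb{R}^N$; (2) $x\mapsto\int_{\mathbb{R}^N}K(x,y)\min\{|x-y|^2,1\}\,dy$ belongs to $L^1_{loc}(\mathbb{R}^N)$; (3) $K(x,y)\ge J(x-y)$. Let $f\in L^2(\Omega)$ and let $c\in L^\infty(\Omega)$ satisfy $c\ge 0$ in $\Omega$. Let $u\in H_\Omega(\mathbb{R}^N,K)$ be the weak solution of $$\mathcal{L}u+cu=f\ \text{ in }\Omega,\qquad u=0\ \text{ on }\mathbb{R}^N\setminus\Omega,$$ and let $v\in H_{\Omega^\sharp}(\mathbb{R}^N,J^\sharp)$ be the weak solution of $$\mathcal{L}^\sharp v+c_\sharp v=f^\sharp\ \text{ in }\Omega^\sharp,\qquad v=0\ \text{ on }\mathbb{R}^N\setminus\Omega^\sharp,$$ where $\mathcal{L}$ is the nonlocal operator with kernel $K$ and $\mathcal{L}^\sharp$ is the nonlocal operator with kernel $J^\sharp(x-y)$ (both understood in the weak sense given in the context). Then $$\int_{B_r}u^\sharp(x)\,dx\le\int_{B_r}v(x)\,dx\qquad\text{for all } r>0,$$ where $B_r$ is the ball of radius $r$ centered at the origin. Moreover, $$\frac12\int_{\mathbb{R}^N}\int_{\mathbb{R}^N}K(x,y)(u(x)-u(y))^2\,dy\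,dx+\int_{\Omega}c(x)u^2(x)\,dx\le\frac12\int_{\mathbb{R}^N}\int_{\mathbb{R}^N}J^\sharp(x-y)(v(x)-v(y))^2\,dy\,dx+\int_{\Omega^\sharp}c_\sharp(x)v^2(x)\,dx.$$
   Context: Rearrangements. $\omega_N$ is the measure of the unit ball of $\mathbb{R}^N$. For a measurable set $E\subseteq\mathbb{R}^N$, $E^\sharp$ is the open ball centered at the origin with $|E^\sharp|=|E|$ ($E^\sharp=\mathbb{R}^N$ if $|E|=+\infty$). For a real measurable function $f$ on an open set $E$, $\mu_f(t)=|\{x\in E:|f(x)|>t\}|$, assumed finite for every $t>0$; $f^*(\sigma)=\sup\{t\ge0:\mu_f(t)>\sigma\}$ for $\sigma\ge0$ (with $\sup\emptyset=0$); the radially decreasing (Schwarz) rearrangement is $f^\sharp(x)=f^*(\omega_N|x|^N)$, $x\in E^\sharp$. If $E$ is bounded, $f_*(\sigma)=f^*(|E|-\sigma)$ for $\sigma\in(0,|E|)$ and the radially increasing rearrangement is $f_\sharp(x)=f_*(\omega_N|x|^N)$, $x\in E^\sharp$. $J^\sharp$ is the Schwarz rearrangement of $J$ on $\mathbb{R}^N$. Functions $u^\sharp$, $v$ are extended by $0$ outside $\Omega^\sharp$. Function spaces. For a nonnegative symmetric measurable kernel $k(x,y)$, $H(\mathbb{R}^N,k)$ is the set of $u\in L^2(\mathbb{R}^N)$ with $\int_{\mathbb{R}^N}\int_{\mathbb{R}^N}|u(x)-u(y)|^2k(x,y)\,dy\,dx<\infty$, and for an open bounded set $E$, $H_E(\mathbb{R}^N,k)=\{u\in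 H(\mathbb{R}^N,k):u=0\text{ a.e. in }\mathbb{R}^N\setminus E\}$. For the symmetrized problem the kernel is $k(x,y)=J^\sharp(x-y)$, and the space is denoted $H_{\Omega^\sharp}(\mathbb{R}^N,J^\sharp)$. Weak solutions. For a bounded nonnegative function $a$ on $E$ and $g\in L^2(E)$, a weak solution of the Dirichlet problem on $E$ for the operator with kernel $k$, zero-order coefficient $a$ and datum $g$ is a function $u\in H_E(\mathbb{R}^N,k)$ such that for all $\varphi\in H_E(\mathbb{R}^N,k)$ $$\frac12\int_{\mathbb{R}^N}\int_{\mathbb{R}^N}k(x,y)(u(x)-u(y))(\varphi(x)-\varphi(y))\,dy\,dx+\int_E a\,u\,\varphi\,dx=\int_E g\,\varphi\,dx.$$ Here $(E,k,a,g)=(\Omega,K,c,f)$ for $u$ and $(E,k,a,g)=(\Omega^\sharp,J^\sharp(x-y),c_\sharp,f^\sharp)$ for $v$. Under the stated hypotheses these weak solutions exist and are unique. *)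

theory Defs
  imports "HOL-Analysis.Analysis"
begin

text \<open>
  Euclidean space of dimension \<open>N\<close> is an arbitrary \<open>'a::euclidean_space\<close> with \<open>N = DIM('a)\<close>,
  and measurable means Lebesgue measurable. A function on a set \<open>E\<close> is a total function whose
  values outside \<open>E\<close> are not used.
\<close>

section \<open>Rearrangements\<close>

text \<open>The quantity \<open>\<omega>\<^sub>N |x|\<^sup>N\<close>.\<close>

definition radial_vol :: "'a::euclidean_space \<Rightarrow> real" where
  "radial_vol x = measure lebesgue (ball (0::'a) 1) * norm x ^ DIM('a)"

definition sym_ball :: "'a::euclidean_space set \<Rightarrow> 'a set" where
  "sym_ball E =
     (if emeasure lebesgue E = \<infinity> then UNIV
      else ball 0 (root DIM('a) (measure lebesgue E / measure lebesgue (ball (0::'a) 1))))"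

lemma emeasure_sym_ball:
  fixes E :: "'a::euclidean_space set"
  shows "emeasure lebesgue (sym_ball E) = emeasure lebesgue E"
proof (cases "emeasure lebesgue E = \<infinity>")
  case True
  then show ?thesis by (simp add: sym_ball_def)
next
  case False
  define w where "w = measure lebesgue (ball (0::'a) 1)"
  have w: "w = unit_ball_vol (real DIM('a))"
    by (simp add: w_def content_ball)
  have wpos: "w > 0" by (simp add: w)
  define r where "r = root DIM('a) (measure lebesgue E / w)"
  have r0: "r \<ge> 0" using wpos by (simp add: r_def)
  have "r ^ DIM('a) = measure lebesgue E / w"
    using wpos by (simp add: r_def)
  then have "w * r ^ DIM('a) = measure lebesgue E"
    using wpos by simp
  then have "emeasure lebesgue (ball (0::'a) r) = ennreal (measure lebesgue E)"
    using r0 by (simp add: emeasure_ball w)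
  moreover have "sym_ball E = ball 0 r"
    using False by (simp add: sym_ball_def r_def w_def)
  ultimately show ?thesis
    using False by (metis emeasure_eq_ennreal_measure infinity_ennreal_def)
qed

definition distr_fun :: "'a::euclidean_space set \<Rightarrow> ('a \<Rightarrow> real) \<Rightarrow> real \<Rightarrow> ennreal" where
  "distr_fun E f t = emeasure lebesgue {x \<in> E. \<bar>f x\<bar> > t}"

text \<open>
  The supremum is taken in \<open>[0,\<infinity>]\<close>: it is \<open>0\<close> for the empty set, and it is infinite
  at \<open>\<sigma> = 0\<close> if \<open>f\<close> is essentially unbounded.
\<close>

definition decr_rearr :: "'a::euclidean_space set \<Rightarrow> ('a \<Rightarrow> real) \<Rightarrow> real \<Rightarrow> ennreal" where
  "decr_rearr E f \<sigma> = Sup (ennreal ` {t. t \<ge> 0 \<and> distr_fun E f t > ennreal \<sigma>})"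

text \<open>Meaningful for bounded \<open>E\<close> and \<open>\<sigma>\<close> in \<open>(0,|E|)\<close>.\<close>

definition incr_rearr :: "'a::euclidean_space set \<Rightarrow> ('a \<Rightarrow> real) \<Rightarrow> real \<Rightarrow> ennreal" where
  "incr_rearr E f \<sigma> = decr_rearr E f (measure lebesgue E - \<sigma>)"

text \<open>
  The radial rearrangements are real valued and extended by \<open>0\<close> outside \<open>sym_ball E\<close>. If all
  superlevel sets \<open>{|f| > t}\<close> with \<open>t > 0\<close> have finite measure, the one-dimensional
  rearrangement is finite on \<open>(0,\<infinity>)\<close>, so \<open>enn2real\<close> (which sends \<open>\<infinity>\<close> to \<open>0\<close>)
  only fixes a value at the origin.
\<close>

definition schwarz :: "'a::euclidean_space set \<Rightarrow> ('a \<Rightarrow> real) \<Rightarrow> 'a \<Rightarrow> real" where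
  "schwarz E f x = (if x \<in> sym_ball E then enn2real (decr_rearr E f (radial_vol x)) else 0)"

definition incr_schwarz :: "'a::euclidean_space set \<Rightarrow> ('a \<Rightarrow> real) \<Rightarrow> 'a \<Rightarrow> real" where
  "incr_schwarz E f x = (if x \<in> sym_ball E then enn2real (incr_rearr E f (radial_vol x)) else 0)"

section \<open>Function spaces and weak solutions\<close>

definition L2_on :: "'a::euclidean_space set \<Rightarrow> ('a \<Rightarrow> real) set" where
  "L2_on E = {f. f \<in> borel_measurable (lebesgue_on E) \<and>
                 integrable (lebesgue_on E) (\<lambda>x. (f x)\<^sup>2)}"

definition Linf_on :: "'a::euclidean_space set \<Rightarrow> ('a \<Rightarrow> real) set" where
  "Linf_on E = {f. f \<in> borel_measurable (lebesgue_on E) \<and>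
                   (\<exists>M. AE x in lebesgue_on E. \<bar>f x\<bar> \<le> M)}"

text \<open>For functions with values in \<open>[0,\<infinity>]\<close>.\<close>

definition L1_loc_nonneg :: "('a::euclidean_space \<Rightarrow> ennreal) \<Rightarrow> bool" where
  "L1_loc_nonneg h \<longleftrightarrow>
     h \<in> borel_measurable lebesgue \<and>
     (\<forall>C. compact C \<longrightarrow> (\<integral>\<^sup>+x\<in>C. h x \<partial>lebesgue) < \<infinity>)"

definition H_space :: "('a::euclidean_space \<Rightarrow> 'a \<Rightarrow> real) \<Rightarrow> ('a \<Rightarrow> real) set" where
  "H_space k = {u \<in> L2_on UNIV.
     (\<integral>\<^sup>+x. (\<integral>\<^sup>+y. ennreal (\<bar>u x - u y\<bar>\<^sup>2 * k x y) \<partial>lebesgue) \<partial>lebesgue) < \<infinity>}"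

definition H_dirichlet ::
  "'a::euclidean_space set \<Rightarrow> ('a \<Rightarrow> 'a \<Rightarrow> real) \<Rightarrow> ('a \<Rightarrow> real) set" where
  "H_dirichlet E k = {u \<in> H_space k. AE x in lebesgue. x \<notin> E \<longrightarrow> u x = 0}"

definition weak_solution ::
  "'a::euclidean_space set \<Rightarrow> ('a \<Rightarrow> 'a \<Rightarrow> real) \<Rightarrow> ('a \<Rightarrow> real) \<Rightarrow> ('a \<Rightarrow> real) \<Rightarrow>
   ('a \<Rightarrow> real) \<Rightarrow> bool" where
  "weak_solution E k a g u \<longleftrightarrow>
     u \<in> H_dirichlet E k \<and>
     (\<forall>\<phi> \<in> H_dirichlet E k.
        1 / 2 * (LINT x|lebesgue. (LINT y|lebesgue. k x y * (u x - u y) * (\<phi> x - \<phi> y)))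
          + (LINT x:E|lebesgue. a x * u x * \<phi> x)
        = (LINT x:E|lebesgue. g x * \<phi> x))"

end

theory Submission
  imports Defs
begin

text \<open>
  For bounded, compactly supported truncations \<open>J\<^sub>n\<close> of \<open>J\<close>, with integral \<open>j\<^sub>n\<close>, test the equation of
  \<open>u\<close> with approximations of the sign of \<open>u\<close> cut off to \<open>{|u| > t}\<close>. Since \<open>K(x,y) \<ge> J\<^sub>n(x - y)\<close>, the rearrangement
  inequalities of Riesz and Hardy-Littlewood turn this into
  \<open>\<integral>\<^bsub>B\<^esub> (j\<^sub>n + c\<^sub>\<sharp>) u\<^sup>\<sharp> \<le> \<integral>\<^bsub>B\<^esub> (f\<^sup>\<sharp> + J\<^sub>n\<^sup>\<sharp> * u\<^sup>\<sharp>)\<close> for \<open>B = {u\<^sup>\<sharp> > t}\<close>, and then for every centered ball \<open>B\<close> in \<open>\<Omega>\<^sup>\<sharp>\<close>.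
  In other words \<open>u\<^sup>\<sharp> \<prec> T u\<^sup>\<sharp>\<close>, where \<open>p \<prec> q\<close> means that \<open>q\<close> has at least the mass of \<open>p\<close> on each centered ball and
  \<open>T w = (f\<^sup>\<sharp> + J\<^sub>n\<^sup>\<sharp> * w) / (j\<^sub>n + c\<^sub>\<sharp>)\<close> on \<open>\<Omega>\<^sup>\<sharp>\<close>. The map \<open>T\<close> is monotone for \<open>\<prec>\<close> on radially decreasing functions, and its iterates
  minimise the energy of the symmetrized problem with kernel \<open>J\<^sub>n\<^sup>\<sharp>\<close>, so \<open>u\<^sup>\<sharp> \<prec> w\<^sub>n\<close> for some almost minimiser \<open>w\<^sub>n\<close>.
  By a Poincare inequality that is uniform in \<open>n\<close> the \<open>w\<^sub>n\<close> converge to \<open>v\<close>, hence \<open>u\<^sup>\<sharp> \<prec> v\<close>. The two energies are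
  \<open>\<integral> f u\<close> and \<open>\<integral> f\<^sup>\<sharp> v\<close>, and \<open>\<integral> f u \<le> \<integral> f\<^sup>\<sharp> u\<^sup>\<sharp> \<le> \<integral> f\<^sup>\<sharp> v\<close>. Riesz's inequality itself is reduced to dimension one by
  Steiner symmetrizations in a sequence of directions that rounds the three sets simultaneously.
\<close>

section \<open>Integration along lines and the Riesz functional\<close>

lemma nn_integral_lborel_translate:
  fixes f :: "'a::euclidean_space \<Rightarrow> ennreal"
  assumes [measurable]: "f \<in> borel_measurable borel"
  shows "(\<integral>\<^sup>+x. f (x + c) \<partial>lborel) = (\<integral>\<^sup>+x. f x \<partial>lborel)"
proof -
  have "(\<integral>\<^sup>+x. f x \<partial>lborel) = (\<integral>\<^sup>+x. f x \<partial>distr lborel borel ((+) c))"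
    by (simp add: lborel_distr_plus)
  also have "\<dots> = (\<integral>\<^sup>+x. f (c + x) \<partial>lborel)"
    by (subst nn_integral_distr) auto
  finally show ?thesis by (simp add: add.commute)
qed

lemma nn_integral_lborel_scale:
  fixes f :: "'a::euclidean_space \<Rightarrow> ennreal"
  assumes [measurable]: "f \<in> borel_measurable borel" and c: "c \<noteq> 0"
  shows "(\<integral>\<^sup>+x. f x \<partial>lborel) = ennreal (\<bar>c\<bar> ^ DIM('a)) * (\<integral>\<^sup>+x. f (c *\<^sub>R x) \<partial>lborel)"
proof -
  have "(\<integral>\<^sup>+x. f x \<partial>lborel)
      = (\<integral>\<^sup>+x. f x \<partial>density (distr lborel borel (\<lambda>x. 0 + c *\<^sub>R x)) (\<lambda>_. \<bar>c\<bar> ^ DIM('a)))"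
    by (subst lborel_affine[OF c, of 0]) simp
  also have "\<dots> = ennreal (\<bar>c\<bar> ^ DIM('a)) * (\<integral>\<^sup>+x. f (c *\<^sub>R x) \<partial>lborel)"
    by (simp add: nn_integral_density nn_integral_distr nn_integral_cmult)
  finally show ?thesis .
qed

lemma nn_integral_lborel_reflect:
  fixes f :: "'a::euclidean_space \<Rightarrow> ennreal"
  assumes [measurable]: "f \<in> borel_measurable borel"
  shows "(\<integral>\<^sup>+x. f (c - x) \<partial>lborel) = (\<integral>\<^sup>+x. f x \<partial>lborel)"
  using nn_integral_lborel_scale[of "\<lambda>x. f (x + c)" "-1"] nn_integral_lborel_translate[of f c]
  by simp

lemma nn_integral_indicator_translate:
  fixes A :: "'a::euclidean_space set"
  assumes [measurable]: "A \<in> sets borel"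
  shows "(\<integral>\<^sup>+x. indicator A (x + c) \<partial>lborel) = emeasure lborel A"
    and "(\<integral>\<^sup>+x. indicator A (c - x) \<partial>lborel) = emeasure lborel A"
    and "(\<integral>\<^sup>+x. indicator A (x - c) \<partial>lborel) = emeasure lborel A"
  using nn_integral_lborel_translate[of "indicator A" c] nn_integral_lborel_reflect[of "indicator A" c]
    nn_integral_lborel_translate[of "indicator A" "-c"]
  by auto

definition slab :: "'a::euclidean_space \<Rightarrow> 'a set" where
  "slab e = {y. 0 \<le> y \<bullet> e \<and> y \<bullet> e \<le> 1}"

lemma slab_measurable [measurable]: "slab e \<in> sets borel"
  unfolding slab_def by measurable

text \<open>Fubini along the direction \<open>e\<close>: averaging over translates along \<open>e\<close> replaces an orthogonal splitting
  of the space.\<close>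

lemma nn_integral_slab:
  fixes g :: "'a::euclidean_space \<Rightarrow> ennreal"
  assumes [measurable]: "g \<in> borel_measurable borel" and e: "norm e = 1"
  shows "(\<integral>\<^sup>+x. g x \<partial>lborel) = (\<integral>\<^sup>+y. indicator (slab e) y * (\<integral>\<^sup>+t. g (y + t *\<^sub>R e) \<partial>lborel) \<partial>lborel)"
proof -
  have ee: "e \<bullet> e = 1" using e by (simp add: dot_square_norm)
  have unit: "(\<integral>\<^sup>+t. indicator (slab e) (x + t *\<^sub>R e) \<partial>lborel) = 1" for x
  proof -
    have "(\<integral>\<^sup>+t. indicator (slab e) (x + t *\<^sub>R e) \<partial>lborel) = (\<integral>\<^sup>+t. indicator {-(x \<bullet> e)..1 - x \<bullet> e} t \<partial>lborel)"
      by (intro nn_integral_cong)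
        (auto simp: slab_def indicator_def inner_add_left ee)
    then show ?thesis by simp
  qed
  have "(\<integral>\<^sup>+x. g x \<partial>lborel) = (\<integral>\<^sup>+x. g x * (\<integral>\<^sup>+t. indicator (slab e) (x + t *\<^sub>R e) \<partial>lborel) \<partial>lborel)"
    by (simp add: unit)
  also have "\<dots> = (\<integral>\<^sup>+x. \<integral>\<^sup>+t. g x * indicator (slab e) (x + t *\<^sub>R e) \<partial>lborel \<partial>lborel)"
    by (simp add: nn_integral_cmult)
  also have "\<dots> = (\<integral>\<^sup>+t. \<integral>\<^sup>+x. g x * indicator (slab e) (x + t *\<^sub>R e) \<partial>lborel \<partial>lborel)"
    by (rule lborel_pair.Fubini'[symmetric]) measurable
  also have "\<dots> = (\<integral>\<^sup>+t. \<integral>\<^sup>+y. g (y - t *\<^sub>R e) * indicator (slab e) y \<partial>lborel \<partial>lborel)"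
  proof (rule nn_integral_cong)
    fix t :: real
    show "(\<integral>\<^sup>+x. g x * indicator (slab e) (x + t *\<^sub>R e) \<partial>lborel)
        = (\<integral>\<^sup>+y. g (y - t *\<^sub>R e) * indicator (slab e) y \<partial>lborel)"
      using nn_integral_lborel_translate[of "\<lambda>y. g (y - t *\<^sub>R e) * indicator (slab e) y" "t *\<^sub>R e"]
      by simp
  qed
  also have "\<dots> = (\<integral>\<^sup>+y. \<integral>\<^sup>+t. g (y - t *\<^sub>R e) * indicator (slab e) y \<partial>lborel \<partial>lborel)"
    by (rule lborel_pair.Fubini') measurable
  also have "\<dots> = (\<integral>\<^sup>+y. indicator (slab e) y * (\<integral>\<^sup>+t. g (y + t *\<^sub>R e) \<partial>lborel) \<partial>lborel)"
  proof (rule nn_integral_cong)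
    fix y :: 'a
    have "(\<integral>\<^sup>+t. g (y - t *\<^sub>R e) \<partial>lborel) = (\<integral>\<^sup>+t. g (y + t *\<^sub>R e) \<partial>lborel)"
      using nn_integral_lborel_reflect[of "\<lambda>t. g (y + t *\<^sub>R e)" 0] by simp
    then show "(\<integral>\<^sup>+t. g (y - t *\<^sub>R e) * indicator (slab e) y \<partial>lborel)
        = indicator (slab e) y * (\<integral>\<^sup>+t. g (y + t *\<^sub>R e) \<partial>lborel)"
      by (simp add: nn_integral_cmult mult.commute[of _ "indicator (slab e) y"])
  qed
  finally show ?thesis .
qed

definition riesz3 :: "'a::euclidean_space set \<Rightarrow> 'a set \<Rightarrow> 'a set \<Rightarrow> ennreal" where
  "riesz3 A B C = (\<integral>\<^sup>+x. \<integral>\<^sup>+y. indicator A x * indicator B (x - y) * indicator C y \<partial>lborel \<partial>lborel)"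

lemma riesz3_swap:
  assumes [measurable]: "A \<in> sets borel" "B \<in> sets borel" "C \<in> sets borel"
  shows "riesz3 A B C = (\<integral>\<^sup>+y. \<integral>\<^sup>+x. indicator A x * indicator B (x - y) * indicator C y \<partial>lborel \<partial>lborel)"
  unfolding riesz3_def by (rule lborel_pair.Fubini'[symmetric]) measurable

lemma riesz3_le:
  fixes A B C :: "'a::euclidean_space set"
  assumes [measurable]: "A \<in> sets borel" "B \<in> sets borel" "C \<in> sets borel"
  shows "riesz3 A B C \<le> emeasure lborel A * emeasure lborel C"
    and "riesz3 A B C \<le> emeasure lborel A * emeasure lborel B"
    and "riesz3 A B C \<le> emeasure lborel B * emeasure lborel C"
proof -
  have "riesz3 A B C \<le> (\<integral>\<^sup>+x. \<integral>\<^sup>+y. indicator A x * indicator C y \<partial>lborel \<partial>lborel)"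
    unfolding riesz3_def by (intro nn_integral_mono) (auto simp: indicator_def)
  then show "riesz3 A B C \<le> emeasure lborel A * emeasure lborel C"
    by (simp add: nn_integral_cmult nn_integral_multc)
  have "riesz3 A B C \<le> (\<integral>\<^sup>+x. \<integral>\<^sup>+y. indicator A x * indicator B (x - y) \<partial>lborel \<partial>lborel)"
    unfolding riesz3_def by (intro nn_integral_mono) (auto simp: indicator_def)
  then show "riesz3 A B C \<le> emeasure lborel A * emeasure lborel B"
    by (simp add: nn_integral_cmult nn_integral_multc nn_integral_indicator_translate)
  have "riesz3 A B C \<le> (\<integral>\<^sup>+y. \<integral>\<^sup>+x. indicator B (x - y) * indicator C y \<partial>lborel \<partial>lborel)"
    by (subst riesz3_swap) (auto intro!: nn_integral_mono simp: indicator_def)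
  then show "riesz3 A B C \<le> emeasure lborel B * emeasure lborel C"
    by (simp add: nn_integral_cmult nn_integral_multc nn_integral_indicator_translate)
qed

lemma tail_cut_exists:
  fixes A :: "real set"
  assumes A[measurable]: "A \<in> sets borel" and AM: "A \<subseteq> {-M..M}" and "0 \<le> M"
    and \<tau>: "0 \<le> \<tau>" "ennreal \<tau> \<le> emeasure lborel A"
  obtains p where "emeasure lborel (A \<inter> {p..}) = ennreal \<tau>"
proof -
  have fin: "emeasure lborel (A \<inter> S) < \<infinity>" for S
  proof (rule le_less_trans)
    show "emeasure lborel (A \<inter> S) \<le> emeasure lborel {-M..M}"
      using AM by (intro emeasure_mono) auto
  qed (use \<open>0 \<le> M\<close> in simp)
  define F where "F p = measure lborel (A \<inter> {p..})" for p
  have F: "emeasure lborel (A \<inter> {p..}) = ennreal (F p)" for p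
    unfolding F_def using fin[of "{p..}"] by (simp add: emeasure_eq_ennreal_measure)
  have diff: "F p \<le> F q + (q - p)" "F q \<le> F p" if "p \<le> q" for p q
  proof -
    have "emeasure lborel (A \<inter> {p..}) \<le> emeasure lborel ((A \<inter> {q..}) \<union> {p..q})"
      by (rule emeasure_mono) auto
    also have "\<dots> \<le> emeasure lborel (A \<inter> {q..}) + emeasure lborel {p..q}"
      by (rule emeasure_subadditive) auto
    finally have "ennreal (F p) \<le> ennreal (F q) + ennreal (q - p)"
      using that by (simp add: F)
    then show "F p \<le> F q + (q - p)"
      using that by (simp add: F_def flip: ennreal_plus)
    have "emeasure lborel (A \<inter> {q..}) \<le> emeasure lborel (A \<inter> {p..})"
      using that by (intro emeasure_mono) auto
    then show "F q \<le> F p" by (simp add: F) (simp add: F_def)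
  qed
  have "continuous_on {-M..M+1} (\<lambda>p. - F p)"
    unfolding continuous_on_iff
  proof (intro ballI allI impI)
    fix x e :: real assume "0 < e"
    have "dist (- F y) (- F x) < e" if "dist y x < e" for y
      using that diff[of x y] diff[of y x] by (cases "x \<le> y") (auto simp: dist_real_def)
    then show "\<exists>d>0. \<forall>x'\<in>{- M..M + 1}. dist x' x < d \<longrightarrow> dist (- F x') (- F x) < e"
      using \<open>0 < e\<close> by blast
  qed
  moreover have "A \<inter> {-M..} = A" "A \<inter> {M+1..} = {}" using AM by auto
  then have "\<tau> \<le> F (-M)" "F (M+1) = 0"
    using \<tau> F[of "-M"] F[of "M+1"] by (auto simp: F_def ennreal_le_iff)
  ultimately obtain p where "- F p = - \<tau>"
    using IVT'[of "\<lambda>p. - F p" "-M" "-\<tau>" "M+1"] \<open>0 \<le> M\<close> \<tau> by auto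
  then show ?thesis using that[of p] F[of p] by simp
qed

text \<open>Split off the part of \<open>A \<times> C\<close> where both coordinates lie to the left of the cuts \<open>p\<close> and \<open>q\<close>;
  on each line \<open>s - t = x\<close> the rest has length at most \<open>\<tau>\<close>.\<close>

lemma riesz3_real_upper:
  fixes A B C :: "real set"
  assumes [measurable]: "A \<in> sets borel" "B \<in> sets borel" "C \<in> sets borel"
    and bd: "bounded A" "bounded C"
    and a: "emeasure lborel A = ennreal a" "0 \<le> a"
    and b: "emeasure lborel B = ennreal b" "0 \<le> b"
    and c: "emeasure lborel C = ennreal c" "0 \<le> c"
    and \<tau>: "0 \<le> \<tau>" "\<tau> \<le> a" "\<tau> \<le> c"
  shows "riesz3 A B C \<le> ennreal ((a - \<tau>) * (c - \<tau>) + \<tau> * b)"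
proof -
  obtain M1 where "\<And>x. x \<in> A \<Longrightarrow> norm x \<le> M1" using bd(1) bounded_iff by metis
  moreover obtain M2 where "\<And>x. x \<in> C \<Longrightarrow> norm x \<le> M2" using bd(2) bounded_iff by metis
  ultimately have M: "A \<subseteq> {-max 0 (max M1 M2)..max 0 (max M1 M2)}" "C \<subseteq> {-max 0 (max M1 M2)..max 0 (max M1 M2)}"
    by (force simp: abs_le_iff)+
  obtain p where p: "emeasure lborel (A \<inter> {p..}) = ennreal \<tau>"
    using tail_cut_exists[OF _ M(1), of \<tau>] a \<tau> by auto
  obtain q where q: "emeasure lborel (C \<inter> {q..}) = ennreal \<tau>"
    using tail_cut_exists[OF _ M(2), of \<tau>] c \<tau> by auto
  have left: "emeasure lborel (X \<inter> {..<r}) = ennreal (m - \<tau>)"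
    if [measurable]: "X \<in> sets borel" and "emeasure lborel (X \<inter> {r..}) = ennreal \<tau>"
      "emeasure lborel X = ennreal m" "\<tau> \<le> m" for X :: "real set" and r m
  proof -
    have "X \<inter> {..<r} = X - X \<inter> {r..}" by auto
    moreover have "emeasure lborel (X - X \<inter> {r..}) = emeasure lborel X - emeasure lborel (X \<inter> {r..})"
      using that by (intro emeasure_Diff) auto
    ultimately show ?thesis using that \<tau> by (simp add: ennreal_minus)
  qed
  define S where "S s t = (indicator A s * indicator C t * indicator {z. fst z \<ge> p \<or> snd z \<ge> q} (s, t) :: ennreal)" for s t
  have S_meas[measurable]: "(\<lambda>z. S (f z) (g z)) \<in> borel_measurable N"
    if [measurable]: "f \<in> borel_measurable N" "g \<in> borel_measurable N" for f g and N :: "'b measure"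
  proof -
    have "Measurable.pred (borel \<Otimes>\<^sub>M borel) (\<lambda>z::real\<times>real. fst z \<ge> p \<or> snd z \<ge> q)" by measurable
    then have [measurable]: "{z::real\<times>real. fst z \<ge> p \<or> snd z \<ge> q} \<in> sets (borel \<Otimes>\<^sub>M borel)"
      by (simp add: pred_def space_pair_measure)
    show ?thesis unfolding S_def by measurable
  qed
  have line: "(\<integral>\<^sup>+t. S (x + t) t \<partial>lborel) \<le> ennreal \<tau>" for x
  proof (cases "q \<le> p - x")
    case True
    have "(\<integral>\<^sup>+t. S (x + t) t \<partial>lborel) \<le> (\<integral>\<^sup>+t. indicator (C \<inter> {q..}) t \<partial>lborel)"
      using True by (intro nn_integral_mono) (auto simp: S_def indicator_def)
    then show ?thesis by (simp add: q)
  next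
    case False
    have "(\<integral>\<^sup>+t. S (x + t) t \<partial>lborel) \<le> (\<integral>\<^sup>+t. indicator (A \<inter> {p..}) (t + x) \<partial>lborel)"
      using False by (intro nn_integral_mono) (auto simp: S_def indicator_def algebra_simps)
    then show ?thesis by (subst (asm) nn_integral_indicator_translate) (auto simp: p)
  qed
  have "(\<integral>\<^sup>+s. \<integral>\<^sup>+t. S s t * indicator B (s - t) \<partial>lborel \<partial>lborel)
      = (\<integral>\<^sup>+t. \<integral>\<^sup>+s. S s t * indicator B (s - t) \<partial>lborel \<partial>lborel)"
    by (rule lborel_pair.Fubini'[symmetric]) measurable
  also have "\<dots> = (\<integral>\<^sup>+t. \<integral>\<^sup>+x. S (x + t) t * indicator B x \<partial>lborel \<partial>lborel)"
  proof (rule nn_integral_cong)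
    fix t :: real
    show "(\<integral>\<^sup>+s. S s t * indicator B (s - t) \<partial>lborel) = (\<integral>\<^sup>+x. S (x + t) t * indicator B x \<partial>lborel)"
      using nn_integral_lborel_translate[of "\<lambda>s. S s t * indicator B (s - t)" t] by simp
  qed
  also have "\<dots> = (\<integral>\<^sup>+x. \<integral>\<^sup>+t. S (x + t) t * indicator B x \<partial>lborel \<partial>lborel)"
    by (rule lborel_pair.Fubini') measurable
  also have "\<dots> = (\<integral>\<^sup>+x. (\<integral>\<^sup>+t. S (x + t) t \<partial>lborel) * indicator B x \<partial>lborel)"
    by (simp add: nn_integral_multc)
  also have "\<dots> \<le> (\<integral>\<^sup>+x. ennreal \<tau> * indicator B x \<partial>lborel)"
    by (intro nn_integral_mono mult_right_mono line) auto
  also have "\<dots> = ennreal (\<tau> * b)"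
    using b \<tau> by (simp add: nn_integral_cmult ennreal_mult)
  finally have 1: "(\<integral>\<^sup>+s. \<integral>\<^sup>+t. S s t * indicator B (s - t) \<partial>lborel \<partial>lborel) \<le> ennreal (\<tau> * b)" .
  have "riesz3 A B C \<le> (\<integral>\<^sup>+s. \<integral>\<^sup>+t. indicator (A \<inter> {..<p}) s * indicator (C \<inter> {..<q}) t
      + S s t * indicator B (s - t) \<partial>lborel \<partial>lborel)"
    unfolding riesz3_def by (intro nn_integral_mono) (auto simp: S_def indicator_def)
  also have "\<dots> = (\<integral>\<^sup>+s. \<integral>\<^sup>+t. indicator (A \<inter> {..<p}) s * indicator (C \<inter> {..<q}) t \<partial>lborel \<partial>lborel)
      + (\<integral>\<^sup>+s. \<integral>\<^sup>+t. S s t * indicator B (s - t) \<partial>lborel \<partial>lborel)"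
    by (subst nn_integral_add[symmetric]) (auto intro!: nn_integral_cong nn_integral_add)
  also have "(\<integral>\<^sup>+s. \<integral>\<^sup>+t. indicator (A \<inter> {..<p}) s * indicator (C \<inter> {..<q}) t \<partial>lborel \<partial>lborel)
      = ennreal ((a - \<tau>) * (c - \<tau>))"
    using \<tau> a c p q by (simp add: nn_integral_cmult nn_integral_multc left ennreal_mult)
  also have "ennreal ((a - \<tau>) * (c - \<tau>)) + (\<integral>\<^sup>+s. \<integral>\<^sup>+t. S s t * indicator B (s - t) \<partial>lborel \<partial>lborel)
      \<le> ennreal ((a - \<tau>) * (c - \<tau>)) + ennreal (\<tau> * b)"
    using 1 by (rule add_left_mono)
  finally show ?thesis using \<tau> b by (simp add: ennreal_plus)
qed

section \<open>Riesz's inequality on the line\<close>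

definition centered :: "ennreal \<Rightarrow> real set" where
  "centered m = {x. ennreal (2 * \<bar>x\<bar>) < m}"

lemma centered_ennreal: "centered (ennreal m) = {-m/2<..<m/2}"
proof -
  have "centered (ennreal m) = {x. 2 * \<bar>x\<bar> < m}"
    unfolding centered_def by (intro Collect_cong ennreal_less_iff) simp
  also have "\<dots> = {-m/2<..<m/2}" by (auto simp: abs_if split: if_splits)
  finally show ?thesis .
qed

lemma centered_measurable [measurable]: "centered m \<in> sets borel"
  unfolding centered_def by measurable

lemma emeasure_centered: "emeasure lborel (centered (ennreal m)) = ennreal m"
  unfolding centered_ennreal by (cases "0 \<le> m") (simp_all add: ennreal_neg)

lemma triangle_integral:
  assumes "0 \<le> \<tau>"
  shows "(\<integral>\<^sup>+s. indicator {..<\<tau> + k} s * ennreal (s - k) \<partial>lborel) \<le> ennreal (\<tau>\<^sup>2 / 2)"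
proof -
  have "(\<integral>\<^sup>+s. indicator {..<\<tau> + k} s * ennreal (s - k) \<partial>lborel)
      = (\<integral>\<^sup>+s. indicator {..<\<tau> + k} (s + k) * ennreal (s + k - k) \<partial>lborel)"
    by (rule nn_integral_lborel_translate[symmetric]) measurable
  also have "\<dots> \<le> (\<integral>\<^sup>+s. ennreal s * indicator {0..\<tau>} s \<partial>lborel)"
    by (intro nn_integral_mono) (auto simp: indicator_def ennreal_neg)
  also have "\<dots> = ennreal (\<tau>\<^sup>2 / 2 - 0\<^sup>2 / 2)"
    using assms by (intro nn_integral_FTC_Icc) (auto intro!: derivative_eq_intros)
  finally show ?thesis by simp
qed

lemma corner_integral:
  assumes \<tau>: "\<tau> = (a + c - b) / 2" "0 \<le> \<tau>"
  shows "(\<integral>\<^sup>+s. \<integral>\<^sup>+t. indicator {..<a/2} s * indicator {-c/2<..s - b/2} t \<partial>lborel \<partial>lborel) \<le> ennreal (\<tau>\<^sup>2 / 2)"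
proof -
  have "(\<integral>\<^sup>+s. \<integral>\<^sup>+t. indicator {..<a/2} s * indicator {-c/2<..s - b/2} t \<partial>lborel \<partial>lborel)
      = (\<integral>\<^sup>+s. indicator {..<a/2} s * emeasure lborel {-c/2<..s - b/2} \<partial>lborel)"
    by (simp add: nn_integral_cmult)
  also have "\<dots> = (\<integral>\<^sup>+s. indicator {..<\<tau> + (b - c)/2} s * ennreal (s - (b - c)/2) \<partial>lborel)"
  proof (rule nn_integral_cong)
    fix s :: real
    have "emeasure lborel {-c/2<..s - b/2} = ennreal (s - (b - c)/2)"
      by (cases "-c/2 \<le> s - b/2") (auto simp: ennreal_neg field_simps)
    moreover have "\<tau> + (b - c)/2 = a/2" using \<tau> by (simp add: field_simps)
    ultimately show "indicator {..<a/2} s * emeasure lborel {-c/2<..s - b/2}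
        = indicator {..<\<tau> + (b - c)/2} s * ennreal (s - (b - c)/2)" by (simp only:)
  qed
  also have "\<dots> \<le> ennreal (\<tau>\<^sup>2 / 2)" by (rule triangle_integral) fact
  finally show ?thesis .
qed

lemma riesz3_intervals_lower:
  assumes pos: "0 \<le> a" "0 \<le> b" "0 \<le> c" and \<tau>: "\<tau> = (a + c - b) / 2" "0 \<le> \<tau>"
  shows "ennreal (a * c) \<le> riesz3 {-a/2<..<a/2} {-b/2<..<b/2} {-c/2<..<c/2} + ennreal (\<tau>\<^sup>2)"
proof -
  let ?A = "{-a/2<..<a/2}" let ?B = "{-b/2<..<b/2}" let ?C = "{-c/2<..<c/2}"
  define G1 :: "real \<Rightarrow> real \<Rightarrow> ennreal" where "G1 s t = indicator {..<a/2} s * indicator {-c/2<..s - b/2} t" for s t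
  define G2 :: "real \<Rightarrow> real \<Rightarrow> ennreal" where "G2 s t = indicator {..<c/2} t * indicator {-a/2<..t - b/2} s" for s t
  have G_if: "G1 s t = (if s < a/2 \<and> -c/2 < t \<and> t \<le> s - b/2 then 1 else 0)"
    "G2 s t = (if t < c/2 \<and> -a/2 < s \<and> s \<le> t - b/2 then 1 else 0)" for s t
    by (auto simp: indicator_def G1_def G2_def)
  have [measurable]: "(\<lambda>(s, t). G1 s t) \<in> borel_measurable (borel \<Otimes>\<^sub>M borel)"
    "(\<lambda>(s, t). G2 s t) \<in> borel_measurable (borel \<Otimes>\<^sub>M borel)"
    unfolding G_if by measurable
  define R :: "real \<Rightarrow> real \<Rightarrow> ennreal" where "R s t = indicator ?A s * indicator ?B (s - t) * indicator ?C t" for s t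
  have [measurable]: "(\<lambda>(s, t). R s t) \<in> borel_measurable (borel \<Otimes>\<^sub>M borel)"
    unfolding R_def by measurable
  have "ennreal (a * c) = (\<integral>\<^sup>+s. \<integral>\<^sup>+t. indicator ?A s * indicator ?C t \<partial>lborel \<partial>lborel)"
    using pos by (simp add: nn_integral_cmult nn_integral_multc ennreal_mult)
  also have "\<dots> \<le> (\<integral>\<^sup>+s. \<integral>\<^sup>+t. R s t + (G1 s t + G2 s t) \<partial>lborel \<partial>lborel)"
    by (intro nn_integral_mono) (auto simp: indicator_def R_def G_if)
  also have "\<dots> = (\<integral>\<^sup>+s. \<integral>\<^sup>+t. R s t \<partial>lborel \<partial>lborel)
      + ((\<integral>\<^sup>+s. \<integral>\<^sup>+t. G1 s t \<partial>lborel \<partial>lborel) + (\<integral>\<^sup>+s. \<integral>\<^sup>+t. G2 s t \<partial>lborel \<partial>lborel))"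
    by (simp add: nn_integral_add)
  also have "(\<integral>\<^sup>+s. \<integral>\<^sup>+t. R s t \<partial>lborel \<partial>lborel) = riesz3 ?A ?B ?C"
    by (simp add: riesz3_def R_def)
  also have "(\<integral>\<^sup>+s. \<integral>\<^sup>+t. G2 s t \<partial>lborel \<partial>lborel) = (\<integral>\<^sup>+t. \<integral>\<^sup>+s. G2 s t \<partial>lborel \<partial>lborel)"
    by (rule lborel_pair.Fubini'[symmetric]) measurable
  also have "riesz3 ?A ?B ?C + ((\<integral>\<^sup>+s. \<integral>\<^sup>+t. G1 s t \<partial>lborel \<partial>lborel) + (\<integral>\<^sup>+t. \<integral>\<^sup>+s. G2 s t \<partial>lborel \<partial>lborel))
      \<le> riesz3 ?A ?B ?C + (ennreal (\<tau>\<^sup>2 / 2) + ennreal (\<tau>\<^sup>2 / 2))"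
    unfolding G1_def G2_def using \<tau> by (intro add_left_mono add_mono corner_integral) auto
  also have "ennreal (\<tau>\<^sup>2 / 2) + ennreal (\<tau>\<^sup>2 / 2) = ennreal (\<tau>\<^sup>2)"
    by (simp flip: ennreal_plus)
  finally show ?thesis .
qed

lemma riesz3_real:
  fixes A B C :: "real set"
  assumes [measurable]: "A \<in> sets borel" "B \<in> sets borel" "C \<in> sets borel"
    and bd: "bounded A" "bounded B" "bounded C"
  shows "riesz3 A B C \<le> riesz3 (centered (emeasure lborel A)) (centered (emeasure lborel B))
    (centered (emeasure lborel C))"
proof -
  have "\<exists>m\<ge>0. emeasure lborel X = ennreal m" if "bounded X" for X :: "real set"
    using emeasure_bounded_finite[OF that]
    by (intro exI[of _ "measure lborel X"]) (auto simp: emeasure_eq_ennreal_measure)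
  then obtain a b c where a: "emeasure lborel A = ennreal a" "0 \<le> a"
    and b: "emeasure lborel B = ennreal b" "0 \<le> b" and c: "emeasure lborel C = ennreal c" "0 \<le> c"
    using bd by metis
  let ?A = "{-a/2<..<a/2}" let ?B = "{-b/2<..<b/2}" let ?C = "{-c/2<..<c/2}"
  consider "a + c \<le> b" | "b + c \<le> a" | "a + b \<le> c" | "b \<le> a + c" "a \<le> b + c" "c \<le> a + b" by linarith
  then have "riesz3 A B C \<le> riesz3 ?A ?B ?C"
  proof cases
    case 1
    have "ennreal a * ennreal c = (\<integral>\<^sup>+s. \<integral>\<^sup>+t. indicator ?A s * indicator ?C t \<partial>lborel \<partial>lborel)"
      using a c by (simp add: nn_integral_cmult nn_integral_multc)
    also have "\<dots> \<le> riesz3 ?A ?B ?C"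
      unfolding riesz3_def using 1 by (intro nn_integral_mono) (auto simp: indicator_def)
    finally show ?thesis using riesz3_le(1)[of A B C] a c by simp
  next
    case 2
    have "ennreal b * ennreal c = (\<integral>\<^sup>+y. \<integral>\<^sup>+x. indicator ?B (x - y) * indicator ?C y \<partial>lborel \<partial>lborel)"
      using b c by (simp add: nn_integral_cmult nn_integral_multc nn_integral_indicator_translate)
    also have "\<dots> \<le> riesz3 ?A ?B ?C"
      using 2 by (subst riesz3_swap) (auto intro!: nn_integral_mono simp: indicator_def)
    finally show ?thesis using riesz3_le(3)[of A B C] b c by simp
  next
    case 3
    have "ennreal a * ennreal b = (\<integral>\<^sup>+x. \<integral>\<^sup>+y. indicator ?A x * indicator ?B (x - y) \<partial>lborel \<partial>lborel)"
      using a b by (simp add: nn_integral_cmult nn_integral_multc nn_integral_indicator_translate)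
    also have "\<dots> \<le> riesz3 ?A ?B ?C"
      unfolding riesz3_def using 3 by (intro nn_integral_mono) (auto simp: indicator_def)
    finally show ?thesis using riesz3_le(2)[of A B C] a b by simp
  next
    case 4
    define \<tau> where "\<tau> = (a + c - b) / 2"
    have \<tau>: "0 \<le> \<tau>" "\<tau> \<le> a" "\<tau> \<le> c" using 4 by (auto simp: \<tau>_def)
    have eq: "(a - \<tau>) * (c - \<tau>) + \<tau> * b = a * c - \<tau>\<^sup>2"
      by (simp add: \<tau>_def power2_eq_square field_simps)
    have "riesz3 A B C \<le> ennreal ((a - \<tau>) * (c - \<tau>) + \<tau> * b)"
      by (rule riesz3_real_upper[OF _ _ _ bd(1,3) a b c \<tau>]) measurable
    then have "riesz3 A B C \<le> ennreal (a * c - \<tau>\<^sup>2)"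
      by (simp only: eq)
    also have "\<dots> = ennreal (a * c) - ennreal (\<tau>\<^sup>2)"
      by (simp add: ennreal_minus)
    also have "\<dots> \<le> riesz3 ?A ?B ?C"
      using riesz3_intervals_lower[OF a(2) b(2) c(2) \<tau>_def \<tau>(1)]
      by (subst ennreal_minus_le_iff) (auto simp only: add.commute ennreal_neq_top)
    finally show ?thesis .
  qed
  then show ?thesis by (simp add: a b c centered_ennreal)
qed

section \<open>Steiner symmetrization\<close>

definition line_section :: "'a::euclidean_space \<Rightarrow> 'a set \<Rightarrow> 'a \<Rightarrow> real set" where
  "line_section e A x = {t. x + t *\<^sub>R e \<in> A}"

definition line_measure :: "'a::euclidean_space \<Rightarrow> 'a set \<Rightarrow> 'a \<Rightarrow> ennreal" where
  "line_measure e A x = (\<integral>\<^sup>+t. indicator A (x + t *\<^sub>R e) \<partial>lborel)"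

definition steiner :: "'a::euclidean_space \<Rightarrow> 'a set \<Rightarrow> 'a set" where
  "steiner e A = {x. ennreal (2 * \<bar>x \<bullet> e\<bar>) < line_measure e A x}"

lemma indicator_line_section: "indicator (line_section e A x) t = indicator A (x + t *\<^sub>R e)"
  by (simp add: line_section_def indicator_def)

lemma line_section_measurable [measurable]:
  assumes [measurable]: "A \<in> sets borel"
  shows "line_section e A x \<in> sets borel"
proof -
  have "(\<lambda>t. x + t *\<^sub>R e) -` A \<inter> space borel \<in> sets borel" by measurable
  then show ?thesis by (simp add: line_section_def vimage_def)
qed

lemma line_measure_eq:
  assumes [measurable]: "A \<in> sets borel"
  shows "line_measure e A x = emeasure lborel (line_section e A x)"
  unfolding line_measure_def by (simp flip: indicator_line_section)

lemma line_measure_measurable [measurable]: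
  assumes [measurable]: "A \<in> sets borel"
  shows "line_measure e A \<in> borel_measurable borel"
  unfolding line_measure_def by measurable

lemma steiner_measurable [measurable]:
  assumes [measurable]: "A \<in> sets borel"
  shows "steiner e A \<in> sets borel"
  unfolding steiner_def by measurable

lemma line_measure_shift:
  assumes [measurable]: "A \<in> sets borel"
  shows "line_measure e A (x + s *\<^sub>R e) = line_measure e A x"
proof -
  have "line_measure e A (x + s *\<^sub>R e) = (\<integral>\<^sup>+t. indicator A (x + (t + s) *\<^sub>R e) \<partial>lborel)"
    unfolding line_measure_def by (simp add: algebra_simps)
  also have "\<dots> = line_measure e A x"
    unfolding line_measure_def by (rule nn_integral_lborel_translate) measurable
  finally show ?thesis .
qed

lemma line_measure_mono: "A \<subseteq> B \<Longrightarrow> line_measure e A x \<le> line_measure e B x"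
  unfolding line_measure_def by (intro nn_integral_mono) (auto simp: indicator_def)

lemma steiner_mono: "A \<subseteq> B \<Longrightarrow> steiner e A \<subseteq> steiner e B"
  unfolding steiner_def using line_measure_mono[of A B e] by (auto intro: less_le_trans)

lemma line_section_steiner:
  assumes [measurable]: "A \<in> sets borel" and e: "norm e = 1"
  shows "line_section e (steiner e A) x = {t. t + x \<bullet> e \<in> centered (line_measure e A x)}"
proof -
  have "e \<bullet> e = 1" using e by (simp add: dot_square_norm)
  then show ?thesis
    by (simp add: line_section_def steiner_def centered_def line_measure_shift inner_add_left add.commute)
qed

lemma emeasure_centered': "emeasure lborel (centered m) = m"
proof (cases m)
  case (real r)
  then show ?thesis by (simp add: emeasure_centered)
next
  case top
  then show ?thesis by (simp add: centered_def ennreal_less_top)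
qed

lemma emeasure_lborel_vimage_translate:
  fixes A :: "'a::euclidean_space set"
  assumes [measurable]: "A \<in> sets borel"
  shows "emeasure lborel {t. t + c \<in> A} = emeasure lborel A"
proof -
  have "(\<lambda>t. t + c) -` A \<inter> space borel \<in> sets borel" by measurable
  then have [measurable]: "{t. t + c \<in> A} \<in> sets borel" by (simp add: vimage_def)
  have "emeasure lborel {t. t + c \<in> A} = (\<integral>\<^sup>+t. indicator {t. t + c \<in> A} t \<partial>lborel)" by simp
  also have "\<dots> = (\<integral>\<^sup>+t. indicator A (t + c) \<partial>lborel)"
    by (intro nn_integral_cong) (simp add: indicator_def)
  finally show ?thesis by (simp add: nn_integral_indicator_translate)
qed

lemma line_measure_steiner:
  assumes [measurable]: "A \<in> sets borel" and e: "norm e = 1"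
  shows "line_measure e (steiner e A) x = line_measure e A x"
  by (simp add: line_measure_eq line_section_steiner[OF _ e] emeasure_lborel_vimage_translate
      emeasure_centered')

lemma emeasure_slab:
  assumes [measurable]: "A \<in> sets borel" and e: "norm e = 1"
  shows "emeasure lborel A = (\<integral>\<^sup>+y. indicator (slab e) y * line_measure e A y \<partial>lborel)"
  using nn_integral_slab[of "indicator A", OF _ e] by (simp add: line_measure_def)

lemma emeasure_steiner:
  assumes [measurable]: "A \<in> sets borel" and e: "norm e = 1"
  shows "emeasure lborel (steiner e A) = emeasure lborel A"
  by (simp add: emeasure_slab[OF _ e] line_measure_steiner[OF _ e])

lemma riesz3_translate:
  fixes A B C :: "'a::euclidean_space set"
  assumes [measurable]: "A \<in> sets borel" "B \<in> sets borel" "C \<in> sets borel"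
  shows "riesz3 {x. x + \<alpha> \<in> A} {x. x + (\<alpha> - \<beta>) \<in> B} {x. x + \<beta> \<in> C} = riesz3 A B C"
proof -
  have "riesz3 {x. x + \<alpha> \<in> A} {x. x + (\<alpha> - \<beta>) \<in> B} {x. x + \<beta> \<in> C}
     = (\<integral>\<^sup>+x. \<integral>\<^sup>+y. indicator A (x + \<alpha>) * indicator B ((x + \<alpha>) - (y + \<beta>)) * indicator C (y + \<beta>) \<partial>lborel \<partial>lborel)"
    unfolding riesz3_def by (intro nn_integral_cong) (simp add: indicator_def algebra_simps)
  also have "\<dots> = (\<integral>\<^sup>+x. \<integral>\<^sup>+y. indicator A (x + \<alpha>) * indicator B ((x + \<alpha>) - y) * indicator C y \<partial>lborel \<partial>lborel)"
  proof (rule nn_integral_cong)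
    fix x
    show "(\<integral>\<^sup>+y. indicator A (x + \<alpha>) * indicator B ((x + \<alpha>) - (y + \<beta>)) * indicator C (y + \<beta>) \<partial>lborel)
      = (\<integral>\<^sup>+y. indicator A (x + \<alpha>) * indicator B ((x + \<alpha>) - y) * indicator C y \<partial>lborel)"
      by (rule nn_integral_lborel_translate[of "\<lambda>y. indicator A (x + \<alpha>) * indicator B ((x + \<alpha>) - y) * indicator C y"])
        measurable
  qed
  also have "\<dots> = riesz3 A B C"
    unfolding riesz3_def
    by (rule nn_integral_lborel_translate[of "\<lambda>x. \<integral>\<^sup>+y. indicator A x * indicator B (x - y) * indicator C y \<partial>lborel"])
      measurable
  finally show ?thesis .
qed

lemma riesz3_slab:
  fixes A B C :: "'a::euclidean_space set"
  assumes [measurable]: "A \<in> sets borel" "B \<in> sets borel" "C \<in> sets borel" and e: "norm e = 1"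
  shows "riesz3 A B C = (\<integral>\<^sup>+x. indicator (slab e) x * (\<integral>\<^sup>+y. indicator (slab e) y *
      riesz3 (line_section e A x) (line_section e B (x - y)) (line_section e C y) \<partial>lborel) \<partial>lborel)"
proof -
  define H :: "'a \<Rightarrow> 'a \<Rightarrow> ennreal" where "H x y = indicator A x * indicator B (x - y) * indicator C y" for x y
  have [measurable]: "(\<lambda>w. H (f w) (g w)) \<in> borel_measurable M"
    if [measurable]: "f \<in> borel_measurable M" "g \<in> borel_measurable M" for f g :: "'b \<Rightarrow> 'a" and M
    unfolding H_def by measurable
  have [measurable]: "(\<lambda>w. H (f w) (g w)) \<in> borel_measurable M"
    if [measurable]: "f \<in> borel_measurable M" "g \<in> borel_measurable M" for f g :: "'a \<times> 'a \<Rightarrow> 'a" and M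
    unfolding H_def by measurable
  have sec: "riesz3 (line_section e A x) (line_section e B (x - y)) (line_section e C y)
     = (\<integral>\<^sup>+s. \<integral>\<^sup>+t. H (x + s *\<^sub>R e) (y + t *\<^sub>R e) \<partial>lborel \<partial>lborel)" for x y
    unfolding riesz3_def H_def indicator_line_section by (simp add: algebra_simps)
  have "riesz3 A B C = (\<integral>\<^sup>+x. \<integral>\<^sup>+y. H x y \<partial>lborel \<partial>lborel)"
    by (simp add: riesz3_def H_def)
  also have "\<dots> = (\<integral>\<^sup>+x. \<integral>\<^sup>+y. indicator (slab e) y * (\<integral>\<^sup>+t. H x (y + t *\<^sub>R e) \<partial>lborel) \<partial>lborel \<partial>lborel)"
    by (intro nn_integral_cong nn_integral_slab[OF _ e]) (simp add: H_def)
  also have "\<dots> = (\<integral>\<^sup>+x. indicator (slab e) x * (\<integral>\<^sup>+s. \<integral>\<^sup>+y. indicator (slab e) y *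
      (\<integral>\<^sup>+t. H (x + s *\<^sub>R e) (y + t *\<^sub>R e) \<partial>lborel) \<partial>lborel \<partial>lborel) \<partial>lborel)"
    by (rule nn_integral_slab[OF _ e]) (simp add: H_def)
  also have "\<dots> = (\<integral>\<^sup>+x. indicator (slab e) x * (\<integral>\<^sup>+y. \<integral>\<^sup>+s. indicator (slab e) y *
      (\<integral>\<^sup>+t. H (x + s *\<^sub>R e) (y + t *\<^sub>R e) \<partial>lborel) \<partial>lborel \<partial>lborel) \<partial>lborel)"
    by (intro nn_integral_cong arg_cong2[where f="(*)"] refl lborel_pair.Fubini') (simp add: H_def)
  also have "\<dots> = (\<integral>\<^sup>+x. indicator (slab e) x * (\<integral>\<^sup>+y. indicator (slab e) y *
      riesz3 (line_section e A x) (line_section e B (x - y)) (line_section e C y) \<partial>lborel) \<partial>lborel)"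
    unfolding sec by (intro nn_integral_cong arg_cong2[where f="(*)"] refl nn_integral_cmult) (simp add: H_def)
  finally show ?thesis .
qed

lemma bounded_line_section:
  assumes "bounded A" "norm e = 1"
  shows "bounded (line_section e A x)"
proof -
  obtain M where M: "\<And>y. y \<in> A \<Longrightarrow> norm y \<le> M" using assms bounded_iff by metis
  have "\<bar>t\<bar> \<le> M + norm x" if "t \<in> line_section e A x" for t
    using M[of "x + t *\<^sub>R e"] that norm_triangle_ineq4[of "x + t *\<^sub>R e" x] assms(2)
    by (simp add: line_section_def)
  then show ?thesis by (auto simp: bounded_iff)
qed

lemma riesz3_steiner:
  fixes A B C :: "'a::euclidean_space set"
  assumes [measurable]: "A \<in> sets borel" "B \<in> sets borel" "C \<in> sets borel"
    and bd: "bounded A" "bounded B" "bounded C" and e: "norm e = 1"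
  shows "riesz3 A B C \<le> riesz3 (steiner e A) (steiner e B) (steiner e C)"
proof -
  have "riesz3 (line_section e A x) (line_section e B (x - y)) (line_section e C y)
    \<le> riesz3 (line_section e (steiner e A) x) (line_section e (steiner e B) (x - y)) (line_section e (steiner e C) y)" for x y
  proof -
    have "riesz3 (line_section e A x) (line_section e B (x - y)) (line_section e C y)
     \<le> riesz3 (centered (line_measure e A x)) (centered (line_measure e B (x - y))) (centered (line_measure e C y))"
      unfolding line_measure_eq[OF assms(1)] line_measure_eq[OF assms(2)] line_measure_eq[OF assms(3)]
      using bd e by (intro riesz3_real bounded_line_section) auto
    also have "\<dots> = riesz3 {t. t + x \<bullet> e \<in> centered (line_measure e A x)}
      {t. t + (x \<bullet> e - y \<bullet> e) \<in> centered (line_measure e B (x - y))}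
      {t. t + y \<bullet> e \<in> centered (line_measure e C y)}"
      by (rule riesz3_translate[symmetric]) auto
    finally show ?thesis by (simp add: line_section_steiner[OF _ e] inner_diff_left)
  qed
  then show ?thesis
    unfolding riesz3_slab[OF assms(1-3) e]
    by (subst riesz3_slab[OF _ _ _ e]) (auto intro!: nn_integral_mono mult_left_mono)
qed

lemma line_section_ball:
  assumes e: "norm e = 1"
  shows "line_section e (ball 0 r) x = {t. t + x \<bullet> e \<in> centered (line_measure e (ball 0 r) x)}"
proof (cases "0 < r")
  case False
  then have "ball 0 r = ({}::'a set)" by simp
  then show ?thesis by (simp only: line_measure_def line_section_def centered_def) simp
next
  case r: True
  have ee: "e \<bullet> e = 1" using e by (simp add: dot_square_norm)
  define q where "q = r\<^sup>2 - (norm x)\<^sup>2 + (x \<bullet> e)\<^sup>2"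
  have "x + t *\<^sub>R e \<in> ball 0 r \<longleftrightarrow> \<bar>t + x \<bullet> e\<bar> < sqrt q" for t
  proof -
    have "x + t *\<^sub>R e \<in> ball 0 r \<longleftrightarrow> (norm (x + t *\<^sub>R e))\<^sup>2 < r\<^sup>2"
    proof -
      have "r\<^sup>2 \<le> (norm (x + t *\<^sub>R e))\<^sup>2 \<longleftrightarrow> r \<le> norm (x + t *\<^sub>R e)"
        using r by (intro power_mono_iff) auto
      then show ?thesis unfolding mem_ball_0 by (simp only: not_le[symmetric])
    qed
    also have "(norm (x + t *\<^sub>R e))\<^sup>2 = (norm x)\<^sup>2 + 2 * t * (x \<bullet> e) + t\<^sup>2"
      unfolding power2_norm_eq_inner
      by (simp add: inner_add_left inner_add_right ee inner_commute power2_eq_square)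
    also have "\<dots> < r\<^sup>2 \<longleftrightarrow> (t + x \<bullet> e)\<^sup>2 < q"
      by (simp add: q_def power2_eq_square algebra_simps)
    also have "\<dots> \<longleftrightarrow> \<bar>t + x \<bullet> e\<bar> < sqrt q"
      by (simp flip: real_sqrt_abs)
    finally show ?thesis .
  qed
  moreover have "centered (ennreal (2 * sqrt q)) = {s. \<bar>s\<bar> < sqrt q}"
    unfolding centered_ennreal by (auto simp: abs_if split: if_splits)
  ultimately have sec: "line_section e (ball 0 r) x = {t. t + x \<bullet> e \<in> centered (ennreal (2 * sqrt q))}"
    unfolding line_section_def by (simp only: mem_Collect_eq)
  then have "line_measure e (ball 0 r) x = ennreal (2 * sqrt q)"
    by (simp add: line_measure_eq emeasure_lborel_vimage_translate emeasure_centered')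
  with sec show ?thesis by simp
qed

lemma steiner_ball:
  assumes e: "norm e = 1"
  shows "steiner e (ball 0 r) = ball 0 r"
proof -
  have "x \<in> steiner e (ball 0 r) \<longleftrightarrow> x \<in> ball 0 r" for x
  proof -
    have "0 \<in> line_section e (steiner e (ball 0 r)) x \<longleftrightarrow> 0 \<in> line_section e (ball 0 r) x"
      by (simp add: line_section_ball[OF e] line_section_steiner[OF _ e])
    then show ?thesis by (simp add: line_section_def)
  qed
  then show ?thesis by blast
qed

lemma steiner_subset_ball: "A \<subseteq> ball 0 r \<Longrightarrow> norm e = 1 \<Longrightarrow> steiner e A \<subseteq> ball 0 r"
  using steiner_mono[of A "ball 0 r" e] by (simp add: steiner_ball)

lemma line_measure_le:
  fixes A :: "'a::euclidean_space set"
  assumes [measurable]: "A \<in> sets borel" and A: "A \<subseteq> ball 0 R" and e: "norm e = 1" and R: "0 < R"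
  shows "line_measure e A x \<le> ennreal (2 * R)"
proof -
  have ee: "e \<bullet> e = 1" using e by (simp add: dot_square_norm)
  have "line_measure e A x \<le> (\<integral>\<^sup>+t. indicator {-R - x \<bullet> e..R - x \<bullet> e} t \<partial>lborel)"
    unfolding line_measure_def
  proof (intro nn_integral_mono)
    fix t :: real
    have "\<bar>t + x \<bullet> e\<bar> \<le> R" if "x + t *\<^sub>R e \<in> A"
    proof -
      have "\<bar>(x + t *\<^sub>R e) \<bullet> e\<bar> \<le> norm (x + t *\<^sub>R e) * norm e" by (rule Cauchy_Schwarz_ineq2)
      moreover have "norm (x + t *\<^sub>R e) < R" using that A by auto
      ultimately show ?thesis using e by (simp add: inner_add_left ee add.commute)
    qed
    then show "indicator A (x + t *\<^sub>R e) \<le> (indicator {-R - x \<bullet> e..R - x \<bullet> e} t :: ennreal)"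
      by (auto simp: indicator_def abs_le_iff)
  qed
  also have "\<dots> = ennreal (2 * R)" using R by simp
  finally show ?thesis .
qed

lemma steiner_ball_overlap:
  fixes A :: "'a::euclidean_space set"
  assumes [measurable]: "A \<in> sets borel" and e: "norm e = 1"
  shows "emeasure lborel (steiner e A \<inter> ball 0 r)
    = (\<integral>\<^sup>+y. indicator (slab e) y * min (line_measure e A y) (line_measure e (ball 0 r) y) \<partial>lborel)"
proof -
  have "line_measure e (steiner e A \<inter> ball 0 r) y = min (line_measure e A y) (line_measure e (ball 0 r) y)" for y
  proof -
    have "line_section e (steiner e A \<inter> ball 0 r) y
      = line_section e (steiner e A) y \<inter> line_section e (ball 0 r) y"
      by (auto simp: line_section_def)
    also have "\<dots> = {t. t + y \<bullet> e \<in> centered (min (line_measure e A y) (line_measure e (ball 0 r) y))}"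
      by (auto simp: line_section_steiner[OF _ e] line_section_ball[OF e] centered_def)
    finally show ?thesis
      by (simp add: line_measure_eq emeasure_lborel_vimage_translate emeasure_centered')
  qed
  then show ?thesis by (simp add: emeasure_slab[OF _ e])
qed

lemma min_ge_mult:
  fixes a b :: ennreal
  assumes "a \<le> c" "b \<le> c"
  shows "a * b \<le> c * min a b"
  using assms mult_right_mono[of b c a] mult_right_mono[of a c b]
  by (cases "a \<le> b") (auto simp: min_def mult.commute[of a])

lemma ennreal_min_add: "min (c + a) (c + b) = c + min a (b::ennreal)"
  by (cases "a \<le> b") (auto simp: min_def not_le dest: add_left_mono intro: antisym add_left_mono)

lemma steiner_overlap_gain:
  fixes A :: "'a::euclidean_space set"
  assumes A[measurable]: "A \<in> sets borel" and AR: "A \<subseteq> ball 0 R" and rR: "r \<le> R" and R: "0 < R"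
    and e: "norm e = 1"
  shows "ennreal (2 * R) * emeasure lborel (A \<inter> ball 0 r)
      + (\<integral>\<^sup>+t. \<integral>\<^sup>+x. indicator (A - ball 0 r) x * indicator (ball 0 r - A) (x + t *\<^sub>R e) \<partial>lborel \<partial>lborel)
    \<le> ennreal (2 * R) * emeasure lborel (steiner e A \<inter> ball 0 r)"
proof -
  define D where "D = A - ball 0 r"
  define E where "E = ball 0 r - A"
  define I where "I = A \<inter> ball 0 r"
  have [measurable]: "D \<in> sets borel" "E \<in> sets borel" "I \<in> sets borel" by (auto simp: D_def E_def I_def)
  have sub: "D \<subseteq> ball 0 R" "E \<subseteq> ball 0 R" using AR rR by (auto simp: D_def E_def)
  have split: "line_measure e A y = line_measure e I y + line_measure e D y"
    "line_measure e (ball 0 r) y = line_measure e I y + line_measure e E y" for y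
    unfolding line_measure_def
    by (subst nn_integral_add[symmetric]; auto intro!: nn_integral_cong simp: indicator_def I_def D_def E_def)+
  have "(\<integral>\<^sup>+t. \<integral>\<^sup>+x. indicator D x * indicator E (x + t *\<^sub>R e) \<partial>lborel \<partial>lborel)
      = (\<integral>\<^sup>+x. \<integral>\<^sup>+t. indicator D x * indicator E (x + t *\<^sub>R e) \<partial>lborel \<partial>lborel)"
    by (rule lborel_pair.Fubini') measurable
  also have "\<dots> = (\<integral>\<^sup>+x. indicator D x * line_measure e E x \<partial>lborel)"
    by (simp add: line_measure_def nn_integral_cmult)
  also have "\<dots> = (\<integral>\<^sup>+y. indicator (slab e) y * (line_measure e D y * line_measure e E y) \<partial>lborel)"
    by (subst nn_integral_slab[OF _ e]) (simp_all add: line_measure_shift nn_integral_multc line_measure_def[of e D])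
  also have "\<dots> \<le> (\<integral>\<^sup>+y. indicator (slab e) y * (ennreal (2 * R) * min (line_measure e D y) (line_measure e E y)) \<partial>lborel)"
    using sub R e by (intro nn_integral_mono mult_left_mono min_ge_mult line_measure_le) auto
  finally have gain: "(\<integral>\<^sup>+t. \<integral>\<^sup>+x. indicator D x * indicator E (x + t *\<^sub>R e) \<partial>lborel \<partial>lborel) \<le> \<dots>" .
  have "ennreal (2 * R) * emeasure lborel I
      + (\<integral>\<^sup>+t. \<integral>\<^sup>+x. indicator D x * indicator E (x + t *\<^sub>R e) \<partial>lborel \<partial>lborel)
    \<le> (\<integral>\<^sup>+y. ennreal (2 * R) * (indicator (slab e) y * line_measure e I y) \<partial>lborel)
      + (\<integral>\<^sup>+y. indicator (slab e) y * (ennreal (2 * R) * min (line_measure e D y) (line_measure e E y)) \<partial>lborel)"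
    using gain by (intro add_mono) (simp_all add: emeasure_slab[OF _ e] nn_integral_cmult)
  also have "\<dots> = (\<integral>\<^sup>+y. ennreal (2 * R) * (indicator (slab e) y * (line_measure e I y + min (line_measure e D y) (line_measure e E y))) \<partial>lborel)"
    by (subst nn_integral_add[symmetric]) (auto intro!: nn_integral_cong simp: algebra_simps)
  also have "\<dots> = (\<integral>\<^sup>+y. ennreal (2 * R) * (indicator (slab e) y * min (line_measure e A y) (line_measure e (ball 0 r) y)) \<partial>lborel)"
    by (simp add: split ennreal_min_add)
  also have "\<dots> = ennreal (2 * R) * emeasure lborel (steiner e A \<inter> ball 0 r)"
    by (simp add: nn_integral_cmult steiner_ball_overlap[OF _ e])
  finally show ?thesis by (simp add: I_def D_def E_def)
qed

text \<open>Averaging over the dilations by \<open>s \<in> [1,2]\<close> turns an integral over the space into integrals along rays.\<close>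

lemma nn_integral_le_rays:
  fixes G :: "'a::euclidean_space \<Rightarrow> ennreal"
  assumes [measurable]: "G \<in> borel_measurable borel" and \<rho>: "0 < \<rho>" and "0 \<le> \<gamma>"
    and supp: "\<And>h. G h \<noteq> 0 \<Longrightarrow> \<rho> \<le> norm h \<and> norm h < R"
    and rays: "\<And>e. norm e = 1 \<Longrightarrow> (\<integral>\<^sup>+t. G (t *\<^sub>R e) \<partial>lborel) \<le> ennreal \<gamma>"
  shows "(\<integral>\<^sup>+h. G h \<partial>lborel) \<le> ennreal (2 ^ DIM('a) * (2 / \<rho>) * \<gamma>) * emeasure lborel (ball (0::'a) R)"
proof -
  have ray: "(\<integral>\<^sup>+s. indicator {1..2} s * (ennreal (s ^ DIM('a)) * G (s *\<^sub>R h)) \<partial>lborel)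
      \<le> ennreal (2 ^ DIM('a) * (2 / \<rho>) * \<gamma>) * indicator (ball 0 R) h" for h
  proof (cases "\<rho> / 2 \<le> norm h \<and> norm h < R")
    case False
    have "G (s *\<^sub>R h) = 0" if s: "1 \<le> s" "s \<le> 2" for s
    proof (rule ccontr)
      assume "G (s *\<^sub>R h) \<noteq> 0"
      then have "\<rho> \<le> s * norm h" "s * norm h < R" using supp[of "s *\<^sub>R h"] s by auto
      moreover have "s * norm h \<le> 2 * norm h" "1 * norm h \<le> s * norm h"
        using s by (intro mult_right_mono; simp)+
      ultimately show False using False by auto
    qed
    then have "(\<integral>\<^sup>+s. indicator {1..2} s * (ennreal (s ^ DIM('a)) * G (s *\<^sub>R h)) \<partial>lborel) = (\<integral>\<^sup>+s. 0 \<partial>(lborel :: real measure))"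
      by (intro nn_integral_cong) (auto simp: indicator_def)
    then show ?thesis by simp
  next
    case True
    then have h: "norm h > 0" using \<rho> by linarith
    define e where "e = h /\<^sub>R norm h"
    have e: "norm e = 1" using h by (simp add: e_def)
    have he: "s *\<^sub>R h = (norm h * s) *\<^sub>R e" for s using h by (simp add: e_def)
    have "(\<integral>\<^sup>+s. indicator {1..2} s * (ennreal (s ^ DIM('a)) * G (s *\<^sub>R h)) \<partial>lborel)
        \<le> (\<integral>\<^sup>+s. ennreal (2 ^ DIM('a)) * G ((norm h * s) *\<^sub>R e) \<partial>lborel)"
      unfolding he by (intro nn_integral_mono) (auto simp: indicator_def intro!: mult_right_mono ennreal_leI power_mono)
    also have "\<dots> = ennreal (2 ^ DIM('a)) * (\<integral>\<^sup>+s. G ((norm h * s) *\<^sub>R e) \<partial>lborel)"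
      by (rule nn_integral_cmult) measurable
    also have "(\<integral>\<^sup>+s. G ((norm h * s) *\<^sub>R e) \<partial>lborel) = ennreal (1 / norm h) * (\<integral>\<^sup>+t. G (t *\<^sub>R e) \<partial>lborel)"
      using nn_integral_real_affine[of "\<lambda>t. G (t *\<^sub>R e)" "norm h" 0] h
      by (simp add: mult.assoc[symmetric] flip: ennreal_mult)
    also have "\<dots> \<le> ennreal (2 / \<rho>) * ennreal \<gamma>"
      using True h \<rho> by (intro mult_mono rays e ennreal_leI) (auto simp: field_simps)
    finally have "(\<integral>\<^sup>+s. indicator {1..2} s * (ennreal (s ^ DIM('a)) * G (s *\<^sub>R h)) \<partial>lborel)
        \<le> ennreal (2 ^ DIM('a)) * (ennreal (2 / \<rho>) * ennreal \<gamma>)"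
      by (simp add: mult_left_mono)
    also have "\<dots> = ennreal (2 ^ DIM('a) * (2 / \<rho>) * \<gamma>)"
      using \<rho> \<open>0 \<le> \<gamma>\<close> by (subst ennreal_mult, simp, simp, subst ennreal_mult) (simp_all only: mult.assoc, auto)
    finally show ?thesis using True by simp
  qed
  have "(\<integral>\<^sup>+h. G h \<partial>lborel) = (\<integral>\<^sup>+s. indicator {1..2} s * (\<integral>\<^sup>+h. G h \<partial>lborel) \<partial>(lborel :: real measure))"
    by (simp add: nn_integral_multc)
  also have "\<dots> = (\<integral>\<^sup>+s. indicator {1..2} s * (ennreal (s ^ DIM('a)) * (\<integral>\<^sup>+h. G (s *\<^sub>R h) \<partial>lborel)) \<partial>lborel)"
  proof (rule nn_integral_cong)
    fix s :: real
    show "indicator {1..2} s * (\<integral>\<^sup>+h. G h \<partial>lborel)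
        = indicator {1..2} s * (ennreal (s ^ DIM('a)) * (\<integral>\<^sup>+h. G (s *\<^sub>R h) \<partial>lborel))"
      using nn_integral_lborel_scale[of G s] by (cases "s \<in> {1..2}") auto
  qed
  also have "\<dots> = (\<integral>\<^sup>+s. \<integral>\<^sup>+h. indicator {1..2} s * (ennreal (s ^ DIM('a)) * G (s *\<^sub>R h)) \<partial>lborel \<partial>lborel)"
    by (simp add: nn_integral_cmult)
  also have "\<dots> = (\<integral>\<^sup>+h. \<integral>\<^sup>+s. indicator {1..2} s * (ennreal (s ^ DIM('a)) * G (s *\<^sub>R h)) \<partial>lborel \<partial>lborel)"
    by (rule lborel_pair.Fubini'[symmetric]) measurable
  also have "\<dots> \<le> (\<integral>\<^sup>+h. ennreal (2 ^ DIM('a) * (2 / \<rho>) * \<gamma>) * indicator (ball (0::'a) R) h \<partial>lborel)"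
    by (intro nn_integral_mono ray)
  also have "\<dots> = ennreal (2 ^ DIM('a) * (2 / \<rho>) * \<gamma>) * emeasure lborel (ball (0::'a) R)"
    by (intro nn_integral_cmult_indicator) auto
  finally show ?thesis .
qed

lemma small_ball_exists:
  assumes "0 < \<epsilon>"
  obtains \<rho> where "0 < \<rho>" "emeasure lborel (ball (0::'a::euclidean_space) \<rho>) \<le> ennreal \<epsilon>"
proof -
  define w where "w = unit_ball_vol (real DIM('a))"
  define \<rho> where "\<rho> = min 1 (\<epsilon> / w)"
  have w: "w > 0" by (simp add: w_def)
  then have \<rho>: "0 < \<rho>" "\<rho> \<le> 1" using assms by (auto simp: \<rho>_def)
  have "\<rho> ^ DIM('a) \<le> \<rho> ^ 1"
    using \<rho> by (intro power_decreasing) (auto simp: Suc_le_eq)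
  then have "w * \<rho> ^ DIM('a) \<le> w * \<rho>" using w by (simp add: mult_left_mono)
  also have "\<dots> \<le> w * (\<epsilon> / w)" using w by (intro mult_left_mono) (auto simp: \<rho>_def)
  also have "\<dots> = \<epsilon>" using w by simp
  finally show ?thesis
    using that[of \<rho>] \<rho> by (simp add: emeasure_ball w_def ennreal_leI)
qed

lemma good_direction_exists:
  assumes \<delta>: "0 < \<delta>" and R: "0 < R"
  shows "\<exists>\<gamma>>0. \<forall>D E :: 'a::euclidean_space set. D \<in> sets borel \<longrightarrow> E \<in> sets borel \<longrightarrow>
      D \<subseteq> ball 0 R \<longrightarrow> E \<subseteq> ball 0 R \<longrightarrow>
      ennreal \<delta> \<le> emeasure lborel D \<longrightarrow> ennreal \<delta> \<le> emeasure lborel E \<longrightarrow>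
      (\<exists>e. norm e = 1 \<and> ennreal \<gamma> < (\<integral>\<^sup>+t. \<integral>\<^sup>+x. indicator D x * indicator E (x + t *\<^sub>R e) \<partial>lborel \<partial>lborel))"
proof -
  obtain \<rho> where \<rho>: "0 < \<rho>" "emeasure lborel (ball (0::'a) \<rho>) \<le> ennreal (\<delta> / 2)"
    using small_ball_exists[of "\<delta>/2"] \<delta> by auto
  define V where "V = measure lborel (ball (0::'a) (2 * R))"
  have V: "emeasure lborel (ball (0::'a) (2 * R)) = ennreal V" "V > 0"
    using R emeasure_lborel_ball_finite[of "0::'a" "2 * R"]
    by (simp_all add: V_def emeasure_eq_ennreal_measure content_ball_pos less_top[symmetric])
  define c where "c = 2 ^ DIM('a) * (2 / \<rho>) * V"
  have c: "c > 0" using \<rho> V by (simp add: c_def)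
  define \<gamma> where "\<gamma> = \<delta>\<^sup>2 / (4 * c)"
  have \<gamma>: "0 < \<gamma>" using c \<delta> by (simp add: \<gamma>_def)
  show ?thesis
  proof (intro exI[of _ \<gamma>] conjI \<gamma> allI impI)
    fix D E :: "'a set"
    assume [measurable]: "D \<in> sets borel" "E \<in> sets borel" and sub: "D \<subseteq> ball 0 R" "E \<subseteq> ball 0 R"
      and d: "ennreal \<delta> \<le> emeasure lborel D" "ennreal \<delta> \<le> emeasure lborel E"
    define F where "F h = (\<integral>\<^sup>+x. indicator D x * indicator E (x + h) \<partial>lborel)" for h
    have [measurable]: "F \<in> borel_measurable borel" unfolding F_def by measurable
    define G where "G h = F h * indicator (- ball 0 \<rho>) h" for h
    have [measurable]: "G \<in> borel_measurable borel" unfolding G_def by measurable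
    have supp: "\<rho> \<le> norm h \<and> norm h < 2 * R" if "G h \<noteq> 0" for h
    proof -
      have "F h \<noteq> 0" "\<rho> \<le> norm h" using that by (auto simp: G_def indicator_def split: if_splits)
      moreover have "\<exists>x. x \<in> D \<and> x + h \<in> E"
      proof (rule ccontr)
        assume "\<nexists>x. x \<in> D \<and> x + h \<in> E"
        then have "F h = (\<integral>\<^sup>+x. 0 \<partial>(lborel :: 'a measure))"
          unfolding F_def by (intro nn_integral_cong) (auto simp: indicator_def)
        then show False using \<open>F h \<noteq> 0\<close> by simp
      qed
      then obtain x where "norm x < R" "norm (x + h) < R" using sub by (meson mem_ball_0 subsetD)
      then have "norm h < 2 * R" using norm_triangle_ineq4[of "x + h" x] by simp
      ultimately show ?thesis by simp
    qed
    have FE: "F h \<le> emeasure lborel E" for h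
    proof -
      have "F h \<le> (\<integral>\<^sup>+x. indicator E (x + h) \<partial>lborel)"
        unfolding F_def by (intro nn_integral_mono) (auto simp: indicator_def)
      then show ?thesis by (simp add: nn_integral_indicator_translate)
    qed
    have "(\<integral>\<^sup>+h. indicator E (x + h) \<partial>lborel) = emeasure lborel E" for x
      using nn_integral_indicator_translate(1)[of E x] by (simp add: add.commute)
    then have "emeasure lborel D * emeasure lborel E = (\<integral>\<^sup>+x. \<integral>\<^sup>+h. indicator D x * indicator E (x + h) \<partial>lborel \<partial>lborel)"
      by (simp add: nn_integral_cmult nn_integral_multc)
    also have "\<dots> = (\<integral>\<^sup>+h. F h \<partial>lborel)"
      unfolding F_def by (rule lborel_pair.Fubini'[symmetric]) measurable
    also have "\<dots> \<le> (\<integral>\<^sup>+h. G h + emeasure lborel E * indicator (ball 0 \<rho>) h \<partial>lborel)"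
      using FE by (intro nn_integral_mono) (auto simp: G_def indicator_def)
    also have "\<dots> = (\<integral>\<^sup>+h. G h \<partial>lborel) + emeasure lborel E * emeasure lborel (ball (0::'a) \<rho>)"
    proof -
      have [measurable]: "ball (0::'a) \<rho> \<in> sets borel" by simp
      have "(\<lambda>h::'a. emeasure lborel E * indicator (ball 0 \<rho>) h) \<in> borel_measurable lborel" by measurable
      then show ?thesis by (simp add: nn_integral_add nn_integral_cmult_indicator)
    qed
    finally have total: "emeasure lborel D * emeasure lborel E
      \<le> (\<integral>\<^sup>+h. G h \<partial>lborel) + emeasure lborel E * emeasure lborel (ball (0::'a) \<rho>)" .
    show "\<exists>e. norm e = 1 \<and> ennreal \<gamma> < (\<integral>\<^sup>+t. \<integral>\<^sup>+x. indicator D x * indicator E (x + t *\<^sub>R e) \<partial>lborel \<partial>lborel)"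
    proof (rule ccontr)
      assume "\<not> ?thesis"
      then have no: "(\<integral>\<^sup>+t. F (t *\<^sub>R e) \<partial>lborel) \<le> ennreal \<gamma>" if "norm e = 1" for e
        using that unfolding F_def by (auto simp: not_less)
      have "(\<integral>\<^sup>+t. G (t *\<^sub>R e) \<partial>lborel) \<le> ennreal \<gamma>" if "norm e = 1" for e
      proof -
        have "(\<integral>\<^sup>+t. G (t *\<^sub>R e) \<partial>lborel) \<le> (\<integral>\<^sup>+t. F (t *\<^sub>R e) \<partial>lborel)"
          by (intro nn_integral_mono) (auto simp: G_def indicator_def)
        then show ?thesis using no[OF that] by simp
      qed
      then have "(\<integral>\<^sup>+h. G h \<partial>lborel) \<le> ennreal (2 ^ DIM('a) * (2 / \<rho>) * \<gamma>) * emeasure lborel (ball (0::'a) (2*R))"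
        using \<rho> \<gamma> by (intro nn_integral_le_rays supp) auto
      also have "\<dots> = ennreal (c * \<gamma>)"
        using V \<rho> \<gamma> by (simp add: c_def flip: ennreal_mult)
      also have "c * \<gamma> = \<delta>\<^sup>2 / 4" using c by (simp add: \<gamma>_def)
      finally have G: "(\<integral>\<^sup>+h. G h \<partial>lborel) \<le> ennreal (\<delta>\<^sup>2 / 4)" .
      have fin: "emeasure lborel D < \<infinity>" "emeasure lborel E < \<infinity>"
        using sub by (meson bounded_ball bounded_subset emeasure_bounded_finite)+
      define d' where "d' = measure lborel D"
      define e' where "e' = measure lborel E"
      have d': "emeasure lborel D = ennreal d'" "emeasure lborel E = ennreal e'"
        using fin by (simp_all add: d'_def e'_def emeasure_eq_ennreal_measure)
      have de: "\<delta> \<le> d'" "\<delta> \<le> e'" using d \<delta> unfolding d' by (auto simp: ennreal_le_iff2)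
      have "ennreal (d' * e') \<le> ennreal (\<delta>\<^sup>2 / 4) + ennreal e' * ennreal (\<delta> / 2)"
        using total G \<rho>(2) unfolding d' using de \<delta>
        by (simp add: ennreal_mult) (meson add_mono mult_left_mono order_trans zero_le)
      also have "\<dots> = ennreal (\<delta>\<^sup>2 / 4 + e' * (\<delta> / 2))"
        using de \<delta> by (subst ennreal_plus) (simp_all flip: ennreal_mult')
      finally have "d' * e' \<le> \<delta>\<^sup>2 / 4 + e' * (\<delta> / 2)"
        using de \<delta> by (subst (asm) ennreal_le_iff) auto
      moreover have "\<delta> * e' \<le> d' * e'" "\<delta> * \<delta> \<le> \<delta> * e'" using de \<delta> by (auto intro: mult_right_mono)
      moreover have "e' * (\<delta> / 2) = \<delta> * e' / 2" by simp
      ultimately have "\<delta> * \<delta> / 4 \<le> 0" unfolding power2_eq_square by linarith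
      then show False using \<delta> by (simp add: mult_le_0_iff)
    qed
  qed
qed

definition steiners :: "'a::euclidean_space list \<Rightarrow> 'a set \<Rightarrow> 'a set" where
  "steiners es A = fold steiner es A"

lemma steiners_simps: "steiners [] A = A" "steiners (es @ [e]) A = steiner e (steiners es A)"
  by (simp_all add: steiners_def)

lemma steiners_props:
  fixes A :: "'a::euclidean_space set"
  assumes A[measurable]: "A \<in> sets borel" and AR: "A \<subseteq> ball 0 R" and es: "\<forall>e\<in>set es. norm e = 1"
  shows "steiners es A \<in> sets borel" "steiners es A \<subseteq> ball 0 R"
    "emeasure lborel (steiners es A) = emeasure lborel A"
proof -
  have "steiners es A \<in> sets borel \<and> steiners es A \<subseteq> ball 0 R \<and> emeasure lborel (steiners es A) = emeasure lborel A"
    using es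
  proof (induction es rule: rev_induct)
    case Nil
    then show ?case using A AR by (simp add: steiners_simps)
  next
    case (snoc e es)
    then show ?case
      by (auto simp: steiners_simps emeasure_steiner dest: steiner_subset_ball[of _ R e])
  qed
  then show "steiners es A \<in> sets borel" "steiners es A \<subseteq> ball 0 R"
    "emeasure lborel (steiners es A) = emeasure lborel A" by auto
qed

lemma riesz3_steiners:
  fixes A B C :: "'a::euclidean_space set"
  assumes "A \<in> sets borel" "B \<in> sets borel" "C \<in> sets borel"
    and "A \<subseteq> ball 0 R" "B \<subseteq> ball 0 R" "C \<subseteq> ball 0 R" and "\<forall>e\<in>set es. norm e = 1"
  shows "riesz3 A B C \<le> riesz3 (steiners es A) (steiners es B) (steiners es C)"
  using assms(7)
proof (induction es rule: rev_induct)
  case Nil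
  then show ?case by (simp add: steiners_simps)
next
  case (snoc e es)
  have "riesz3 (steiners es A) (steiners es B) (steiners es C)
    \<le> riesz3 (steiners (es @ [e]) A) (steiners (es @ [e]) B) (steiners (es @ [e]) C)"
    unfolding steiners_simps using snoc.prems assms
    by (intro riesz3_steiner steiners_props bounded_subset[OF bounded_ball steiners_props(2)]) auto
  moreover have "riesz3 A B C \<le> riesz3 (steiners es A) (steiners es B) (steiners es C)"
    using snoc by simp
  ultimately show ?case by (rule order_trans[rotated])
qed

lemma measure_steiner_overlap_ge:
  fixes A :: "'a::euclidean_space set"
  assumes [measurable]: "A \<in> sets borel" and e: "norm e = 1"
  shows "measure lborel (A \<inter> ball 0 r) \<le> measure lborel (steiner e A \<inter> ball 0 r)"
proof -
  have fin: "emeasure lborel (X \<inter> ball 0 r) < \<infinity>" for X :: "'a set"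
    by (rule emeasure_bounded_finite) auto
  have "emeasure lborel (A \<inter> ball 0 r) = (\<integral>\<^sup>+y. indicator (slab e) y * line_measure e (A \<inter> ball 0 r) y \<partial>lborel)"
    by (rule emeasure_slab[OF _ e]) measurable
  also have "\<dots> \<le> emeasure lborel (steiner e A \<inter> ball 0 r)"
    unfolding steiner_ball_overlap[OF assms]
    by (intro nn_integral_mono mult_left_mono) (auto intro: line_measure_mono)
  finally show ?thesis
    unfolding measure_def using fin[of "steiner e A"] by (intro enn2real_mono) auto
qed

text \<open>A single sequence of directions rounds finitely many sets: the total overlap with the balls is bounded, and as
  long as some set misses its ball by \<open>\<delta>\<close>, one more direction gains a fixed amount.\<close>

lemma steiners_approx_balls:
  fixes X :: "'i \<Rightarrow> 'a::euclidean_space set" and r :: "'i \<Rightarrow> real"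
  assumes I: "finite I" and X: "\<And>i. i \<in> I \<Longrightarrow> X i \<in> sets borel" "\<And>i. i \<in> I \<Longrightarrow> X i \<subseteq> ball 0 R"
    and r: "\<And>i. i \<in> I \<Longrightarrow> r i \<le> R" and R: "0 < R"
    and eq: "\<And>i. i \<in> I \<Longrightarrow> emeasure lborel (X i) = emeasure lborel (ball (0::'a) (r i))"
    and \<delta>: "0 < \<delta>"
  obtains es where "\<forall>e\<in>set es. norm e = 1"
    "\<And>i. i \<in> I \<Longrightarrow> emeasure lborel (steiners es (X i) - ball 0 (r i)) \<le> ennreal \<delta>"
proof -
  obtain \<gamma> where \<gamma>: "0 < \<gamma>"
    "\<forall>D E :: 'a set. D \<in> sets borel \<longrightarrow> E \<in> sets borel \<longrightarrow> D \<subseteq> ball 0 R \<longrightarrow> E \<subseteq> ball 0 R \<longrightarrow>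
      ennreal \<delta> \<le> emeasure lborel D \<longrightarrow> ennreal \<delta> \<le> emeasure lborel E \<longrightarrow>
      (\<exists>e. norm e = 1 \<and> ennreal \<gamma> < (\<integral>\<^sup>+t. \<integral>\<^sup>+x. indicator D x * indicator E (x + t *\<^sub>R e) \<partial>lborel \<partial>lborel))"
    using good_direction_exists[OF \<delta> R, where 'a = 'a] by blast
  have fin: "emeasure lborel Y < \<infinity>" if "Y \<subseteq> ball 0 R" for Y :: "'a set"
    by (rule emeasure_bounded_finite) (use that bounded_subset in blast)
  define P where "P es = (\<Sum>i\<in>I. measure lborel (steiners es (X i) \<inter> ball 0 (r i)))" for es
  define U where "U = {es :: 'a list. \<forall>e\<in>set es. norm e = 1}"
  have bdd: "P es \<le> (\<Sum>i\<in>I. measure lborel (ball (0::'a) R))" if "es \<in> U" for es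
    unfolding P_def
  proof (rule sum_mono)
    fix i assume "i \<in> I"
    show "measure lborel (steiners es (X i) \<inter> ball 0 (r i)) \<le> measure lborel (ball (0::'a) R)"
      unfolding measure_def
    proof (intro enn2real_mono emeasure_mono)
      show "steiners es (X i) \<inter> ball 0 (r i) \<subseteq> ball 0 R"
        using subset_ball[OF r[OF \<open>i \<in> I\<close>], of "0::'a"] by blast
    qed (use fin[of "ball 0 R"] in auto)
  qed
  have bddS: "bdd_above (P ` U)" by (rule bdd_aboveI2[OF bdd])
  define S where "S = Sup (P ` U)"
  have "[] \<in> U" by (simp add: U_def)
  then have "\<exists>y\<in>P ` U. S - \<gamma> / (2 * R) < y"
    using less_cSup_iff[of "P ` U" "S - \<gamma> / (2 * R)"] bddS \<gamma>(1) R unfolding S_def by auto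
  then obtain es where es: "es \<in> U" "S - \<gamma> / (2 * R) < P es" by auto
  have es': "\<forall>e\<in>set es. norm e = 1" using es by (simp add: U_def)
  show thesis
  proof (rule that[OF es'], rule ccontr)
    fix i assume i: "i \<in> I" and "\<not> emeasure lborel (steiners es (X i) - ball 0 (r i)) \<le> ennreal \<delta>"
    define A where "A = steiners es (X i)"
    have A[measurable]: "A \<in> sets borel" and AR: "A \<subseteq> ball 0 R" and Am: "emeasure lborel A = emeasure lborel (ball (0::'a) (r i))"
      unfolding A_def using steiners_props[OF X(1,2)[OF i] es'] eq[OF i] by auto
    have D: "ennreal \<delta> \<le> emeasure lborel (A - ball 0 (r i))"
      using \<open>\<not> _ \<le> ennreal \<delta>\<close> by (simp add: A_def)
    have brR: "ball 0 (r i) \<subseteq> ball (0::'a) R" using r[OF i] by auto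
    have "emeasure lborel (A - ball 0 (r i)) = emeasure lborel (ball 0 (r i) - A)"
    proof -
      have fin': "emeasure lborel (A \<inter> ball 0 (r i)) \<noteq> \<infinity>"
        using fin[of "A \<inter> ball 0 (r i)"] brR by (auto simp: le_infI2)
      have "emeasure lborel (A - (A \<inter> ball 0 (r i))) = emeasure lborel A - emeasure lborel (A \<inter> ball 0 (r i))"
        using fin' by (intro emeasure_Diff) auto
      moreover have "emeasure lborel (ball 0 (r i) - (A \<inter> ball 0 (r i))) = emeasure lborel (ball (0::'a) (r i)) - emeasure lborel (A \<inter> ball 0 (r i))"
        using fin' by (intro emeasure_Diff) auto
      moreover have "A - (A \<inter> ball 0 (r i)) = A - ball 0 (r i)" "ball 0 (r i) - (A \<inter> ball 0 (r i)) = ball 0 (r i) - A" by auto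
      ultimately show ?thesis using Am by simp
    qed
    then obtain e where e: "norm e = 1"
      "ennreal \<gamma> < (\<integral>\<^sup>+t. \<integral>\<^sup>+x. indicator (A - ball 0 (r i)) x * indicator (ball 0 (r i) - A) (x + t *\<^sub>R e) \<partial>lborel \<partial>lborel)"
      using \<gamma>(2)[rule_format, of "A - ball 0 (r i)" "ball 0 (r i) - A"] D AR brR by auto
    have "ennreal (2 * R) * emeasure lborel (A \<inter> ball 0 (r i)) + ennreal \<gamma>
        \<le> ennreal (2 * R) * emeasure lborel (steiner e A \<inter> ball 0 (r i))"
      using steiner_overlap_gain[OF A AR r[OF i] R e(1)] e(2) by (meson add_left_mono less_imp_le order_trans)
    moreover have "emeasure lborel (Y \<inter> ball 0 (r i)) = ennreal (measure lborel (Y \<inter> ball 0 (r i)))" for Y :: "'a set"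
      using fin[of "Y \<inter> ball 0 (r i)"] brR by (intro emeasure_eq_ennreal_measure) (auto simp: less_top)
    ultimately have "ennreal (2 * R * measure lborel (A \<inter> ball 0 (r i)) + \<gamma>)
      \<le> ennreal (2 * R * measure lborel (steiner e A \<inter> ball 0 (r i)))"
      using R \<gamma>(1) by (simp add: ennreal_mult ennreal_plus)
    then have "2 * R * measure lborel (A \<inter> ball 0 (r i)) + \<gamma> \<le> 2 * R * measure lborel (steiner e A \<inter> ball 0 (r i))"
      using R by (subst (asm) ennreal_le_iff) auto
    then have gain: "measure lborel (A \<inter> ball 0 (r i)) + \<gamma> / (2 * R) \<le> measure lborel (steiner e A \<inter> ball 0 (r i))"
      using R by (simp add: field_simps)
    have "P es + \<gamma> / (2 * R) \<le> P (es @ [e])"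
    proof -
      have "P es + \<gamma> / (2 * R) = (\<Sum>k\<in>I. measure lborel (steiners es (X k) \<inter> ball 0 (r k)) + (if k = i then \<gamma> / (2 * R) else 0))"
        using I i by (simp add: P_def sum.distrib)
      also have "\<dots> \<le> P (es @ [e])"
        unfolding P_def
      proof (rule sum_mono)
        fix k assume k: "k \<in> I"
        show "measure lborel (steiners es (X k) \<inter> ball 0 (r k)) + (if k = i then \<gamma> / (2 * R) else 0)
          \<le> measure lborel (steiners (es @ [e]) (X k) \<inter> ball 0 (r k))"
          using gain measure_steiner_overlap_ge[OF steiners_props(1)[OF X(1,2)[OF k] es'] e(1), of "r k"]
          by (auto simp: steiners_simps A_def)
      qed
      finally show ?thesis .
    qed
    moreover have "es @ [e] \<in> U" using es' e by (auto simp: U_def)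
    then have "P (es @ [e]) \<le> S" unfolding S_def by (intro cSup_upper bddS) auto
    ultimately show False using es(2) by simp
  qed
qed

lemma riesz3_split:
  fixes A B C :: "'a::euclidean_space set"
  assumes [measurable]: "A \<in> sets borel" "B \<in> sets borel" "C \<in> sets borel"
    "A' \<in> sets borel" "B' \<in> sets borel" "C' \<in> sets borel"
  shows "riesz3 A B C \<le> riesz3 A' B' C' + (emeasure lborel (A - A') * emeasure lborel B
    + (emeasure lborel (B - B') * emeasure lborel C + emeasure lborel (C - C') * emeasure lborel A))"
proof -
  have "riesz3 A B C \<le> (\<integral>\<^sup>+x. \<integral>\<^sup>+y. indicator A' x * indicator B' (x - y) * indicator C' y
      + (indicator (A - A') x * indicator B (x - y) * indicator C y
      + (indicator A x * indicator (B - B') (x - y) * indicator C y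
      + indicator A x * indicator B (x - y) * indicator (C - C') y)) \<partial>lborel \<partial>lborel)"
    unfolding riesz3_def by (intro nn_integral_mono) (auto simp: indicator_def)
  also have "\<dots> = riesz3 A' B' C' + (riesz3 (A - A') B C + (riesz3 A (B - B') C + riesz3 A B (C - C')))"
    unfolding riesz3_def by (simp add: nn_integral_add)
  also have "\<dots> \<le> riesz3 A' B' C' + (emeasure lborel (A - A') * emeasure lborel B
    + (emeasure lborel (B - B') * emeasure lborel C + emeasure lborel (C - C') * emeasure lborel A))"
    using riesz3_le(2)[of "A - A'" B C] riesz3_le(3)[of A "B - B'" C] riesz3_le(1)[of A B "C - C'"]
    by (intro add_left_mono add_mono) (auto simp: mult.commute)
  finally show ?thesis .
qed

lemma sym_ball_bounded:
  fixes A :: "'a::euclidean_space set"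
  assumes [measurable]: "A \<in> sets borel" and "bounded A"
  obtains r where "0 \<le> r" "sym_ball A = ball 0 r" "emeasure lborel A = emeasure lborel (ball (0::'a) r)"
proof -
  define r where "r = root DIM('a) (measure lebesgue A / measure lebesgue (ball (0::'a) 1))"
  have "emeasure lborel A < \<infinity>" using assms(2) by (rule emeasure_bounded_finite)
  then have "emeasure lebesgue A \<noteq> \<infinity>" by simp
  then have r: "sym_ball A = ball 0 r" by (simp add: sym_ball_def r_def)
  moreover have "emeasure lborel A = emeasure lborel (ball (0::'a) r)"
    using emeasure_sym_ball[of A] unfolding r by simp
  moreover have "0 \<le> r" by (simp add: r_def)
  ultimately show ?thesis using that by blast
qed

theorem riesz3_sym_ball:
  fixes A B C :: "'a::euclidean_space set"
  assumes [measurable]: "A \<in> sets borel" "B \<in> sets borel" "C \<in> sets borel"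
    and bd: "bounded A" "bounded B" "bounded C"
  shows "riesz3 A B C \<le> riesz3 (sym_ball A) (sym_ball B) (sym_ball C)"
proof -
  obtain ra where ra: "0 \<le> ra" "sym_ball A = ball 0 ra" "emeasure lborel A = emeasure lborel (ball (0::'a) ra)"
    using sym_ball_bounded[OF assms(1) bd(1)] .
  obtain rb where rb: "0 \<le> rb" "sym_ball B = ball 0 rb" "emeasure lborel B = emeasure lborel (ball (0::'a) rb)"
    using sym_ball_bounded[OF assms(2) bd(2)] .
  obtain rc where rc: "0 \<le> rc" "sym_ball C = ball 0 rc" "emeasure lborel C = emeasure lborel (ball (0::'a) rc)"
    using sym_ball_bounded[OF assms(3) bd(3)] .
  obtain R0 where R0: "A \<union> B \<union> C \<subseteq> ball 0 R0"
    using bounded_subset_ballD[of "A \<union> B \<union> C" 0] bd by auto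
  define R where "R = Max {1, R0, ra, rb, rc}"
  have R: "0 < R" "ra \<le> R" "rb \<le> R" "rc \<le> R" "R0 \<le> R" by (auto simp: R_def Max_ge_iff less_eq_real_def[of 0] intro: less_le_trans[of 0 1])
  have sub: "A \<subseteq> ball 0 R" "B \<subseteq> ball 0 R" "C \<subseteq> ball 0 R" using R0 subset_ball[OF R(5), of "0::'a"] by auto
  have fin: "emeasure lborel A < \<infinity>" "emeasure lborel B < \<infinity>" "emeasure lborel C < \<infinity>"
    using bd emeasure_bounded_finite by blast+
  define V where "V = measure lborel A + measure lborel B + measure lborel C + 1"
  have V: "V > 0" by (simp add: V_def add_nonneg_pos)
  have VV: "emeasure lborel B + (emeasure lborel C + emeasure lborel A) \<le> ennreal V"
    using fin by (simp add: V_def emeasure_eq_ennreal_measure flip: ennreal_plus)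
  show ?thesis
  proof (rule ennreal_le_epsilon)
    fix \<epsilon> :: real assume \<epsilon>: "0 < \<epsilon>"
    define \<delta> where "\<delta> = \<epsilon> / V"
    have \<delta>: "0 < \<delta>" using \<epsilon> V by (simp add: \<delta>_def)
    define Y where "Y i = (if i = 0 then A else if i = 1 then B else C)" for i :: nat
    define q where "q i = (if i = 0 then ra else if i = 1 then rb else rc)" for i :: nat
    obtain es where es: "\<forall>e\<in>set es. norm e = 1"
      and *: "\<And>i. i \<in> {0,1,2} \<Longrightarrow> emeasure lborel (steiners es (Y i) - ball 0 (q i)) \<le> ennreal \<delta>"
    proof (rule steiners_approx_balls[of "{0,1,2}" Y R q \<delta>])
      show "emeasure lborel (Y i) = emeasure lborel (ball (0::'a) (q i))" for i
        using ra rb rc by (simp add: Y_def q_def)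
      show "Y i \<in> sets borel" "Y i \<subseteq> ball 0 R" "q i \<le> R" for i
        using sub R by (simp_all add: Y_def q_def)
    qed (use R \<delta> in auto)
    note m = steiners_props[OF assms(1) sub(1) es] steiners_props[OF assms(2) sub(2) es] steiners_props[OF assms(3) sub(3) es]
    have "riesz3 A B C \<le> riesz3 (steiners es A) (steiners es B) (steiners es C)"
      using assms sub es by (intro riesz3_steiners) auto
    also have "\<dots> \<le> riesz3 (ball (0::'a) ra) (ball 0 rb) (ball 0 rc) + (emeasure lborel (steiners es A - ball 0 ra) * emeasure lborel B
      + (emeasure lborel (steiners es B - ball 0 rb) * emeasure lborel C + emeasure lborel (steiners es C - ball 0 rc) * emeasure lborel A))"
      using riesz3_split[of "steiners es A" "steiners es B" "steiners es C" "ball 0 ra" "ball 0 rb" "ball 0 rc"] m by simp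
    also have "\<dots> \<le> riesz3 (ball (0::'a) ra) (ball 0 rb) (ball 0 rc) + (ennreal \<delta> * emeasure lborel B
      + (ennreal \<delta> * emeasure lborel C + ennreal \<delta> * emeasure lborel A))"
      using *[of 0] *[of 1] *[of 2] by (intro add_left_mono add_mono mult_right_mono) (auto simp: Y_def q_def)
    also have "\<dots> = riesz3 (ball (0::'a) ra) (ball 0 rb) (ball 0 rc) + ennreal \<delta> * (emeasure lborel B + (emeasure lborel C + emeasure lborel A))"
      by (simp add: distrib_left)
    also have "\<dots> \<le> riesz3 (ball (0::'a) ra) (ball 0 rb) (ball 0 rc) + ennreal \<delta> * ennreal V"
      using VV by (intro add_left_mono mult_left_mono) auto
    also have "ennreal \<delta> * ennreal V = ennreal \<epsilon>" using \<delta> V by (simp add: \<delta>_def flip: ennreal_mult')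
    finally show "riesz3 A B C \<le> riesz3 (sym_ball A) (sym_ball B) (sym_ball C) + ennreal \<epsilon>"
      by (simp add: ra rb rc)
  qed
qed

section \<open>Schwarz rearrangement\<close>

lemma radial_vol_ball:
  "ennreal (radial_vol (x::'a::euclidean_space)) < ennreal m \<longleftrightarrow>
    x \<in> ball 0 (root DIM('a) (m / measure lebesgue (ball (0::'a) 1)))" if "0 \<le> m"
proof -
  define w where "w = measure lebesgue (ball (0::'a) 1)"
  have w: "w > 0" by (simp add: w_def content_ball)
  have "ennreal (radial_vol x) < ennreal m \<longleftrightarrow> w * norm x ^ DIM('a) < m"
    using w by (simp add: radial_vol_def w_def ennreal_less_iff)
  also have "\<dots> \<longleftrightarrow> norm x ^ DIM('a) < m / w"
    using w by (simp add: field_simps)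
  also have "\<dots> \<longleftrightarrow> root DIM('a) (norm x ^ DIM('a)) < root DIM('a) (m / w)"
    by simp
  also have "\<dots> \<longleftrightarrow> x \<in> ball 0 (root DIM('a) (m / w))"
    by (simp add: real_root_power_cancel)
  finally show ?thesis by (simp add: w_def)
qed

lemma sym_ball_iff: "x \<in> sym_ball E \<longleftrightarrow> ennreal (radial_vol x) < emeasure lebesgue E"
proof (cases "emeasure lebesgue E = \<infinity>")
  case True
  then show ?thesis by (simp add: sym_ball_def)
next
  case False
  then have "emeasure lebesgue E = ennreal (measure lebesgue E)"
    by (simp add: emeasure_eq_ennreal_measure)
  then show ?thesis
    using False radial_vol_ball[of "measure lebesgue E" x] by (simp add: sym_ball_def)
qed

lemma sym_ball_mono_emeasure: "emeasure lebesgue A \<le> emeasure lebesgue B \<Longrightarrow> sym_ball A \<subseteq> sym_ball B"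
  by (auto simp: sym_ball_iff intro: less_le_trans)

lemma distr_fun_antimono:
  assumes "\<And>t. 0 \<le> t \<Longrightarrow> {x \<in> E. \<bar>f x\<bar> > t} \<in> sets lebesgue" "0 \<le> s" "s \<le> t"
  shows "distr_fun E f t \<le> distr_fun E f s"
  unfolding distr_fun_def using assms by (intro emeasure_mono) auto

lemma less_decr_rearr_iff:
  assumes m: "\<And>t. 0 \<le> t \<Longrightarrow> {x \<in> E. \<bar>f x\<bar> > t} \<in> sets lebesgue" and s: "0 \<le> s"
  shows "ennreal s < decr_rearr E f \<sigma> \<longleftrightarrow> ennreal \<sigma> < distr_fun E f s"
proof
  assume "ennreal s < decr_rearr E f \<sigma>"
  then obtain t where t: "0 \<le> t" "ennreal \<sigma> < distr_fun E f t" "ennreal s < ennreal t"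
    unfolding decr_rearr_def less_Sup_iff by auto
  then have "s \<le> t" using s by (simp add: ennreal_less_iff)
  then show "ennreal \<sigma> < distr_fun E f s"
    using distr_fun_antimono[OF m s \<open>s \<le> t\<close>] t by simp
next
  assume *: "ennreal \<sigma> < distr_fun E f s"
  have "(\<Union>n. {x \<in> E. \<bar>f x\<bar> > s + inverse (real (Suc n))}) = {x \<in> E. \<bar>f x\<bar> > s}"
  proof safe
    fix x assume "x \<in> E" "s < \<bar>f x\<bar>"
    then obtain n where "inverse (real (Suc n)) < \<bar>f x\<bar> - s" using reals_Archimedean[of "\<bar>f x\<bar> - s"] by auto
    then show "x \<in> (\<Union>n. {x \<in> E. \<bar>f x\<bar> > s + inverse (real (Suc n))})" using \<open>x \<in> E\<close> by (auto intro!: exI[of _ n])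
  next
    fix x n assume "s + inverse (real (Suc n)) < \<bar>f x\<bar>"
    moreover have "0 < inverse (real (Suc n))" by simp
    ultimately show "s < \<bar>f x\<bar>" by linarith
  qed
  moreover have "(SUP n. emeasure lebesgue {x \<in> E. \<bar>f x\<bar> > s + inverse (real (Suc n))})
      = emeasure lebesgue (\<Union>n. {x \<in> E. \<bar>f x\<bar> > s + inverse (real (Suc n))})"
  proof (rule SUP_emeasure_incseq)
    show "range (\<lambda>n. {x \<in> E. \<bar>f x\<bar> > s + inverse (real (Suc n))}) \<subseteq> sets lebesgue"
      using m s by auto
    show "incseq (\<lambda>n. {x \<in> E. \<bar>f x\<bar> > s + inverse (real (Suc n))})"
    proof (rule incseq_SucI, safe)
      fix n x assume "s + inverse (real (Suc n)) < \<bar>f x\<bar>"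
      moreover have "inverse (real (Suc (Suc n))) \<le> inverse (real (Suc n))" by simp
      ultimately show "s + inverse (real (Suc (Suc n))) < \<bar>f x\<bar>" by linarith
    qed
  qed
  ultimately have "ennreal \<sigma> < (SUP n. distr_fun E f (s + inverse (real (Suc n))))"
    using * by (simp add: distr_fun_def)
  then obtain n where n: "ennreal \<sigma> < distr_fun E f (s + inverse (real (Suc n)))"
    by (auto simp: less_SUP_iff)
  have "ennreal s < ennreal (s + inverse (real (Suc n)))"
    using s by (simp add: ennreal_less_iff)
  also have "\<dots> \<le> decr_rearr E f \<sigma>"
    unfolding decr_rearr_def using n s by (intro Sup_upper imageI) simp
  finally show "ennreal s < decr_rearr E f \<sigma>" .
qed

lemma decr_rearr_finite:
  assumes m: "\<And>t. 0 \<le> t \<Longrightarrow> {x \<in> E. \<bar>f x\<bar> > t} \<in> sets lebesgue"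
    and t: "0 \<le> t" "distr_fun E f t \<le> ennreal \<sigma>"
  shows "decr_rearr E f \<sigma> \<le> ennreal t"
  using less_decr_rearr_iff[OF m t(1), of \<sigma>] t(2) by (simp add: not_less[symmetric])

definition bsupp :: "('a::euclidean_space \<Rightarrow> real) \<Rightarrow> bool" where
  "bsupp g \<longleftrightarrow> g \<in> borel_measurable borel \<and> bounded {x. g x \<noteq> 0}"

lemma bsupp_measurable [measurable_dest]: "bsupp g \<Longrightarrow> g \<in> borel_measurable borel"
  by (simp add: bsupp_def)

lemma bsupp_levels:
  assumes "bsupp g"
  shows "{x. s < \<bar>g x\<bar>} \<in> sets borel" "0 \<le> s \<Longrightarrow> bounded {x. s < \<bar>g x\<bar>}"
proof -
  have [measurable]: "g \<in> borel_measurable borel" using assms by (simp add: bsupp_def)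
  show "{x. s < \<bar>g x\<bar>} \<in> sets borel" by measurable
  show "0 \<le> s \<Longrightarrow> bounded {x. s < \<bar>g x\<bar>}"
    using assms unfolding bsupp_def by (elim conjE bounded_subset) auto
qed

lemma distr_fun_vanish:
  assumes g: "bsupp g" and "0 < \<sigma>"
  obtains t where "0 \<le> t" "distr_fun UNIV g t \<le> ennreal \<sigma>"
proof -
  have "(\<lambda>n. emeasure lebesgue {x. real n < \<bar>g x\<bar>}) \<longlonglongrightarrow> emeasure lebesgue (\<Inter>n. {x. real n < \<bar>g x\<bar>})"
  proof (rule Lim_emeasure_decseq)
    show "range (\<lambda>n. {x. real n < \<bar>g x\<bar>}) \<subseteq> sets lebesgue" using bsupp_levels[OF g] by auto
    show "decseq (\<lambda>n. {x. real n < \<bar>g x\<bar>})" by (rule decseq_SucI) auto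
    show "emeasure lebesgue {x. real n < \<bar>g x\<bar>} \<noteq> \<infinity>" for n
      using emeasure_bounded_finite[OF bsupp_levels(2)[OF g, of "real n"]] bsupp_levels(1)[OF g, of "real n"] by simp
  qed
  moreover have "(\<Inter>n. {x. real n < \<bar>g x\<bar>}) = {}"
  proof (rule equals0I)
    fix x assume "x \<in> (\<Inter>n. {x. real n < \<bar>g x\<bar>})"
    moreover obtain n where "\<bar>g x\<bar> < real n" using reals_Archimedean2 by blast
    ultimately show False by (auto dest: spec[of _ n])
  qed
  ultimately have "(\<lambda>n. emeasure lebesgue {x. real n < \<bar>g x\<bar>}) \<longlonglongrightarrow> 0" by simp
  then have "eventually (\<lambda>n. emeasure lebesgue {x. real n < \<bar>g x\<bar>} < ennreal \<sigma>) sequentially"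
    using \<open>0 < \<sigma>\<close> by (intro order_tendstoD(2)) auto
  then obtain n where "emeasure lebesgue {x. real n < \<bar>g x\<bar>} < ennreal \<sigma>"
    by (auto simp: eventually_sequentially)
  then show ?thesis using that[of "real n"] by (simp add: distr_fun_def)
qed

lemma schwarz_UNIV: "schwarz UNIV g x = enn2real (decr_rearr UNIV g (radial_vol x))"
  by (simp add: schwarz_def sym_ball_def)

lemma radial_vol_pos: "x \<noteq> 0 \<Longrightarrow> 0 < radial_vol x"
  by (simp add: radial_vol_def content_ball)

lemma schwarz_nonneg [simp]: "0 \<le> schwarz E g x" by (simp add: schwarz_def)

lemma decr_rearr_bsupp_finite:
  assumes g: "bsupp g" and "0 < \<sigma>" shows "decr_rearr UNIV g \<sigma> < \<infinity>"
proof -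
  obtain t where t: "0 \<le> t" "distr_fun UNIV g t \<le> ennreal \<sigma>" using distr_fun_vanish[OF assms] .
  have "decr_rearr UNIV g \<sigma> \<le> ennreal t"
    using bsupp_levels[OF g] by (intro decr_rearr_finite t) simp
  then show ?thesis by (simp add: le_less_trans)
qed

lemma schwarz_level:
  assumes g: "bsupp g" and x: "x \<noteq> 0" and s: "0 \<le> s"
  shows "s < schwarz UNIV g x \<longleftrightarrow> x \<in> sym_ball {y. s < \<bar>g y\<bar>}"
proof -
  have "s < schwarz UNIV g x \<longleftrightarrow> ennreal s < decr_rearr UNIV g (radial_vol x)"
    using decr_rearr_bsupp_finite[OF g radial_vol_pos[OF x]] s
    by (cases "decr_rearr UNIV g (radial_vol x)") (auto simp: schwarz_UNIV ennreal_less_iff)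
  also have "\<dots> \<longleftrightarrow> ennreal (radial_vol x) < distr_fun UNIV g s"
    using bsupp_levels[OF g] by (intro less_decr_rearr_iff s) simp
  also have "\<dots> \<longleftrightarrow> x \<in> sym_ball {y. s < \<bar>g y\<bar>}"
    by (simp add: sym_ball_iff distr_fun_def)
  finally show ?thesis .
qed

definition rdec :: "('a::real_normed_vector \<Rightarrow> real) \<Rightarrow> bool" where
  "rdec g \<longleftrightarrow> (\<forall>x. 0 \<le> g x) \<and> (\<forall>x y. x \<noteq> 0 \<longrightarrow> norm x \<le> norm y \<longrightarrow> g y \<le> g x) \<and> bounded {x. g x \<noteq> 0}"

lemma rdec_nonneg: "rdec g \<Longrightarrow> 0 \<le> g x" by (simp add: rdec_def)

lemma rdecD: "rdec g \<Longrightarrow> x \<noteq> 0 \<Longrightarrow> norm x \<le> norm y \<Longrightarrow> g y \<le> g x" unfolding rdec_def by blast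

lemma rdec_level:
  fixes g :: "'a::euclidean_space \<Rightarrow> real"
  assumes g: "rdec g" and s: "0 \<le> s"
  obtains r where "{x. s < g x} - {0} = ball 0 r - {0} \<or> {x. s < g x} - {0} = cball 0 r - {0}"
proof (cases "{x. s < g x} - {0} = {}")
  case True
  then show ?thesis using that[of 0] by simp
next
  case False
  define D where "D = {x. s < g x} - {0}"
  have down: "y \<in> D" if "x \<in> D" "norm y \<le> norm x" "y \<noteq> 0" for x y :: 'a
    using that rdecD[OF g, of y x] by (auto simp: D_def)
  have "D \<subseteq> {x. g x \<noteq> 0}" using s by (auto simp: D_def)
  then have "bounded D" using g bounded_subset unfolding rdec_def by blast
  then obtain M where M: "\<And>x. x \<in> D \<Longrightarrow> norm x \<le> M" by (auto simp: bounded_iff)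
  define r where "r = Sup (norm ` D)"
  have bdd: "bdd_above (norm ` D)" using M by (auto intro!: bdd_aboveI)
  have le: "norm x \<le> r" if "x \<in> D" for x
    unfolding r_def using that bdd by (intro cSup_upper) auto
  have lt: "x \<in> D" if x: "norm x < r" "x \<noteq> 0" for x :: 'a
  proof -
    have "\<exists>y\<in>norm ` D. norm x < y"
      using x(1) less_cSup_iff[of "norm ` D" "norm x"] False bdd unfolding r_def D_def[symmetric] by simp
    then obtain y where "y \<in> D" "norm x < norm y" by blast
    then show ?thesis using down[of y x] x(2) by simp
  qed
  show ?thesis
  proof (cases "\<exists>x\<in>D. norm x = r")
    case True
    then obtain x where x: "x \<in> D" "norm x = r" by blast
    have "D = cball 0 r - {0}"
    proof (intro equalityI subsetI)
      fix y :: 'a assume "y \<in> cball 0 r - {0}"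
      then show "y \<in> D" using down[OF x(1), of y] x(2) by simp
    qed (use le in \<open>auto simp: D_def\<close>)
    then show ?thesis using that[of r] by (simp add: D_def)
  next
    case False
    then have "D = ball 0 r - {0}"
    proof (intro equalityI subsetI)
      fix y assume "y \<in> D"
      then show "y \<in> ball 0 r - {0}" using le[of y] False by (auto simp: D_def less_le)
    qed (use lt in auto)
    then show ?thesis using that[of r] by (simp add: D_def)
  qed
qed

lemma rdec_measurable [measurable_dest]:
  fixes g :: "'a::euclidean_space \<Rightarrow> real"
  assumes g: "rdec g" shows "g \<in> borel_measurable borel"
proof (rule borel_measurableI_greater)
  fix s :: real
  show "{x \<in> space borel. s < g x} \<in> sets borel"
  proof (cases "0 \<le> s")
    case True
    obtain r where r: "{x. s < g x} - {0} = ball 0 r - {0} \<or> {x. s < g x} - {0} = cball 0 r - {0}"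
      using rdec_level[OF g True] .
    have m: "ball (0::'a) r - {0} \<in> sets borel" "cball (0::'a) r - {0} \<in> sets borel" by simp_all
    have A: "{x. s < g x} - {0} \<in> sets borel"
      by (rule disjE[OF r]; simp only: m)
    have "({x. s < g x} - {0}) \<union> ({x. s < g x} \<inter> {0}) \<in> sets borel"
      by (intro sets.Un[OF A] borel_closed finite_imp_closed) simp
    moreover have "({x. s < g x} - {0}) \<union> ({x. s < g x} \<inter> {0}) = {x. s < g x}" by blast
    ultimately show ?thesis by simp
  next
    case False
    then have "{x. s < g x} = UNIV" using rdec_nonneg[OF g] by (auto simp: not_le intro: less_le_trans)
    then show ?thesis by simp
  qed
qed

lemma sphere_null: "emeasure lborel (sphere (a::'a::euclidean_space) r) = 0"
proof -
  have "emeasure lebesgue (sphere a r) = 0"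
    using negligible_sphere[of a r] by (simp add: negligible_iff_null_sets null_setsD1)
  then show ?thesis by simp
qed

lemma rdec_level_AE:
  fixes g :: "'a::euclidean_space \<Rightarrow> real"
  assumes g: "rdec g" and s: "0 \<le> s"
  obtains r where "AE x in lborel. s < g x \<longleftrightarrow> x \<in> ball 0 r"
proof -
  obtain r where r: "{x. s < g x} - {0} = ball 0 r - {0} \<or> {x. s < g x} - {0} = cball 0 r - {0}"
    using rdec_level[OF g s] .
  have "AE x in lborel. x \<notin> sphere (0::'a) r"
    by (intro AE_not_in null_setsI sphere_null) simp
  then have "AE x in lborel. s < g x \<longleftrightarrow> x \<in> ball 0 r"
    using AE_lborel_singleton[of 0]
  proof eventually_elim
    case (elim x)
    from r show ?case
    proof
      assume "{x. s < g x} - {0} = ball 0 r - {0}"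
      then have "x \<in> {x. s < g x} - {0} \<longleftrightarrow> x \<in> ball 0 r - {0}" by (rule arg_cong)
      then show ?case using elim by simp
    next
      assume "{x. s < g x} - {0} = cball 0 r - {0}"
      then have "x \<in> {x. s < g x} - {0} \<longleftrightarrow> x \<in> cball 0 r - {0}" by (rule arg_cong)
      then show ?case using elim by (auto simp: less_le)
    qed
  qed
  then show ?thesis using that by blast
qed

lemma rdec_schwarz:
  assumes g: "bsupp g" shows "rdec (schwarz UNIV g)"
  unfolding rdec_def
proof (intro conjI allI impI)
  show "0 \<le> schwarz UNIV g x" for x by simp
  fix x y :: 'a assume xy: "x \<noteq> 0" "norm x \<le> norm y"
  then have y: "y \<noteq> 0" by auto
  have rv: "radial_vol x \<le> radial_vol y"
    unfolding radial_vol_def using xy by (intro mult_left_mono power_mono) auto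
  show "schwarz UNIV g y \<le> schwarz UNIV g x"
  proof (rule ccontr)
    assume "\<not> ?thesis"
    then have "schwarz UNIV g x < schwarz UNIV g y" by simp
    then have "y \<in> sym_ball {z. schwarz UNIV g x < \<bar>g z\<bar>}"
      using schwarz_level[OF g y, of "schwarz UNIV g x"] by simp
    then have "x \<in> sym_ball {z. schwarz UNIV g x < \<bar>g z\<bar>}"
      using rv by (auto simp: sym_ball_iff intro: le_less_trans[OF ennreal_leI])
    then show False using schwarz_level[OF g xy(1), of "schwarz UNIV g x"] by simp
  qed
next
  obtain r where r: "sym_ball {z. 0 < \<bar>g z\<bar>} = ball 0 r"
    using sym_ball_bounded[OF bsupp_levels[OF g], of 0] by (metis order_refl)
  have "{x. schwarz UNIV g x \<noteq> 0} \<subseteq> insert 0 (ball 0 r)"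
  proof
    fix x assume "x \<in> {x. schwarz UNIV g x \<noteq> 0}"
    then have "0 < schwarz UNIV g x" using schwarz_nonneg[of UNIV g x] by (simp add: less_le)
    then show "x \<in> insert 0 (ball 0 r)" using schwarz_level[OF g, of x 0] r by auto
  qed
  then show "bounded {x. schwarz UNIV g x \<noteq> 0}"
    by (rule bounded_subset[rotated]) simp
qed

lemma layer_cake:
  assumes "0 \<le> (a::real)"
  shows "ennreal a = (\<integral>\<^sup>+s. indicator {0..} s * (if s < a then 1 else 0) \<partial>lborel)"
proof -
  have "(\<integral>\<^sup>+s. indicator {0..} s * (if s < a then 1 else 0) \<partial>lborel) = (\<integral>\<^sup>+s. indicator {0..<a} s \<partial>lborel)"
    by (intro nn_integral_cong) (auto simp: indicator_def)
  then show ?thesis using assms by simp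
qed

lemma nn_integral_layer_cake:
  fixes h :: "'a::euclidean_space \<Rightarrow> real" and G :: "'a \<Rightarrow> ennreal"
  assumes [measurable]: "h \<in> borel_measurable borel" "G \<in> borel_measurable borel" and h: "\<And>x. 0 \<le> h x"
  shows "(\<integral>\<^sup>+x. G x * ennreal (h x) \<partial>lborel)
    = (\<integral>\<^sup>+s. indicator {0..} s * (\<integral>\<^sup>+x. G x * indicator {x. s < h x} x \<partial>lborel) \<partial>lborel)"
proof -
  have "(\<integral>\<^sup>+x. G x * ennreal (h x) \<partial>lborel)
     = (\<integral>\<^sup>+x. \<integral>\<^sup>+s. G x * (indicator {0..} s * (if s < h x then 1 else 0)) \<partial>lborel \<partial>lborel)"
    by (simp add: layer_cake[OF h] nn_integral_cmult)
  also have "\<dots> = (\<integral>\<^sup>+s. \<integral>\<^sup>+x. G x * (indicator {0..} s * (if s < h x then 1 else 0)) \<partial>lborel \<partial>lborel)"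
    by (rule lborel_pair.Fubini'[symmetric]) measurable
  also have "\<dots> = (\<integral>\<^sup>+s. \<integral>\<^sup>+x. indicator {0..} s * (G x * (if s < h x then 1 else 0)) \<partial>lborel \<partial>lborel)"
    by (simp add: mult_ac)
  also have "\<dots> = (\<integral>\<^sup>+s. indicator {0..} s * (\<integral>\<^sup>+x. G x * (if s < h x then 1 else 0) \<partial>lborel) \<partial>lborel)"
    by (simp add: nn_integral_cmult)
  finally show ?thesis by (simp add: indicator_def of_bool_def)
qed

section \<open>Riesz and Hardy-Littlewood inequalities\<close>

definition trip :: "('a::euclidean_space \<Rightarrow> ennreal) \<Rightarrow> ('a \<Rightarrow> ennreal) \<Rightarrow> ('a \<Rightarrow> ennreal) \<Rightarrow> ennreal" where
  "trip a b c = (\<integral>\<^sup>+x. \<integral>\<^sup>+y. a x * b (x - y) * c y \<partial>lborel \<partial>lborel)"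

lemma trip_fst:
  assumes [measurable]: "a \<in> borel_measurable borel" "b \<in> borel_measurable borel" "c \<in> borel_measurable borel"
  shows "trip a b c = (\<integral>\<^sup>+x. (\<integral>\<^sup>+y. b (x - y) * c y \<partial>lborel) * a x \<partial>lborel)"
proof -
  have "trip a b c = (\<integral>\<^sup>+x. \<integral>\<^sup>+y. (b (x - y) * c y) * a x \<partial>lborel \<partial>lborel)"
    unfolding trip_def by (simp add: mult_ac)
  then show ?thesis by (simp add: nn_integral_multc)
qed

lemma trip_thd:
  assumes [measurable]: "a \<in> borel_measurable borel" "b \<in> borel_measurable borel" "c \<in> borel_measurable borel"
  shows "trip a b c = (\<integral>\<^sup>+y. (\<integral>\<^sup>+x. a x * b (x - y) \<partial>lborel) * c y \<partial>lborel)"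
proof -
  have "trip a b c = (\<integral>\<^sup>+y. \<integral>\<^sup>+x. a x * b (x - y) * c y \<partial>lborel \<partial>lborel)"
    unfolding trip_def by (rule lborel_pair.Fubini'[symmetric]) measurable
  then show ?thesis by (simp add: nn_integral_multc)
qed

lemma trip_snd:
  assumes [measurable]: "a \<in> borel_measurable borel" "b \<in> borel_measurable borel" "c \<in> borel_measurable borel"
  shows "trip a b c = (\<integral>\<^sup>+z. (\<integral>\<^sup>+y. a (z + y) * c y \<partial>lborel) * b z \<partial>lborel)"
proof -
  have "trip a b c = (\<integral>\<^sup>+y. \<integral>\<^sup>+x. a x * b (x - y) * c y \<partial>lborel \<partial>lborel)"
    unfolding trip_def by (rule lborel_pair.Fubini'[symmetric]) measurable
  also have "\<dots> = (\<integral>\<^sup>+y. \<integral>\<^sup>+z. a (z + y) * b z * c y \<partial>lborel \<partial>lborel)"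
  proof (rule nn_integral_cong)
    fix y
    show "(\<integral>\<^sup>+x. a x * b (x - y) * c y \<partial>lborel) = (\<integral>\<^sup>+z. a (z + y) * b z * c y \<partial>lborel)"
      using nn_integral_lborel_translate[of "\<lambda>x. a x * b (x - y) * c y" y] by simp
  qed
  also have "\<dots> = (\<integral>\<^sup>+z. \<integral>\<^sup>+y. a (z + y) * b z * c y \<partial>lborel \<partial>lborel)"
    by (rule lborel_pair.Fubini') measurable
  also have "\<dots> = (\<integral>\<^sup>+z. \<integral>\<^sup>+y. (a (z + y) * c y) * b z \<partial>lborel \<partial>lborel)"
    by (simp add: mult_ac)
  also have "\<dots> = (\<integral>\<^sup>+z. (\<integral>\<^sup>+y. a (z + y) * c y \<partial>lborel) * b z \<partial>lborel)"
    by (simp add: nn_integral_multc)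
  finally show ?thesis .
qed

lemma trip_layers:
  fixes p q :: "'a::euclidean_space \<Rightarrow> real"
  assumes [measurable]: "p \<in> borel_measurable borel" "q \<in> borel_measurable borel" "C \<in> sets borel"
    and pos: "\<And>x. 0 \<le> p x" "\<And>x. 0 \<le> q x"
  shows "trip (\<lambda>x. ennreal (p x)) (\<lambda>x. ennreal (q x)) (indicator C)
    = (\<integral>\<^sup>+s. indicator {0..} s * (\<integral>\<^sup>+t. indicator {0..} t * riesz3 {x. s < p x} {x. t < q x} C \<partial>lborel) \<partial>lborel)"
proof -
  have [measurable]: "{x. s < p x} \<in> sets borel" "{x. s < q x} \<in> sets borel" for s by measurable
  have "trip (\<lambda>x. ennreal (p x)) (\<lambda>x. ennreal (q x)) (indicator C)
    = (\<integral>\<^sup>+s. indicator {0..} s * trip (indicator {x. s < p x}) (\<lambda>x. ennreal (q x)) (indicator C) \<partial>lborel)"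
    by (simp add: trip_fst nn_integral_layer_cake pos)
  also have "\<dots> = (\<integral>\<^sup>+s. indicator {0..} s * (\<integral>\<^sup>+t. indicator {0..} t *
      trip (indicator {x. s < p x}) (indicator {x. t < q x}) (indicator C) \<partial>lborel) \<partial>lborel)"
    by (simp add: trip_snd nn_integral_layer_cake pos)
  finally show ?thesis by (simp add: trip_def riesz3_def)
qed

lemma riesz3_null:
  fixes A B C :: "'a::euclidean_space set"
  assumes "A \<in> sets borel" "B \<in> sets borel" "C \<in> sets borel" "A' \<in> sets borel" "B' \<in> sets borel"
    and "A - A' \<subseteq> {0}" "B - B' \<subseteq> {0}"
  shows "riesz3 A B C \<le> riesz3 A' B' C"
proof -
  have null: "emeasure lborel X = 0" if "X \<subseteq> {0}" for X :: "'a set"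
  proof -
    have "X = {} \<or> X = {0}" using that by auto
    then show ?thesis by auto
  qed
  show ?thesis
    using riesz3_split[OF assms(1-5) assms(3)] null[OF assms(6)] null[OF assms(7)] by simp
qed

lemma sym_ball_measurable [measurable]: "sym_ball A \<in> sets borel"
  by (simp add: sym_ball_def)

lemma schwarz_measurable: "bsupp g \<Longrightarrow> schwarz UNIV g \<in> borel_measurable borel"
  by (intro rdec_measurable rdec_schwarz)

lemma schwarz_level_sym_diff:
  assumes g: "bsupp g" and s: "0 \<le> s"
  shows "sym_ball {y. s < \<bar>g y\<bar>} - {x. s < schwarz UNIV g x} \<subseteq> {0}"
    "{x. s < schwarz UNIV g x} - sym_ball {y. s < \<bar>g y\<bar>} \<subseteq> {0}"
  using schwarz_level[OF g _ s] by blast+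

theorem riesz_rearrangement:
  fixes g h :: "'a::euclidean_space \<Rightarrow> real"
  assumes g: "bsupp g" and h: "bsupp h" and A: "A \<in> sets borel" "bounded A"
  shows "trip (\<lambda>x. ennreal \<bar>g x\<bar>) (\<lambda>x. ennreal \<bar>h x\<bar>) (indicator A)
    \<le> trip (\<lambda>x. ennreal (schwarz UNIV g x)) (\<lambda>x. ennreal (schwarz UNIV h x)) (indicator (sym_ball A))"
proof -
  have [measurable]: "A \<in> sets borel" "g \<in> borel_measurable borel" "h \<in> borel_measurable borel"
    "schwarz UNIV g \<in> borel_measurable borel" "schwarz UNIV h \<in> borel_measurable borel"
    using A g h by (simp_all add: bsupp_measurable schwarz_measurable)
  have "riesz3 {x. s < \<bar>g x\<bar>} {x. t < \<bar>h x\<bar>} A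
      \<le> riesz3 {x. s < schwarz UNIV g x} {x. t < schwarz UNIV h x} (sym_ball A)" if "0 \<le> s" "0 \<le> t" for s t
  proof -
    have "riesz3 {x. s < \<bar>g x\<bar>} {x. t < \<bar>h x\<bar>} A
        \<le> riesz3 (sym_ball {x. s < \<bar>g x\<bar>}) (sym_ball {x. t < \<bar>h x\<bar>}) (sym_ball A)"
      using that by (intro riesz3_sym_ball bsupp_levels g h A)
    also have "\<dots> \<le> riesz3 {x. s < schwarz UNIV g x} {x. t < schwarz UNIV h x} (sym_ball A)"
      using that by (intro riesz3_null schwarz_level_sym_diff g h) measurable
    finally show ?thesis .
  qed
  then show ?thesis
    by (simp add: trip_layers) (auto intro!: nn_integral_mono simp: indicator_def)
qed

lemma emeasure_null_diff:
  fixes A B :: "'a::euclidean_space set"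
  assumes "A \<in> sets borel" "B \<in> sets borel" "A - B \<subseteq> {0}"
  shows "emeasure lborel A \<le> emeasure lborel B"
proof -
  have "emeasure lborel A \<le> emeasure lborel (B \<union> {0})" using assms by (intro emeasure_mono) auto
  also have "\<dots> \<le> emeasure lborel B + emeasure lborel {0::'a}" using assms by (intro emeasure_subadditive) auto
  finally show ?thesis by simp
qed

lemma emeasure_sym_ball_lborel:
  "A \<in> sets borel \<Longrightarrow> emeasure lborel (sym_ball A) = emeasure lborel A"
  using emeasure_sym_ball[of A] by simp

lemma sym_ball_Int:
  assumes "A \<in> sets borel" "B \<in> sets borel"
  shows "emeasure lborel (A \<inter> B) \<le> emeasure lborel (sym_ball A \<inter> sym_ball B)"
proof -
  have "sym_ball A \<subseteq> sym_ball B \<or> sym_ball B \<subseteq> sym_ball A"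
    using sym_ball_mono_emeasure[of A B] sym_ball_mono_emeasure[of B A] linear by blast
  then have "sym_ball A \<inter> sym_ball B = sym_ball A \<or> sym_ball A \<inter> sym_ball B = sym_ball B" by blast
  then show ?thesis
    using emeasure_sym_ball_lborel[OF assms(1)] emeasure_sym_ball_lborel[OF assms(2)] assms
    by (metis emeasure_mono inf_le1 inf_le2 sets_lborel)
qed

lemma hardy_littlewood_set:
  fixes g :: "'a::euclidean_space \<Rightarrow> real"
  assumes g: "bsupp g" and A[measurable]: "A \<in> sets borel"
  shows "(\<integral>\<^sup>+x. indicator A x * ennreal \<bar>g x\<bar> \<partial>lborel)
    \<le> (\<integral>\<^sup>+x. indicator (sym_ball A) x * ennreal (schwarz UNIV g x) \<partial>lborel)"
proof -
  have [measurable]: "g \<in> borel_measurable borel" "schwarz UNIV g \<in> borel_measurable borel"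
    using g by (simp_all add: bsupp_measurable schwarz_measurable)
  have [measurable]: "{x. s < schwarz UNIV g x} \<in> sets borel" "{x. s < \<bar>g x\<bar>} \<in> sets borel" for s by measurable
  have "emeasure lborel (A \<inter> {x. s < \<bar>g x\<bar>}) \<le> emeasure lborel (sym_ball A \<inter> {x. s < schwarz UNIV g x})"
    if "0 \<le> s" for s
  proof -
    have "emeasure lborel (A \<inter> {x. s < \<bar>g x\<bar>}) \<le> emeasure lborel (sym_ball A \<inter> sym_ball {x. s < \<bar>g x\<bar>})"
      by (intro sym_ball_Int) measurable
    also have "\<dots> \<le> emeasure lborel (sym_ball A \<inter> {x. s < schwarz UNIV g x})"
      using schwarz_level_sym_diff[OF g that] by (intro emeasure_null_diff) auto
    finally show ?thesis .
  qed
  then show ?thesis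
    by (simp add: nn_integral_layer_cake flip: indicator_inter_arith)
      (auto intro!: nn_integral_mono simp: indicator_def)
qed

lemma hardy_littlewood:
  fixes g h :: "'a::euclidean_space \<Rightarrow> real"
  assumes g: "bsupp g" and h: "bsupp h"
  shows "(\<integral>\<^sup>+x. ennreal \<bar>g x\<bar> * ennreal \<bar>h x\<bar> \<partial>lborel)
    \<le> (\<integral>\<^sup>+x. ennreal (schwarz UNIV g x) * ennreal (schwarz UNIV h x) \<partial>lborel)"
proof -
  have [measurable]: "g \<in> borel_measurable borel" "schwarz UNIV g \<in> borel_measurable borel"
      "h \<in> borel_measurable borel" "schwarz UNIV h \<in> borel_measurable borel"
    using g h by (simp_all add: bsupp_measurable schwarz_measurable)
  have [measurable]: "{x. s < schwarz UNIV h x} \<in> sets borel" "{x. s < \<bar>h x\<bar>} \<in> sets borel" for s by measurable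
  have "(\<integral>\<^sup>+x. ennreal \<bar>g x\<bar> * indicator {x. s < \<bar>h x\<bar>} x \<partial>lborel)
     \<le> (\<integral>\<^sup>+x. ennreal (schwarz UNIV g x) * indicator {x. s < schwarz UNIV h x} x \<partial>lborel)" if "0 \<le> s" for s
  proof -
    have "(\<integral>\<^sup>+x. ennreal \<bar>g x\<bar> * indicator {x. s < \<bar>h x\<bar>} x \<partial>lborel)
      \<le> (\<integral>\<^sup>+x. indicator (sym_ball {x. s < \<bar>h x\<bar>}) x * ennreal (schwarz UNIV g x) \<partial>lborel)"
      using hardy_littlewood_set[OF g, of "{x. s < \<bar>h x\<bar>}"] by (simp add: mult.commute)
    also have "\<dots> = (\<integral>\<^sup>+x. ennreal (schwarz UNIV g x) * indicator {x. s < schwarz UNIV h x} x \<partial>lborel)"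
    proof (rule nn_integral_cong_AE)
      show "AE x in lborel. indicator (sym_ball {x. s < \<bar>h x\<bar>}) x * ennreal (schwarz UNIV g x)
        = ennreal (schwarz UNIV g x) * indicator {x. s < schwarz UNIV h x} x"
        using AE_lborel_singleton[of 0]
        by eventually_elim (auto simp: indicator_def schwarz_level[OF h _ that])
    qed
    finally show ?thesis .
  qed
  then show ?thesis
    by (simp add: nn_integral_layer_cake) (auto intro!: nn_integral_mono simp: indicator_def)
qed

lemma nn_integral_schwarz:
  fixes g :: "'a::euclidean_space \<Rightarrow> real"
  assumes g: "bsupp g"
  shows "(\<integral>\<^sup>+x. ennreal (schwarz UNIV g x) \<partial>lborel) = (\<integral>\<^sup>+x. ennreal \<bar>g x\<bar> \<partial>lborel)"
proof -
  have [measurable]: "g \<in> borel_measurable borel" "schwarz UNIV g \<in> borel_measurable borel"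
    using g by (simp_all add: bsupp_measurable schwarz_measurable)
  have [measurable]: "{x. s < schwarz UNIV g x} \<in> sets borel" "{x. s < \<bar>g x\<bar>} \<in> sets borel" for s by measurable
  have "emeasure lborel {x. s < schwarz UNIV g x} = emeasure lborel {x. s < \<bar>g x\<bar>}" if "0 \<le> s" for s
  proof -
    have "emeasure lborel {x. s < schwarz UNIV g x} = emeasure lborel (sym_ball {x. s < \<bar>g x\<bar>})"
      using schwarz_level_sym_diff[OF g that] by (intro antisym emeasure_null_diff) auto
    then show ?thesis by (simp add: emeasure_sym_ball_lborel)
  qed
  then show ?thesis
    using nn_integral_layer_cake[of "schwarz UNIV g" "\<lambda>_. 1"] nn_integral_layer_cake[of "\<lambda>x. \<bar>g x\<bar>" "\<lambda>_. 1"]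
    by simp (auto intro!: nn_integral_cong simp: indicator_def)
qed

definition trunc :: "real \<Rightarrow> ('a \<Rightarrow> real) \<Rightarrow> 'a \<Rightarrow> real" where
  "trunc t g x = (if t < \<bar>g x\<bar> then g x else 0)"

lemma bsupp_trunc: "bsupp g \<Longrightarrow> bsupp (trunc t g)"
proof -
  assume g: "bsupp g"
  then have [measurable]: "g \<in> borel_measurable borel" by (simp add: bsupp_def)
  have "trunc t g \<in> borel_measurable borel" unfolding trunc_def by measurable
  moreover have "bounded {x. trunc t g x \<noteq> 0}"
    using g unfolding bsupp_def by (elim conjE bounded_subset) (auto simp: trunc_def)
  ultimately show ?thesis by (simp add: bsupp_def)
qed

lemma schwarz_trunc:
  assumes g: "bsupp g" and t: "0 \<le> t" and x: "x \<noteq> 0"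
  shows "schwarz UNIV (trunc t g) x = (if x \<in> sym_ball {y. t < \<bar>g y\<bar>} then schwarz UNIV g x else 0)"
proof -
  have lv: "s < schwarz UNIV (trunc t g) x \<longleftrightarrow> s < schwarz UNIV g x \<and> t < schwarz UNIV g x" if "0 \<le> s" for s
  proof -
    have "{y. s < \<bar>trunc t g y\<bar>} = {y. max s t < \<bar>g y\<bar>}" using that t by (auto simp: trunc_def)
    then show ?thesis
      using schwarz_level[OF bsupp_trunc[OF g] x that, of t] schwarz_level[OF g x, of "max s t"] that by simp
  qed
  let ?T = "schwarz UNIV (trunc t g) x"
  have "?T = (if t < schwarz UNIV g x then schwarz UNIV g x else 0)"
  proof (cases "t < schwarz UNIV g x")
    case True
    then show ?thesis using lv[of ?T] lv[of "schwarz UNIV g x"] by (simp add: not_less)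
  next
    case False
    then show ?thesis using lv[of 0] schwarz_nonneg[of UNIV "trunc t g" x] by simp
  qed
  then show ?thesis using schwarz_level[OF g x t] by simp
qed

section \<open>Comparison of mass on centered balls\<close>

locale incr_coeff =
  fixes \<Omega> :: "'a::euclidean_space set" and c :: "'a \<Rightarrow> real" and M :: real
  assumes \<Omega>[measurable]: "\<Omega> \<in> sets borel" and bdd: "bounded \<Omega>"
    and c_bsupp: "bsupp c" and c_pos: "0 \<le> c x" and c_le: "c x \<le> M" and c_out: "x \<notin> \<Omega> \<Longrightarrow> c x = 0"
begin

lemma c_measurable [measurable]: "c \<in> borel_measurable borel"
  using c_bsupp by (rule bsupp_measurable)

lemma c_levels: "0 \<le> t \<Longrightarrow> {x \<in> \<Omega>. \<bar>c x\<bar> > t} = {x. t < c x}"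
  using c_pos c_out by (auto simp: abs_of_nonneg) (metis not_le)

lemma M_nonneg: "0 \<le> M" using c_pos c_le order_trans by blast

lemma decr_rearr_c_le: "decr_rearr \<Omega> c \<sigma> \<le> ennreal M"
proof (rule decr_rearr_finite)
  have "{x \<in> \<Omega>. \<bar>c x\<bar> > M} = {}" using c_le by (simp add: c_levels M_nonneg not_less)
  then show "distr_fun \<Omega> c M \<le> ennreal \<sigma>" unfolding distr_fun_def by (simp only: emeasure_empty) simp
qed (simp_all add: c_levels M_nonneg)

lemma incr_schwarz_c: "x \<in> sym_ball \<Omega> \<Longrightarrow> ennreal (incr_schwarz \<Omega> c x) = decr_rearr \<Omega> c (measure lebesgue \<Omega> - radial_vol x)"
  using decr_rearr_c_le[of "measure lebesgue \<Omega> - radial_vol x"]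
  by (simp add: incr_schwarz_def incr_rearr_def le_less_trans)

lemma incr_schwarz_nonneg: "0 \<le> incr_schwarz \<Omega> c x"
  by (simp add: incr_schwarz_def)

lemma incr_schwarz_le: "incr_schwarz \<Omega> c x \<le> M"
proof (cases "x \<in> sym_ball \<Omega>")
  case True
  then show ?thesis using incr_schwarz_c[OF True] decr_rearr_c_le M_nonneg by (metis ennreal_le_iff)
qed (simp add: incr_schwarz_def M_nonneg)

lemma emeasure_\<Omega>: "emeasure lborel \<Omega> = ennreal (measure lebesgue \<Omega>)" "emeasure lebesgue \<Omega> = ennreal (measure lebesgue \<Omega>)"
proof -
  have "emeasure lborel \<Omega> < \<infinity>" using bdd by (rule emeasure_bounded_finite)
  then show "emeasure lebesgue \<Omega> = ennreal (measure lebesgue \<Omega>)"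
    by (intro emeasure_eq_ennreal_measure) simp
  then show "emeasure lborel \<Omega> = ennreal (measure lebesgue \<Omega>)" by simp
qed

lemma incr_schwarz_mono:
  assumes y: "y \<in> sym_ball \<Omega>" and xy: "norm x \<le> norm y"
  shows "x \<in> sym_ball \<Omega>" "incr_schwarz \<Omega> c x \<le> incr_schwarz \<Omega> c y"
proof -
  have rv: "radial_vol x \<le> radial_vol y"
    unfolding radial_vol_def using xy by (intro mult_left_mono power_mono) auto
  then show x: "x \<in> sym_ball \<Omega>" using y by (auto simp: sym_ball_iff intro: le_less_trans[OF ennreal_leI])
  have "decr_rearr \<Omega> c (measure lebesgue \<Omega> - radial_vol x) \<le> decr_rearr \<Omega> c (measure lebesgue \<Omega> - radial_vol y)"
  proof -
    have "ennreal (measure lebesgue \<Omega> - radial_vol y) \<le> ennreal (measure lebesgue \<Omega> - radial_vol x)"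
      using rv by (intro ennreal_leI) simp
    then show ?thesis
      unfolding decr_rearr_def by (intro Sup_subset_mono image_mono) (auto intro: le_less_trans)
  qed
  then have "ennreal (incr_schwarz \<Omega> c x) \<le> ennreal (incr_schwarz \<Omega> c y)"
    by (simp add: incr_schwarz_c x y)
  then show "incr_schwarz \<Omega> c x \<le> incr_schwarz \<Omega> c y" by (simp add: incr_schwarz_nonneg)
qed

lemma incr_schwarz_level:
  assumes x: "x \<in> sym_ball \<Omega>" and s: "0 \<le> s"
  shows "s < incr_schwarz \<Omega> c x \<longleftrightarrow> ennreal (measure lebesgue \<Omega> - radial_vol x) < emeasure lborel {y. s < c y}"
proof -
  have "s < incr_schwarz \<Omega> c x \<longleftrightarrow> ennreal s < decr_rearr \<Omega> c (measure lebesgue \<Omega> - radial_vol x)"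
    unfolding incr_schwarz_c[OF x, symmetric] using s by (simp add: ennreal_less_iff)
  also have "\<dots> \<longleftrightarrow> ennreal (measure lebesgue \<Omega> - radial_vol x) < distr_fun \<Omega> c s"
    by (rule less_decr_rearr_iff) (simp_all add: c_levels s)
  finally show ?thesis using s by (simp add: distr_fun_def c_levels)
qed

lemma bounded_sym_ball: "bounded (sym_ball \<Omega>)"
  using sym_ball_bounded[OF \<Omega> bdd] bounded_ball by metis

lemma incr_schwarz_measurable [measurable]: "incr_schwarz \<Omega> c \<in> borel_measurable borel"
proof -
  define g where "g x = (if x \<in> sym_ball \<Omega> then M - incr_schwarz \<Omega> c x else 0)" for x
  have "rdec g"
    unfolding rdec_def
  proof (intro conjI allI impI)
    show "0 \<le> g x" for x using incr_schwarz_le by (simp add: g_def)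
    show "g y \<le> g x" if "x \<noteq> 0" "norm x \<le> norm y" for x y
      using incr_schwarz_mono[of y x] that incr_schwarz_le[of x] by (auto simp: g_def)
    show "bounded {x. g x \<noteq> 0}"
      by (rule bounded_subset[OF bounded_sym_ball]) (auto simp: g_def)
  qed
  then have [measurable]: "g \<in> borel_measurable borel" by (rule rdec_measurable)
  have "incr_schwarz \<Omega> c = (\<lambda>x. if x \<in> sym_ball \<Omega> then M - g x else 0)"
    by (auto simp: g_def incr_schwarz_def)
  also have "\<dots> \<in> borel_measurable borel" by measurable
  finally show ?thesis .
qed

lemma incr_schwarz_set:
  assumes A[measurable]: "A \<in> sets borel" and A\<Omega>: "A \<subseteq> \<Omega>"
  shows "(\<integral>\<^sup>+x. indicator (sym_ball A) x * ennreal (incr_schwarz \<Omega> c x) \<partial>lborel)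
    \<le> (\<integral>\<^sup>+x. indicator A x * ennreal (c x) \<partial>lborel)"
proof -
  have [measurable]: "{x. s < incr_schwarz \<Omega> c x} \<in> sets borel" for s by measurable
  have fin: "emeasure lborel X \<noteq> \<infinity>" if "X \<subseteq> \<Omega>" for X
    using emeasure_bounded_finite[OF bounded_subset[OF bdd that]] by simp
  have "emeasure lborel (sym_ball A \<inter> {x. s < incr_schwarz \<Omega> c x}) \<le> emeasure lborel (A \<inter> {x. s < c x})"
    if s: "0 \<le> s" for s
  proof -
    define C where "C = {x. s < c x}"
    have C: "C \<subseteq> \<Omega>" using s c_out by (force simp: C_def)
    have [measurable]: "C \<in> sets borel" by (simp add: C_def)
    define q where "q = emeasure lborel (\<Omega> - C)"
    have "sym_ball A \<inter> {x. s < incr_schwarz \<Omega> c x} \<subseteq> sym_ball A - sym_ball (\<Omega> - C)"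
    proof safe
      fix x assume x: "x \<in> sym_ball A" "s < incr_schwarz \<Omega> c x" "x \<in> sym_ball (\<Omega> - C)"
      have x\<Omega>: "x \<in> sym_ball \<Omega>"
      proof -
        have "emeasure lebesgue A \<le> emeasure lebesgue \<Omega>" using A\<Omega> by (intro emeasure_mono) auto
        then show ?thesis using sym_ball_mono_emeasure x(1) by blast
      qed
      obtain a where a: "emeasure lborel C = ennreal a" "0 \<le> a" using fin[OF C] by (cases "emeasure lborel C") auto
      obtain b where b: "emeasure lborel (\<Omega> - C) = ennreal b" "0 \<le> b" using fin[of "\<Omega> - C"] by (cases "emeasure lborel (\<Omega> - C)") auto
      have "emeasure lborel (C \<union> (\<Omega> - C)) = emeasure lborel C + emeasure lborel (\<Omega> - C)"
        by (intro plus_emeasure[symmetric]) auto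
      also have "C \<union> (\<Omega> - C) = \<Omega>" using C by auto
      finally have "measure lebesgue \<Omega> = a + b"
        unfolding emeasure_\<Omega> a b using a b by (simp flip: ennreal_plus)
      moreover have "ennreal (measure lebesgue \<Omega> - radial_vol x) < ennreal a"
        using incr_schwarz_level[OF x\<Omega> s] x(2) a by (simp add: C_def)
      then have "measure lebesgue \<Omega> - radial_vol x < a"
        by (metis ennreal_leI not_le)
      moreover have "ennreal (radial_vol x) < ennreal b"
        using x(3) b by (simp add: sym_ball_iff)
      then have "radial_vol x < b"
        by (metis ennreal_leI not_le)
      ultimately show False by simp
    qed
    then have "emeasure lborel (sym_ball A \<inter> {x. s < incr_schwarz \<Omega> c x}) \<le> emeasure lborel (sym_ball A - sym_ball (\<Omega> - C))"
      by (intro emeasure_mono) auto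
    also have "\<dots> \<le> emeasure lborel (A \<inter> C)"
    proof (cases "emeasure lborel A \<le> emeasure lborel (\<Omega> - C)")
      case True
      then have "sym_ball A \<subseteq> sym_ball (\<Omega> - C)" by (intro sym_ball_mono_emeasure) simp
      then have "sym_ball A - sym_ball (\<Omega> - C) = {}" by blast
      then show ?thesis by (simp only:) simp
    next
      case False
      then have "sym_ball (\<Omega> - C) \<subseteq> sym_ball A" by (intro sym_ball_mono_emeasure) simp
      then have "emeasure lborel (sym_ball A - sym_ball (\<Omega> - C)) = emeasure lborel A - emeasure lborel (\<Omega> - C)"
        using fin[of "\<Omega> - C"] by (subst emeasure_Diff) (auto simp: emeasure_sym_ball_lborel)
      also have "\<dots> \<le> emeasure lborel A - emeasure lborel (A - C)"
        using A\<Omega> by (intro ennreal_minus_mono emeasure_mono) auto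
      also have "\<dots> = emeasure lborel (A - (A - C))"
        using fin[of "A - C"] A\<Omega> by (intro emeasure_Diff[symmetric]) auto
      also have "A - (A - C) = A \<inter> C" by auto
      finally show ?thesis .
    qed
    finally show ?thesis by (simp add: C_def)
  qed
  then show ?thesis
    by (simp add: nn_integral_layer_cake c_pos incr_schwarz_nonneg flip: indicator_inter_arith)
      (auto intro!: nn_integral_mono simp: indicator_def)
qed

lemma incr_schwarz_mult:
  assumes g: "bsupp g" and out: "\<And>x. x \<notin> \<Omega> \<Longrightarrow> g x = 0"
  shows "(\<integral>\<^sup>+x. ennreal (incr_schwarz \<Omega> c x) * ennreal (schwarz UNIV g x) \<partial>lborel)
    \<le> (\<integral>\<^sup>+x. ennreal (c x) * ennreal \<bar>g x\<bar> \<partial>lborel)"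
proof -
  have [measurable]: "g \<in> borel_measurable borel" "schwarz UNIV g \<in> borel_measurable borel"
    using g by (simp_all add: bsupp_measurable schwarz_measurable)
  have [measurable]: "{x. s < schwarz UNIV g x} \<in> sets borel" "{x. s < \<bar>g x\<bar>} \<in> sets borel" for s by measurable
  have "(\<integral>\<^sup>+x. ennreal (incr_schwarz \<Omega> c x) * indicator {x. s < schwarz UNIV g x} x \<partial>lborel)
     \<le> (\<integral>\<^sup>+x. ennreal (c x) * indicator {x. s < \<bar>g x\<bar>} x \<partial>lborel)" if s: "0 \<le> s" for s
  proof -
    have "(\<integral>\<^sup>+x. ennreal (incr_schwarz \<Omega> c x) * indicator {x. s < schwarz UNIV g x} x \<partial>lborel)
      = (\<integral>\<^sup>+x. indicator (sym_ball {x. s < \<bar>g x\<bar>}) x * ennreal (incr_schwarz \<Omega> c x) \<partial>lborel)"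
    proof (rule nn_integral_cong_AE)
      show "AE x in lborel. ennreal (incr_schwarz \<Omega> c x) * indicator {x. s < schwarz UNIV g x} x
        = indicator (sym_ball {x. s < \<bar>g x\<bar>}) x * ennreal (incr_schwarz \<Omega> c x)"
        using AE_lborel_singleton[of 0]
        by eventually_elim (auto simp: indicator_def schwarz_level[OF g _ s])
    qed
    also have "\<dots> \<le> (\<integral>\<^sup>+x. indicator {x. s < \<bar>g x\<bar>} x * ennreal (c x) \<partial>lborel)"
    proof (rule incr_schwarz_set)
      show "{x. s < \<bar>g x\<bar>} \<subseteq> \<Omega>" using s out by (metis (mono_tags, lifting) abs_zero mem_Collect_eq not_less subsetI)
    qed measurable
    finally show ?thesis by (simp add: mult.commute)
  qed
  then show ?thesis
    by (simp add: nn_integral_layer_cake) (auto intro!: nn_integral_mono simp: indicator_def)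
qed

end

lemma rdec_mult:
  assumes "rdec f" "rdec g" shows "rdec (\<lambda>x. f x * g x)"
  unfolding rdec_def
proof (intro conjI allI impI)
  show "0 \<le> f x * g x" for x using assms by (simp add: rdec_nonneg)
  show "f y * g y \<le> f x * g x" if "x \<noteq> 0" "norm x \<le> norm y" for x y
    using mult_mono[OF rdecD[OF assms(1) that] rdecD[OF assms(2) that]] assms by (simp add: rdec_nonneg)
  have "bounded {x. f x \<noteq> 0}" using assms by (simp add: rdec_def)
  then show "bounded {x. f x * g x \<noteq> 0}" by (rule bounded_subset) auto
qed

lemma rdec_add:
  assumes "rdec f" "rdec g" shows "rdec (\<lambda>x. f x + g x)"
  unfolding rdec_def
proof (intro conjI allI impI)
  show "0 \<le> f x + g x" for x using assms by (simp add: rdec_nonneg)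
  show "f y + g y \<le> f x + g x" if "x \<noteq> 0" "norm x \<le> norm y" for x y
    using add_mono[OF rdecD[OF assms(1) that] rdecD[OF assms(2) that]] .
  have "bounded ({x. f x \<noteq> 0} \<union> {x. g x \<noteq> 0})" using assms by (simp add: rdec_def)
  then show "bounded {x. f x + g x \<noteq> 0}" by (rule bounded_subset) auto
qed

definition conc_le :: "('a::euclidean_space \<Rightarrow> ennreal) \<Rightarrow> ('a \<Rightarrow> ennreal) \<Rightarrow> bool" where
  "conc_le p q \<longleftrightarrow> (\<forall>r. (\<integral>\<^sup>+x. p x * indicator (ball 0 r) x \<partial>lborel) \<le> (\<integral>\<^sup>+x. q x * indicator (ball 0 r) x \<partial>lborel))"

lemma conc_le_mult:
  fixes g :: "'a::euclidean_space \<Rightarrow> real"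
  assumes le: "conc_le p q" and [measurable]: "p \<in> borel_measurable borel" "q \<in> borel_measurable borel"
    and g: "rdec g"
  shows "(\<integral>\<^sup>+x. p x * ennreal (g x) \<partial>lborel) \<le> (\<integral>\<^sup>+x. q x * ennreal (g x) \<partial>lborel)"
proof -
  have [measurable]: "g \<in> borel_measurable borel" using g by (rule rdec_measurable)
  have "(\<integral>\<^sup>+x. p x * indicator {x. s < g x} x \<partial>lborel) \<le> (\<integral>\<^sup>+x. q x * indicator {x. s < g x} x \<partial>lborel)"
    if s: "0 \<le> s" for s
  proof -
    obtain r where r: "AE x in lborel. s < g x \<longleftrightarrow> x \<in> ball 0 r" using rdec_level_AE[OF g s] .
    have "(\<integral>\<^sup>+x. k x * indicator {x. s < g x} x \<partial>lborel) = (\<integral>\<^sup>+x. k x * indicator (ball 0 r) x \<partial>lborel)" for k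
      by (intro nn_integral_cong_AE) (use r in eventually_elim, auto simp: indicator_def)
    then show ?thesis using le by (simp add: conc_le_def)
  qed
  then show ?thesis
    by (simp add: nn_integral_layer_cake rdec_nonneg[OF g]) (auto intro!: nn_integral_mono simp: indicator_def)
qed

lemma centered_overlap:
  assumes "\<bar>\<alpha>\<bar> \<le> \<bar>\<beta>\<bar>"
  shows "emeasure lborel {t. t \<in> centered (ennreal a) \<and> t - \<beta> \<in> centered (ennreal b)}
    \<le> emeasure lborel {t. t \<in> centered (ennreal a) \<and> t - \<alpha> \<in> centered (ennreal b)}"
proof -
  have eq: "{t. t \<in> centered (ennreal a) \<and> t - \<gamma> \<in> centered (ennreal b)}
      = {max (- a/2) (\<gamma> - b/2) <..< min (a/2) (\<gamma> + b/2)}" for \<gamma>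
    unfolding centered_ennreal by auto
  have m: "emeasure lborel {l<..<u} = ennreal (u - l)" for l u :: real
    by (cases "l \<le> u") (auto simp: ennreal_neg)
  show ?thesis
    unfolding eq m
  proof (cases "0 \<le> a \<and> 0 \<le> b")
    case True
    then show "ennreal (min (a/2) (\<beta> + b/2) - max (- a/2) (\<beta> - b/2)) \<le> ennreal (min (a/2) (\<alpha> + b/2) - max (- a/2) (\<alpha> - b/2))"
      using assms by (intro ennreal_leI) (auto simp: min_def max_def abs_if split: if_splits)
  next
    case False
    then have "min (a/2) (\<beta> + b/2) - max (- a/2) (\<beta> - b/2) \<le> 0" by (auto simp: min_def max_def)
    then show "ennreal (min (a/2) (\<beta> + b/2) - max (- a/2) (\<beta> - b/2)) \<le> ennreal (min (a/2) (\<alpha> + b/2) - max (- a/2) (\<alpha> - b/2))"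
      by (simp add: ennreal_neg)
  qed
qed

lemma line_measure_finite:
  fixes A :: "'a::euclidean_space set"
  assumes "A \<in> sets borel" "bounded A" "norm e = 1"
  obtains m where "line_measure e A x = ennreal m"
proof -
  have "emeasure lborel (line_section e A x) < \<infinity>"
    by (intro emeasure_bounded_finite bounded_line_section assms)
  then show ?thesis using that line_measure_eq[OF assms(1), of e x]
    by (metis emeasure_eq_ennreal_measure less_irrefl infinity_ennreal_def)
qed

lemma ball_overlap:
  fixes x y :: "'a::euclidean_space"
  assumes xy: "norm x \<le> norm y"
  shows "emeasure lborel (ball 0 a \<inter> ball y b) \<le> emeasure lborel (ball 0 a \<inter> ball x b)"
proof (cases "x = y")
  case False
  define d where "d = norm (y - x)"
  define e where "e = (y - x) /\<^sub>R d"
  have d: "d > 0" using False by (simp add: d_def)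
  have e: "norm e = 1" using d by (simp add: e_def d_def)
  have ye: "y = x + d *\<^sub>R e" using d by (simp add: e_def)
  have ee: "e \<bullet> e = 1" using e by (simp add: dot_square_norm)
  have "y \<bullet> e = x \<bullet> e + d" by (simp add: ye inner_add_left ee)
  moreover have "(norm y)\<^sup>2 = (norm x)\<^sup>2 + 2 * d * (x \<bullet> e) + d\<^sup>2"
    unfolding ye power2_norm_eq_inner
    by (simp add: inner_add_left inner_add_right ee inner_commute power2_eq_square)
  moreover have "(norm x)\<^sup>2 \<le> (norm y)\<^sup>2" using xy by (intro power_mono) auto
  ultimately have "0 \<le> d * (2 * (x \<bullet> e) + d)" and yx: "y \<bullet> e = x \<bullet> e + d"
    by (simp_all add: power2_eq_square algebra_simps)
  then have "0 \<le> 2 * (x \<bullet> e) + d" using d by (simp add: zero_le_mult_iff)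
  then have abs: "\<bar>x \<bullet> e\<bar> \<le> \<bar>y \<bullet> e\<bar>" using yx d by (auto simp: abs_if)
  have lm: "line_measure e (ball 0 a \<inter> ball w b) z
      = emeasure lborel {t. t \<in> centered (line_measure e (ball 0 a) z) \<and> t - w \<bullet> e \<in> centered (line_measure e (ball 0 b) (z - w))}" for w z
  proof -
    have "line_section e (ball w b) z = line_section e (ball 0 b) (z - w)"
      by (auto simp: line_section_def dist_norm norm_minus_commute algebra_simps)
    then have "line_section e (ball 0 a \<inter> ball w b) z
      = {t. t + z \<bullet> e \<in> {t. t \<in> centered (line_measure e (ball 0 a) z) \<and> t - w \<bullet> e \<in> centered (line_measure e (ball 0 b) (z - w))}}"
      using line_section_ball[OF e, of a z] line_section_ball[OF e, of b "z - w"]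
      by (auto simp: line_section_def inner_diff_left algebra_simps set_eq_iff)
    moreover have "{t. t \<in> centered (line_measure e (ball 0 a) z) \<and> t - w \<bullet> e \<in> centered (line_measure e (ball 0 b) (z - w))} \<in> sets borel"
    proof -
      have "(\<lambda>t. t - w \<bullet> e) -` centered (line_measure e (ball 0 b) (z - w)) \<inter> space borel \<in> sets borel"
        by measurable
      then have "centered (line_measure e (ball 0 a) z) \<inter> (\<lambda>t. t - w \<bullet> e) -` centered (line_measure e (ball 0 b) (z - w)) \<in> sets borel"
        by simp
      then show ?thesis by (simp add: vimage_def Int_def)
    qed
    ultimately show ?thesis
      by (simp only: line_measure_eq[of "ball 0 a \<inter> ball w b"] borel_open open_Int open_ball emeasure_lborel_vimage_translate)
  qed
  have "line_measure e (ball 0 a \<inter> ball y b) z \<le> line_measure e (ball 0 a \<inter> ball x b) z" for z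
  proof -
    obtain m1 where m1: "line_measure e (ball 0 a) z = ennreal m1"
      using line_measure_finite[of "ball 0 a" e z] e by auto
    obtain m2 where m2: "line_measure e (ball 0 b) (z - y) = ennreal m2"
      using line_measure_finite[of "ball 0 b" e "z - y"] e by auto
    have "line_measure e (ball 0 b) (z - x) = ennreal m2"
      using line_measure_shift[of "ball 0 b" e "z - y" d] m2 by (simp add: ye)
    then show ?thesis using centered_overlap[OF abs] by (simp add: lm m1 m2)
  qed
  then show ?thesis
    by (simp add: emeasure_slab[OF _ e] mult_left_mono nn_integral_mono)
qed simp

lemma nn_convolution_radial:
  fixes q w :: "'a::euclidean_space \<Rightarrow> real"
  assumes q: "rdec q" and w: "rdec w" and xy: "norm x \<le> norm y"
  shows "(\<integral>\<^sup>+z. ennreal (q (y - z)) * ennreal (w z) \<partial>lborel) \<le> (\<integral>\<^sup>+z. ennreal (q (x - z)) * ennreal (w z) \<partial>lborel)"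
proof -
  have [measurable]: "q \<in> borel_measurable borel" "w \<in> borel_measurable borel"
    using q w by (simp_all add: rdec_measurable)
  have lay: "(\<integral>\<^sup>+z. ennreal (q (v - z)) * ennreal (w z) \<partial>lborel)
    = (\<integral>\<^sup>+s. indicator {0..} s * (\<integral>\<^sup>+t. indicator {0..} t * emeasure lborel ({z. s < w z} \<inter> {z. t < q (v - z)}) \<partial>lborel) \<partial>lborel)" for v
  proof -
    have [measurable]: "{z. s < w z} \<in> sets borel" "{z. t < q (v - z)} \<in> sets borel" for s t by measurable
    have "(\<integral>\<^sup>+z. ennreal (q (v - z)) * ennreal (w z) \<partial>lborel)
      = (\<integral>\<^sup>+s. indicator {0..} s * (\<integral>\<^sup>+z. indicator {z. s < w z} z * ennreal (q (v - z)) \<partial>lborel) \<partial>lborel)"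
    proof -
      have "(\<integral>\<^sup>+z. ennreal (q (v - z)) * ennreal (w z) \<partial>lborel)
        = (\<integral>\<^sup>+s. indicator {0..} s * (\<integral>\<^sup>+z. ennreal (q (v - z)) * indicator {z. s < w z} z \<partial>lborel) \<partial>lborel)"
        by (rule nn_integral_layer_cake) (simp_all add: rdec_nonneg[OF w])
      then show ?thesis by (simp only: mult.commute)
    qed
    also have "\<dots> = (\<integral>\<^sup>+s. indicator {0..} s * (\<integral>\<^sup>+t. indicator {0..} t * (\<integral>\<^sup>+z. indicator {z. s < w z} z * indicator {z. t < q (v - z)} z \<partial>lborel) \<partial>lborel) \<partial>lborel)"
      by (simp add: nn_integral_layer_cake rdec_nonneg[OF q])
    finally show ?thesis by (simp flip: indicator_inter_arith)
  qed
  have "emeasure lborel ({z. s < w z} \<inter> {z. t < q (y - z)}) \<le> emeasure lborel ({z. s < w z} \<inter> {z. t < q (x - z)})"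
    if s: "0 \<le> s" and t: "0 \<le> t" for s t
  proof -
    obtain a where a: "AE z in lborel. s < w z \<longleftrightarrow> z \<in> ball 0 a" using rdec_level_AE[OF w s] .
    obtain r where r: "{x. t < q x} - {0} = ball 0 r - {0} \<or> {x. t < q x} - {0} = cball 0 r - {0}"
      using rdec_level[OF q t] .
    have eq: "emeasure lborel ({z. s < w z} \<inter> {z. t < q (v - z)}) = emeasure lborel (ball 0 a \<inter> ball v r)" for v
    proof (rule emeasure_eq_AE)
      have 1: "AE z in lborel. z \<notin> sphere v r"
        by (intro AE_not_in null_setsI sphere_null) simp
      show "AE z in lborel. z \<in> {z. s < w z} \<inter> {z. t < q (v - z)} \<longleftrightarrow> z \<in> ball 0 a \<inter> ball v r"
        using a 1 AE_lborel_singleton[of v]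
      proof eventually_elim
        case (elim z)
        have "v - z \<in> {x. t < q x} - {0} \<longleftrightarrow> z \<in> ball v r"
        proof (rule disjE[OF r])
          assume "{x. t < q x} - {0} = ball 0 r - {0}"
          then have "v - z \<in> {x. t < q x} - {0} \<longleftrightarrow> v - z \<in> ball 0 r - {0}" by (rule arg_cong)
          then show ?thesis using elim by (simp add: dist_norm norm_minus_commute)
        next
          assume "{x. t < q x} - {0} = cball 0 r - {0}"
          then have "v - z \<in> {x. t < q x} - {0} \<longleftrightarrow> v - z \<in> cball 0 r - {0}" by (rule arg_cong)
          then show ?thesis using elim by (simp add: dist_norm norm_minus_commute less_le)
        qed
        then show ?case using elim by simp
      qed
    qed measurable
    show ?thesis unfolding eq by (rule ball_overlap[OF xy])
  qed
  then show ?thesis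
    unfolding lay by (auto intro!: nn_integral_mono simp: indicator_def)
qed

section \<open>A Poincare inequality\<close>

lemma nn_integral_lborel_iter_translate:
  fixes z :: "'a::euclidean_space \<Rightarrow> real"
  assumes [measurable]: "z \<in> borel_measurable borel"
  shows "(\<integral>\<^sup>+x. ennreal ((z (x + real k *\<^sub>R h) - z x)\<^sup>2) \<partial>lborel)
    \<le> ennreal (real k * real k) * (\<integral>\<^sup>+x. ennreal ((z (x + h) - z x)\<^sup>2) \<partial>lborel)"
proof -
  have tele: "z (x + real k *\<^sub>R h) - z x = (\<Sum>i<k. z (x + real i *\<^sub>R h + h) - z (x + real i *\<^sub>R h))" for x
  proof (induction k)
    case (Suc k)
    then show ?case by (simp add: algebra_simps)
  qed simp
  have "(\<integral>\<^sup>+x. ennreal ((z (x + real k *\<^sub>R h) - z x)\<^sup>2) \<partial>lborel)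
    \<le> (\<integral>\<^sup>+x. ennreal (real k) * (\<Sum>i<k. ennreal ((z (x + real i *\<^sub>R h + h) - z (x + real i *\<^sub>R h))\<^sup>2)) \<partial>lborel)"
  proof (rule nn_integral_mono)
    fix x
    have "(z (x + real k *\<^sub>R h) - z x)\<^sup>2 \<le> real k * (\<Sum>i<k. (z (x + real i *\<^sub>R h + h) - z (x + real i *\<^sub>R h))\<^sup>2)"
      unfolding tele using sum_squared_le_sum_of_squares[of "\<lambda>i. z (x + real i *\<^sub>R h + h) - z (x + real i *\<^sub>R h)" "{..<k}"]
      by (simp add: mult.commute)
    then show "ennreal ((z (x + real k *\<^sub>R h) - z x)\<^sup>2)
      \<le> ennreal (real k) * (\<Sum>i<k. ennreal ((z (x + real i *\<^sub>R h + h) - z (x + real i *\<^sub>R h))\<^sup>2))"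
      by (simp add: sum_ennreal sum_nonneg flip: ennreal_mult)
  qed
  also have "\<dots> = ennreal (real k) * (\<Sum>i<k. \<integral>\<^sup>+x. ennreal ((z (x + real i *\<^sub>R h + h) - z (x + real i *\<^sub>R h))\<^sup>2) \<partial>lborel)"
    by (simp add: nn_integral_cmult nn_integral_sum del: sum_ennreal)
  also have "\<dots> = ennreal (real k) * (\<Sum>i<k. \<integral>\<^sup>+x. ennreal ((z (x + h) - z x)\<^sup>2) \<partial>lborel)"
    by (intro arg_cong2[where f="(*)"] refl sum.cong
        nn_integral_lborel_translate[of "\<lambda>x. ennreal ((z (x + h) - z x)\<^sup>2)"]) measurable
  also have "\<dots> = ennreal (real k * real k) * (\<integral>\<^sup>+x. ennreal ((z (x + h) - z x)\<^sup>2) \<partial>lborel)"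
    by (simp add: ennreal_mult mult.assoc ennreal_of_nat_eq_real_of_nat)
  finally show ?thesis .
qed

lemma nn_integral_far_translate:
  fixes z :: "'a::euclidean_space \<Rightarrow> real"
  assumes [measurable]: "z \<in> borel_measurable borel" and out: "\<And>x. x \<notin> ball 0 R \<Longrightarrow> z x = 0"
    and v: "2 * R \<le> norm v"
  shows "(\<integral>\<^sup>+x. ennreal ((z (x + v) - z x)\<^sup>2) \<partial>lborel) = 2 * (\<integral>\<^sup>+x. ennreal ((z x)\<^sup>2) \<partial>lborel)"
proof -
  have "ennreal ((z (x + v) - z x)\<^sup>2) = ennreal ((z (x + v))\<^sup>2) + ennreal ((z x)\<^sup>2)" for x
  proof -
    have "\<not> (norm (x + v) < R \<and> norm x < R)" using v norm_triangle_ineq4[of "x + v" x] by auto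
    then have "z (x + v) = 0 \<or> z x = 0" using out[of "x + v"] out[of x] by auto
    then show ?thesis by auto
  qed
  then have "(\<integral>\<^sup>+x. ennreal ((z (x + v) - z x)\<^sup>2) \<partial>lborel)
    = (\<integral>\<^sup>+x. ennreal ((z (x + v))\<^sup>2) \<partial>lborel) + (\<integral>\<^sup>+x. ennreal ((z x)\<^sup>2) \<partial>lborel)"
    by (simp add: nn_integral_add)
  also have "(\<integral>\<^sup>+x. ennreal ((z (x + v))\<^sup>2) \<partial>lborel) = (\<integral>\<^sup>+x. ennreal ((z x)\<^sup>2) \<partial>lborel)"
    by (rule nn_integral_lborel_translate[of "\<lambda>x. ennreal ((z x)\<^sup>2)"]) measurable
  finally show ?thesis by (simp add: mult_2)
qed

lemma poincare:
  assumes \<eta>: "0 < \<eta>" and \<delta>: "0 < \<delta>" and R: "0 < R"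
  obtains \<kappa> where "0 < \<kappa>"
    "\<And>q z :: 'a::euclidean_space \<Rightarrow> real. q \<in> borel_measurable borel \<Longrightarrow> z \<in> borel_measurable borel \<Longrightarrow>
      (\<And>x. x \<noteq> 0 \<Longrightarrow> norm x < \<delta> \<Longrightarrow> \<eta> \<le> q x) \<Longrightarrow> (\<And>x. x \<notin> ball 0 R \<Longrightarrow> z x = 0) \<Longrightarrow>
      ennreal (2 * \<kappa>) * (\<integral>\<^sup>+x. ennreal ((z x)\<^sup>2) \<partial>lborel)
        \<le> (\<integral>\<^sup>+x. \<integral>\<^sup>+y. ennreal (q (x - y) * (z x - z y)\<^sup>2) \<partial>lborel \<partial>lborel)"
proof -
  define S where "S = ball (0::'a) \<delta> - cball 0 (\<delta> / 2)"
  have [measurable]: "S \<in> sets borel" by (simp add: S_def)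
  obtain b :: 'a where "b \<in> Basis" using nonempty_Basis by blast
  then have "(3/4 * \<delta>) *\<^sub>R b \<in> S" using \<delta> by (simp add: S_def)
  moreover have "open S" by (simp add: S_def open_Diff)
  ultimately have "\<not> negligible S" using open_not_negligible by blast
  then have "emeasure lebesgue S \<noteq> 0" by (auto simp: negligible_iff_null_sets null_sets_def)
  then have S0: "emeasure lborel S \<noteq> 0" by simp
  have "emeasure lborel S < \<infinity>" by (rule emeasure_bounded_finite) (simp add: S_def bounded_diff)
  then obtain m where m: "emeasure lborel S = ennreal m" "0 < m"
    using S0 by (cases "emeasure lborel S") (auto simp: less_le)
  define k where "k = nat \<lceil>4 * R / \<delta>\<rceil>"
  have k: "4 * R / \<delta> \<le> real k" by (simp add: k_def real_nat_ceiling_ge)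
  then have k0: "0 < real k" using R \<delta> by (meson divide_pos_pos less_le_trans mult_pos_pos zero_less_numeral)
  define \<kappa> where "\<kappa> = \<eta> * m / (real k * real k)"
  have \<kappa>: "0 < \<kappa>" using \<eta> m k0 by (simp add: \<kappa>_def)
  show thesis
  proof (rule that[OF \<kappa>])
    fix q z :: "'a \<Rightarrow> real"
    assume [measurable]: "q \<in> borel_measurable borel" "z \<in> borel_measurable borel"
      and q: "\<And>x. x \<noteq> 0 \<Longrightarrow> norm x < \<delta> \<Longrightarrow> \<eta> \<le> q x" and out: "\<And>x. x \<notin> ball 0 R \<Longrightarrow> z x = 0"
    define E where "E = (\<integral>\<^sup>+x. ennreal ((z x)\<^sup>2) \<partial>lborel)"
    have one: "ennreal (2 / (real k * real k)) * E \<le> (\<integral>\<^sup>+x. ennreal ((z (x + h) - z x)\<^sup>2) \<partial>lborel)" if "h \<in> S" for h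
    proof -
      have "\<delta> / 2 < norm h" using that by (auto simp: S_def)
      then have "4 * R / \<delta> * (\<delta> / 2) \<le> real k * norm h" using k \<delta> by (intro mult_mono) auto
      then have "2 * R \<le> norm (real k *\<^sub>R h)" using \<delta> by simp
      then have "2 * E = (\<integral>\<^sup>+x. ennreal ((z (x + real k *\<^sub>R h) - z x)\<^sup>2) \<partial>lborel)"
        unfolding E_def by (intro nn_integral_far_translate[symmetric, of _ R] out) auto
      also have "\<dots> \<le> ennreal (real k * real k) * (\<integral>\<^sup>+x. ennreal ((z (x + h) - z x)\<^sup>2) \<partial>lborel)"
        by (rule nn_integral_lborel_iter_translate) measurable
      finally have "ennreal (1 / (real k * real k)) * (2 * E)
        \<le> ennreal (1 / (real k * real k)) * (ennreal (real k * real k) * (\<integral>\<^sup>+x. ennreal ((z (x + h) - z x)\<^sup>2) \<partial>lborel))"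
        by (rule mult_left_mono) simp
      moreover have "ennreal (1 / (real k * real k)) * ennreal (real k * real k) = 1"
        using k0 by (simp flip: ennreal_mult)
      moreover have "ennreal (1 / (real k * real k)) * 2 = ennreal (2 / (real k * real k))"
        using ennreal_mult[of "1 / (real k * real k)" 2] by simp
      ultimately show ?thesis by (simp only: mult.assoc[symmetric] mult_1_left)
    qed
    have "ennreal (2 * \<kappa>) * E = (\<integral>\<^sup>+h. (ennreal \<eta> * (ennreal (2 / (real k * real k)) * E)) * indicator S h \<partial>lborel)"
    proof -
      have "2 * \<kappa> = \<eta> * (2 / (real k * real k)) * m" by (simp add: \<kappa>_def)
      moreover have "ennreal (\<eta> * (2 / (real k * real k)) * m) = ennreal (\<eta> * (2 / (real k * real k))) * ennreal m"
        using \<eta> m by (intro ennreal_mult) auto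
      moreover have "ennreal (\<eta> * (2 / (real k * real k))) = ennreal \<eta> * ennreal (2 / (real k * real k))"
        using \<eta> by (intro ennreal_mult) auto
      ultimately have "ennreal (2 * \<kappa>) = ennreal \<eta> * ennreal (2 / (real k * real k)) * ennreal m"
        by (simp only:)
      moreover have "(\<integral>\<^sup>+h. (ennreal \<eta> * (ennreal (2 / (real k * real k)) * E)) * indicator S h \<partial>lborel)
        = ennreal \<eta> * (ennreal (2 / (real k * real k)) * E) * emeasure lborel S"
        by (rule nn_integral_cmult_indicator) measurable
      ultimately show ?thesis by (simp only: m mult_ac)
    qed
    also have "\<dots> \<le> (\<integral>\<^sup>+h. ennreal (q h) * (\<integral>\<^sup>+x. ennreal ((z (x + h) - z x)\<^sup>2) \<partial>lborel) \<partial>lborel)"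
    proof (rule nn_integral_mono)
      fix h
      show "(ennreal \<eta> * (ennreal (2 / (real k * real k)) * E)) * indicator S h
        \<le> ennreal (q h) * (\<integral>\<^sup>+x. ennreal ((z (x + h) - z x)\<^sup>2) \<partial>lborel)"
      proof (cases "h \<in> S")
        case True
        then have "h \<noteq> 0" "norm h < \<delta>" using \<delta> by (auto simp: S_def)
        then show ?thesis using True q[of h] one[OF True] by (auto intro!: mult_mono ennreal_leI)
      qed simp
    qed
    also have "\<dots> = (\<integral>\<^sup>+h. \<integral>\<^sup>+x. ennreal (q h) * ennreal ((z (x + h) - z x)\<^sup>2) \<partial>lborel \<partial>lborel)"
      by (simp add: nn_integral_cmult)
    also have "\<dots> = (\<integral>\<^sup>+y. \<integral>\<^sup>+h. ennreal (q h) * ennreal ((z (y + h) - z y)\<^sup>2) \<partial>lborel \<partial>lborel)"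
      by (rule lborel_pair.Fubini') measurable
    also have "\<dots> = (\<integral>\<^sup>+y. \<integral>\<^sup>+x. ennreal (q (x - y) * (z x - z y)\<^sup>2) \<partial>lborel \<partial>lborel)"
    proof (rule nn_integral_cong)
      fix y
      show "(\<integral>\<^sup>+h. ennreal (q h) * ennreal ((z (y + h) - z y)\<^sup>2) \<partial>lborel) = (\<integral>\<^sup>+x. ennreal (q (x - y) * (z x - z y)\<^sup>2) \<partial>lborel)"
        using nn_integral_lborel_translate[of "\<lambda>x. ennreal (q (x - y) * (z x - z y)\<^sup>2)" y]
        by (simp add: ennreal_mult'' add.commute)
    qed
    also have "\<dots> = (\<integral>\<^sup>+x. \<integral>\<^sup>+y. ennreal (q (x - y) * (z x - z y)\<^sup>2) \<partial>lborel \<partial>lborel)"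
      by (rule lborel_pair.Fubini') measurable
    finally show "ennreal (2 * \<kappa>) * (\<integral>\<^sup>+x. ennreal ((z x)\<^sup>2) \<partial>lborel)
        \<le> (\<integral>\<^sup>+x. \<integral>\<^sup>+y. ennreal (q (x - y) * (z x - z y)\<^sup>2) \<partial>lborel \<partial>lborel)"
      by (simp add: E_def)
  qed
qed

definition L2ball :: "real \<Rightarrow> ('a::euclidean_space \<Rightarrow> real) set" where
  "L2ball R = {z. z \<in> borel_measurable borel \<and> (\<forall>x. x \<notin> ball 0 R \<longrightarrow> z x = 0) \<and> integrable lborel (\<lambda>x. (z x)\<^sup>2)}"

lemma L2ballD:
  assumes "z \<in> L2ball R"
  shows "z \<in> borel_measurable borel" "x \<notin> ball 0 R \<Longrightarrow> z x = 0" "integrable lborel (\<lambda>x. (z x)\<^sup>2)"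
  using assms by (auto simp: L2ball_def)

lemma L2ball_weight:
  assumes z: "z \<in> L2ball R" and w: "w \<in> L2ball R'" and [measurable]: "k \<in> borel_measurable borel"
    and k: "\<And>x. \<bar>k x\<bar> \<le> (C::real)"
  shows "integrable lborel (\<lambda>x. k x * (z x * w x))"
proof (rule Bochner_Integration.integrable_bound)
  show "integrable lborel (\<lambda>x. C * ((z x)\<^sup>2 + (w x)\<^sup>2))"
    using L2ballD(3)[OF z] L2ballD(3)[OF w] by simp
  have [measurable]: "z \<in> borel_measurable borel" "w \<in> borel_measurable borel"
    using L2ballD(1)[OF z] L2ballD(1)[OF w] .
  show "(\<lambda>x. k x * (z x * w x)) \<in> borel_measurable lborel" by measurable
  show "AE x in lborel. norm (k x * (z x * w x)) \<le> norm (C * ((z x)\<^sup>2 + (w x)\<^sup>2))"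
  proof (rule AE_I2)
    fix x
    have C: "0 \<le> C" using k[of x] by simp
    have "0 \<le> (\<bar>z x\<bar> - \<bar>w x\<bar>)\<^sup>2" by simp
    then have "2 * (\<bar>z x\<bar> * \<bar>w x\<bar>) \<le> (z x)\<^sup>2 + (w x)\<^sup>2"
      by (simp add: power2_diff)
    then have "\<bar>z x\<bar> * \<bar>w x\<bar> \<le> (z x)\<^sup>2 + (w x)\<^sup>2"
      using mult_nonneg_nonneg[OF abs_ge_zero[of "z x"] abs_ge_zero[of "w x"]] by linarith
    then have "\<bar>k x\<bar> * (\<bar>z x\<bar> * \<bar>w x\<bar>) \<le> C * ((z x)\<^sup>2 + (w x)\<^sup>2)"
      using k[of x] C by (intro mult_mono) auto
    then show "norm (k x * (z x * w x)) \<le> norm (C * ((z x)\<^sup>2 + (w x)\<^sup>2))"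
      using C by (simp add: abs_mult)
  qed
qed

lemma L2ball_mult:
  "z \<in> L2ball R \<Longrightarrow> w \<in> L2ball R' \<Longrightarrow> integrable lborel (\<lambda>x. z x * w x)"
  using L2ball_weight[of z R w R' "\<lambda>_. 1" 1] by simp

lemma L2ball_lincomb:
  assumes z: "z \<in> L2ball R" and w: "w \<in> L2ball R"
  shows "(\<lambda>x. a * z x + b * w x) \<in> L2ball R"
proof -
  have [measurable]: "z \<in> borel_measurable borel" "w \<in> borel_measurable borel"
    using L2ballD(1)[OF z] L2ballD(1)[OF w] .
  have "integrable lborel (\<lambda>x. a\<^sup>2 * (z x)\<^sup>2 + 2 * a * b * (z x * w x) + b\<^sup>2 * (w x)\<^sup>2)"
    using L2ballD(3)[OF z] L2ballD(3)[OF w] L2ball_mult[OF z w]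
    by (intro Bochner_Integration.integrable_add) auto
  then have "integrable lborel (\<lambda>x. (a * z x + b * w x)\<^sup>2)"
    by (simp add: power2_eq_square algebra_simps)
  then show ?thesis using L2ballD(2)[OF z] L2ballD(2)[OF w] by (simp add: L2ball_def)
qed

lemma L2ball_diff: "z \<in> L2ball R \<Longrightarrow> w \<in> L2ball R \<Longrightarrow> (\<lambda>x. z x - w x) \<in> L2ball R"
  using L2ball_lincomb[of z R w 1 "-1"] by simp

lemma L2ball_indicator: "indicator (ball 0 R) \<in> L2ball R"
proof -
  have "integrable lborel (\<lambda>x::'a. indicator (ball 0 R) x :: real)"
    using emeasure_lborel_ball_finite[of "0::'a" R] by (intro integrable_real_indicator) simp_all
  moreover have "(indicator (ball (0::'a) R) x :: real)\<^sup>2 = indicator (ball 0 R) x" for x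
    by (simp add: indicator_def)
  ultimately show ?thesis by (simp add: L2ball_def)
qed

lemma L2ball_integrable: "z \<in> L2ball R \<Longrightarrow> integrable lborel z"
proof -
  assume z: "z \<in> L2ball R"
  have "(\<lambda>x. z x * indicator (ball 0 R) x) = z"
  proof
    show "z x * indicator (ball 0 R) x = z x" for x
      using L2ballD(2)[OF z, of x] by (cases "x \<in> ball 0 R") (simp_all add: indicator_def)
  qed
  then show ?thesis using L2ball_mult[OF z L2ball_indicator[of R]] by simp
qed

lemma L2ball_dominated:
  assumes z: "z \<in> L2ball R" and [measurable]: "w \<in> borel_measurable borel" and le: "\<And>x. \<bar>w x\<bar> \<le> \<bar>z x\<bar>"
  shows "w \<in> L2ball R"
proof -
  have "integrable lborel (\<lambda>x. (w x)\<^sup>2)"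
    by (rule Bochner_Integration.integrable_bound[OF L2ballD(3)[OF z]]) (use le in \<open>auto simp: abs_le_square_iff[symmetric]\<close>)
  moreover have "w x = 0" if "x \<notin> ball 0 R" for x using le[of x] L2ballD(2)[OF z that] by simp
  ultimately show ?thesis by (simp add: L2ball_def)
qed

section \<open>The energy of an integrable kernel\<close>

lemma rdec_indicator_ball: "rdec (indicator (ball (0::'a::euclidean_space) r))"
  unfolding rdec_def
proof (intro conjI allI impI)
  show "bounded {x::'a. (indicator (ball 0 r) x :: real) \<noteq> 0}"
    by (rule bounded_subset[OF bounded_ball[of 0 r]]) (auto simp: indicator_def)
qed (auto simp: indicator_def)

locale bounded_kernel =
  fixes q F cs :: "'a::euclidean_space \<Rightarrow> real" and Q R M \<kappa> :: real
  assumes q: "rdec q" and q_le: "q x \<le> Q" and R: "0 < R" and j_pos: "0 < (LINT x|lborel. q x)"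
    and cs_meas [measurable]: "cs \<in> borel_measurable borel"
    and cs_nonneg: "0 \<le> cs x" and cs_le: "cs x \<le> M"
    and cs_mono: "y \<in> ball 0 R \<Longrightarrow> norm x \<le> norm y \<Longrightarrow> cs x \<le> cs y"
    and F_rdec: "rdec F" and F_L2: "F \<in> L2ball R"
    and \<kappa>: "0 < \<kappa>"
    and poinc: "z \<in> L2ball R \<Longrightarrow> ennreal (2 * \<kappa>) * (\<integral>\<^sup>+x. ennreal ((z x)\<^sup>2) \<partial>lborel)
        \<le> (\<integral>\<^sup>+x. \<integral>\<^sup>+y. ennreal (q (x - y) * (z x - z y)\<^sup>2) \<partial>lborel \<partial>lborel)"
begin

definition j :: real where "j = (LINT x|lborel. q x)"

lemma j: "0 < j" using j_pos by (simp add: j_def)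

lemma q_meas [measurable]: "q \<in> borel_measurable borel" using q by (rule rdec_measurable)

lemma q_nonneg: "0 \<le> q x" using q by (rule rdec_nonneg)

lemma F_meas [measurable]: "F \<in> borel_measurable borel" using F_rdec by (rule rdec_measurable)

lemma q_sym: "q (x - y) = q (y - x)"
proof (cases "x = y")
  case False
  then show ?thesis using rdecD[OF q, of "x - y" "y - x"] rdecD[OF q, of "y - x" "x - y"]
    by (simp add: norm_minus_commute)
qed simp

lemma q_int: "integrable lborel q"
proof -
  obtain r where r: "{x. q x \<noteq> 0} \<subseteq> ball 0 r"
    using q unfolding rdec_def by (meson bounded_subset_ballD)
  have "integrable lborel (indicator (ball (0::'a) r) :: 'a \<Rightarrow> real)"
    using emeasure_lborel_ball_finite[of "0::'a" r] by (intro integrable_real_indicator) simp_all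
  then have "integrable lborel (\<lambda>x. Q * indicator (ball (0::'a) r) x)" by simp
  then show ?thesis
  proof (rule Bochner_Integration.integrable_bound)
    show "AE x in lborel. norm (q x) \<le> norm (Q * indicator (ball 0 r) x)"
    proof (rule AE_I2)
      fix x
      show "norm (q x) \<le> norm (Q * indicator (ball 0 r) x)"
      proof (cases "x \<in> ball 0 r")
        case True
        then show ?thesis using q_le[of x] q_nonneg[of x] by (simp add: indicator_def)
      next
        case False
        then have "q x = 0" using r by blast
        then show ?thesis by simp
      qed
    qed
  qed measurable
qed

lemma nn_q: "(\<integral>\<^sup>+x. ennreal (q x) \<partial>lborel) = ennreal j"
  unfolding j_def by (rule nn_integral_eq_integral[OF q_int]) (simp add: q_nonneg)

lemma nn_q_shift: "(\<integral>\<^sup>+y. ennreal (q (x - y)) \<partial>lborel) = ennreal j" "(\<integral>\<^sup>+x. ennreal (q (x - y)) \<partial>lborel) = ennreal j"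
  using nn_integral_lborel_reflect[of "\<lambda>y. ennreal (q y)" x] nn_integral_lborel_translate[of "\<lambda>y. ennreal (q y)" "- y"]
  by (simp_all add: nn_q)

lemma sq_nn:
  assumes "z \<in> L2ball R"
  shows "(\<integral>\<^sup>+x. ennreal ((z x)\<^sup>2) \<partial>lborel) = ennreal (LINT x|lborel. (z x)\<^sup>2)"
  by (rule nn_integral_eq_integral[OF L2ballD(3)[OF assms]]) simp

lemma pair_fst_sq:
  assumes z: "z \<in> L2ball R"
  shows "has_bochner_integral (lborel \<Otimes>\<^sub>M lborel) (\<lambda>p. q (fst p - snd p) * (z (fst p))\<^sup>2) (j * (LINT x|lborel. (z x)\<^sup>2))"
proof (rule has_bochner_integral_nn_integral)
  have [measurable]: "z \<in> borel_measurable borel" using L2ballD(1)[OF z] .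
  show "(\<lambda>p. q (fst p - snd p) * (z (fst p))\<^sup>2) \<in> borel_measurable (lborel \<Otimes>\<^sub>M lborel)" by measurable
  have "(\<integral>\<^sup>+p. ennreal (q (fst p - snd p) * (z (fst p))\<^sup>2) \<partial>(lborel \<Otimes>\<^sub>M lborel))
    = (\<integral>\<^sup>+x. \<integral>\<^sup>+y. ennreal (q (x - y)) * ennreal ((z x)\<^sup>2) \<partial>lborel \<partial>lborel)"
    by (subst lborel.nn_integral_fst[symmetric]) (simp_all add: ennreal_mult q_nonneg)
  also have "\<dots> = ennreal j * (\<integral>\<^sup>+x. ennreal ((z x)\<^sup>2) \<partial>lborel)"
    by (simp add: nn_integral_multc nn_q_shift nn_integral_cmult)
  also have "\<dots> = ennreal (j * (LINT x|lborel. (z x)\<^sup>2))"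
    using j by (simp add: sq_nn[OF z] ennreal_mult)
  finally show "(\<integral>\<^sup>+p. ennreal (q (fst p - snd p) * (z (fst p))\<^sup>2) \<partial>(lborel \<Otimes>\<^sub>M lborel)) = ennreal (j * (LINT x|lborel. (z x)\<^sup>2))" .
qed (use j q_nonneg in simp_all)

lemma pair_snd_sq:
  assumes z: "z \<in> L2ball R"
  shows "has_bochner_integral (lborel \<Otimes>\<^sub>M lborel) (\<lambda>p. q (fst p - snd p) * (z (snd p))\<^sup>2) (j * (LINT x|lborel. (z x)\<^sup>2))"
proof (rule has_bochner_integral_nn_integral)
  have [measurable]: "z \<in> borel_measurable borel" using L2ballD(1)[OF z] .
  show "(\<lambda>p. q (fst p - snd p) * (z (snd p))\<^sup>2) \<in> borel_measurable (lborel \<Otimes>\<^sub>M lborel)" by measurable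
  have "(\<integral>\<^sup>+p. ennreal (q (fst p - snd p) * (z (snd p))\<^sup>2) \<partial>(lborel \<Otimes>\<^sub>M lborel))
    = (\<integral>\<^sup>+y. \<integral>\<^sup>+x. ennreal (q (x - y)) * ennreal ((z y)\<^sup>2) \<partial>lborel \<partial>lborel)"
    by (subst lborel_pair.nn_integral_snd[symmetric]) (simp_all add: ennreal_mult q_nonneg)
  also have "\<dots> = ennreal j * (\<integral>\<^sup>+x. ennreal ((z x)\<^sup>2) \<partial>lborel)"
    by (simp add: nn_integral_multc nn_q_shift nn_integral_cmult)
  also have "\<dots> = ennreal (j * (LINT x|lborel. (z x)\<^sup>2))"
    using j by (simp add: sq_nn[OF z] ennreal_mult)
  finally show "(\<integral>\<^sup>+p. ennreal (q (fst p - snd p) * (z (snd p))\<^sup>2) \<partial>(lborel \<Otimes>\<^sub>M lborel)) = ennreal (j * (LINT x|lborel. (z x)\<^sup>2))" .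
qed (use j q_nonneg in simp_all)

definition B :: "('a \<Rightarrow> real) \<Rightarrow> ('a \<Rightarrow> real) \<Rightarrow> real" where
  "B z w = (LINT p|(lborel \<Otimes>\<^sub>M lborel). q (fst p - snd p) * (z (fst p) * w (snd p)))"

lemma B_int:
  assumes z: "z \<in> L2ball R" and w: "w \<in> L2ball R"
  shows "integrable (lborel \<Otimes>\<^sub>M lborel) (\<lambda>p. q (fst p - snd p) * (z (fst p) * w (snd p)))"
proof (rule Bochner_Integration.integrable_bound)
  have [measurable]: "z \<in> borel_measurable borel" "w \<in> borel_measurable borel"
    using L2ballD(1)[OF z] L2ballD(1)[OF w] .
  show "integrable (lborel \<Otimes>\<^sub>M lborel) (\<lambda>p. q (fst p - snd p) * (z (fst p))\<^sup>2 + q (fst p - snd p) * (w (snd p))\<^sup>2)"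
    using pair_fst_sq[OF z] pair_snd_sq[OF w] by (auto simp: has_bochner_integral_iff)
  show "(\<lambda>p. q (fst p - snd p) * (z (fst p) * w (snd p))) \<in> borel_measurable (lborel \<Otimes>\<^sub>M lborel)" by measurable
  show "AE p in lborel \<Otimes>\<^sub>M lborel. norm (q (fst p - snd p) * (z (fst p) * w (snd p)))
    \<le> norm (q (fst p - snd p) * (z (fst p))\<^sup>2 + q (fst p - snd p) * (w (snd p))\<^sup>2)"
  proof (rule AE_I2)
    fix p
    have "0 \<le> (\<bar>z (fst p)\<bar> - \<bar>w (snd p)\<bar>)\<^sup>2" by simp
    then have "2 * (\<bar>z (fst p)\<bar> * \<bar>w (snd p)\<bar>) \<le> (z (fst p))\<^sup>2 + (w (snd p))\<^sup>2"
      by (simp add: power2_diff)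
    then have "\<bar>z (fst p)\<bar> * \<bar>w (snd p)\<bar> \<le> (z (fst p))\<^sup>2 + (w (snd p))\<^sup>2"
      using mult_nonneg_nonneg[OF abs_ge_zero[of "z (fst p)"] abs_ge_zero[of "w (snd p)"]] by linarith
    from mult_left_mono[OF this q_nonneg[of "fst p - snd p"]]
    show "norm (q (fst p - snd p) * (z (fst p) * w (snd p)))
      \<le> norm (q (fst p - snd p) * (z (fst p))\<^sup>2 + q (fst p - snd p) * (w (snd p))\<^sup>2)"
      using q_nonneg[of "fst p - snd p"] by (simp add: abs_mult distrib_left)
  qed
qed

lemma B_lincomb:
  assumes "z \<in> L2ball R" "z' \<in> L2ball R" "w \<in> L2ball R"
  shows "B (\<lambda>x. a * z x + b * z' x) w = a * B z w + b * B z' w"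
proof -
  have "B (\<lambda>x. a * z x + b * z' x) w = (LINT p|(lborel \<Otimes>\<^sub>M lborel).
      a * (q (fst p - snd p) * (z (fst p) * w (snd p))) + b * (q (fst p - snd p) * (z' (fst p) * w (snd p))))"
    unfolding B_def by (simp add: algebra_simps)
  also have "\<dots> = a * B z w + b * B z' w"
    unfolding B_def using assms by (simp add: B_int)
  finally show ?thesis .
qed

lemma B_sym:
  assumes z: "z \<in> L2ball R" and w: "w \<in> L2ball R"
  shows "B z w = B w z"
proof -
  have [measurable]: "z \<in> borel_measurable borel" "w \<in> borel_measurable borel"
    using L2ballD(1)[OF z] L2ballD(1)[OF w] .
  have "(\<lambda>p. q (fst p - snd p) * (z (fst p) * w (snd p))) \<in> borel_measurable (lborel \<Otimes>\<^sub>M lborel)" by measurable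
  from lborel_pair.integral_product_swap[OF this]
  have "B z w = (LINT p|(lborel \<Otimes>\<^sub>M lborel). (case p of (x, y) \<Rightarrow> q (y - x) * (z y * w x)))"
    unfolding B_def by simp
  also have "\<dots> = B w z"
    unfolding B_def
  proof (rule Bochner_Integration.integral_cong[OF refl])
    fix p :: "'a \<times> 'a"
    show "(case p of (x, y) \<Rightarrow> q (y - x) * (z y * w x)) = q (fst p - snd p) * (w (fst p) * z (snd p))"
      using q_sym[of "snd p" "fst p"] by (simp add: case_prod_beta)
  qed
  finally show ?thesis .
qed

lemma energy:
  assumes z: "z \<in> L2ball R" and s: "s * s = 1"
  shows "has_bochner_integral (lborel \<Otimes>\<^sub>M lborel) (\<lambda>p. q (fst p - snd p) * (z (fst p) + s * z (snd p))\<^sup>2)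
    (2 * j * (LINT x|lborel. (z x)\<^sup>2) + 2 * s * B z z)"
proof -
  have "has_bochner_integral (lborel \<Otimes>\<^sub>M lborel) (\<lambda>p. q (fst p - snd p) * (z (fst p) * z (snd p))) (B z z)"
    unfolding B_def using B_int[OF z z] by (simp add: has_bochner_integral_iff)
  then have "has_bochner_integral (lborel \<Otimes>\<^sub>M lborel)
    (\<lambda>p. q (fst p - snd p) * (z (fst p))\<^sup>2 + q (fst p - snd p) * (z (snd p))\<^sup>2
      + (2 * s) * (q (fst p - snd p) * (z (fst p) * z (snd p))))
    (j * (LINT x|lborel. (z x)\<^sup>2) + j * (LINT x|lborel. (z x)\<^sup>2) + (2 * s) * B z z)"
    by (intro has_bochner_integral_add pair_fst_sq[OF z] pair_snd_sq[OF z] has_bochner_integral_mult_right) auto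
  moreover have "q (fst p - snd p) * (z (fst p))\<^sup>2 + q (fst p - snd p) * (z (snd p))\<^sup>2
      + (2 * s) * (q (fst p - snd p) * (z (fst p) * z (snd p))) = q (fst p - snd p) * (z (fst p) + s * z (snd p))\<^sup>2" for p
  proof -
    have "(z (fst p) + s * z (snd p))\<^sup>2 = (z (fst p))\<^sup>2 + (s * s) * (z (snd p))\<^sup>2 + 2 * s * (z (fst p) * z (snd p))"
      by (simp add: power2_eq_square algebra_simps)
    then show ?thesis by (simp add: s algebra_simps)
  qed
  ultimately show ?thesis by (simp add: algebra_simps)
qed

lemma energy_nn:
  assumes z: "z \<in> L2ball R"
  shows "(\<integral>\<^sup>+x. \<integral>\<^sup>+y. ennreal (q (x - y) * (z x - z y)\<^sup>2) \<partial>lborel \<partial>lborel)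
    = ennreal (2 * j * (LINT x|lborel. (z x)\<^sup>2) - 2 * B z z)"
proof -
  have [measurable]: "z \<in> borel_measurable borel" using L2ballD(1)[OF z] .
  have e: "has_bochner_integral (lborel \<Otimes>\<^sub>M lborel) (\<lambda>p. q (fst p - snd p) * (z (fst p) - z (snd p))\<^sup>2)
    (2 * j * (LINT x|lborel. (z x)\<^sup>2) - 2 * B z z)"
    using energy[OF z, of "-1"] by simp
  have "(\<integral>\<^sup>+x. \<integral>\<^sup>+y. ennreal (q (x - y) * (z x - z y)\<^sup>2) \<partial>lborel \<partial>lborel)
    = (\<integral>\<^sup>+p. ennreal (q (fst p - snd p) * (z (fst p) - z (snd p))\<^sup>2) \<partial>(lborel \<Otimes>\<^sub>M lborel))"
    by (subst lborel.nn_integral_fst[symmetric]) simp_all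
  also have "\<dots> = ennreal (LINT p|(lborel \<Otimes>\<^sub>M lborel). q (fst p - snd p) * (z (fst p) - z (snd p))\<^sup>2)"
    using e q_nonneg by (intro nn_integral_eq_integral) (auto simp: has_bochner_integral_iff)
  also have "\<dots> = ennreal (2 * j * (LINT x|lborel. (z x)\<^sup>2) - 2 * B z z)"
    using e by (simp add: has_bochner_integral_iff)
  finally show ?thesis .
qed

lemma energy_nonneg:
  assumes z: "z \<in> L2ball R"
  shows "\<kappa> * (LINT x|lborel. (z x)\<^sup>2) \<le> j * (LINT x|lborel. (z x)\<^sup>2) - B z z"
proof -
  have e: "has_bochner_integral (lborel \<Otimes>\<^sub>M lborel) (\<lambda>p. q (fst p - snd p) * (z (fst p) - z (snd p))\<^sup>2)
    (2 * j * (LINT x|lborel. (z x)\<^sup>2) - 2 * B z z)"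
    using energy[OF z, of "-1"] by simp
  have "0 \<le> (LINT p|(lborel \<Otimes>\<^sub>M lborel). q (fst p - snd p) * (z (fst p) - z (snd p))\<^sup>2)"
    using q_nonneg by (intro integral_nonneg_AE) simp
  then have "0 \<le> 2 * j * (LINT x|lborel. (z x)\<^sup>2) - 2 * B z z" using e by (simp add: has_bochner_integral_iff)
  moreover have "ennreal (2 * \<kappa> * (LINT x|lborel. (z x)\<^sup>2)) \<le> ennreal (2 * j * (LINT x|lborel. (z x)\<^sup>2) - 2 * B z z)"
    using poinc[OF z] \<kappa> by (simp only: energy_nn[OF z] sq_nn[OF z]) (simp add: ennreal_mult)
  ultimately show ?thesis by simp
qed

lemma energy_plus:
  assumes z: "z \<in> L2ball R"
  shows "\<kappa> * (LINT x|lborel. (z x)\<^sup>2) \<le> j * (LINT x|lborel. (z x)\<^sup>2) + B z z"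
proof -
  have [measurable]: "z \<in> borel_measurable borel" using L2ballD(1)[OF z] .
  have az: "(\<lambda>x. \<bar>z x\<bar>) \<in> L2ball R" by (rule L2ball_dominated[OF z]) auto
  have e1: "has_bochner_integral (lborel \<Otimes>\<^sub>M lborel) (\<lambda>p. q (fst p - snd p) * (\<bar>z (fst p)\<bar> + -1 * \<bar>z (snd p)\<bar>)\<^sup>2)
    (2 * j * (LINT x|lborel. \<bar>z x\<bar>\<^sup>2) + 2 * (-1) * B (\<lambda>x. \<bar>z x\<bar>) (\<lambda>x. \<bar>z x\<bar>))"
    by (rule energy[OF az]) simp
  have e2: "has_bochner_integral (lborel \<Otimes>\<^sub>M lborel) (\<lambda>p. q (fst p - snd p) * (z (fst p) + 1 * z (snd p))\<^sup>2)
    (2 * j * (LINT x|lborel. (z x)\<^sup>2) + 2 * 1 * B z z)"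
    by (rule energy[OF z]) simp
  have "(LINT p|(lborel \<Otimes>\<^sub>M lborel). q (fst p - snd p) * (\<bar>z (fst p)\<bar> + -1 * \<bar>z (snd p)\<bar>)\<^sup>2)
    \<le> (LINT p|(lborel \<Otimes>\<^sub>M lborel). q (fst p - snd p) * (z (fst p) + 1 * z (snd p))\<^sup>2)"
  proof (rule integral_mono)
    fix p
    have "(\<bar>z (fst p)\<bar> + -1 * \<bar>z (snd p)\<bar>)\<^sup>2 \<le> (z (fst p) + 1 * z (snd p))\<^sup>2"
      unfolding abs_le_square_iff[symmetric] by simp
    then show "q (fst p - snd p) * (\<bar>z (fst p)\<bar> + -1 * \<bar>z (snd p)\<bar>)\<^sup>2 \<le> q (fst p - snd p) * (z (fst p) + 1 * z (snd p))\<^sup>2"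
      using q_nonneg by (rule mult_left_mono)
  qed (use e1 e2 in \<open>auto simp: has_bochner_integral_iff\<close>)
  then have "2 * j * (LINT x|lborel. \<bar>z x\<bar>\<^sup>2) + 2 * (-1) * B (\<lambda>x. \<bar>z x\<bar>) (\<lambda>x. \<bar>z x\<bar>)
    \<le> 2 * j * (LINT x|lborel. (z x)\<^sup>2) + 2 * 1 * B z z"
    unfolding has_bochner_integral_integral_eq[OF e1] has_bochner_integral_integral_eq[OF e2] .
  then show ?thesis using energy_nonneg[OF az] by simp
qed

definition S :: "('a \<Rightarrow> real) \<Rightarrow> ('a \<Rightarrow> real) \<Rightarrow> real" where
  "S z w = (LINT x|lborel. (j + cs x) * (z x * w x))"

definition I :: "('a \<Rightarrow> real) \<Rightarrow> real" where
  "I z = (S z z - B z z) / 2 - (LINT x|lborel. F x * z x)"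

lemma S_int:
  assumes "z \<in> L2ball R" "w \<in> L2ball R"
  shows "integrable lborel (\<lambda>x. (j + cs x) * (z x * w x))"
proof (rule L2ball_weight[OF assms])
  show "\<bar>j + cs x\<bar> \<le> j + M" for x using cs_nonneg[of x] cs_le[of x] j by simp
qed measurable

lemma S_lincomb:
  assumes "z \<in> L2ball R" "z' \<in> L2ball R" "w \<in> L2ball R"
  shows "S (\<lambda>x. a * z x + b * z' x) w = a * S z w + b * S z' w"
proof -
  have "S (\<lambda>x. a * z x + b * z' x) w = (LINT x|lborel. a * ((j + cs x) * (z x * w x)) + b * ((j + cs x) * (z' x * w x)))"
    unfolding S_def by (simp add: algebra_simps)
  also have "\<dots> = a * S z w + b * S z' w"
    unfolding S_def using assms by (simp add: S_int)
  finally show ?thesis .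
qed

lemma S_sym: "S z w = S w z" unfolding S_def by (simp add: mult_ac)

lemma S_ge:
  assumes z: "z \<in> L2ball R"
  shows "j * (LINT x|lborel. (z x)\<^sup>2) \<le> S z z"
proof -
  have "(LINT x|lborel. j * (z x)\<^sup>2) \<le> S z z"
    unfolding S_def
  proof (rule integral_mono)
    show "j * (z x)\<^sup>2 \<le> (j + cs x) * (z x * z x)" for x
      using cs_nonneg[of x] by (simp add: power2_eq_square mult_right_mono)
  qed (use L2ballD(3)[OF z] S_int[OF z z] in auto)
  then show ?thesis by simp
qed

lemma I_expand:
  assumes z: "z \<in> L2ball R" and w: "w \<in> L2ball R"
  shows "I (\<lambda>x. z x + a * w x) = I z + a * (S z w - B z w - (LINT x|lborel. F x * w x)) + a * a * ((S w w - B w w) / 2)"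
proof -
  have zw: "(\<lambda>x. 1 * z x + a * w x) \<in> L2ball R" by (rule L2ball_lincomb[OF z w])
  have "S (\<lambda>x. 1 * z x + a * w x) (\<lambda>x. 1 * z x + a * w x) = S z z + 2 * a * S z w + a * a * S w w"
    using S_lincomb[OF z w zw, of 1 a] S_lincomb[OF z w z, of 1 a] S_lincomb[OF z w w, of 1 a]
      S_sym[of z "\<lambda>x. 1 * z x + a * w x"] S_sym[of w "\<lambda>x. 1 * z x + a * w x"] S_sym[of z w]
    by (simp add: algebra_simps)
  moreover have "B (\<lambda>x. 1 * z x + a * w x) (\<lambda>x. 1 * z x + a * w x) = B z z + 2 * a * B z w + a * a * B w w"
    using B_lincomb[OF z w zw, of 1 a] B_lincomb[OF z w z, of 1 a] B_lincomb[OF z w w, of 1 a]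
      B_sym[OF z zw] B_sym[OF w zw] B_sym[OF z w]
    by (simp add: algebra_simps)
  moreover have "(LINT x|lborel. F x * (z x + a * w x)) = (LINT x|lborel. F x * z x) + a * (LINT x|lborel. F x * w x)"
    using L2ball_mult[OF F_L2 z] L2ball_mult[OF F_L2 w] by (simp add: algebra_simps)
  ultimately show ?thesis unfolding I_def by (simp add: algebra_simps add_divide_distrib diff_divide_distrib)
qed

end

lemma ball_measurable [measurable]: "ball (a::'a::euclidean_space) r \<in> sets borel"
  by simp

context bounded_kernel
begin

definition A :: "('a \<Rightarrow> real) \<Rightarrow> 'a \<Rightarrow> real" where
  "A w x = (LINT y|lborel. q (x - y) * w y)"

definition T :: "('a \<Rightarrow> real) \<Rightarrow> 'a \<Rightarrow> real" where
  "T w x = indicator (ball 0 R) x * (F x + A w x) * (1 / (j + cs x))"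

lemma Q_nonneg: "0 \<le> Q" using q_nonneg q_le order_trans by blast

lemma A_int:
  assumes w: "w \<in> L2ball R"
  shows "integrable lborel (\<lambda>y. q (x - y) * w y)"
proof (rule Bochner_Integration.integrable_bound)
  have [measurable]: "w \<in> borel_measurable borel" using L2ballD(1)[OF w] .
  show "integrable lborel (\<lambda>y. Q * \<bar>w y\<bar>)" using L2ball_integrable[OF w] by simp
  show "(\<lambda>y. q (x - y) * w y) \<in> borel_measurable lborel" by measurable
  show "AE y in lborel. norm (q (x - y) * w y) \<le> norm (Q * \<bar>w y\<bar>)"
    using q_le q_nonneg Q_nonneg by (intro AE_I2) (auto simp: abs_mult intro!: mult_right_mono)
qed

lemma A_meas [measurable]:
  assumes w: "w \<in> L2ball R"
  shows "A w \<in> borel_measurable borel"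
proof -
  have [measurable]: "w \<in> borel_measurable borel" using L2ballD(1)[OF w] .
  show ?thesis unfolding A_def by measurable
qed

lemma A_bound:
  assumes w: "w \<in> L2ball R"
  shows "\<bar>A w x\<bar> \<le> Q * (LINT y|lborel. \<bar>w y\<bar>)"
proof -
  have "\<bar>A w x\<bar> \<le> (LINT y|lborel. norm (q (x - y) * w y))"
    unfolding A_def using integral_norm_bound[of lborel "\<lambda>y. q (x - y) * w y"] by simp
  also have "\<dots> \<le> (LINT y|lborel. Q * \<bar>w y\<bar>)"
  proof (rule integral_mono)
    show "integrable lborel (\<lambda>y. norm (q (x - y) * w y))" using A_int[OF w] by (rule integrable_norm)
    show "integrable lborel (\<lambda>y. Q * \<bar>w y\<bar>)" using L2ball_integrable[OF w] by simp
    show "norm (q (x - y) * w y) \<le> Q * \<bar>w y\<bar>" for y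
      using q_le q_nonneg by (auto simp: abs_mult intro!: mult_right_mono)
  qed
  finally show ?thesis by simp
qed

lemma A_nn:
  assumes w: "w \<in> L2ball R" and pos: "\<And>x. 0 \<le> w x"
  shows "ennreal (A w x) = (\<integral>\<^sup>+y. ennreal (q (x - y)) * ennreal (w y) \<partial>lborel)" "0 \<le> A w x"
proof -
  have "(\<integral>\<^sup>+y. ennreal (q (x - y)) * ennreal (w y) \<partial>lborel) = (\<integral>\<^sup>+y. ennreal (q (x - y) * w y) \<partial>lborel)"
    by (simp add: ennreal_mult q_nonneg pos)
  also have "\<dots> = ennreal (A w x)"
    unfolding A_def by (rule nn_integral_eq_integral[OF A_int[OF w]]) (simp add: q_nonneg pos)
  finally show "ennreal (A w x) = (\<integral>\<^sup>+y. ennreal (q (x - y)) * ennreal (w y) \<partial>lborel)" by simp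
  show "0 \<le> A w x" unfolding A_def by (intro integral_nonneg_AE) (simp add: q_nonneg pos)
qed

lemma A_antimono:
  assumes w: "w \<in> L2ball R" "rdec w" and xy: "norm x \<le> norm y"
  shows "A w y \<le> A w x"
proof -
  have "ennreal (A w y) \<le> ennreal (A w x)"
    unfolding A_nn(1)[OF w(1) rdec_nonneg[OF w(2)]] by (rule nn_convolution_radial[OF q w(2) xy])
  then show ?thesis using A_nn(2)[OF w(1) rdec_nonneg[OF w(2)]] by simp
qed

lemma A_ball_rdec:
  assumes w: "w \<in> L2ball R" "rdec w"
  shows "rdec (\<lambda>x. indicator (ball 0 R) x * A w x)"
  unfolding rdec_def
proof (intro conjI allI impI)
  show "0 \<le> indicator (ball 0 R) x * A w x" for x
    using A_nn(2)[OF w(1) rdec_nonneg[OF w(2)]] by simp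
  show "indicator (ball 0 R) y * A w y \<le> indicator (ball 0 R) x * A w x" if "norm x \<le> norm y" for x y :: 'a
    using A_antimono[OF w that] A_nn(2)[OF w(1) rdec_nonneg[OF w(2)]] that by (auto simp: indicator_def)
  show "bounded {x. indicator (ball 0 R) x * A w x \<noteq> 0}"
    by (rule bounded_subset[OF bounded_ball[of 0 R]]) (auto simp: indicator_def)
qed

lemma B_A:
  assumes z: "z \<in> L2ball R" and w: "w \<in> L2ball R"
  shows "B z w = (LINT x|lborel. z x * A w x)" "integrable lborel (\<lambda>x. z x * A w x)"
proof -
  have eq: "(LINT y|lborel. q (fst (x, y) - snd (x, y)) * (z (fst (x, y)) * w (snd (x, y)))) = z x * A w x" for x
  proof -
    have "(LINT y|lborel. q (fst (x, y) - snd (x, y)) * (z (fst (x, y)) * w (snd (x, y)))) = (LINT y|lborel. z x * (q (x - y) * w y))"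
      by (simp add: mult_ac)
    then show ?thesis by (simp add: A_def)
  qed
  show "B z w = (LINT x|lborel. z x * A w x)"
    using lborel_pair.integral_fst'[OF B_int[OF z w]] unfolding eq B_def by simp
  show "integrable lborel (\<lambda>x. z x * A w x)"
    using lborel_pair.integrable_fst'[OF B_int[OF z w]] unfolding eq .
qed

lemma weight_rdec: "rdec (\<lambda>x. indicator (ball 0 r) x * (indicator (ball 0 R) x * (1 / (j + cs x))))"
proof (rule rdec_mult[OF rdec_indicator_ball])
  show "rdec (\<lambda>x. indicator (ball 0 R) x * (1 / (j + cs x)))"
    unfolding rdec_def
  proof (intro conjI allI impI)
    show "0 \<le> indicator (ball 0 R) x * (1 / (j + cs x))" for x using j cs_nonneg[of x] by simp
    show "indicator (ball 0 R) y * (1 / (j + cs y)) \<le> indicator (ball 0 R) x * (1 / (j + cs x))" if "norm x \<le> norm y" for x y :: 'a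
    proof (cases "y \<in> ball 0 R")
      case True
      then have "x \<in> ball 0 R" using that by auto
      moreover have "1 / (j + cs y) \<le> 1 / (j + cs x)"
        using cs_mono[OF True that] cs_nonneg[of x] j by (intro divide_left_mono) auto
      ultimately show ?thesis using True by simp
    next
      case False
      then show ?thesis using j cs_nonneg[of x] by simp
    qed
    show "bounded {x. indicator (ball 0 R) x * (1 / (j + cs x)) \<noteq> 0}"
      by (rule bounded_subset[OF bounded_ball[of 0 R]]) (auto simp: indicator_def)
  qed
qed

lemma T_rdec:
  assumes w: "w \<in> L2ball R" "rdec w"
  shows "rdec (T w)"
proof -
  have "rdec (\<lambda>x. (F x + indicator (ball 0 R) x * A w x)
      * (indicator (ball 0 R) x * (indicator (ball 0 R) x * (1 / (j + cs x)))))"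
    by (intro rdec_mult rdec_add F_rdec A_ball_rdec w weight_rdec)
  moreover have "(\<lambda>x. (F x + indicator (ball 0 R) x * A w x)
      * (indicator (ball 0 R) x * (indicator (ball 0 R) x * (1 / (j + cs x))))) = T w"
    by (rule ext) (simp add: T_def indicator_def)
  ultimately show ?thesis by simp
qed

lemma T_L2:
  assumes w: "w \<in> L2ball R"
  shows "T w \<in> L2ball R"
proof -
  have [measurable]: "A w \<in> borel_measurable borel" by (rule A_meas[OF w])
  define C where "C = Q * (LINT y|lborel. \<bar>w y\<bar>)"
  have "(\<lambda>x. (1 / j) * \<bar>F x\<bar> + (C / j) * indicator (ball 0 R) x) \<in> L2ball R"
    by (intro L2ball_lincomb L2ball_indicator L2ball_dominated[OF F_L2]) auto
  then show ?thesis
  proof (rule L2ball_dominated)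
    show "T w \<in> borel_measurable borel" unfolding T_def by measurable
    show "\<bar>T w x\<bar> \<le> \<bar>(1 / j) * \<bar>F x\<bar> + (C / j) * indicator (ball 0 R) x\<bar>" for x
    proof (cases "x \<in> ball 0 R")
      case True
      have C: "\<bar>A w x\<bar> \<le> C" unfolding C_def by (rule A_bound[OF w])
      have "\<bar>T w x\<bar> = \<bar>F x + A w x\<bar> * (1 / (j + cs x))"
        using True j cs_nonneg[of x] by (simp add: T_def abs_mult)
      also have "\<dots> \<le> (\<bar>F x\<bar> + C) * (1 / j)"
        using C j cs_nonneg[of x] by (intro mult_mono divide_left_mono) (auto intro: order_trans[OF abs_triangle_ineq])
      also have "\<dots> = (1 / j) * \<bar>F x\<bar> + (C / j) * indicator (ball 0 R) x"
        using True by (simp add: algebra_simps add_divide_distrib)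
      finally show ?thesis by simp
    qed (simp add: T_def)
  qed
qed

lemma S_T:
  assumes w: "w \<in> L2ball R" and p: "p \<in> L2ball R"
  shows "S (T w) p = (LINT x|lborel. F x * p x) + B p w"
proof -
  have "(j + cs x) * (T w x * p x) = F x * p x + p x * A w x" for x
  proof (cases "x \<in> ball 0 R")
    case True
    then show ?thesis using j cs_nonneg[of x] by (simp add: T_def field_simps)
  next
    case False
    then show ?thesis using L2ballD(2)[OF p False] by simp
  qed
  then have "S (T w) p = (LINT x|lborel. F x * p x + p x * A w x)" by (simp add: S_def)
  then show ?thesis using L2ball_mult[OF F_L2 p] B_A[OF p w] by simp
qed

lemma T_descent:
  assumes w: "w \<in> L2ball R"
  shows "I (T w) \<le> I w - \<kappa> / 2 * (LINT x|lborel. (T w x - w x)\<^sup>2)"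
proof -
  define d where "d x = T w x - w x" for x
  have d: "d \<in> L2ball R" unfolding d_def by (rule L2ball_diff[OF T_L2[OF w] w])
  have Tw: "T w = (\<lambda>x. w x + 1 * d x)" by (auto simp: d_def)
  have "S d d = S (T w) d - S w d"
    using S_lincomb[OF T_L2[OF w] w d, of 1 "-1"] unfolding d_def by simp
  then have "S w d - B w d - (LINT x|lborel. F x * d x) = - S d d"
    using S_T[OF w d] B_sym[OF d w] by simp
  then have "I (T w) = I w - S d d + (S d d - B d d) / 2"
    unfolding Tw by (subst I_expand[OF w d]) simp
  then show ?thesis using energy_plus[OF d] S_ge[OF d] by (simp add: d_def field_simps)
qed

lemma young:
  fixes a b :: real
  assumes "0 \<le> C" "0 < k"
  shows "C * \<bar>a\<bar> * \<bar>b\<bar> \<le> C\<^sup>2 / (2 * k) * a\<^sup>2 + k / 2 * b\<^sup>2"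
proof -
  have "0 \<le> (C * \<bar>a\<bar> - k * \<bar>b\<bar>)\<^sup>2" by simp
  then have "2 * (C * \<bar>a\<bar>) * (k * \<bar>b\<bar>) \<le> C\<^sup>2 * a\<^sup>2 + k\<^sup>2 * b\<^sup>2"
    by (simp add: power2_diff power_mult_distrib)
  then have "(2 * (C * \<bar>a\<bar>) * (k * \<bar>b\<bar>)) / (2 * k) \<le> (C\<^sup>2 * a\<^sup>2 + k\<^sup>2 * b\<^sup>2) / (2 * k)"
    using assms by (intro divide_right_mono) auto
  then show ?thesis using assms by (simp add: field_simps power2_eq_square)
qed

lemma I_gap:
  assumes w: "w \<in> L2ball R" and z: "z \<in> L2ball R"
  shows "I w \<le> I z + (j + M)\<^sup>2 / (2 * \<kappa>) * (LINT x|lborel. (T w x - w x)\<^sup>2)"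
proof -
  define d where "d x = T w x - w x" for x
  define e where "e x = z x - w x" for x
  have d: "d \<in> L2ball R" unfolding d_def by (rule L2ball_diff[OF T_L2[OF w] w])
  have e: "e \<in> L2ball R" unfolding e_def by (rule L2ball_diff[OF z w])
  have z': "z = (\<lambda>x. w x + 1 * e x)" by (auto simp: e_def)
  have "S d e = S (T w) e - S w e"
    using S_lincomb[OF T_L2[OF w] w e, of 1 "-1"] unfolding d_def by simp
  then have "S w e - B w e - (LINT x|lborel. F x * e x) = - S d e"
    using S_T[OF w e] B_sym[OF e w] by simp
  then have Iz: "I z = I w - S d e + (S e e - B e e) / 2"
    unfolding z' by (subst I_expand[OF w e]) simp
  have "S d e \<le> (LINT x|lborel. (j + M)\<^sup>2 / (2 * \<kappa>) * (d x)\<^sup>2 + \<kappa> / 2 * (e x)\<^sup>2)"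
    unfolding S_def
  proof (rule integral_mono)
    show "(j + cs x) * (d x * e x) \<le> (j + M)\<^sup>2 / (2 * \<kappa>) * (d x)\<^sup>2 + \<kappa> / 2 * (e x)\<^sup>2" for x
    proof -
      have "(j + cs x) * (d x * e x) \<le> (j + cs x) * (\<bar>d x\<bar> * \<bar>e x\<bar>)"
        using j cs_nonneg[of x] by (intro mult_left_mono) (auto simp flip: abs_mult)
      also have "\<dots> \<le> (j + M) * (\<bar>d x\<bar> * \<bar>e x\<bar>)"
        using cs_le[of x] by (intro mult_right_mono) auto
      also have "\<dots> \<le> (j + M)\<^sup>2 / (2 * \<kappa>) * (d x)\<^sup>2 + \<kappa> / 2 * (e x)\<^sup>2"
        using young[of "j + M" \<kappa> "d x" "e x"] \<kappa> j cs_nonneg[of x] cs_le[of x] by (simp add: mult.assoc)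
      finally show ?thesis .
    qed
  qed (use S_int[OF d e] L2ballD(3)[OF d] L2ballD(3)[OF e] in auto)
  also have "\<dots> = (j + M)\<^sup>2 / (2 * \<kappa>) * (LINT x|lborel. (d x)\<^sup>2) + \<kappa> / 2 * (LINT x|lborel. (e x)\<^sup>2)"
    using L2ballD(3)[OF d] L2ballD(3)[OF e] by simp
  also have "\<dots> = (j + M)\<^sup>2 / (2 * \<kappa>) * (LINT x|lborel. (d x)\<^sup>2) + (\<kappa> * (LINT x|lborel. (e x)\<^sup>2)) / 2" by simp
  finally have "S d e \<le> (j + M)\<^sup>2 / (2 * \<kappa>) * (LINT x|lborel. (d x)\<^sup>2) + (\<kappa> * (LINT x|lborel. (e x)\<^sup>2)) / 2" .
  moreover have "sde \<le> p + k / 2 \<Longrightarrow> k \<le> m - b \<Longrightarrow> m \<le> s \<Longrightarrow> iz = iw - sde + (s - b) / 2 \<Longrightarrow> iw \<le> iz + p"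
    for sde p k m b s iz iw :: real by (simp add: field_simps)
  ultimately have "I w \<le> I z + (j + M)\<^sup>2 / (2 * \<kappa>) * (LINT x|lborel. (d x)\<^sup>2)"
    using energy_nonneg[OF e] S_ge[OF e] Iz by blast
  then show ?thesis by (simp only: d_def)
qed

lemma I_lower:
  assumes z: "z \<in> L2ball R"
  shows "- (1 / (2 * \<kappa>)) * (LINT x|lborel. (F x)\<^sup>2) \<le> I z"
proof -
  have "(LINT x|lborel. F x * z x) \<le> (LINT x|lborel. 1\<^sup>2 / (2 * \<kappa>) * (F x)\<^sup>2 + \<kappa> / 2 * (z x)\<^sup>2)"
  proof (rule integral_mono)
    show "F x * z x \<le> 1\<^sup>2 / (2 * \<kappa>) * (F x)\<^sup>2 + \<kappa> / 2 * (z x)\<^sup>2" for x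
      using young[of 1 \<kappa> "F x" "z x"] \<kappa> abs_ge_self[of "F x * z x"] by (simp add: abs_mult)
  qed (use L2ball_mult[OF F_L2 z] L2ballD(3)[OF F_L2] L2ballD(3)[OF z] in auto)
  also have "\<dots> = 1\<^sup>2 / (2 * \<kappa>) * (LINT x|lborel. (F x)\<^sup>2) + \<kappa> / 2 * (LINT x|lborel. (z x)\<^sup>2)"
    using L2ballD(3)[OF F_L2] L2ballD(3)[OF z] by simp
  also have "\<dots> = 1 / (2 * \<kappa>) * (LINT x|lborel. (F x)\<^sup>2) + (\<kappa> * (LINT x|lborel. (z x)\<^sup>2)) / 2" by simp
  finally have "(LINT x|lborel. F x * z x) \<le> 1 / (2 * \<kappa>) * (LINT x|lborel. (F x)\<^sup>2) + (\<kappa> * (LINT x|lborel. (z x)\<^sup>2)) / 2" .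
  moreover have "a \<le> p + k / 2 \<Longrightarrow> k \<le> m - b \<Longrightarrow> m \<le> s \<Longrightarrow> - p \<le> (s - b) / 2 - a" for a p k m b s :: real
    by (simp add: field_simps)
  ultimately have "- (1 / (2 * \<kappa>) * (LINT x|lborel. (F x)\<^sup>2)) \<le> I z"
    unfolding I_def using energy_nonneg[OF z] S_ge[OF z] by blast
  then show ?thesis by simp
qed

lemma T_conc:
  assumes w: "w \<in> L2ball R" "rdec w" and w': "w' \<in> L2ball R" "rdec w'"
    and le: "conc_le (\<lambda>x. ennreal (w x)) (\<lambda>x. ennreal (w' x))"
  shows "conc_le (\<lambda>x. ennreal (T w x)) (\<lambda>x. ennreal (T w' x))"
  unfolding conc_le_def
proof
  fix r
  define g where "g x = indicator (ball 0 r) x * (indicator (ball 0 R) x * (1 / (j + cs x)))" for x :: 'a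
  have g: "rdec g" unfolding g_def by (rule weight_rdec)
  then have [measurable]: "g \<in> borel_measurable borel" by (rule rdec_measurable)
  have g0: "0 \<le> g x" for x using g by (rule rdec_nonneg)
  have gL: "g \<in> L2ball R"
  proof (rule L2ball_dominated)
    have "(\<lambda>x. (1 / j) * indicator (ball 0 R) x + 0 * indicator (ball 0 R) x) \<in> L2ball R"
      by (intro L2ball_lincomb L2ball_indicator)
    then show "(\<lambda>x. (1 / j) * indicator (ball 0 R) x) \<in> L2ball R" by simp
    show "\<bar>g x\<bar> \<le> \<bar>(1 / j) * indicator (ball 0 R) x\<bar>" for x
      using j cs_nonneg[of x] by (auto simp: g_def indicator_def intro!: divide_left_mono)
  qed measurable
  have split: "(\<integral>\<^sup>+x. ennreal (T w x) * indicator (ball 0 r) x \<partial>lborel)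
      = (\<integral>\<^sup>+x. ennreal (F x) * ennreal (g x) \<partial>lborel)
        + (\<integral>\<^sup>+y. ennreal (w y) * ennreal (indicator (ball 0 R) y * A g y) \<partial>lborel)"
    if w: "w \<in> L2ball R" "rdec w" for w
  proof -
    have [measurable]: "w \<in> borel_measurable borel" "A w \<in> borel_measurable borel"
      using L2ballD(1)[OF w(1)] A_meas[OF w(1)] .
    have w0: "0 \<le> w x" for x using w(2) by (rule rdec_nonneg)
    have F0: "0 \<le> F x" for x using F_rdec by (rule rdec_nonneg)
    have "(\<integral>\<^sup>+x. ennreal (T w x) * indicator (ball 0 r) x \<partial>lborel)
      = (\<integral>\<^sup>+x. ennreal (F x) * ennreal (g x) + ennreal (A w x) * ennreal (g x) \<partial>lborel)"
    proof (rule nn_integral_cong)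
      fix x
      have "ennreal (F x) * ennreal (g x) + ennreal (A w x) * ennreal (g x) = ennreal ((F x + A w x) * g x)"
        using F0[of x] g0[of x] A_nn(2)[OF w(1) w0, of x] by (simp add: ennreal_mult ennreal_plus distrib_right)
      also have "(F x + A w x) * g x = T w x * indicator (ball 0 r) x"
        by (simp add: T_def g_def mult_ac)
      finally show "ennreal (T w x) * indicator (ball 0 r) x = ennreal (F x) * ennreal (g x) + ennreal (A w x) * ennreal (g x)"
        by (simp add: indicator_def)
    qed
    also have "\<dots> = (\<integral>\<^sup>+x. ennreal (F x) * ennreal (g x) \<partial>lborel) + (\<integral>\<^sup>+x. ennreal (A w x) * ennreal (g x) \<partial>lborel)"
      by (rule nn_integral_add) measurable
    also have "(\<integral>\<^sup>+x. ennreal (A w x) * ennreal (g x) \<partial>lborel)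
      = trip (\<lambda>x. ennreal (g x)) (\<lambda>x. ennreal (q x)) (\<lambda>x. ennreal (w x))"
      by (subst trip_fst) (simp_all add: A_nn(1)[OF w(1) w0])
    also have "\<dots> = (\<integral>\<^sup>+y. ennreal (A g y) * ennreal (w y) \<partial>lborel)"
      by (subst trip_thd) (simp_all add: A_nn(1)[OF gL g0] q_sym mult.commute)
    also have "\<dots> = (\<integral>\<^sup>+y. ennreal (w y) * ennreal (indicator (ball 0 R) y * A g y) \<partial>lborel)"
    proof (rule nn_integral_cong)
      fix y
      show "ennreal (A g y) * ennreal (w y) = ennreal (w y) * ennreal (indicator (ball 0 R) y * A g y)"
        using L2ballD(2)[OF w(1), of y] by (cases "y \<in> ball 0 R") (simp_all add: mult.commute)
    qed
    finally show ?thesis .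
  qed
  have "(\<integral>\<^sup>+y. ennreal (w y) * ennreal (indicator (ball 0 R) y * A g y) \<partial>lborel)
    \<le> (\<integral>\<^sup>+y. ennreal (w' y) * ennreal (indicator (ball 0 R) y * A g y) \<partial>lborel)"
    using L2ballD(1)[OF w(1)] L2ballD(1)[OF w'(1)]
    by (intro conc_le_mult[OF le] A_ball_rdec gL g) auto
  then show "(\<integral>\<^sup>+x. ennreal (T w x) * indicator (ball 0 r) x \<partial>lborel)
    \<le> (\<integral>\<^sup>+x. ennreal (T w' x) * indicator (ball 0 r) x \<partial>lborel)"
    unfolding split[OF w] split[OF w'] by (rule add_left_mono)
qed

lemma conc_start:
  assumes U: "U \<in> L2ball R" "rdec U"
    and D: "conc_le (\<lambda>x. ennreal (indicator (ball 0 R) x * ((j + cs x) * U x))) (\<lambda>x. ennreal (indicator (ball 0 R) x * (F x + A U x)))"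
  shows "conc_le (\<lambda>x. ennreal (U x)) (\<lambda>x. ennreal (T U x))"
  unfolding conc_le_def
proof
  fix r
  define g where "g x = indicator (ball 0 r) x * (indicator (ball 0 R) x * (1 / (j + cs x)))" for x :: 'a
  have g: "rdec g" unfolding g_def by (rule weight_rdec)
  have g0: "0 \<le> g x" for x using g by (rule rdec_nonneg)
  have [measurable]: "U \<in> borel_measurable borel" "A U \<in> borel_measurable borel" "g \<in> borel_measurable borel"
    using L2ballD(1)[OF U(1)] A_meas[OF U(1)] rdec_measurable[OF g] .
  have U0: "0 \<le> U x" for x using U(2) by (rule rdec_nonneg)
  have "(\<integral>\<^sup>+x. ennreal (indicator (ball 0 R) x * ((j + cs x) * U x)) * ennreal (g x) \<partial>lborel)
     \<le> (\<integral>\<^sup>+x. ennreal (indicator (ball 0 R) x * (F x + A U x)) * ennreal (g x) \<partial>lborel)"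
    by (intro conc_le_mult[OF D _ _ g]) measurable
  moreover have "ennreal (indicator (ball 0 R) x * ((j + cs x) * U x)) * ennreal (g x) = ennreal (U x) * indicator (ball 0 r) x" for x
  proof -
    have "indicator (ball 0 R) x * ((j + cs x) * U x) * g x = U x * indicator (ball 0 r) x"
      using L2ballD(2)[OF U(1), of x] j cs_nonneg[of x] by (cases "x \<in> ball 0 R") (simp_all add: g_def)
    then have "ennreal (indicator (ball 0 R) x * ((j + cs x) * U x)) * ennreal (g x) = ennreal (U x * indicator (ball 0 r) x)"
      using g0[of x] by (simp only: ennreal_mult''[symmetric])
    then show ?thesis by (simp add: indicator_def)
  qed
  moreover have "ennreal (indicator (ball 0 R) x * (F x + A U x)) * ennreal (g x) = ennreal (T U x) * indicator (ball 0 r) x" for x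
  proof -
    have "indicator (ball 0 R) x * (F x + A U x) * g x = T U x * indicator (ball 0 r) x"
      by (cases "x \<in> ball 0 R") (simp_all add: g_def T_def)
    then have "ennreal (indicator (ball 0 R) x * (F x + A U x)) * ennreal (g x) = ennreal (T U x * indicator (ball 0 r) x)"
      using g0[of x] by (simp only: ennreal_mult''[symmetric])
    then show ?thesis by (simp add: indicator_def)
  qed
  ultimately show "(\<integral>\<^sup>+x. ennreal (U x) * indicator (ball 0 r) x \<partial>lborel) \<le> (\<integral>\<^sup>+x. ennreal (T U x) * indicator (ball 0 r) x \<partial>lborel)"
    by simp
qed

text \<open>The iterates of \<open>T\<close> stay above \<open>U\<close> for \<open>conc_le\<close>, and since \<open>I\<close> decreases along them by a multiple of
  the squared step, some step is small; a small step forces almost minimality.\<close>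

lemma almost_minimiser:
  assumes U: "U \<in> L2ball R" "rdec U"
    and D: "conc_le (\<lambda>x. ennreal (indicator (ball 0 R) x * ((j + cs x) * U x))) (\<lambda>x. ennreal (indicator (ball 0 R) x * (F x + A U x)))"
    and \<epsilon>: "0 < \<epsilon>"
  obtains w where "w \<in> L2ball R" "rdec w" "conc_le (\<lambda>x. ennreal (U x)) (\<lambda>x. ennreal (w x))"
    "\<And>z. z \<in> L2ball R \<Longrightarrow> I w \<le> I z + \<epsilon>"
proof -
  define W where "W k = (T ^^ k) U" for k
  have W: "W k \<in> L2ball R \<and> rdec (W k)" for k
    by (induction k) (simp_all add: W_def U T_L2 T_rdec)
  have WS: "W (Suc k) = T (W k)" for k by (simp add: W_def)
  have step: "conc_le (\<lambda>x. ennreal (W k x)) (\<lambda>x. ennreal (W (Suc k) x))" for k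
  proof (induction k)
    case 0
    then show ?case using conc_start[OF U D] by (simp add: W_def)
  next
    case (Suc k)
    then show ?case using T_conc[of "W k" "W (Suc k)"] W[of k] W[of "Suc k"] by (simp only: WS)
  qed
  have UW: "conc_le (\<lambda>x. ennreal (U x)) (\<lambda>x. ennreal (W k x))" for k
  proof (induction k)
    case 0
    then show ?case by (simp add: W_def conc_le_def)
  next
    case (Suc k)
    then show ?case using step[of k] unfolding conc_le_def by (meson order_trans)
  qed
  define D2 where "D2 k = (LINT x|lborel. (T (W k) x - W k x)\<^sup>2)" for k
  define C where "C = (j + M)\<^sup>2 / (2 * \<kappa>)"
  have C: "0 \<le> C" using \<kappa> by (simp add: C_def)
  define \<delta> where "\<delta> = \<epsilon> / (C + 1)"
  have \<delta>: "0 < \<delta>" using C \<epsilon> by (simp add: \<delta>_def)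
  have "\<exists>k. D2 k < \<delta>"
  proof (rule ccontr)
    assume "\<nexists>k. D2 k < \<delta>"
    then have "I (W (Suc k)) \<le> I (W k) - \<kappa> / 2 * \<delta>" for k
    proof -
      have "\<kappa> / 2 * \<delta> \<le> \<kappa> / 2 * D2 k"
        using \<open>\<nexists>k. D2 k < \<delta>\<close> \<kappa> by (intro mult_left_mono) (auto simp: not_less)
      moreover have "I (W (Suc k)) \<le> I (W k) - \<kappa> / 2 * D2 k"
        unfolding WS D2_def using W[of k] by (intro T_descent) simp
      ultimately show ?thesis by linarith
    qed
    then have "I (W k) \<le> I U - real k * (\<kappa> / 2 * \<delta>)" for k
    proof (induction k)
      case 0
      then show ?case by (simp add: W_def)
    next
      case (Suc k)
      have "I (W (Suc k)) \<le> I (W k) - \<kappa> / 2 * \<delta>" "I (W k) \<le> I U - real k * (\<kappa> / 2 * \<delta>)"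
        using Suc by auto
      moreover have "real (Suc k) * (\<kappa> / 2 * \<delta>) = \<kappa> / 2 * \<delta> + real k * (\<kappa> / 2 * \<delta>)"
        by (simp add: distrib_right)
      ultimately show ?case by argo
    qed
    moreover obtain k where "(I U + (1 / (2 * \<kappa>)) * (LINT x|lborel. (F x)\<^sup>2)) / (\<kappa> / 2 * \<delta>) < real k"
      using reals_Archimedean2 by blast
    then have "I U + (1 / (2 * \<kappa>)) * (LINT x|lborel. (F x)\<^sup>2) < real k * (\<kappa> / 2 * \<delta>)"
      using \<kappa> \<delta> by (subst (asm) pos_divide_less_eq) auto
    moreover have "- (1 / (2 * \<kappa>) * (LINT x|lborel. (F x)\<^sup>2)) \<le> I (W k)"
      using I_lower[of "W k"] W[of k] by simp
    moreover have "a \<le> u - r \<Longrightarrow> u + p < r \<Longrightarrow> - p \<le> a \<Longrightarrow> False" for a u r p :: real by simp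
    ultimately show False by blast
  qed
  then obtain k where k: "D2 k < \<delta>" by blast
  show thesis
  proof (rule that[of "W k"])
    fix z :: "'a \<Rightarrow> real" assume z: "z \<in> L2ball R"
    have "I (W k) \<le> I z + C * D2 k"
      using I_gap[of "W k" z] W[of k] z by (simp add: C_def D2_def)
    also have "C * D2 k \<le> C * \<delta>" using k C by (intro mult_left_mono) auto
    also have "C * \<delta> \<le> \<epsilon>" using C \<epsilon> by (simp add: \<delta>_def field_simps)
    finally show "I (W k) \<le> I z + \<epsilon>" by simp
  qed (use W UW in auto)
qed

end

section \<open>Superlevel sets of the solution\<close>

lemma trip_reflect:
  assumes [measurable]: "a \<in> borel_measurable borel" "b \<in> borel_measurable borel" "c \<in> borel_measurable borel"
  shows "trip a b c = trip c (\<lambda>z. b (- z)) a"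
proof -
  have "trip a b c = (\<integral>\<^sup>+y. \<integral>\<^sup>+x. a x * b (x - y) * c y \<partial>lborel \<partial>lborel)"
    unfolding trip_def by (rule lborel_pair.Fubini'[symmetric]) measurable
  also have "\<dots> = trip c (\<lambda>z. b (- z)) a"
    unfolding trip_def by (simp add: mult_ac)
  finally show ?thesis .
qed

lemma ennreal_two_cancel: "2 * a \<le> 2 * (b::ennreal) \<Longrightarrow> a \<le> b"
proof -
  assume "2 * a \<le> 2 * b"
  then have "ennreal (1/2) * (2 * a) \<le> ennreal (1/2) * (2 * b)" by (rule mult_left_mono) simp
  moreover have "ennreal (1/2) * 2 = 1" using ennreal_mult[of "1/2" 2] by simp
  ultimately show ?thesis by (simp only: mult.assoc[symmetric] mult_1_left)
qed

lemma bsupp_reflect: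
  fixes g :: "'a::euclidean_space \<Rightarrow> real"
  assumes g: "bsupp g" shows "bsupp (\<lambda>z. g (- z))"
proof -
  have [measurable]: "g \<in> borel_measurable borel" using g by (rule bsupp_measurable)
  have "{z. g (- z) \<noteq> 0} = uminus ` {z. g z \<noteq> 0}" by (auto intro!: image_eqI[of _ uminus "- _"])
  moreover have "bounded (uminus ` {z. g z \<noteq> 0})" using g by (simp add: bsupp_def)
  ultimately show ?thesis by (simp add: bsupp_def)
qed

lemma schwarz_reflect:
  fixes g :: "'a::euclidean_space \<Rightarrow> real"
  assumes g: "bsupp g" shows "schwarz UNIV (\<lambda>z. g (- z)) = schwarz UNIV g"
proof -
  have "distr_fun UNIV (\<lambda>z. g (- z)) t = distr_fun UNIV g t" for t
  proof -
    have [measurable]: "g \<in> borel_measurable borel" using g by (rule bsupp_measurable)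
    have m[measurable]: "{x. t < \<bar>g x\<bar>} \<in> sets borel" "{x. t < \<bar>g (- x)\<bar>} \<in> sets borel" by measurable
    have "emeasure lborel {x. t < \<bar>g (- x)\<bar>} = (\<integral>\<^sup>+x. indicator {x. t < \<bar>g (- x)\<bar>} x \<partial>lborel)" by simp
    also have "\<dots> = (\<integral>\<^sup>+x. indicator {x. t < \<bar>g x\<bar>} (0 - x) \<partial>lborel)"
      by (intro nn_integral_cong) (simp add: indicator_def)
    also have "\<dots> = emeasure lborel {x. t < \<bar>g x\<bar>}"
      by (rule nn_integral_indicator_translate) measurable
    finally show ?thesis by (simp add: distr_fun_def)
  qed
  then show ?thesis by (simp add: schwarz_def decr_rearr_def fun_eq_iff)
qed

definition tst :: "real \<Rightarrow> nat \<Rightarrow> real \<Rightarrow> real" where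
  "tst t k s = sgn s * min 1 (real k * max 0 (\<bar>s\<bar> - t))"

lemma tst_abs: "\<bar>tst t k s\<bar> = (if s = 0 then 0 else min 1 (real k * max 0 (\<bar>s\<bar> - t)))"
  by (simp add: tst_def abs_mult sgn_if)

lemma tst_le_1: "\<bar>tst t k s\<bar> \<le> 1" by (simp add: tst_abs)

lemma tst_abs_nonneg: "0 \<le> t \<Longrightarrow> \<bar>tst t k s\<bar> = min 1 (real k * max 0 (\<bar>s\<bar> - t))"
  by (simp add: tst_abs)

lemma tst_prod: "s * tst t k s = \<bar>s\<bar> * \<bar>tst t k s\<bar>"
proof -
  have "0 \<le> min 1 (real k * max 0 (\<bar>s\<bar> - t))" by simp
  then show ?thesis by (simp add: tst_abs) (simp add: tst_def sgn_if)
qed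

lemma tst_mono:
  assumes "r \<le> s" shows "tst t k r \<le> tst t k s"
proof -
  define m where "m s = min 1 (real k * max 0 (\<bar>s\<bar> - t))" for s
  have m0: "0 \<le> m s" for s by (simp add: m_def)
  have mono: "\<bar>r\<bar> \<le> \<bar>s\<bar> \<Longrightarrow> m r \<le> m s" for r s
    unfolding m_def by (intro min.mono mult_left_mono max.mono) auto
  have e: "tst t k s = sgn s * m s" for s by (simp add: tst_def m_def)
  show ?thesis
    unfolding e using mono[of r s] mono[of s r] m0[of r] m0[of s] assms by (auto simp: sgn_if)
qed

lemma tst_lipschitz:
  assumes t: "0 \<le> t" shows "\<bar>tst t k r - tst t k s\<bar> \<le> real k * \<bar>r - s\<bar>"
proof -
  define m where "m s = min 1 (real k * max 0 (\<bar>s\<bar> - t))" for s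
  have m0: "0 \<le> m s" for s by (simp add: m_def)
  have e: "tst t k s = sgn s * m s" for s by (simp add: tst_def m_def)
  have bd: "m s \<le> real k * \<bar>s\<bar>" for s
  proof -
    have "m s \<le> real k * max 0 (\<bar>s\<bar> - t)" by (simp add: m_def)
    also have "\<dots> \<le> real k * \<bar>s\<bar>" using t by (intro mult_left_mono) auto
    finally show ?thesis .
  qed
  have lip: "\<bar>m r - m s\<bar> \<le> real k * \<bar>\<bar>r\<bar> - \<bar>s\<bar>\<bar>" for r s
  proof -
    have "\<bar>m r - m s\<bar> \<le> \<bar>real k * max 0 (\<bar>r\<bar> - t) - real k * max 0 (\<bar>s\<bar> - t)\<bar>"
      by (auto simp: m_def min_def)
    also have "\<dots> = real k * \<bar>max 0 (\<bar>r\<bar> - t) - max 0 (\<bar>s\<bar> - t)\<bar>"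
      by (simp add: abs_mult flip: right_diff_distrib)
    also have "\<dots> \<le> real k * \<bar>\<bar>r\<bar> - \<bar>s\<bar>\<bar>" by (intro mult_left_mono) (auto simp: max_def)
    finally show ?thesis .
  qed
  consider "0 \<le> r * s" | "r < 0" "0 < s" | "0 < r" "s < 0" by (force simp: zero_le_mult_iff)
  then show ?thesis
  proof cases
    case 1
    then have "\<bar>\<bar>r\<bar> - \<bar>s\<bar>\<bar> = \<bar>r - s\<bar>" by (auto simp: zero_le_mult_iff)
    moreover have "m 0 = 0" using t by (simp add: m_def)
    then have "\<bar>tst t k r - tst t k s\<bar> = \<bar>m r - m s\<bar>"
      using 1 unfolding e by (auto simp: zero_le_mult_iff sgn_if)
    ultimately show ?thesis using lip[of r s] by simp
  next
    case 2
    then show ?thesis unfolding e using bd[of r] bd[of s] m0[of r] m0[of s] by (simp add: algebra_simps)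
  next
    case 3
    then show ?thesis unfolding e using bd[of r] bd[of s] m0[of r] m0[of s] by (simp add: algebra_simps)
  qed
qed

lemma tst_measurable [measurable]: "tst t k \<in> borel_measurable borel"
  unfolding tst_def by measurable

context incr_coeff
begin

lemma level_inequality:
  fixes u f J :: "'a \<Rightarrow> real"
  assumes u: "bsupp u" and u_out: "\<And>x. x \<notin> \<Omega> \<Longrightarrow> u x = 0" and f: "bsupp f"
    and J: "bsupp J" and J_pos: "\<And>x. 0 \<le> J x" and t: "0 \<le> t"
    and W: "\<And>k. (\<integral>\<^sup>+x. \<integral>\<^sup>+y. ennreal (J (x - y) * ((u x - u y) * (tst t k (u x) - tst t k (u y)))) \<partial>lborel \<partial>lborel)
        + 2 * (\<integral>\<^sup>+x. ennreal (c x * (\<bar>u x\<bar> * \<bar>tst t k (u x)\<bar>)) \<partial>lborel)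
      \<le> 2 * (\<integral>\<^sup>+x. ennreal (\<bar>f x\<bar> * \<bar>tst t k (u x)\<bar>) \<partial>lborel)"
  shows "(\<integral>\<^sup>+x. indicator (sym_ball {x. t < \<bar>u x\<bar>}) x
        * (((\<integral>\<^sup>+z. ennreal (J z) \<partial>lborel) + ennreal (incr_schwarz \<Omega> c x)) * ennreal (schwarz UNIV u x)) \<partial>lborel)
    \<le> (\<integral>\<^sup>+x. indicator (sym_ball {x. t < \<bar>u x\<bar>}) x * (ennreal (schwarz UNIV f x)
        + (\<integral>\<^sup>+y. ennreal (schwarz UNIV J (x - y)) * ennreal (schwarz UNIV u y) \<partial>lborel)) \<partial>lborel)"
proof -
  define E where "E = {x. t < \<bar>u x\<bar>}"
  define jj where "jj = (\<integral>\<^sup>+z. ennreal (J z) \<partial>lborel)"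
  define v where "v = schwarz UNIV u"
  define Js where "Js = schwarz UNIV J"
  have [measurable]: "u \<in> borel_measurable borel" "f \<in> borel_measurable borel" "J \<in> borel_measurable borel"
    "schwarz UNIV u \<in> borel_measurable borel" "schwarz UNIV f \<in> borel_measurable borel" "Js \<in> borel_measurable borel"
    "v \<in> borel_measurable borel"
    using u f J by (simp_all add: bsupp_measurable schwarz_measurable Js_def v_def)
  have E[measurable]: "E \<in> sets borel" and Eb: "bounded E"
    using bsupp_levels[OF u] t by (simp_all add: E_def)
  define p where "p k x = \<bar>tst t k (u x)\<bar>" for k x
  have [measurable]: "p k \<in> borel_measurable borel" for k unfolding p_def by measurable
  have p_ind: "ennreal (p k x) \<le> indicator E x" for k x
    using tst_le_1[of t k "u x"] t by (auto simp: p_def E_def indicator_def tst_abs_nonneg)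
  have jj1: "(\<integral>\<^sup>+y. ennreal (J (x - y)) \<partial>lborel) = jj" "(\<integral>\<^sup>+x. ennreal (J (x - y)) \<partial>lborel) = jj" for x y
    using nn_integral_lborel_reflect[of "\<lambda>y. ennreal (J y)" x] nn_integral_lborel_translate[of "\<lambda>y. ennreal (J y)" "- y"]
    by (simp_all add: jj_def)
  define TR where "TR = trip (\<lambda>x. ennreal (v x)) (\<lambda>x. ennreal (Js x)) (indicator (sym_ball E))"
  have TR1: "trip (\<lambda>x. ennreal \<bar>u x\<bar>) (\<lambda>x. ennreal (J x)) (indicator E) \<le> TR"
    using riesz_rearrangement[OF u J E Eb] J_pos by (simp add: TR_def v_def Js_def)
  have TR2: "trip (\<lambda>x. ennreal \<bar>u x\<bar>) (\<lambda>x. ennreal (J (- x))) (indicator E) \<le> TR"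
    using riesz_rearrangement[OF u bsupp_reflect[OF J] E Eb] J_pos by (simp add: TR_def v_def Js_def schwarz_reflect[OF J])
  have main: "(\<integral>\<^sup>+x. (jj + ennreal (c x)) * ennreal \<bar>u x\<bar> * ennreal (p k x) \<partial>lborel)
      \<le> (\<integral>\<^sup>+x. indicator E x * ennreal \<bar>f x\<bar> \<partial>lborel) + TR" for k
  proof -
    define X where "X = (\<integral>\<^sup>+x. ennreal \<bar>u x\<bar> * ennreal (p k x) \<partial>lborel)"
    define Z where "Z = (\<integral>\<^sup>+x. ennreal (c x) * (ennreal \<bar>u x\<bar> * ennreal (p k x)) \<partial>lborel)"
    define EN where "EN = (\<integral>\<^sup>+x. \<integral>\<^sup>+y. ennreal (J (x - y) * ((u x - u y) * (tst t k (u x) - tst t k (u y)))) \<partial>lborel \<partial>lborel)"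
    have "2 * (jj * X) = (\<integral>\<^sup>+x. \<integral>\<^sup>+y. ennreal (J (x - y)) * (ennreal \<bar>u x\<bar> * ennreal (p k x)) \<partial>lborel \<partial>lborel)
      + (\<integral>\<^sup>+y. \<integral>\<^sup>+x. ennreal (J (x - y)) * (ennreal \<bar>u y\<bar> * ennreal (p k y)) \<partial>lborel \<partial>lborel)"
      by (simp add: nn_integral_multc jj1 nn_integral_cmult X_def mult_2)
    also have "(\<integral>\<^sup>+y. \<integral>\<^sup>+x. ennreal (J (x - y)) * (ennreal \<bar>u y\<bar> * ennreal (p k y)) \<partial>lborel \<partial>lborel)
      = (\<integral>\<^sup>+x. \<integral>\<^sup>+y. ennreal (J (x - y)) * (ennreal \<bar>u y\<bar> * ennreal (p k y)) \<partial>lborel \<partial>lborel)"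
      by (rule lborel_pair.Fubini') measurable
    also have "(\<integral>\<^sup>+x. \<integral>\<^sup>+y. ennreal (J (x - y)) * (ennreal \<bar>u x\<bar> * ennreal (p k x)) \<partial>lborel \<partial>lborel)
      + (\<integral>\<^sup>+x. \<integral>\<^sup>+y. ennreal (J (x - y)) * (ennreal \<bar>u y\<bar> * ennreal (p k y)) \<partial>lborel \<partial>lborel)
      = (\<integral>\<^sup>+x. \<integral>\<^sup>+y. ennreal (J (x - y)) * (ennreal \<bar>u x\<bar> * ennreal (p k x))
          + ennreal (J (x - y)) * (ennreal \<bar>u y\<bar> * ennreal (p k y)) \<partial>lborel \<partial>lborel)"
      by (simp add: nn_integral_add)
    also have "\<dots> \<le> (\<integral>\<^sup>+x. \<integral>\<^sup>+y. ennreal (J (x - y) * ((u x - u y) * (tst t k (u x) - tst t k (u y))))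
        + (ennreal \<bar>u x\<bar> * ennreal (J (x - y)) * ennreal (p k y) + ennreal (p k x) * ennreal (J (x - y)) * ennreal \<bar>u y\<bar>) \<partial>lborel \<partial>lborel)"
    proof (intro nn_integral_mono)
      fix x y
      let ?P = "tst t k (u x)" let ?Q = "tst t k (u y)"
      have "0 \<le> (u x - u y) * (?P - ?Q)"
        using tst_mono[of "u x" "u y" t k] tst_mono[of "u y" "u x" t k]
        by (cases "u x \<le> u y") (auto simp: mult_nonpos_nonpos)
      then have nn: "0 \<le> J (x - y) * ((u x - u y) * (?P - ?Q))" using J_pos by simp
      have "u x * ?Q \<le> \<bar>u x\<bar> * \<bar>?Q\<bar>" "u y * ?P \<le> \<bar>u y\<bar> * \<bar>?P\<bar>"
        by (simp_all flip: abs_mult)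
      then have "\<bar>u x\<bar> * p k x + \<bar>u y\<bar> * p k y \<le> (u x - u y) * (?P - ?Q) + (\<bar>u x\<bar> * p k y + p k x * \<bar>u y\<bar>)"
        using tst_prod[of "u x" t k] tst_prod[of "u y" t k] by (simp add: p_def algebra_simps)
      from mult_left_mono[OF this J_pos[of "x - y"]]
      have "J (x - y) * (\<bar>u x\<bar> * p k x) + J (x - y) * (\<bar>u y\<bar> * p k y)
        \<le> J (x - y) * ((u x - u y) * (?P - ?Q)) + (\<bar>u x\<bar> * J (x - y) * p k y + p k x * J (x - y) * \<bar>u y\<bar>)"
        by (simp add: algebra_simps)
      moreover have "0 \<le> p k x" "0 \<le> p k y" by (simp_all add: p_def)
      ultimately show "ennreal (J (x - y)) * (ennreal \<bar>u x\<bar> * ennreal (p k x)) + ennreal (J (x - y)) * (ennreal \<bar>u y\<bar> * ennreal (p k y))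
        \<le> ennreal (J (x - y) * ((u x - u y) * (?P - ?Q)))
        + (ennreal \<bar>u x\<bar> * ennreal (J (x - y)) * ennreal (p k y) + ennreal (p k x) * ennreal (J (x - y)) * ennreal \<bar>u y\<bar>)"
        using nn J_pos[of "x - y"] by (simp flip: ennreal_mult ennreal_plus)
    qed
    also have "\<dots> = EN + (trip (\<lambda>x. ennreal \<bar>u x\<bar>) (\<lambda>x. ennreal (J x)) (\<lambda>x. ennreal (p k x))
        + trip (\<lambda>x. ennreal (p k x)) (\<lambda>x. ennreal (J x)) (\<lambda>x. ennreal \<bar>u x\<bar>))"
      unfolding EN_def trip_def by (simp add: nn_integral_add)
    also have "trip (\<lambda>x. ennreal (p k x)) (\<lambda>x. ennreal (J x)) (\<lambda>x. ennreal \<bar>u x\<bar>)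
      = trip (\<lambda>x. ennreal \<bar>u x\<bar>) (\<lambda>x. ennreal (J (- x))) (\<lambda>x. ennreal (p k x))"
      by (rule trip_reflect) measurable
    also have "EN + (trip (\<lambda>x. ennreal \<bar>u x\<bar>) (\<lambda>x. ennreal (J x)) (\<lambda>x. ennreal (p k x))
        + trip (\<lambda>x. ennreal \<bar>u x\<bar>) (\<lambda>x. ennreal (J (- x))) (\<lambda>x. ennreal (p k x)))
      \<le> EN + (trip (\<lambda>x. ennreal \<bar>u x\<bar>) (\<lambda>x. ennreal (J x)) (indicator E)
        + trip (\<lambda>x. ennreal \<bar>u x\<bar>) (\<lambda>x. ennreal (J (- x))) (indicator E))"
      unfolding trip_def by (intro add_left_mono add_mono nn_integral_mono mult_left_mono p_ind) auto
    also have "\<dots> \<le> EN + (TR + TR)" by (intro add_left_mono add_mono TR1 TR2)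
    finally have "2 * (jj * X) + 2 * Z \<le> (EN + 2 * Z) + 2 * TR"
      by (simp add: mult_2 add_ac)
    also have "EN + 2 * Z \<le> 2 * (\<integral>\<^sup>+x. indicator E x * ennreal \<bar>f x\<bar> \<partial>lborel)"
    proof -
      have "Z = (\<integral>\<^sup>+x. ennreal (c x * (\<bar>u x\<bar> * \<bar>tst t k (u x)\<bar>)) \<partial>lborel)"
        unfolding Z_def p_def by (simp add: ennreal_mult c_pos)
      then have "EN + 2 * Z \<le> 2 * (\<integral>\<^sup>+x. ennreal (\<bar>f x\<bar> * \<bar>tst t k (u x)\<bar>) \<partial>lborel)"
        using W[of k] by (simp add: EN_def)
      also have "\<dots> \<le> 2 * (\<integral>\<^sup>+x. indicator E x * ennreal \<bar>f x\<bar> \<partial>lborel)"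
      proof (intro mult_left_mono nn_integral_mono)
        fix x
        have "ennreal (\<bar>f x\<bar> * \<bar>tst t k (u x)\<bar>) = ennreal (p k x) * ennreal \<bar>f x\<bar>"
          by (simp add: p_def ennreal_mult mult.commute)
        also have "\<dots> \<le> indicator E x * ennreal \<bar>f x\<bar>" by (intro mult_right_mono p_ind) simp
        finally show "ennreal (\<bar>f x\<bar> * \<bar>tst t k (u x)\<bar>) \<le> indicator E x * ennreal \<bar>f x\<bar>" .
      qed simp
      finally show ?thesis .
    qed
    finally have "2 * (jj * X + Z) \<le> 2 * ((\<integral>\<^sup>+x. indicator E x * ennreal \<bar>f x\<bar> \<partial>lborel) + TR)"
      by (simp add: distrib_left add_right_mono)
    then have "jj * X + Z \<le> (\<integral>\<^sup>+x. indicator E x * ennreal \<bar>f x\<bar> \<partial>lborel) + TR"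
      by (rule ennreal_two_cancel)
    moreover have "(\<integral>\<^sup>+x. (jj + ennreal (c x)) * ennreal \<bar>u x\<bar> * ennreal (p k x) \<partial>lborel) = jj * X + Z"
      unfolding X_def Z_def by (simp add: distrib_right nn_integral_add nn_integral_cmult mult.assoc)
    ultimately show ?thesis by simp
  qed
  have lim: "(SUP k. ennreal (p k x)) = indicator E x" for x
  proof (cases "x \<in> E")
    case True
    then have d: "0 < \<bar>u x\<bar> - t" by (simp add: E_def)
    obtain k where k: "1 / (\<bar>u x\<bar> - t) \<le> real k" using real_arch_simple by blast
    then have "1 \<le> real k * (\<bar>u x\<bar> - t)" using d by (simp add: field_simps)
    then have "p k x = 1" using d t by (simp add: p_def tst_abs_nonneg)
    then show ?thesis using True p_ind[of _ x] by (intro antisym SUP_least) (auto intro: SUP_upper2[of k])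
  next
    case False
    then have "ennreal (p k x) = 0" for k using p_ind[of k x] by simp
    then show ?thesis using False by simp
  qed
  have "(\<integral>\<^sup>+x. (jj + ennreal (c x)) * ennreal \<bar>u x\<bar> * indicator E x \<partial>lborel)
    = (\<integral>\<^sup>+x. (SUP k. (jj + ennreal (c x)) * ennreal \<bar>u x\<bar> * ennreal (p k x)) \<partial>lborel)"
    by (simp add: lim SUP_mult_left_ennreal[symmetric])
  also have "\<dots> = (SUP k. \<integral>\<^sup>+x. (jj + ennreal (c x)) * ennreal \<bar>u x\<bar> * ennreal (p k x) \<partial>lborel)"
  proof (rule nn_integral_monotone_convergence_SUP)
    show "incseq (\<lambda>k x. (jj + ennreal (c x)) * ennreal \<bar>u x\<bar> * ennreal (p k x))"
    proof (rule incseq_SucI, rule le_funI)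
      fix k x
      have "p k x \<le> p (Suc k) x"
        unfolding p_def tst_abs_nonneg[OF t] by (intro min.mono mult_right_mono) auto
      then show "(jj + ennreal (c x)) * ennreal \<bar>u x\<bar> * ennreal (p k x) \<le> (jj + ennreal (c x)) * ennreal \<bar>u x\<bar> * ennreal (p (Suc k) x)"
        by (intro mult_left_mono ennreal_leI) auto
    qed
  qed measurable
  also have "\<dots> \<le> (\<integral>\<^sup>+x. indicator E x * ennreal \<bar>f x\<bar> \<partial>lborel) + TR"
    by (intro SUP_least main)
  also have "\<dots> \<le> (\<integral>\<^sup>+x. indicator (sym_ball E) x * ennreal (schwarz UNIV f x) \<partial>lborel) + TR"
    by (intro add_right_mono hardy_littlewood_set f E)
  also have "\<dots> = (\<integral>\<^sup>+x. indicator (sym_ball E) x * (ennreal (schwarz UNIV f x)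
        + (\<integral>\<^sup>+y. ennreal (Js (x - y)) * ennreal (v y) \<partial>lborel)) \<partial>lborel)"
  proof -
    have "TR = trip (indicator (sym_ball E)) (\<lambda>x. ennreal (Js (- x))) (\<lambda>x. ennreal (v x))"
      unfolding TR_def by (rule trip_reflect) measurable
    also have "\<dots> = trip (indicator (sym_ball E)) (\<lambda>x. ennreal (Js x)) (\<lambda>x. ennreal (v x))"
    proof -
      have "Js (- x) = Js x" for x
        using rdecD[OF rdec_schwarz[OF J], of x "- x"] rdecD[OF rdec_schwarz[OF J], of "- x" x]
        by (cases "x = 0") (auto simp: Js_def)
      then show ?thesis by simp
    qed
    also have "\<dots> = (\<integral>\<^sup>+x. (\<integral>\<^sup>+y. ennreal (Js (x - y)) * ennreal (v y) \<partial>lborel) * indicator (sym_ball E) x \<partial>lborel)"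
      by (rule trip_fst) measurable
    finally show ?thesis by (simp add: nn_integral_add distrib_left mult.commute[of _ "indicator (sym_ball E) _ :: ennreal"])
  qed
  finally have up: "(\<integral>\<^sup>+x. (jj + ennreal (c x)) * ennreal \<bar>u x\<bar> * indicator E x \<partial>lborel) \<le> \<dots>" .
  have tr: "ennreal \<bar>trunc t u x\<bar> = ennreal \<bar>u x\<bar> * indicator E x" for x
    by (simp add: trunc_def E_def indicator_def)
  have trs: "AE x in lborel. ennreal (schwarz UNIV (trunc t u) x) = indicator (sym_ball E) x * ennreal (v x)"
    using AE_lborel_singleton[of 0]
    by eventually_elim (auto simp: schwarz_trunc[OF u t] E_def v_def indicator_def)
  have tm: "schwarz UNIV (trunc t u) \<in> borel_measurable borel"
    by (rule schwarz_measurable[OF bsupp_trunc[OF u]])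
  have one: "(\<integral>\<^sup>+x. ennreal \<bar>u x\<bar> * indicator E x \<partial>lborel) = (\<integral>\<^sup>+x. indicator (sym_ball E) x * ennreal (v x) \<partial>lborel)"
  proof -
    have "(\<integral>\<^sup>+x. indicator (sym_ball E) x * ennreal (v x) \<partial>lborel) = (\<integral>\<^sup>+x. ennreal (schwarz UNIV (trunc t u) x) \<partial>lborel)"
      by (intro nn_integral_cong_AE) (use trs in eventually_elim, simp)
    also have "\<dots> = (\<integral>\<^sup>+x. ennreal \<bar>trunc t u x\<bar> \<partial>lborel)"
      by (rule nn_integral_schwarz[OF bsupp_trunc[OF u]])
    finally show ?thesis by (simp add: tr)
  qed
  have two: "(\<integral>\<^sup>+x. ennreal (incr_schwarz \<Omega> c x) * (indicator (sym_ball E) x * ennreal (v x)) \<partial>lborel)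
      \<le> (\<integral>\<^sup>+x. ennreal (c x) * (ennreal \<bar>u x\<bar> * indicator E x) \<partial>lborel)"
  proof -
    have "(\<integral>\<^sup>+x. ennreal (incr_schwarz \<Omega> c x) * (indicator (sym_ball E) x * ennreal (v x)) \<partial>lborel)
      = (\<integral>\<^sup>+x. ennreal (incr_schwarz \<Omega> c x) * ennreal (schwarz UNIV (trunc t u) x) \<partial>lborel)"
      by (intro nn_integral_cong_AE) (use trs in eventually_elim, simp)
    also have "\<dots> \<le> (\<integral>\<^sup>+x. ennreal (c x) * ennreal \<bar>trunc t u x\<bar> \<partial>lborel)"
      using u_out by (intro incr_schwarz_mult bsupp_trunc u) (simp add: trunc_def)
    finally show ?thesis by (simp add: tr)
  qed
  have "(\<integral>\<^sup>+x. indicator (sym_ball E) x * ((jj + ennreal (incr_schwarz \<Omega> c x)) * ennreal (v x)) \<partial>lborel)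
    = jj * (\<integral>\<^sup>+x. indicator (sym_ball E) x * ennreal (v x) \<partial>lborel)
      + (\<integral>\<^sup>+x. ennreal (incr_schwarz \<Omega> c x) * (indicator (sym_ball E) x * ennreal (v x)) \<partial>lborel)"
    by (simp add: nn_integral_cmult[symmetric] nn_integral_add[symmetric] distrib_left distrib_right mult_ac)
  also have "\<dots> \<le> jj * (\<integral>\<^sup>+x. ennreal \<bar>u x\<bar> * indicator E x \<partial>lborel) + (\<integral>\<^sup>+x. ennreal (c x) * (ennreal \<bar>u x\<bar> * indicator E x) \<partial>lborel)"
    unfolding one by (intro add_left_mono two)
  also have "\<dots> = (\<integral>\<^sup>+x. (jj + ennreal (c x)) * ennreal \<bar>u x\<bar> * indicator E x \<partial>lborel)"
    by (simp add: nn_integral_cmult[symmetric] nn_integral_add[symmetric] distrib_left distrib_right mult_ac)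
  also note up
  finally show ?thesis by (simp add: E_def jj_def v_def Js_def)
qed

end

text \<open>On an annulus where \<open>U\<close> is constant the difference of the two integrands is monotone, so the
  comparison propagates from the level balls of \<open>U\<close> to all balls.\<close>

lemma conc_from_levels:
  fixes U P h :: "'a::euclidean_space \<Rightarrow> real"
  assumes U: "rdec U" and out: "\<And>x. x \<notin> ball 0 R \<Longrightarrow> U x = 0" and R: "0 < R"
    and P[measurable]: "P \<in> borel_measurable borel" and P0: "\<And>x. 0 \<le> P x" and P1: "\<And>x. P x \<le> Pm"
    and P_mono: "\<And>x y. y \<in> ball 0 R \<Longrightarrow> norm x \<le> norm y \<Longrightarrow> P x \<le> P y"
    and h[measurable]: "h \<in> borel_measurable borel" and h0: "\<And>x. 0 \<le> h x"
    and h_anti: "\<And>x y. x \<noteq> 0 \<Longrightarrow> norm x \<le> norm y \<Longrightarrow> h y \<le> h x"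
    and lev: "\<And>t. 0 \<le> t \<Longrightarrow> (\<integral>\<^sup>+x. indicator {x. t < U x} x * ennreal (P x * U x) \<partial>lborel)
        \<le> (\<integral>\<^sup>+x. indicator {x. t < U x} x * ennreal (h x) \<partial>lborel)"
  shows "conc_le (\<lambda>x. ennreal (indicator (ball 0 R) x * (P x * U x))) (\<lambda>x. ennreal (indicator (ball 0 R) x * h x))"
  unfolding conc_le_def
proof
  fix r0 :: real
  define r where "r = min r0 R"
  have rR: "r \<le> R" by (simp add: r_def)
  have [measurable]: "U \<in> borel_measurable borel" using U by (rule rdec_measurable)
  have U0: "0 \<le> U x" for x using U by (rule rdec_nonneg)
  have PU0: "0 \<le> P x * U x" for x using P0 U0 by simp
  have [measurable]: "{x. t < U x} \<in> sets borel" for t by measurable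
  have red: "ennreal (indicator (ball 0 R) x * g x) * indicator (ball 0 r0) x = indicator (ball 0 r) x * ennreal (g x)" for g :: "'a \<Rightarrow> real" and x
    by (auto simp: indicator_def r_def)
  have "(\<integral>\<^sup>+x. indicator (ball 0 r) x * ennreal (P x * U x) \<partial>lborel) \<le> (\<integral>\<^sup>+x. indicator (ball 0 r) x * ennreal (h x) \<partial>lborel)"
  proof (cases "0 < r")
    case False
    then have "ball (0::'a) r = {}" by simp
    then show ?thesis by (simp only:) simp
  next
    case r: True
    obtain b :: 'a where b: "b \<in> Basis" using nonempty_Basis by blast
    define x0 where "x0 = r *\<^sub>R b"
    have x0: "norm x0 = r" "x0 \<noteq> 0" using b r by (auto simp: x0_def)
    define \<tau> where "\<tau> = U x0"
    have \<tau>0: "0 \<le> \<tau>" by (simp add: \<tau>_def U0)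
    have inside: "\<tau> \<le> U x" if "x \<noteq> 0" "norm x \<le> r" for x
      using rdecD[OF U that(1), of x0] that x0 by (simp add: \<tau>_def)
    have outside: "U x \<le> \<tau>" if "r \<le> norm x" for x
      using rdecD[OF U x0(2), of x] that x0 by (simp add: \<tau>_def)
    show ?thesis
    proof (cases "\<forall>x. x \<noteq> 0 \<longrightarrow> norm x < r \<longrightarrow> \<not> \<tau> < U x \<longrightarrow> P x * \<tau> \<le> h x")
      case True
      have "(\<integral>\<^sup>+x. indicator (ball 0 r) x * ennreal (P x * U x) \<partial>lborel)
        \<le> (\<integral>\<^sup>+x. indicator {x. \<tau> < U x} x * ennreal (P x * U x) + indicator (ball 0 r - {x. \<tau> < U x}) x * ennreal (h x) \<partial>lborel)"
      proof (rule nn_integral_mono_AE)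
        show "AE x in lborel. indicator (ball 0 r) x * ennreal (P x * U x)
          \<le> indicator {x. \<tau> < U x} x * ennreal (P x * U x) + indicator (ball 0 r - {x. \<tau> < U x}) x * ennreal (h x)"
          using AE_lborel_singleton[of 0]
        proof eventually_elim
          case (elim x)
          show ?case
          proof (cases "norm x < r \<and> \<not> \<tau> < U x")
            case True2: True
            then have "U x = \<tau>" using inside[of x] elim by simp
            then have "ennreal (P x * U x) \<le> ennreal (h x)" using True True2 elim by (intro ennreal_leI) auto
            then show ?thesis using True2 by (simp add: indicator_def)
          qed (auto simp: indicator_def)
        qed
      qed
      also have "\<dots> = (\<integral>\<^sup>+x. indicator {x. \<tau> < U x} x * ennreal (P x * U x) \<partial>lborel)
          + (\<integral>\<^sup>+x. indicator (ball 0 r - {x. \<tau> < U x}) x * ennreal (h x) \<partial>lborel)"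
        by (rule nn_integral_add) measurable
      also have "\<dots> \<le> (\<integral>\<^sup>+x. indicator {x. \<tau> < U x} x * ennreal (h x) \<partial>lborel)
          + (\<integral>\<^sup>+x. indicator (ball 0 r - {x. \<tau> < U x}) x * ennreal (h x) \<partial>lborel)"
        by (intro add_right_mono lev \<tau>0)
      also have "\<dots> = (\<integral>\<^sup>+x. indicator {x. \<tau> < U x} x * ennreal (h x) + indicator (ball 0 r - {x. \<tau> < U x}) x * ennreal (h x) \<partial>lborel)"
        by (rule nn_integral_add[symmetric]) measurable
      also have "\<dots> \<le> (\<integral>\<^sup>+x. indicator (ball 0 r) x * ennreal (h x) \<partial>lborel)"
      proof (rule nn_integral_mono)
        fix x
        show "indicator {x. \<tau> < U x} x * ennreal (h x) + indicator (ball 0 r - {x. \<tau> < U x}) x * ennreal (h x)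
          \<le> indicator (ball 0 r) x * ennreal (h x)"
          using outside[of x] by (auto simp: indicator_def)
      qed
      finally show ?thesis .
    next
      case False
      then obtain x1 where x1: "x1 \<noteq> 0" "norm x1 < r" "h x1 < P x1 * \<tau>" by auto
      have \<tau>: "0 < \<tau>" using x1(3) h0[of x1] P0[of x1] \<tau>0 by (cases "\<tau> = 0") auto
      have Pm: "0 \<le> Pm" using P0 P1 order_trans by blast
      obtain V where V: "emeasure lborel (ball (0::'a) R) = ennreal V" "0 \<le> V"
        using emeasure_lborel_ball_finite[of "0::'a" R] by (cases "emeasure lborel (ball (0::'a) R)") auto
      have far: "h x \<le> P x * \<tau>" if "x \<in> ball 0 R" "r \<le> norm x" for x
      proof -
        have "h x \<le> h x1" using h_anti[OF x1(1)] x1(2) that by simp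
        also have "\<dots> \<le> P x1 * \<tau>" using x1 by simp
        also have "\<dots> \<le> P x * \<tau>" using P_mono[OF that(1), of x1] x1(2) that \<tau>0 by (intro mult_right_mono) auto
        finally show ?thesis .
      qed
      show ?thesis
      proof (rule ennreal_le_epsilon)
        fix \<epsilon> :: real assume \<epsilon>: "0 < \<epsilon>"
        define t where "t = max 0 (\<tau> - \<epsilon> / (Pm * V + 1))"
        have PV: "0 < Pm * V + 1" using Pm V by (simp add: add_nonneg_pos)
        have t: "0 \<le> t" "t < \<tau>" using \<tau> \<epsilon> PV by (auto simp: t_def)
        have "(\<tau> - t) * (Pm * V) \<le> \<epsilon> / (Pm * V + 1) * (Pm * V)"
          using Pm V t by (intro mult_right_mono) (auto simp: t_def)
        also have "\<dots> \<le> \<epsilon>" using \<epsilon> PV Pm V by (simp add: field_simps)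
        finally have small: "(\<tau> - t) * (Pm * V) \<le> \<epsilon>" .
        define L where "L = {x. t < U x}"
        define N where "N = L - ball 0 r"
        have [measurable]: "L \<in> sets borel" "N \<in> sets borel" by (auto simp: L_def N_def)
        have LR: "x \<in> ball 0 R" if "x \<in> L" for x using that out[of x] t by (auto simp: L_def)
        define X where "X = (\<integral>\<^sup>+x. indicator N x * ennreal (P x * t) \<partial>lborel)"
        have Xfin: "X \<noteq> \<infinity>"
        proof -
          have "X \<le> (\<integral>\<^sup>+x. ennreal (Pm * t) * indicator (ball (0::'a) R) x \<partial>lborel)"
            unfolding X_def
          proof (rule nn_integral_mono)
            fix x
            have "P x * t \<le> Pm * t" using P1[of x] t by (intro mult_right_mono) auto
            then show "indicator N x * ennreal (P x * t) \<le> ennreal (Pm * t) * indicator (ball 0 R) x"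
              using LR[of x] by (auto simp: indicator_def N_def intro: ennreal_leI)
          qed
          also have "\<dots> = ennreal (Pm * t) * ennreal V" by (simp add: nn_integral_cmult_indicator V)
          finally show ?thesis by (auto simp: top_unique ennreal_mult_eq_top_iff)
        qed
        have "(\<integral>\<^sup>+x. indicator (ball 0 r) x * ennreal (P x * U x) \<partial>lborel) + X
          = (\<integral>\<^sup>+x. indicator (ball 0 r) x * ennreal (P x * U x) + indicator N x * ennreal (P x * t) \<partial>lborel)"
          unfolding X_def by (rule nn_integral_add[symmetric]) measurable
        also have "\<dots> \<le> (\<integral>\<^sup>+x. indicator L x * ennreal (P x * U x) \<partial>lborel)"
        proof (rule nn_integral_mono_AE)
          show "AE x in lborel. indicator (ball 0 r) x * ennreal (P x * U x) + indicator N x * ennreal (P x * t)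
            \<le> indicator L x * ennreal (P x * U x)"
            using AE_lborel_singleton[of 0]
          proof eventually_elim
            case (elim x)
            consider "norm x < r" | "\<not> norm x < r" "x \<in> L" | "\<not> norm x < r" "x \<notin> L" by blast
            then show ?case
            proof cases
              case 1
              then have "x \<in> L" using inside[of x] elim t by (simp add: L_def)
              then show ?thesis using 1 by (simp add: N_def)
            next
              case 2
              then have "P x * t \<le> P x * U x" using P0[of x] by (intro mult_left_mono) (auto simp: L_def)
              then show ?thesis using 2 by (simp add: N_def ennreal_leI)
            next
              case 3
              then show ?thesis by (simp add: N_def)
            qed
          qed
        qed
        also have "\<dots> \<le> (\<integral>\<^sup>+x. indicator L x * ennreal (h x) \<partial>lborel)"
          unfolding L_def by (rule lev[OF t(1)])
        also have "\<dots> \<le> (\<integral>\<^sup>+x. indicator (ball 0 r) x * ennreal (h x)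
            + (indicator N x * ennreal (P x * t) + ennreal ((\<tau> - t) * Pm) * indicator (ball 0 R) x) \<partial>lborel)"
        proof (rule nn_integral_mono)
          fix x
          consider "norm x < r" | "\<not> norm x < r" "x \<in> L" | "x \<notin> L" by blast
          then show "indicator L x * ennreal (h x) \<le> indicator (ball 0 r) x * ennreal (h x)
            + (indicator N x * ennreal (P x * t) + ennreal ((\<tau> - t) * Pm) * indicator (ball 0 R) x)"
          proof cases
            case 1
            then show ?thesis by (simp add: indicator_def)
          next
            case 2
            then have x: "x \<in> ball 0 R" using LR by blast
            have "h x \<le> P x * \<tau>" using far[OF x] 2 by simp
            also have "P x * \<tau> = P x * t + (\<tau> - t) * P x" by (simp add: algebra_simps)
            also have "\<dots> \<le> P x * t + (\<tau> - t) * Pm" using P1[of x] t by (intro add_left_mono mult_left_mono) auto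
            finally have "ennreal (h x) \<le> ennreal (P x * t + (\<tau> - t) * Pm)" by (rule ennreal_leI)
            also have "\<dots> = ennreal (P x * t) + ennreal ((\<tau> - t) * Pm)" using P0[of x] t Pm by (intro ennreal_plus) auto
            finally show ?thesis using 2 x by (simp add: N_def)
          next
            case 3
            then show ?thesis by simp
          qed
        qed
        also have "\<dots> = (\<integral>\<^sup>+x. indicator (ball 0 r) x * ennreal (h x) \<partial>lborel) + (X + ennreal ((\<tau> - t) * Pm) * ennreal V)"
          unfolding X_def by (simp add: nn_integral_add nn_integral_cmult_indicator V)
        also have "ennreal ((\<tau> - t) * Pm) * ennreal V = ennreal ((\<tau> - t) * (Pm * V))"
          using t Pm V by (simp add: mult.assoc flip: ennreal_mult)
        also have "(\<integral>\<^sup>+x. indicator (ball 0 r) x * ennreal (h x) \<partial>lborel) + (X + ennreal ((\<tau> - t) * (Pm * V)))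
          \<le> (\<integral>\<^sup>+x. indicator (ball 0 r) x * ennreal (h x) \<partial>lborel) + (X + ennreal \<epsilon>)"
          using small by (intro add_left_mono ennreal_leI)
        finally have "X + (\<integral>\<^sup>+x. indicator (ball 0 r) x * ennreal (P x * U x) \<partial>lborel)
          \<le> X + ((\<integral>\<^sup>+x. indicator (ball 0 r) x * ennreal (h x) \<partial>lborel) + ennreal \<epsilon>)"
          by (simp only: add_ac)
        then show "(\<integral>\<^sup>+x. indicator (ball 0 r) x * ennreal (P x * U x) \<partial>lborel)
          \<le> (\<integral>\<^sup>+x. indicator (ball 0 r) x * ennreal (h x) \<partial>lborel) + ennreal \<epsilon>"
          using Xfin by (subst (asm) ennreal_add_left_cancel_le) auto
      qed
    qed
  qed
  then show "(\<integral>\<^sup>+x. ennreal (indicator (ball 0 R) x * (P x * U x)) * indicator (ball 0 r0) x \<partial>lborel)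
    \<le> (\<integral>\<^sup>+x. ennreal (indicator (ball 0 R) x * h x) * indicator (ball 0 r0) x \<partial>lborel)"
    by (simp only: red[of _ h] red[of _ "\<lambda>x. P x * U x"])
qed

lemma borel_measurable_lebesgue_AE:
  fixes f g :: "'a::euclidean_space \<Rightarrow> 'b::topological_space"
  assumes g[measurable]: "g \<in> borel_measurable borel" and eq: "AE x in lborel. f x = g x"
  shows "f \<in> borel_measurable lebesgue"
proof (rule measurableI)
  fix S :: "'b set" assume [measurable]: "S \<in> sets borel"
  have "AE x in lebesgue. x \<in> g -` S \<longleftrightarrow> x \<in> f -` S"
    using AE_completion[OF eq] by eventually_elim simp
  moreover have "g -` S \<inter> space borel \<in> sets borel" by measurable
  then have "g -` S \<in> sets lebesgue" by simp
  ultimately have "f -` S \<in> sets lebesgue" by (rule completion.in_sets_AE) simp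
  then show "f -` S \<inter> space lebesgue \<in> sets lebesgue" by simp
qed simp

lemma lebesgue_integral_lborel_AE:
  fixes f g :: "'a::euclidean_space \<Rightarrow> real"
  assumes g: "g \<in> borel_measurable borel" and eq: "AE x in lborel. f x = g x"
  shows "(LINT x|lebesgue. f x) = (LINT x|lborel. g x)"
proof -
  have "(LINT x|lebesgue. f x) = (LINT x|lebesgue. g x)"
    using borel_measurable_lebesgue_AE[OF g eq] g eq
    by (intro integral_cong_AE) (auto intro: AE_completion measurable_completion)
  also have "\<dots> = (LINT x|lborel. g x)" using g by (intro integral_completion) simp
  finally show ?thesis .
qed

lemma lebesgue_iterated_integral_AE:
  fixes f g :: "'a::euclidean_space \<Rightarrow> 'a \<Rightarrow> real"
  assumes g[measurable]: "(\<lambda>p. g (fst p) (snd p)) \<in> borel_measurable (borel \<Otimes>\<^sub>M borel)"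
    and eq: "AE x in lborel. AE y in lborel. f x y = g x y"
  shows "(LINT x|lebesgue. (LINT y|lebesgue. f x y)) = (LINT x|lborel. (LINT y|lborel. g x y))"
proof (rule lebesgue_integral_lborel_AE)
  have g': "(\<lambda>(x, y). g x y) \<in> borel_measurable (lborel \<Otimes>\<^sub>M lborel)"
    using g by (simp add: case_prod_beta)
  show "(\<lambda>x. LINT y|lborel. g x y) \<in> borel_measurable borel"
    using lborel.borel_measurable_lebesgue_integral[of g lborel] g' by simp
  have gx: "g x \<in> borel_measurable borel" for x
  proof -
    have "(\<lambda>y. (\<lambda>p. g (fst p) (snd p)) (x, y)) \<in> borel_measurable borel" by measurable
    then show ?thesis by simp
  qed
  show "AE x in lborel. (LINT y|lebesgue. f x y) = (LINT y|lborel. g x y)"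
    using eq
  proof eventually_elim
    case (elim x)
    with gx show ?case by (rule lebesgue_integral_lborel_AE)
  qed
qed

lemma lebesgue_borel_version:
  fixes f :: "'a::euclidean_space \<Rightarrow> real"
  assumes "f \<in> borel_measurable lebesgue"
  obtains g where "g \<in> borel_measurable borel" "AE x in lborel. f x = g x"
  using completion_ex_borel_measurable_real[OF assms] by auto

lemma lebesgue_on_borel_version:
  fixes f :: "'a::euclidean_space \<Rightarrow> real"
  assumes f: "f \<in> borel_measurable (lebesgue_on E)" and E: "E \<in> sets borel"
  obtains g where "g \<in> borel_measurable borel" "AE x in lborel. x \<in> E \<longrightarrow> f x = g x" "\<And>x. x \<notin> E \<Longrightarrow> g x = 0"
proof -
  have "(\<lambda>x. if x \<in> E then f x else 0) \<in> borel_measurable lebesgue"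
    using f E by (intro borel_measurable_if_I) auto
  then obtain g where g: "g \<in> borel_measurable borel" "AE x in lborel. (if x \<in> E then f x else 0) = g x"
    using lebesgue_borel_version by blast
  have [measurable]: "g \<in> borel_measurable borel" "E \<in> sets borel" using g E by auto
  show thesis
  proof (rule that)
    show "(\<lambda>x. if x \<in> E then g x else 0) \<in> borel_measurable borel" by measurable
    show "AE x in lborel. x \<in> E \<longrightarrow> f x = (if x \<in> E then g x else 0)"
      using g(2) by eventually_elim auto
  qed simp
qed

section \<open>Weak solutions with Borel data\<close>

definition kenergy :: "('a::euclidean_space \<Rightarrow> 'a \<Rightarrow> real) \<Rightarrow> ('a \<Rightarrow> real) \<Rightarrow> ennreal" where
  "kenergy k z = (\<integral>\<^sup>+x. \<integral>\<^sup>+y. ennreal (k x y * (z x - z y)\<^sup>2) \<partial>lborel \<partial>lborel)"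

lemma kenergy_pair:
  fixes k :: "'a::euclidean_space \<Rightarrow> 'a \<Rightarrow> real"
  assumes [measurable]: "(\<lambda>p. k (fst p) (snd p)) \<in> borel_measurable (borel \<Otimes>\<^sub>M borel)" "z \<in> borel_measurable borel"
  shows "kenergy k z = (\<integral>\<^sup>+p. ennreal (k (fst p) (snd p) * (z (fst p) - z (snd p))\<^sup>2) \<partial>(lborel \<Otimes>\<^sub>M lborel))"
proof -
  have "(\<lambda>p. ennreal (k (fst p) (snd p) * (z (fst p) - z (snd p))\<^sup>2)) \<in> borel_measurable (lborel \<Otimes>\<^sub>M lborel)"
    by measurable
  from lborel.nn_integral_fst[OF this] show ?thesis by (simp add: kenergy_def)
qed

lemma kenergy_integrable:
  fixes k :: "'a::euclidean_space \<Rightarrow> 'a \<Rightarrow> real"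
  assumes [measurable]: "(\<lambda>p. k (fst p) (snd p)) \<in> borel_measurable (borel \<Otimes>\<^sub>M borel)" "z \<in> borel_measurable borel"
    and k0: "\<And>x y. 0 \<le> k x y" and fin: "kenergy k z < \<infinity>"
  shows "integrable (lborel \<Otimes>\<^sub>M lborel) (\<lambda>p. k (fst p) (snd p) * (z (fst p) - z (snd p))\<^sup>2)"
proof (rule integrableI_nonneg)
  show "(\<lambda>p. k (fst p) (snd p) * (z (fst p) - z (snd p))\<^sup>2) \<in> borel_measurable (lborel \<Otimes>\<^sub>M lborel)" by measurable
qed (use fin k0 kenergy_pair[OF assms(1,2)] in auto)

lemma kenergy_bilinear_integrable:
  fixes k :: "'a::euclidean_space \<Rightarrow> 'a \<Rightarrow> real"
  assumes [measurable]: "(\<lambda>p. k (fst p) (snd p)) \<in> borel_measurable (borel \<Otimes>\<^sub>M borel)"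
      "z \<in> borel_measurable borel" "w \<in> borel_measurable borel"
    and k0: "\<And>x y. 0 \<le> k x y" and fin: "kenergy k z < \<infinity>" "kenergy k w < \<infinity>"
  shows "integrable (lborel \<Otimes>\<^sub>M lborel) (\<lambda>p. k (fst p) (snd p) * ((z (fst p) - z (snd p)) * (w (fst p) - w (snd p))))"
proof (rule Bochner_Integration.integrable_bound)
  show "integrable (lborel \<Otimes>\<^sub>M lborel) (\<lambda>p. k (fst p) (snd p) * (z (fst p) - z (snd p))\<^sup>2
      + k (fst p) (snd p) * (w (fst p) - w (snd p))\<^sup>2)"
    using assms by (intro Bochner_Integration.integrable_add kenergy_integrable)
  show "(\<lambda>p. k (fst p) (snd p) * ((z (fst p) - z (snd p)) * (w (fst p) - w (snd p)))) \<in> borel_measurable (lborel \<Otimes>\<^sub>M lborel)"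
    by measurable
  show "AE p in lborel \<Otimes>\<^sub>M lborel. norm (k (fst p) (snd p) * ((z (fst p) - z (snd p)) * (w (fst p) - w (snd p))))
    \<le> norm (k (fst p) (snd p) * (z (fst p) - z (snd p))\<^sup>2 + k (fst p) (snd p) * (w (fst p) - w (snd p))\<^sup>2)"
  proof (rule AE_I2)
    fix p :: "'a \<times> 'a"
    define A B K where "A = z (fst p) - z (snd p)" and "B = w (fst p) - w (snd p)" and "K = k (fst p) (snd p)"
    have K: "0 \<le> K" by (simp add: K_def k0)
    have "0 \<le> (\<bar>A\<bar> - \<bar>B\<bar>)\<^sup>2" by simp
    then have "2 * (\<bar>A\<bar> * \<bar>B\<bar>) \<le> A\<^sup>2 + B\<^sup>2" by (simp add: power2_diff)
    then have "\<bar>A\<bar> * \<bar>B\<bar> \<le> A\<^sup>2 + B\<^sup>2"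
      using mult_nonneg_nonneg[OF abs_ge_zero[of A] abs_ge_zero[of B]] by linarith
    from mult_left_mono[OF this K] have "norm (K * (A * B)) \<le> norm (K * A\<^sup>2 + K * B\<^sup>2)"
      using K by (simp add: abs_mult distrib_left)
    then show "norm (k (fst p) (snd p) * ((z (fst p) - z (snd p)) * (w (fst p) - w (snd p))))
      \<le> norm (k (fst p) (snd p) * (z (fst p) - z (snd p))\<^sup>2 + k (fst p) (snd p) * (w (fst p) - w (snd p))\<^sup>2)"
      by (simp only: A_def B_def K_def)
  qed
qed

lemma H_dirichlet_borel:
  fixes k k' :: "'a::euclidean_space \<Rightarrow> 'a \<Rightarrow> real"
  assumes keq: "AE x in lborel. AE y in lborel. k x y = k' x y"
    and p: "p \<in> borel_measurable borel" "integrable lborel (\<lambda>x. (p x)\<^sup>2)" "\<And>x. x \<notin> E \<Longrightarrow> p x = 0"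
    and fin: "kenergy k' p < \<infinity>"
  shows "p \<in> H_dirichlet E k"
proof -
  have [measurable]: "p \<in> borel_measurable borel" by fact
  have "(\<integral>\<^sup>+x. (\<integral>\<^sup>+y. ennreal (\<bar>p x - p y\<bar>\<^sup>2 * k x y) \<partial>lebesgue) \<partial>lebesgue)
    = (\<integral>\<^sup>+x. (\<integral>\<^sup>+y. ennreal (\<bar>p x - p y\<bar>\<^sup>2 * k x y) \<partial>lborel) \<partial>lborel)"
    by (simp only: nn_integral_completion)
  also have "\<dots> = kenergy k' p"
    unfolding kenergy_def
  proof (rule nn_integral_cong_AE)
    show "AE x in lborel. (\<integral>\<^sup>+y. ennreal (\<bar>p x - p y\<bar>\<^sup>2 * k x y) \<partial>lborel) = (\<integral>\<^sup>+y. ennreal (k' x y * (p x - p y)\<^sup>2) \<partial>lborel)"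
      using keq
    proof eventually_elim
      case (elim x)
      show ?case by (rule nn_integral_cong_AE) (use elim in eventually_elim, simp add: mult.commute)
    qed
  qed
  finally have "(\<integral>\<^sup>+x. (\<integral>\<^sup>+y. ennreal (\<bar>p x - p y\<bar>\<^sup>2 * k x y) \<partial>lebesgue) \<partial>lebesgue) < \<infinity>"
    using fin by simp
  moreover have "p \<in> L2_on UNIV"
    using p by (simp add: L2_on_def lebesgue_on_UNIV_eq measurable_completion integrable_completion)
  ultimately show ?thesis using p(3) by (auto simp: H_dirichlet_def H_space_def)
qed

lemma H_dirichlet_borel_version:
  fixes k k' :: "'a::euclidean_space \<Rightarrow> 'a \<Rightarrow> real"
  assumes u: "u \<in> H_dirichlet E k" and keq: "AE x in lborel. AE y in lborel. k x y = k' x y" and E: "E \<in> sets borel"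
  obtains u' where "u' \<in> borel_measurable borel" "AE x in lborel. u x = u' x" "\<And>x. x \<notin> E \<Longrightarrow> u' x = 0"
    "integrable lborel (\<lambda>x. (u' x)\<^sup>2)" "kenergy k' u' < \<infinity>"
proof -
  have um: "u \<in> borel_measurable lebesgue" and ui: "integrable lebesgue (\<lambda>x. (u x)\<^sup>2)"
    and uE: "AE x in lborel. x \<notin> E \<longrightarrow> u x = 0"
    and ue: "(\<integral>\<^sup>+x. (\<integral>\<^sup>+y. ennreal (\<bar>u x - u y\<bar>\<^sup>2 * k x y) \<partial>lebesgue) \<partial>lebesgue) < \<infinity>"
    using u by (simp_all add: H_dirichlet_def H_space_def L2_on_def lebesgue_on_UNIV_eq AE_completion_iff)
  obtain g where g: "g \<in> borel_measurable borel" "AE x in lborel. u x = g x"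
    using lebesgue_borel_version[OF um] .
  have [measurable]: "g \<in> borel_measurable borel" "E \<in> sets borel" by fact+
  define u' where "u' x = (if x \<in> E then g x else 0)" for x
  have m: "u' \<in> borel_measurable borel" unfolding u'_def by measurable
  have eq: "AE x in lborel. u x = u' x"
    using g(2) uE by eventually_elim (auto simp: u'_def)
  show thesis
  proof (rule that[OF m eq])
    show "u' x = 0" if "x \<notin> E" for x using that by (simp add: u'_def)
    have "(\<lambda>x. (u' x)\<^sup>2) \<in> borel_measurable borel" using m by measurable
    moreover have "integrable lebesgue (\<lambda>x. (u' x)\<^sup>2) = integrable lebesgue (\<lambda>x. (u x)\<^sup>2)"
      using um m AE_completion[OF eq]
      by (intro integrable_cong_AE) (auto intro: measurable_completion)
    ultimately show "integrable lborel (\<lambda>x. (u' x)\<^sup>2)"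
      using ui by (simp add: integrable_completion)
    have "kenergy k' u' = (\<integral>\<^sup>+x. (\<integral>\<^sup>+y. ennreal (\<bar>u x - u y\<bar>\<^sup>2 * k x y) \<partial>lborel) \<partial>lborel)"
      unfolding kenergy_def
    proof (rule nn_integral_cong_AE)
      show "AE x in lborel. (\<integral>\<^sup>+y. ennreal (k' x y * (u' x - u' y)\<^sup>2) \<partial>lborel) = (\<integral>\<^sup>+y. ennreal (\<bar>u x - u y\<bar>\<^sup>2 * k x y) \<partial>lborel)"
        using keq eq
      proof eventually_elim
        case (elim x)
        show ?case by (rule nn_integral_cong_AE) (use elim(1) eq in eventually_elim, simp add: mult.commute elim(2))
      qed
    qed
    then show "kenergy k' u' < \<infinity>" using ue by (simp only: nn_integral_completion)
  qed
qed

lemma weak_borel: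
  fixes k k' :: "'a::euclidean_space \<Rightarrow> 'a \<Rightarrow> real"
  assumes sol: "weak_solution E k a g u" and E[measurable]: "E \<in> sets borel"
    and k'[measurable]: "(\<lambda>p. k' (fst p) (snd p)) \<in> borel_measurable (borel \<Otimes>\<^sub>M borel)"
    and k0: "\<And>x y. 0 \<le> k' x y"
    and keq: "AE x in lborel. AE y in lborel. k x y = k' x y"
    and u'[measurable]: "u' \<in> borel_measurable borel" and ueq: "AE x in lborel. u x = u' x"
    and ufin: "kenergy k' u' < \<infinity>"
    and a'[measurable]: "a' \<in> borel_measurable borel" and aeq: "AE x in lborel. x \<in> E \<longrightarrow> a x = a' x"
    and g'[measurable]: "g' \<in> borel_measurable borel" and geq: "AE x in lborel. x \<in> E \<longrightarrow> g x = g' x"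
    and p[measurable]: "p \<in> borel_measurable borel" and pi: "integrable lborel (\<lambda>x. (p x)\<^sup>2)"
    and pE: "\<And>x. x \<notin> E \<Longrightarrow> p x = 0" and pfin: "kenergy k' p < \<infinity>"
  shows "1 / 2 * (LINT q|(lborel \<Otimes>\<^sub>M lborel). k' (fst q) (snd q) * ((u' (fst q) - u' (snd q)) * (p (fst q) - p (snd q))))
      + (LINT x|lborel. a' x * (u' x * p x)) = (LINT x|lborel. g' x * p x)"
proof -
  have pH: "p \<in> H_dirichlet E k" by (rule H_dirichlet_borel[OF keq p pi pE pfin])
  have "(LINT x|lebesgue. (LINT y|lebesgue. k x y * (u x - u y) * (p x - p y)))
    = (LINT x|lborel. (LINT y|lborel. k' x y * ((u' x - u' y) * (p x - p y))))"
  proof (rule lebesgue_iterated_integral_AE)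
    show "AE x in lborel. AE y in lborel. k x y * (u x - u y) * (p x - p y) = k' x y * ((u' x - u' y) * (p x - p y))"
      using keq ueq
    proof eventually_elim
      case (elim x)
      from elim(1) ueq show ?case by eventually_elim (simp add: elim(2))
    qed
  qed measurable
  also have "\<dots> = (LINT q|(lborel \<Otimes>\<^sub>M lborel). k' (fst q) (snd q) * ((u' (fst q) - u' (snd q)) * (p (fst q) - p (snd q))))"
    using lborel_pair.integral_fst'[OF kenergy_bilinear_integrable[OF k' u' p k0 ufin pfin]] by simp
  finally have 1: "(LINT x|lebesgue. (LINT y|lebesgue. k x y * (u x - u y) * (p x - p y))) = \<dots>" .
  have 2: "(LINT x:E|lebesgue. a x * u x * p x) = (LINT x|lborel. a' x * (u' x * p x))"
    unfolding set_lebesgue_integral_def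
  proof (rule lebesgue_integral_lborel_AE)
    show "AE x in lborel. indicator E x *\<^sub>R (a x * u x * p x) = a' x * (u' x * p x)"
      using aeq ueq by eventually_elim (use pE in \<open>auto simp: indicator_def\<close>)
  qed measurable
  have 3: "(LINT x:E|lebesgue. g x * p x) = (LINT x|lborel. g' x * p x)"
    unfolding set_lebesgue_integral_def
  proof (rule lebesgue_integral_lborel_AE)
    show "AE x in lborel. indicator E x *\<^sub>R (g x * p x) = g' x * p x"
      using geq by eventually_elim (use pE in \<open>auto simp: indicator_def\<close>)
  qed measurable
  have "1 / 2 * (LINT x|lebesgue. (LINT y|lebesgue. k x y * (u x - u y) * (p x - p y)))
      + (LINT x:E|lebesgue. a x * u x * p x) = (LINT x:E|lebesgue. g x * p x)"
    using sol pH by (simp add: weak_solution_def)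
  then show ?thesis unfolding 1 2 3 .
qed

lemma tst_energy_le:
  fixes k :: "'a::euclidean_space \<Rightarrow> 'a \<Rightarrow> real"
  assumes [measurable]: "(\<lambda>p. k (fst p) (snd p)) \<in> borel_measurable (borel \<Otimes>\<^sub>M borel)" "u \<in> borel_measurable borel"
    and k0: "\<And>x y. 0 \<le> k x y" and t: "0 \<le> t" and fin: "kenergy k u < \<infinity>"
  shows "kenergy k (\<lambda>x. tst t n (u x)) < \<infinity>"
proof -
  have "kenergy k (\<lambda>x. tst t n (u x)) \<le> (\<integral>\<^sup>+p. ennreal ((real n)\<^sup>2) * ennreal (k (fst p) (snd p) * (u (fst p) - u (snd p))\<^sup>2) \<partial>(lborel \<Otimes>\<^sub>M lborel))"
  proof (subst kenergy_pair)
    show "(\<integral>\<^sup>+p. ennreal (k (fst p) (snd p) * (tst t n (u (fst p)) - tst t n (u (snd p)))\<^sup>2) \<partial>(lborel \<Otimes>\<^sub>M lborel))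
      \<le> (\<integral>\<^sup>+p. ennreal ((real n)\<^sup>2) * ennreal (k (fst p) (snd p) * (u (fst p) - u (snd p))\<^sup>2) \<partial>(lborel \<Otimes>\<^sub>M lborel))"
    proof (rule nn_integral_mono)
      fix p :: "'a \<times> 'a"
      have "\<bar>tst t n (u (fst p)) - tst t n (u (snd p))\<bar>\<^sup>2 \<le> (real n * \<bar>u (fst p) - u (snd p)\<bar>)\<^sup>2"
        by (intro power_mono tst_lipschitz t) simp
      then have "k (fst p) (snd p) * (tst t n (u (fst p)) - tst t n (u (snd p)))\<^sup>2 \<le> k (fst p) (snd p) * ((real n)\<^sup>2 * (u (fst p) - u (snd p))\<^sup>2)"
        by (intro mult_left_mono k0) (simp add: power_mult_distrib)
      then show "ennreal (k (fst p) (snd p) * (tst t n (u (fst p)) - tst t n (u (snd p)))\<^sup>2)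
        \<le> ennreal ((real n)\<^sup>2) * ennreal (k (fst p) (snd p) * (u (fst p) - u (snd p))\<^sup>2)"
        using k0[of "fst p" "snd p"] by (subst ennreal_mult[symmetric]) (auto intro!: ennreal_leI simp: mult_ac)
    qed
  qed measurable
  also have "\<dots> = ennreal ((real n)\<^sup>2) * kenergy k u"
    by (subst nn_integral_cmult) (simp_all add: kenergy_pair)
  also have "\<dots> < \<infinity>" using fin by (simp add: ennreal_mult_less_top)
  finally show ?thesis .
qed

lemma weak_test:
  fixes k k' :: "'a::euclidean_space \<Rightarrow> 'a \<Rightarrow> real"
  assumes sol: "weak_solution E k a g u" and E[measurable]: "E \<in> sets borel"
    and k'[measurable]: "(\<lambda>p. k' (fst p) (snd p)) \<in> borel_measurable (borel \<Otimes>\<^sub>M borel)"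
    and k0: "\<And>x y. 0 \<le> k' x y"
    and keq: "AE x in lborel. AE y in lborel. k x y = k' x y"
    and J[measurable]: "J \<in> borel_measurable borel" and Jk: "AE x in lborel. AE y in lborel. J (x - y) \<le> k' x y"
    and u'[measurable]: "u' \<in> borel_measurable borel" and ueq: "AE x in lborel. u x = u' x"
    and uE: "\<And>x. x \<notin> E \<Longrightarrow> u' x = 0" and ui: "integrable lborel (\<lambda>x. (u' x)\<^sup>2)"
    and ufin: "kenergy k' u' < \<infinity>"
    and a'[measurable]: "a' \<in> borel_measurable borel" and aeq: "AE x in lborel. x \<in> E \<longrightarrow> a x = a' x"
    and a0: "\<And>x. 0 \<le> a' x" and aM: "\<And>x. a' x \<le> M"
    and g'[measurable]: "g' \<in> borel_measurable borel" and geq: "AE x in lborel. x \<in> E \<longrightarrow> g x = g' x"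
    and gi: "integrable lborel (\<lambda>x. (g' x)\<^sup>2)"
    and ER: "E \<subseteq> ball 0 R" and gE: "\<And>x. x \<notin> E \<Longrightarrow> g' x = 0"
    and t: "0 \<le> t"
  shows "(\<integral>\<^sup>+x. \<integral>\<^sup>+y. ennreal (J (x - y) * ((u' x - u' y) * (tst t n (u' x) - tst t n (u' y)))) \<partial>lborel \<partial>lborel)
        + 2 * (\<integral>\<^sup>+x. ennreal (a' x * (\<bar>u' x\<bar> * \<bar>tst t n (u' x)\<bar>)) \<partial>lborel)
      \<le> 2 * (\<integral>\<^sup>+x. ennreal (\<bar>g' x\<bar> * \<bar>tst t n (u' x)\<bar>) \<partial>lborel)"
proof -
  define p where "p x = tst t n (u' x)" for x
  have p[measurable]: "p \<in> borel_measurable borel" unfolding p_def by measurable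
  have out: "x \<notin> E" if "x \<notin> ball 0 R" for x using ER that by blast
  have uL: "u' \<in> L2ball R" and gL: "g' \<in> L2ball R"
    using uE[OF out] ui gE[OF out] gi by (simp_all add: L2ball_def)
  have nuL: "(\<lambda>x. real n * u' x) \<in> L2ball R" using L2ball_lincomb[OF uL uL, of "real n" 0] by simp
  have p_le: "\<bar>p x\<bar> \<le> \<bar>real n * u' x\<bar>" for x
    using tst_lipschitz[OF t, of n "u' x" 0] by (simp add: p_def tst_def abs_mult)
  have pL: "p \<in> L2ball R" by (rule L2ball_dominated[OF nuL p p_le])
  have pE: "p x = 0" if "x \<notin> E" for x using uE[OF that] by (simp add: p_def tst_def)
  have pfin: "kenergy k' p < \<infinity>" unfolding p_def by (rule tst_energy_le[OF k' u' k0 t ufin])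
  note eq = weak_borel[OF sol E k' k0 keq u' ueq ufin a' aeq g' geq p L2ballD(3)[OF pL] pE pfin]
  have mono: "0 \<le> (u' x - u' y) * (p x - p y)" for x y
    using tst_mono[of "u' x" "u' y" t n] tst_mono[of "u' y" "u' x" t n]
    by (cases "u' x \<le> u' y") (auto simp: p_def mult_nonpos_nonpos)
  define X where "X = (LINT q|(lborel \<Otimes>\<^sub>M lborel). k' (fst q) (snd q) * ((u' (fst q) - u' (snd q)) * (p (fst q) - p (snd q))))"
  have X0: "0 \<le> X" unfolding X_def using k0 mono by (intro integral_nonneg_AE) simp
  have "(\<integral>\<^sup>+x. \<integral>\<^sup>+y. ennreal (J (x - y) * ((u' x - u' y) * (p x - p y))) \<partial>lborel \<partial>lborel)
    \<le> (\<integral>\<^sup>+x. \<integral>\<^sup>+y. ennreal (k' x y * ((u' x - u' y) * (p x - p y))) \<partial>lborel \<partial>lborel)"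
  proof (rule nn_integral_mono_AE)
    show "AE x in lborel. (\<integral>\<^sup>+y. ennreal (J (x - y) * ((u' x - u' y) * (p x - p y))) \<partial>lborel)
      \<le> (\<integral>\<^sup>+y. ennreal (k' x y * ((u' x - u' y) * (p x - p y))) \<partial>lborel)"
      using Jk
    proof eventually_elim
      case (elim x)
      show ?case
        by (rule nn_integral_mono_AE) (use elim in eventually_elim, intro ennreal_leI mult_right_mono mono)
    qed
  qed
  also have "\<dots> = (\<integral>\<^sup>+q. ennreal (k' (fst q) (snd q) * ((u' (fst q) - u' (snd q)) * (p (fst q) - p (snd q)))) \<partial>(lborel \<Otimes>\<^sub>M lborel))"
    by (subst lborel.nn_integral_fst[symmetric]) simp_all
  also have "\<dots> = ennreal X"
    unfolding X_def using k0 mono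
    by (intro nn_integral_eq_integral kenergy_bilinear_integrable[OF k' u' p k0 ufin pfin]) simp
  finally have 1: "(\<integral>\<^sup>+x. \<integral>\<^sup>+y. ennreal (J (x - y) * ((u' x - u' y) * (p x - p y))) \<partial>lborel \<partial>lborel) \<le> ennreal X" .
  have up: "u' x * p x = \<bar>u' x\<bar> * \<bar>p x\<bar>" for x unfolding p_def by (rule tst_prod)
  define Y where "Y = (LINT x|lborel. a' x * (u' x * p x))"
  have ai: "integrable lborel (\<lambda>x. a' x * (u' x * p x))"
    using a0 aM by (intro L2ball_weight[OF uL pL a', of M]) simp
  have 2: "(\<integral>\<^sup>+x. ennreal (a' x * (\<bar>u' x\<bar> * \<bar>p x\<bar>)) \<partial>lborel) = ennreal Y"
    unfolding Y_def up[symmetric] using a0 by (intro nn_integral_eq_integral ai) (simp add: up)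
  have Y0: "0 \<le> Y" unfolding Y_def up using a0 by (intro integral_nonneg_AE) simp
  define Z where "Z = (LINT x|lborel. \<bar>g' x\<bar> * \<bar>p x\<bar>)"
  have gi': "integrable lborel (\<lambda>x. \<bar>g' x\<bar> * \<bar>p x\<bar>)"
    using integrable_abs[OF L2ball_mult[OF gL pL]] by (simp add: abs_mult)
  have 3: "(\<integral>\<^sup>+x. ennreal (\<bar>g' x\<bar> * \<bar>p x\<bar>) \<partial>lborel) = ennreal Z"
    unfolding Z_def by (intro nn_integral_eq_integral gi') simp
  have Z0: "0 \<le> Z" unfolding Z_def by (intro integral_nonneg_AE) simp
  have "(LINT x|lborel. g' x * p x) \<le> Z"
    unfolding Z_def using L2ball_mult[OF gL pL] gi' by (intro integral_mono) (auto simp flip: abs_mult)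
  then have "X + 2 * Y \<le> 2 * Z" using eq by (simp add: X_def Y_def)
  then have "ennreal (X + 2 * Y) \<le> ennreal (2 * Z)" by (rule ennreal_leI)
  then have "ennreal X + 2 * ennreal Y \<le> 2 * ennreal Z"
    using X0 Y0 Z0 by (simp add: ennreal_mult)
  then show ?thesis
    using 1 unfolding p_def[symmetric] 2 3 by (meson add_right_mono order_trans)
qed

section \<open>Passage to the limit of the kernels\<close>

lemma L2ball_cauchy_schwarz:
  assumes a: "a \<in> L2ball R" and d: "d \<in> L2ball R" and k[measurable]: "k \<in> borel_measurable borel"
    and kC: "\<And>x. \<bar>k x\<bar> \<le> C"
  shows "\<bar>LINT x|lborel. k x * (a x * d x)\<bar> \<le> C * (sqrt (LINT x|lborel. (a x)\<^sup>2) * sqrt (LINT x|lborel. (d x)\<^sup>2))"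
proof -
  have [measurable]: "a \<in> borel_measurable borel" "d \<in> borel_measurable borel"
    using L2ballD(1)[OF a] L2ballD(1)[OF d] .
  have C: "0 \<le> C" using kC[of 0] by simp
  define X where "X = (LINT x|lborel. \<bar>a x\<bar> * \<bar>d x\<bar>)"
  have iX: "integrable lborel (\<lambda>x. \<bar>a x\<bar> * \<bar>d x\<bar>)"
    using integrable_abs[OF L2ball_mult[OF a d]] by (simp add: abs_mult)
  have X0: "0 \<le> X" unfolding X_def by (intro integral_nonneg_AE) simp
  have A0: "0 \<le> (LINT x|lborel. (a x)\<^sup>2)" "0 \<le> (LINT x|lborel. (d x)\<^sup>2)" by (auto intro!: integral_nonneg_AE)
  have sq: "(\<integral>\<^sup>+x. ennreal ((z x)\<^sup>2) \<partial>lborel) = ennreal (LINT x|lborel. (z x)\<^sup>2)" if "z \<in> L2ball R" for z :: "'a \<Rightarrow> real"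
    by (rule nn_integral_eq_integral[OF L2ballD(3)[OF that]]) simp
  have "(\<integral>\<^sup>+x. ennreal \<bar>a x\<bar> * ennreal \<bar>d x\<bar> \<partial>lborel) = ennreal X"
    unfolding X_def using nn_integral_eq_integral[OF iX] by (simp add: ennreal_mult)
  moreover have "(\<integral>\<^sup>+x. ennreal \<bar>a x\<bar> * ennreal \<bar>d x\<bar> \<partial>lborel)\<^sup>2
     \<le> (\<integral>\<^sup>+x. (ennreal \<bar>a x\<bar>)\<^sup>2 \<partial>lborel) * (\<integral>\<^sup>+x. (ennreal \<bar>d x\<bar>)\<^sup>2 \<partial>lborel)"
    by (rule Cauchy_Schwarz_nn_integral) measurable
  ultimately have "ennreal (X\<^sup>2) \<le> ennreal ((LINT x|lborel. (a x)\<^sup>2) * (LINT x|lborel. (d x)\<^sup>2))"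
    using X0 A0 by (simp add: ennreal_power sq[OF a] sq[OF d] ennreal_mult)
  then have "X\<^sup>2 \<le> (LINT x|lborel. (a x)\<^sup>2) * (LINT x|lborel. (d x)\<^sup>2)"
    using A0 by (subst (asm) ennreal_le_iff) auto
  then have X: "X \<le> sqrt (LINT x|lborel. (a x)\<^sup>2) * sqrt (LINT x|lborel. (d x)\<^sup>2)"
    by (simp add: real_le_rsqrt flip: real_sqrt_mult)
  have "\<bar>LINT x|lborel. k x * (a x * d x)\<bar> \<le> (LINT x|lborel. \<bar>k x * (a x * d x)\<bar>)"
    by (rule integral_abs_bound)
  also have "\<dots> \<le> (LINT x|lborel. C * (\<bar>a x\<bar> * \<bar>d x\<bar>))"
    using iX integrable_abs[OF L2ball_weight[OF a d k kC]] kC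
    by (intro integral_mono) (auto simp: abs_mult intro!: mult_right_mono)
  also have "\<dots> = C * X" by (simp add: X_def)
  finally show ?thesis using mult_left_mono[OF X C] by simp
qed

lemma L2ball_tendsto:
  assumes W: "\<And>i. W i \<in> L2ball R" and w: "w \<in> L2ball R" and a: "a \<in> L2ball R"
    and lim: "(\<lambda>i. LINT x|lborel. (W i x - w x)\<^sup>2) \<longlonglongrightarrow> 0"
    and k: "k \<in> borel_measurable borel" "\<And>x. \<bar>k x\<bar> \<le> C"
  shows "(\<lambda>i. LINT x|lborel. k x * (a x * W i x)) \<longlonglongrightarrow> (LINT x|lborel. k x * (a x * w x))"
proof -
  have "(\<lambda>i. C * (sqrt (LINT x|lborel. (a x)\<^sup>2) * sqrt (LINT x|lborel. (W i x - w x)\<^sup>2))) \<longlonglongrightarrow>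
    C * (sqrt (LINT x|lborel. (a x)\<^sup>2) * sqrt 0)"
    by (intro tendsto_intros lim)
  then have 0: "(\<lambda>i. C * (sqrt (LINT x|lborel. (a x)\<^sup>2) * sqrt (LINT x|lborel. (W i x - w x)\<^sup>2))) \<longlonglongrightarrow> 0"
    by simp
  have "(\<lambda>i. LINT x|lborel. k x * (a x * (W i x - w x))) \<longlonglongrightarrow> 0"
    by (rule tendsto_rabs_zero_cancel, rule tendsto_sandwich[OF _ _ tendsto_const 0])
      (auto intro!: always_eventually L2ball_cauchy_schwarz[OF a L2ball_diff[OF W w] k])
  moreover have "(LINT x|lborel. k x * (a x * (W i x - w x)))
    = (LINT x|lborel. k x * (a x * W i x)) - (LINT x|lborel. k x * (a x * w x))" for i
    using L2ball_weight[OF a W k, of i] L2ball_weight[OF a w k]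
    by (simp add: right_diff_distrib)
  ultimately show ?thesis using LIM_zero_cancel by fastforce
qed

lemma L2ball_tendsto_sq:
  assumes W: "\<And>i. W i \<in> L2ball R" and w: "w \<in> L2ball R"
    and lim: "(\<lambda>i. LINT x|lborel. (W i x - w x)\<^sup>2) \<longlonglongrightarrow> 0"
    and k: "k \<in> borel_measurable borel" "\<And>x. \<bar>k x\<bar> \<le> C"
  shows "(\<lambda>i. LINT x|lborel. k x * (W i x * W i x)) \<longlonglongrightarrow> (LINT x|lborel. k x * (w x * w x))"
proof -
  have bnd: "\<bar>LINT x|lborel. k x * ((W i x - w x) * (W i x - w x))\<bar> \<le> C * (LINT x|lborel. (W i x - w x)\<^sup>2)" for i
    using L2ball_cauchy_schwarz[OF L2ball_diff[OF W w] L2ball_diff[OF W w] k, of i i] by simp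
  have lim0: "(\<lambda>i. C * (LINT x|lborel. (W i x - w x)\<^sup>2)) \<longlonglongrightarrow> 0"
    using tendsto_mult_left[OF lim, of C] by simp
  have "(\<lambda>i. LINT x|lborel. k x * ((W i x - w x) * (W i x - w x))) \<longlonglongrightarrow> 0"
    by (rule Lim_null_comparison[OF always_eventually lim0]) (simp only: real_norm_def bnd simp_thms)
  moreover have "(\<lambda>i. LINT x|lborel. k x * (w x * W i x)) \<longlonglongrightarrow> (LINT x|lborel. k x * (w x * w x))"
    by (rule L2ball_tendsto[OF W w w lim k])
  ultimately have "(\<lambda>i. (LINT x|lborel. k x * ((W i x - w x) * (W i x - w x))) + 2 * (LINT x|lborel. k x * (w x * W i x))
      - (LINT x|lborel. k x * (w x * w x))) \<longlonglongrightarrow> 0 + 2 * (LINT x|lborel. k x * (w x * w x)) - (LINT x|lborel. k x * (w x * w x))"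
    by (intro tendsto_intros)
  moreover have "(LINT x|lborel. k x * ((W i x - w x) * (W i x - w x))) + 2 * (LINT x|lborel. k x * (w x * W i x))
      - (LINT x|lborel. k x * (w x * w x)) = (LINT x|lborel. k x * (W i x * W i x))" for i
  proof -
    have "(LINT x|lborel. k x * ((W i x - w x) * (W i x - w x)))
      = (LINT x|lborel. k x * (W i x * W i x) - 2 * (k x * (w x * W i x)) + k x * (w x * w x))"
      by (simp add: algebra_simps)
    also have "\<dots> = (LINT x|lborel. k x * (W i x * W i x)) - 2 * (LINT x|lborel. k x * (w x * W i x)) + (LINT x|lborel. k x * (w x * w x))"
      using L2ball_weight[OF W W k, of i i] L2ball_weight[OF w W k, of i] L2ball_weight[OF w w k] by simp
    finally show ?thesis by simp
  qed
  ultimately show ?thesis by simp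
qed

context bounded_kernel
begin

lemma I_energy:
  assumes z: "z \<in> L2ball R"
  shows "kenergy (\<lambda>x y. q (x - y)) z = ennreal (4 * (I z + (LINT x|lborel. F x * z x)) - 2 * (LINT x|lborel. cs x * (z x * z x)))"
    "2 * (LINT x|lborel. cs x * (z x * z x)) \<le> 4 * (I z + (LINT x|lborel. F x * z x))"
proof -
  have ci: "integrable lborel (\<lambda>x. cs x * (z x * z x))"
    using cs_nonneg cs_le by (intro L2ball_weight[OF z z, of _ M]) auto
  have "S z z = (LINT x|lborel. j * (z x)\<^sup>2 + cs x * (z x * z x))"
    unfolding S_def by (simp add: distrib_right power2_eq_square)
  also have "\<dots> = j * (LINT x|lborel. (z x)\<^sup>2) + (LINT x|lborel. cs x * (z x * z x))"
    using ci L2ballD(3)[OF z] by simp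
  finally have S: "S z z = j * (LINT x|lborel. (z x)\<^sup>2) + (LINT x|lborel. cs x * (z x * z x))" .
  then have eq: "2 * j * (LINT x|lborel. (z x)\<^sup>2) - 2 * B z z
    = 4 * (I z + (LINT x|lborel. F x * z x)) - 2 * (LINT x|lborel. cs x * (z x * z x))"
    unfolding I_def by (simp add: field_simps)
  then show "kenergy (\<lambda>x y. q (x - y)) z = ennreal (4 * (I z + (LINT x|lborel. F x * z x)) - 2 * (LINT x|lborel. cs x * (z x * z x)))"
    unfolding kenergy_def by (simp only: energy_nn[OF z])
  have "0 \<le> \<kappa> * (LINT x|lborel. (z x)\<^sup>2)" using \<kappa> by (auto intro!: mult_nonneg_nonneg integral_nonneg_AE)
  then have "0 \<le> j * (LINT x|lborel. (z x)\<^sup>2) - B z z" using energy_nonneg[OF z] by linarith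
  then show "2 * (LINT x|lborel. cs x * (z x * z x)) \<le> 4 * (I z + (LINT x|lborel. F x * z x))"
    using eq by linarith
qed

lemma I_midpoint:
  assumes x: "x \<in> L2ball R" and y: "y \<in> L2ball R"
  obtains m where "m \<in> L2ball R" "\<kappa> / 8 * (LINT t|lborel. (x t - y t)\<^sup>2) \<le> (I x + I y) / 2 - I m"
proof -
  define d where "d t = x t - y t" for t
  have d: "d \<in> L2ball R" unfolding d_def by (rule L2ball_diff[OF x y])
  define l where "l = S y d - B y d - (LINT t|lborel. F t * d t)"
  define b where "b = S d d - B d d"
  have "I (\<lambda>t. y t + 1 * d t) = I y + 1 * l + 1 * 1 * (b / 2)" unfolding l_def b_def by (rule I_expand[OF y d])
  moreover have "(\<lambda>t. y t + 1 * d t) = x" by (simp add: d_def)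
  ultimately have 1: "I x = I y + l + b / 2" by simp
  have 2: "I (\<lambda>t. y t + (1/2) * d t) = I y + (1/2) * l + (1/2) * (1/2) * (b / 2)" unfolding l_def b_def by (rule I_expand[OF y d])
  have "(\<lambda>t. 1 * y t + (1/2) * d t) \<in> L2ball R" by (rule L2ball_lincomb[OF y d])
  then have m: "(\<lambda>t. y t + (1/2) * d t) \<in> L2ball R" by simp
  have "\<kappa> * (LINT t|lborel. (d t)\<^sup>2) \<le> b" using energy_nonneg[OF d] S_ge[OF d] by (simp add: b_def)
  then have "\<kappa> / 8 * (LINT t|lborel. (d t)\<^sup>2) \<le> b / 8" by simp
  also have "b / 8 = (I x + I y) / 2 - I (\<lambda>t. y t + (1/2) * d t)" unfolding 2 using 1 by (simp add: field_simps)
  finally show thesis using that[OF m] by (simp add: d_def)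
qed

end

locale kernel_limit =
  fixes q :: "nat \<Rightarrow> 'a::euclidean_space \<Rightarrow> real" and qs F cs U v :: "'a \<Rightarrow> real" and R M \<kappa> :: real and Q :: "nat \<Rightarrow> real"
  assumes bk: "\<And>n. bounded_kernel (q n) F cs (Q n) R M \<kappa>"
    and q_mono: "\<And>n m x. n \<le> m \<Longrightarrow> q n x \<le> q m x"
    and q_le: "\<And>n x. x \<noteq> 0 \<Longrightarrow> q n x \<le> qs x"
    and q_lim: "\<And>x. x \<noteq> 0 \<Longrightarrow> (\<lambda>n. q n x) \<longlonglongrightarrow> qs x"
    and qs_meas[measurable]: "qs \<in> borel_measurable borel" and qs_nonneg: "\<And>x. 0 \<le> qs x"
    and U: "U \<in> L2ball R" "rdec U"
    and D: "\<And>n. conc_le (\<lambda>x. ennreal (indicator (ball 0 R) x * ((bounded_kernel.j (q n) + cs x) * U x)))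
        (\<lambda>x. ennreal (indicator (ball 0 R) x * (F x + bounded_kernel.A (q n) U x)))"
    and v: "v \<in> L2ball R" and v_fin: "kenergy (\<lambda>x y. qs (x - y)) v < \<infinity>"
    and v_weak: "\<And>p. p \<in> L2ball R \<Longrightarrow> kenergy (\<lambda>x y. qs (x - y)) p < \<infinity> \<Longrightarrow>
        1 / 2 * (LINT z|(lborel \<Otimes>\<^sub>M lborel). qs (fst z - snd z) * ((v (fst z) - v (snd z)) * (p (fst z) - p (snd z))))
          + (LINT x|lborel. cs x * (v x * p x)) = (LINT x|lborel. F x * p x)"
begin

abbreviation "I n \<equiv> bounded_kernel.I (q n) F cs"

lemma kp: "0 < \<kappa>" "0 < R" "F \<in> L2ball R" "cs \<in> borel_measurable borel" "0 \<le> cs x" "cs x \<le> M"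
  using bounded_kernel.\<kappa>[OF bk[of 0]] bounded_kernel.R[OF bk[of 0]] bounded_kernel.F_L2[OF bk[of 0]]
    bounded_kernel.cs_meas[OF bk[of 0]] bounded_kernel.cs_nonneg[OF bk[of 0]] bounded_kernel.cs_le[OF bk[of 0]] by auto

lemma q_meas [measurable]: "q n \<in> borel_measurable borel"
  by (rule bounded_kernel.q_meas[OF bk])

lemma cs_meas [measurable]: "cs \<in> borel_measurable borel" by (rule kp)

lemma cs_abs: "\<bar>cs x\<bar> \<le> M" using kp(5,6)[of x] by simp

lemma kenergy_mono: "n \<le> m \<Longrightarrow> kenergy (\<lambda>x y. q n (x - y)) z \<le> kenergy (\<lambda>x y. q m (x - y)) z"
  unfolding kenergy_def by (intro nn_integral_mono ennreal_leI mult_right_mono q_mono) auto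

lemma kenergy_le: "kenergy (\<lambda>x y. q n (x - y)) z \<le> kenergy (\<lambda>x y. qs (x - y)) z"
  unfolding kenergy_def
proof (intro nn_integral_mono ennreal_leI)
  fix x y
  show "q n (x - y) * (z x - z y)\<^sup>2 \<le> qs (x - y) * (z x - z y)\<^sup>2"
    using q_le[of "x - y" n] by (cases "x = y") (auto intro: mult_right_mono)
qed

lemma I_mono:
  assumes z: "z \<in> L2ball R" and "n \<le> m" shows "I n z \<le> I m z"
proof -
  have "ennreal (4 * (I n z + (LINT x|lborel. F x * z x)) - 2 * (LINT x|lborel. cs x * (z x * z x)))
    \<le> ennreal (4 * (I m z + (LINT x|lborel. F x * z x)) - 2 * (LINT x|lborel. cs x * (z x * z x)))"
    using kenergy_mono[OF \<open>n \<le> m\<close>, of z] by (simp only: bounded_kernel.I_energy(1)[OF bk z])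
  then show ?thesis using bounded_kernel.I_energy(2)[OF bk z, of m] by (subst (asm) ennreal_le_iff) auto
qed

definition Ev :: real where "Ev = enn2real (kenergy (\<lambda>x y. qs (x - y)) v)"

lemma Ev: "kenergy (\<lambda>x y. qs (x - y)) v = ennreal Ev" "0 \<le> Ev"
  using v_fin by (auto simp: Ev_def)

lemma pair_integral_energy:
  assumes z: "z \<in> L2ball R" and fin: "kenergy (\<lambda>x y. qs (x - y)) z < \<infinity>"
  shows "kenergy (\<lambda>x y. qs (x - y)) z = ennreal (LINT p|(lborel \<Otimes>\<^sub>M lborel). qs (fst p - snd p) * (z (fst p) - z (snd p))\<^sup>2)"
    "integrable (lborel \<Otimes>\<^sub>M lborel) (\<lambda>p. qs (fst p - snd p) * (z (fst p) - z (snd p))\<^sup>2)"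
proof -
  have [measurable]: "z \<in> borel_measurable borel" using L2ballD(1)[OF z] .
  have m: "(\<lambda>p. qs (fst p - snd p)) \<in> borel_measurable (borel \<Otimes>\<^sub>M borel)" by measurable
  show i: "integrable (lborel \<Otimes>\<^sub>M lborel) (\<lambda>p. qs (fst p - snd p) * (z (fst p) - z (snd p))\<^sup>2)"
    using kenergy_integrable[of "\<lambda>x y. qs (x - y)" z] m fin qs_nonneg by simp
  show "kenergy (\<lambda>x y. qs (x - y)) z = ennreal (LINT p|(lborel \<Otimes>\<^sub>M lborel). qs (fst p - snd p) * (z (fst p) - z (snd p))\<^sup>2)"
    using kenergy_pair[of "\<lambda>x y. qs (x - y)" z] m nn_integral_eq_integral[OF i] qs_nonneg by simp
qed

lemma v_test_v: "Ev / 2 + (LINT x|lborel. cs x * (v x * v x)) = (LINT x|lborel. F x * v x)"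
proof -
  have "0 \<le> (LINT p|(lborel \<Otimes>\<^sub>M lborel). qs (fst p - snd p) * (v (fst p) - v (snd p))\<^sup>2)"
    using qs_nonneg by (intro integral_nonneg_AE) simp
  then have "Ev = (LINT p|(lborel \<Otimes>\<^sub>M lborel). qs (fst p - snd p) * (v (fst p) - v (snd p))\<^sup>2)"
    using pair_integral_energy(1)[OF v v_fin] Ev by simp
  then show ?thesis using v_weak[OF v v_fin] by (simp add: power2_eq_square)
qed

lemma I_v: "I n v \<le> - (LINT x|lborel. F x * v x) / 2"
proof -
  have "ennreal (4 * (I n v + (LINT x|lborel. F x * v x)) - 2 * (LINT x|lborel. cs x * (v x * v x))) \<le> ennreal Ev"
    using kenergy_le[of n v] by (simp only: bounded_kernel.I_energy(1)[OF bk v] Ev(1))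
  then have "4 * (I n v + (LINT x|lborel. F x * v x)) - 2 * (LINT x|lborel. cs x * (v x * v x)) \<le> Ev"
    using Ev(2) by (subst (asm) ennreal_le_iff) auto
  then show ?thesis using v_test_v by simp
qed

lemma minimising_sequence:
  obtains W where "\<forall>n. W n \<in> L2ball R \<and> rdec (W n) \<and> conc_le (\<lambda>x. ennreal (U x)) (\<lambda>x. ennreal (W n x))
    \<and> (\<forall>z\<in>L2ball R. I n (W n) \<le> I n z + 1 / real (Suc n))"
proof -
  have "\<exists>w. w \<in> L2ball R \<and> rdec w \<and> conc_le (\<lambda>x. ennreal (U x)) (\<lambda>x. ennreal (w x))
    \<and> (\<forall>z\<in>L2ball R. I n w \<le> I n z + 1 / real (Suc n))" for n
    by (rule bounded_kernel.almost_minimiser[OF bk U D, of "1 / real (Suc n)" n]) auto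
  then obtain W where "\<forall>n. W n \<in> L2ball R \<and> rdec (W n) \<and> conc_le (\<lambda>x. ennreal (U x)) (\<lambda>x. ennreal (W n x))
    \<and> (\<forall>z\<in>L2ball R. I n (W n) \<le> I n z + 1 / real (Suc n))" by metis
  then show ?thesis by (rule that)
qed

context
  fixes W :: "nat \<Rightarrow> 'a \<Rightarrow> real"
  assumes W: "\<And>n. W n \<in> L2ball R" and W_rdec: "\<And>n. rdec (W n)"
    and UW: "\<And>n. conc_le (\<lambda>x. ennreal (U x)) (\<lambda>x. ennreal (W n x))"
    and W_min: "\<And>n z. z \<in> L2ball R \<Longrightarrow> I n (W n) \<le> I n z + 1 / real (Suc n)"
begin

lemma values_cauchy: "Cauchy (\<lambda>n. I n (W n))"
proof -
  define m where "m n = Inf (I n ` L2ball R)" for n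
  have ne: "L2ball R \<noteq> ({} :: ('a \<Rightarrow> real) set)" using v by auto
  have bdd: "bdd_below (I n ` L2ball R)" for n
    using bounded_kernel.I_lower[OF bk] by (auto intro!: bdd_belowI2)
  have m_le: "m n \<le> I n (W n)" for n
    unfolding m_def using W bdd by (intro cInf_lower) auto
  have le_m: "I n (W n) - 1 / real (Suc n) \<le> m n" for n
    unfolding m_def using ne W_min[of _ n] by (intro cInf_greatest) (auto simp: algebra_simps)
  have "incseq m"
  proof (rule incseq_SucI)
    fix n
    show "m n \<le> m (Suc n)"
      unfolding m_def[of "Suc n"]
    proof (rule cInf_greatest)
      fix y assume "y \<in> I (Suc n) ` L2ball R"
      then obtain z where z: "z \<in> L2ball R" "y = I (Suc n) z" by blast
      have "m n \<le> I n z" unfolding m_def using z bdd by (intro cInf_lower) auto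
      then show "m n \<le> y" using I_mono[OF z(1), of n "Suc n"] z by simp
    qed (use ne in simp)
  qed
  moreover have "m n \<le> - (LINT x|lborel. F x * v x) / 2" for n
  proof -
    have "m n \<le> I n v" unfolding m_def using v bdd by (intro cInf_lower) auto
    then show ?thesis using I_v[of n] by simp
  qed
  ultimately obtain L where L: "m \<longlonglongrightarrow> L" using incseq_convergent by blast
  have "(\<lambda>n. 1 / real (Suc n)) \<longlonglongrightarrow> 0" by (rule lim_1_over_n[THEN LIMSEQ_Suc])
  then have "(\<lambda>n. m n + 1 / real (Suc n)) \<longlonglongrightarrow> L + 0" by (intro tendsto_add L)
  then have up: "(\<lambda>n. m n + 1 / real (Suc n)) \<longlonglongrightarrow> L" by simp
  have "(\<lambda>n. I n (W n)) \<longlonglongrightarrow> L"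
  proof (rule tendsto_sandwich[OF _ _ L])
    show "eventually (\<lambda>n. m n \<le> I n (W n)) sequentially" using m_le by (intro always_eventually allI)
    show "eventually (\<lambda>n. I n (W n) \<le> m n + 1 / real (Suc n)) sequentially"
      using le_m unfolding diff_le_eq by (intro always_eventually allI)
  qed (rule up)
  then show ?thesis by (rule LIMSEQ_imp_Cauchy)
qed

lemma L2_cauchy:
  assumes "0 < \<epsilon>"
  obtains N where "\<And>n m. N \<le> n \<Longrightarrow> N \<le> m \<Longrightarrow> (LINT x|lborel. (W n x - W m x)\<^sup>2) < \<epsilon>"
proof -
  have step: "\<kappa> / 8 * (LINT x|lborel. (W n x - W m x)\<^sup>2) \<le> (I m (W m) - I n (W n)) / 2 + 1 / real (Suc n)" if "n \<le> m" for n m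
  proof -
    obtain p where p: "p \<in> L2ball R" "\<kappa> / 8 * (LINT t|lborel. (W n t - W m t)\<^sup>2) \<le> (I n (W n) + I n (W m)) / 2 - I n p"
      using bounded_kernel.I_midpoint[OF bk[of n] W[of n] W[of m]] .
    then show ?thesis using W_min[OF p(1), of n] I_mono[OF W[of m] that] by argo
  qed
  define e where "e = \<kappa> * \<epsilon> / 16"
  have e: "0 < e" using assms kp(1) by (simp add: e_def)
  obtain N1 where N1: "\<And>n m. N1 \<le> n \<Longrightarrow> N1 \<le> m \<Longrightarrow> \<bar>I m (W m) - I n (W n)\<bar> < e"
    using values_cauchy e unfolding Cauchy_def dist_real_def by metis
  obtain N2 where N2: "1 / e \<le> real N2" using real_arch_simple by blast
  have inv: "1 / real (Suc n) < e" if "N2 \<le> n" for n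
  proof -
    have "1 / e < real (Suc n)" using N2 that by linarith
    then show ?thesis using e by (simp add: field_simps)
  qed
  have ord: "(LINT x|lborel. (W n x - W m x)\<^sup>2) < \<epsilon>" if "max N1 N2 \<le> n" "n \<le> m" for n m
  proof -
    have "\<bar>I m (W m) - I n (W n)\<bar> < e" using N1[of n m] that by simp
    moreover have "1 / real (Suc n) < e" using inv[of n] that by simp
    moreover have "D \<le> (a - b) / 2 + c \<Longrightarrow> \<bar>a - b\<bar> < e \<Longrightarrow> c < e \<Longrightarrow> D < e + e" for D a b c :: real
      using e by (simp add: field_simps abs_less_iff)
    ultimately have "\<kappa> / 8 * (LINT x|lborel. (W n x - W m x)\<^sup>2) < e + e"
      using step[OF that(2)] by blast
    then have "\<kappa> / 8 * (LINT x|lborel. (W n x - W m x)\<^sup>2) < \<kappa> / 8 * \<epsilon>"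
      by (simp add: e_def mult.commute)
    then show ?thesis using kp(1) by simp
  qed
  show thesis
  proof (rule that[of "max N1 N2"])
    fix n m assume "max N1 N2 \<le> n" "max N1 N2 \<le> m"
    then show "(LINT x|lborel. (W n x - W m x)\<^sup>2) < \<epsilon>"
      using ord[of n m] ord[of m n] by (cases "n \<le> m") (simp_all add: power2_commute)
  qed
qed

lemma AE_limit:
  obtains r w where "strict_mono r" "w \<in> borel_measurable borel" "\<forall>x. x \<notin> ball 0 R \<longrightarrow> w x = 0"
    "AE x in lborel. (\<lambda>i. W (r i) x) \<longlonglongrightarrow> w x"
proof -
  have Wm[measurable]: "W n \<in> borel_measurable borel" for n using L2ballD(1)[OF W] .
  define V where "V = (LINT x|lborel. (indicator (ball (0::'a) R) x :: real)\<^sup>2)"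
  have V0: "0 \<le> V" unfolding V_def by (intro integral_nonneg_AE) simp
  have L1: "(LINT x|lborel. norm (W n x - W m x)) \<le> sqrt V * sqrt (LINT x|lborel. (W n x - W m x)\<^sup>2)" for n m
  proof -
    have d: "(\<lambda>x. \<bar>W n x - W m x\<bar>) \<in> L2ball R"
      by (rule L2ball_dominated[OF L2ball_diff[OF W W]]) auto
    have "(LINT x|lborel. norm (W n x - W m x)) = (LINT x|lborel. 1 * (indicator (ball 0 R) x * \<bar>W n x - W m x\<bar>))"
      by (intro Bochner_Integration.integral_cong) (use L2ballD(2)[OF W] in \<open>auto simp: indicator_def\<close>)
    also have "\<dots> \<le> 1 * (sqrt V * sqrt (LINT x|lborel. \<bar>W n x - W m x\<bar>\<^sup>2))"
      using L2ball_cauchy_schwarz[OF L2ball_indicator d, of "\<lambda>_. 1" 1] by (simp add: V_def)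
    finally show ?thesis by simp
  qed
  have cau: "\<exists>N. \<forall>i\<ge>N. \<forall>j\<ge>N. (LINT x|lborel. norm (W i x - W j x)) < \<epsilon>" if \<epsilon>: "0 < \<epsilon>" for \<epsilon>
  proof -
    define \<delta> where "\<delta> = (\<epsilon> / (sqrt V + 1))\<^sup>2"
    have p: "0 < sqrt V + 1" using V0 by (simp add: add_nonneg_pos)
    then have "0 < \<delta>" using \<epsilon> by (simp add: \<delta>_def)
    then obtain N where N: "\<And>n m. N \<le> n \<Longrightarrow> N \<le> m \<Longrightarrow> (LINT x|lborel. (W n x - W m x)\<^sup>2) < \<delta>"
      using L2_cauchy by blast
    have "(LINT x|lborel. norm (W i x - W j x)) < \<epsilon>" if "N \<le> i" "N \<le> j" for i j
    proof -
      have "sqrt (LINT x|lborel. (W i x - W j x)\<^sup>2) < sqrt \<delta>" using N[OF that] by simp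
      also have "sqrt \<delta> = \<epsilon> / (sqrt V + 1)" using \<epsilon> p by (simp add: \<delta>_def)
      finally have s: "sqrt (LINT x|lborel. (W i x - W j x)\<^sup>2) < \<epsilon> / (sqrt V + 1)" .
      have s0: "0 \<le> sqrt (LINT x|lborel. (W i x - W j x)\<^sup>2)" by (simp add: integral_nonneg_AE)
      have "sqrt V * sqrt (LINT x|lborel. (W i x - W j x)\<^sup>2) \<le> (sqrt V + 1) * sqrt (LINT x|lborel. (W i x - W j x)\<^sup>2)"
        using s0 by (intro mult_right_mono) auto
      also have "\<dots> < (sqrt V + 1) * (\<epsilon> / (sqrt V + 1))" using s p by (intro mult_strict_left_mono)
      also have "\<dots> = \<epsilon>" using p by simp
      finally show ?thesis using L1[of i j] by simp
    qed
    then show ?thesis by blast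
  qed
  obtain r where r: "strict_mono r" "AE x in lborel. Cauchy (\<lambda>i. W (r i) x)"
    using cauchy_L1_AE_cauchy_subseq[of lborel W, OF L2ball_integrable[OF W] cau] by blast
  define w where "w x = indicator (ball 0 R) x * lim (\<lambda>i. W (r i) x)" for x
  show thesis
  proof (rule that[OF r(1)])
    show "w \<in> borel_measurable borel" unfolding w_def by measurable
    show "\<forall>x. x \<notin> ball 0 R \<longrightarrow> w x = 0" by (simp add: w_def)
    show "AE x in lborel. (\<lambda>i. W (r i) x) \<longlonglongrightarrow> w x"
      using r(2)
    proof eventually_elim
      case (elim x)
      then have c: "(\<lambda>i. W (r i) x) \<longlonglongrightarrow> lim (\<lambda>i. W (r i) x)"
        using Cauchy_convergent convergent_LIMSEQ_iff by blast
      show ?case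
      proof (cases "x \<in> ball 0 R")
        case False
        then have "W (r i) x = 0" for i using L2ballD(2)[OF W] by blast
        then show ?thesis using False by (simp add: w_def)
      qed (use c in \<open>simp add: w_def\<close>)
    qed
  qed
qed

lemma L2_limit:
  assumes r: "strict_mono r" and w[measurable]: "w \<in> borel_measurable borel" and out: "\<And>x. x \<notin> ball 0 R \<Longrightarrow> w x = 0"
    and lim: "AE x in lborel. (\<lambda>i. W (r i) x) \<longlonglongrightarrow> w x"
  shows "w \<in> L2ball R" "(\<lambda>n. LINT x|lborel. (W n x - w x)\<^sup>2) \<longlonglongrightarrow> 0"
proof -
  have Wm[measurable]: "W n \<in> borel_measurable borel" for n using L2ballD(1)[OF W] .
  have fatou: "(\<integral>\<^sup>+x. ennreal ((W n x - w x)\<^sup>2) \<partial>lborel) \<le> ennreal \<epsilon>"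
    if "0 < \<epsilon>" "\<And>n m. N \<le> n \<Longrightarrow> N \<le> m \<Longrightarrow> (LINT x|lborel. (W n x - W m x)\<^sup>2) < \<epsilon>" "N \<le> n" for n N \<epsilon>
  proof -
    have "(\<integral>\<^sup>+x. ennreal ((W n x - w x)\<^sup>2) \<partial>lborel) = (\<integral>\<^sup>+x. liminf (\<lambda>i. ennreal ((W n x - W (r i) x)\<^sup>2)) \<partial>lborel)"
    proof (rule nn_integral_cong_AE)
      show "AE x in lborel. ennreal ((W n x - w x)\<^sup>2) = liminf (\<lambda>i. ennreal ((W n x - W (r i) x)\<^sup>2))"
        using lim
      proof eventually_elim
        case (elim x)
        have "(\<lambda>i. ennreal ((W n x - W (r i) x)\<^sup>2)) \<longlonglongrightarrow> ennreal ((W n x - w x)\<^sup>2)"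
          by (intro tendsto_ennrealI tendsto_intros elim)
        then show ?case by (intro lim_imp_Liminf[symmetric]) auto
      qed
    qed
    also have "\<dots> \<le> liminf (\<lambda>i. \<integral>\<^sup>+x. ennreal ((W n x - W (r i) x)\<^sup>2) \<partial>lborel)"
      by (rule nn_integral_liminf) measurable
    also have "\<dots> \<le> limsup (\<lambda>i. \<integral>\<^sup>+x. ennreal ((W n x - W (r i) x)\<^sup>2) \<partial>lborel)"
      by (rule Liminf_le_Limsup) simp
    also have "\<dots> \<le> ennreal \<epsilon>"
    proof (rule Limsup_bounded)
      show "\<forall>\<^sub>F i in sequentially. (\<integral>\<^sup>+x. ennreal ((W n x - W (r i) x)\<^sup>2) \<partial>lborel) \<le> ennreal \<epsilon>"
        unfolding eventually_sequentially
      proof (intro exI[of _ N] allI impI)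
        fix i assume "N \<le> i"
        then have "N \<le> r i" using seq_suble[OF r, of i] by simp
        then have "(LINT x|lborel. (W n x - W (r i) x)\<^sup>2) < \<epsilon>" using that by blast
        moreover have "(\<integral>\<^sup>+x. ennreal ((W n x - W (r i) x)\<^sup>2) \<partial>lborel) = ennreal (LINT x|lborel. (W n x - W (r i) x)\<^sup>2)"
          by (rule nn_integral_eq_integral[OF L2ballD(3)[OF L2ball_diff[OF W W]]]) simp
        ultimately show "(\<integral>\<^sup>+x. ennreal ((W n x - W (r i) x)\<^sup>2) \<partial>lborel) \<le> ennreal \<epsilon>"
          by (simp add: ennreal_leI)
      qed
    qed
    finally show ?thesis .
  qed
  have dL: "(\<lambda>x. W n x - w x) \<in> L2ball R"
    if "0 < \<epsilon>" "\<And>n m. N \<le> n \<Longrightarrow> N \<le> m \<Longrightarrow> (LINT x|lborel. (W n x - W m x)\<^sup>2) < \<epsilon>" "N \<le> n" for n N \<epsilon>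
  proof -
    have "integrable lborel (\<lambda>x. (W n x - w x)\<^sup>2)"
      using fatou[OF that] by (intro integrableI_nonneg) (auto simp: le_less_trans)
    moreover have "W n x - w x = 0" if "x \<notin> ball 0 R" for x using L2ballD(2)[OF W that] out[OF that] by simp
    ultimately show ?thesis by (simp add: L2ball_def)
  qed
  show wL: "w \<in> L2ball R"
  proof -
    obtain N where N: "\<And>n m. N \<le> n \<Longrightarrow> N \<le> m \<Longrightarrow> (LINT x|lborel. (W n x - W m x)\<^sup>2) < 1"
      using L2_cauchy[of 1] by auto
    have "(\<lambda>x. W N x - (W N x - w x)) \<in> L2ball R"
      by (rule L2ball_diff[OF W dL[OF _ N]]) auto
    then show ?thesis by simp
  qed
  show "(\<lambda>n. LINT x|lborel. (W n x - w x)\<^sup>2) \<longlonglongrightarrow> 0"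
  proof (rule LIMSEQ_I)
    fix \<epsilon> :: real assume \<epsilon>: "0 < \<epsilon>"
    then obtain N where N: "\<And>n m. N \<le> n \<Longrightarrow> N \<le> m \<Longrightarrow> (LINT x|lborel. (W n x - W m x)\<^sup>2) < \<epsilon> / 2"
      using L2_cauchy[of "\<epsilon>/2"] by auto
    have "norm ((LINT x|lborel. (W n x - w x)\<^sup>2) - 0) < \<epsilon>" if "N \<le> n" for n
    proof -
      have "ennreal (LINT x|lborel. (W n x - w x)\<^sup>2) \<le> ennreal (\<epsilon> / 2)"
        using fatou[OF _ N that] \<epsilon> nn_integral_eq_integral[OF L2ballD(3)[OF L2ball_diff[OF W wL]], of n] by simp
      then have "(LINT x|lborel. (W n x - w x)\<^sup>2) \<le> \<epsilon> / 2" using \<epsilon> by (subst (asm) ennreal_le_iff) auto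
      moreover have "0 \<le> (LINT x|lborel. (W n x - w x)\<^sup>2)" by (intro integral_nonneg_AE) simp
      ultimately show ?thesis using \<epsilon> by simp
    qed
    then show "\<exists>no. \<forall>n\<ge>no. norm ((LINT x|lborel. (W n x - w x)\<^sup>2) - 0) < \<epsilon>" by blast
  qed
qed

lemma limit_energy:
  assumes r: "strict_mono r" and w: "w \<in> L2ball R"
    and lim: "AE x in lborel. (\<lambda>i. W (r i) x) \<longlonglongrightarrow> w x"
    and L2: "(\<lambda>n. LINT x|lborel. (W n x - w x)\<^sup>2) \<longlonglongrightarrow> 0"
  shows "kenergy (\<lambda>x y. qs (x - y)) w
    \<le> ennreal (4 * (LINT x|lborel. F x * w x) - 2 * (LINT x|lborel. F x * v x) - 2 * (LINT x|lborel. cs x * (w x * w x)))"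
    "2 * (LINT x|lborel. cs x * (w x * w x)) \<le> 4 * (LINT x|lborel. F x * w x) - 2 * (LINT x|lborel. F x * v x)"
proof -
  have [measurable]: "W n \<in> borel_measurable borel" "w \<in> borel_measurable borel" for n
    using L2ballD(1)[OF W] L2ballD(1)[OF w] by auto
  have L2r: "(\<lambda>i. LINT x|lborel. (W (r i) x - w x)\<^sup>2) \<longlonglongrightarrow> 0"
    using LIMSEQ_subseq_LIMSEQ[OF L2 r] by (simp add: o_def)
  have qlim: "(\<lambda>i. q (r i) z) \<longlonglongrightarrow> qs z" if "z \<noteq> 0" for z
    using LIMSEQ_subseq_LIMSEQ[OF q_lim[OF that] r] by (simp add: o_def)
  have I_le: "I (r i) (W (r i)) \<le> - (LINT x|lborel. F x * v x) / 2 + 1 / real (Suc (r i))" for i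
    using W_min[OF v, of "r i"] I_v[of "r i"] by linarith
  have inv: "(\<lambda>i. 1 / real (Suc (r i))) \<longlonglongrightarrow> 0"
    using LIMSEQ_subseq_LIMSEQ[OF lim_1_over_n[THEN LIMSEQ_Suc] r] by (simp add: o_def)
  have Flim: "(\<lambda>i. LINT x|lborel. F x * W (r i) x) \<longlonglongrightarrow> (LINT x|lborel. F x * w x)"
    using L2ball_tendsto[of "\<lambda>i. W (r i)" R w F "\<lambda>_. 1" 1, OF W w kp(3) L2r] by simp
  have clim: "(\<lambda>i. LINT x|lborel. cs x * (W (r i) x * W (r i) x)) \<longlonglongrightarrow> (LINT x|lborel. cs x * (w x * w x))"
    by (rule L2ball_tendsto_sq[OF W w L2r cs_meas cs_abs])
  have "2 * (LINT x|lborel. cs x * (w x * w x)) \<le> 4 * (- (LINT x|lborel. F x * v x) / 2 + 0 + (LINT x|lborel. F x * w x))"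
  proof (rule LIMSEQ_le)
    show "(\<lambda>i. 2 * (LINT x|lborel. cs x * (W (r i) x * W (r i) x))) \<longlonglongrightarrow> 2 * (LINT x|lborel. cs x * (w x * w x))"
      by (intro tendsto_intros clim)
    show "(\<lambda>i. 4 * (- (LINT x|lborel. F x * v x) / 2 + 1 / real (Suc (r i)) + (LINT x|lborel. F x * W (r i) x)))
      \<longlonglongrightarrow> 4 * (- (LINT x|lborel. F x * v x) / 2 + 0 + (LINT x|lborel. F x * w x))"
      by (intro tendsto_intros inv Flim)
    show "\<exists>N. \<forall>i\<ge>N. 2 * (LINT x|lborel. cs x * (W (r i) x * W (r i) x))
      \<le> 4 * (- (LINT x|lborel. F x * v x) / 2 + 1 / real (Suc (r i)) + (LINT x|lborel. F x * W (r i) x))"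
    proof (intro exI allI impI)
      fix i
      show "2 * (LINT x|lborel. cs x * (W (r i) x * W (r i) x))
        \<le> 4 * (- (LINT x|lborel. F x * v x) / 2 + 1 / real (Suc (r i)) + (LINT x|lborel. F x * W (r i) x))"
        using bounded_kernel.I_energy(2)[OF bk W, of "r i" "r i"]
      proof (rule order_trans)
        show "4 * (I (r i) (W (r i)) + (LINT x|lborel. F x * W (r i) x))
          \<le> 4 * (- (LINT x|lborel. F x * v x) / 2 + 1 / real (Suc (r i)) + (LINT x|lborel. F x * W (r i) x))"
          by (intro mult_left_mono add_right_mono I_le) simp
      qed
    qed
  qed
  then show "2 * (LINT x|lborel. cs x * (w x * w x)) \<le> 4 * (LINT x|lborel. F x * w x) - 2 * (LINT x|lborel. F x * v x)"
    by simp
  have "kenergy (\<lambda>x y. qs (x - y)) w \<le> (\<integral>\<^sup>+x. liminf (\<lambda>i. \<integral>\<^sup>+y. ennreal (q (r i) (x - y) * (W (r i) x - W (r i) y)\<^sup>2) \<partial>lborel) \<partial>lborel)"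
    unfolding kenergy_def
  proof (rule nn_integral_mono_AE)
    show "AE x in lborel. (\<integral>\<^sup>+y. ennreal (qs (x - y) * (w x - w y)\<^sup>2) \<partial>lborel)
      \<le> liminf (\<lambda>i. \<integral>\<^sup>+y. ennreal (q (r i) (x - y) * (W (r i) x - W (r i) y)\<^sup>2) \<partial>lborel)"
      using lim
    proof eventually_elim
      case (elim x)
      note ex = elim
      have "(\<integral>\<^sup>+y. ennreal (qs (x - y) * (w x - w y)\<^sup>2) \<partial>lborel)
        = (\<integral>\<^sup>+y. liminf (\<lambda>i. ennreal (q (r i) (x - y) * (W (r i) x - W (r i) y)\<^sup>2)) \<partial>lborel)"
      proof (rule nn_integral_cong_AE)
        show "AE y in lborel. ennreal (qs (x - y) * (w x - w y)\<^sup>2)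
          = liminf (\<lambda>i. ennreal (q (r i) (x - y) * (W (r i) x - W (r i) y)\<^sup>2))"
          using lim AE_lborel_singleton[of x]
        proof eventually_elim
          case (elim y)
          have "(\<lambda>i. ennreal (q (r i) (x - y) * (W (r i) x - W (r i) y)\<^sup>2)) \<longlonglongrightarrow> ennreal (qs (x - y) * (w x - w y)\<^sup>2)"
            using elim by (intro tendsto_ennrealI tendsto_intros ex qlim) auto
          then show ?case by (intro lim_imp_Liminf[symmetric]) auto
        qed
      qed
      also have "\<dots> \<le> liminf (\<lambda>i. \<integral>\<^sup>+y. ennreal (q (r i) (x - y) * (W (r i) x - W (r i) y)\<^sup>2) \<partial>lborel)"
        by (rule nn_integral_liminf) measurable
      finally show ?case .
    qed
  qed
  also have "\<dots> \<le> liminf (\<lambda>i. kenergy (\<lambda>x y. q (r i) (x - y)) (W (r i)))"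
    unfolding kenergy_def by (rule nn_integral_liminf) measurable
  also have "\<dots> \<le> liminf (\<lambda>i. ennreal (4 * (- (LINT x|lborel. F x * v x) / 2 + 1 / real (Suc (r i)) + (LINT x|lborel. F x * W (r i) x))
      - 2 * (LINT x|lborel. cs x * (W (r i) x * W (r i) x))))"
  proof (intro Liminf_mono always_eventually allI)
    fix i
    from I_le[of i] show "kenergy (\<lambda>x y. q (r i) (x - y)) (W (r i))
      \<le> ennreal (4 * (- (LINT x|lborel. F x * v x) / 2 + 1 / real (Suc (r i)) + (LINT x|lborel. F x * W (r i) x))
      - 2 * (LINT x|lborel. cs x * (W (r i) x * W (r i) x)))"
      unfolding bounded_kernel.I_energy(1)[OF bk W]
      by (intro ennreal_leI diff_right_mono mult_left_mono add_right_mono) simp_all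
  qed
  also have "\<dots> = ennreal (4 * (- (LINT x|lborel. F x * v x) / 2 + 0 + (LINT x|lborel. F x * w x))
      - 2 * (LINT x|lborel. cs x * (w x * w x)))"
    by (intro lim_imp_Liminf tendsto_ennrealI tendsto_intros inv Flim clim) simp
  finally show "kenergy (\<lambda>x y. qs (x - y)) w
    \<le> ennreal (4 * (LINT x|lborel. F x * w x) - 2 * (LINT x|lborel. F x * v x) - 2 * (LINT x|lborel. cs x * (w x * w x)))"
    by (simp add: algebra_simps)
qed

lemma limit_eq_v:
  assumes w: "w \<in> L2ball R"
    and en: "kenergy (\<lambda>x y. qs (x - y)) w
    \<le> ennreal (4 * (LINT x|lborel. F x * w x) - 2 * (LINT x|lborel. F x * v x) - 2 * (LINT x|lborel. cs x * (w x * w x)))"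
    and nn: "2 * (LINT x|lborel. cs x * (w x * w x)) \<le> 4 * (LINT x|lborel. F x * w x) - 2 * (LINT x|lborel. F x * v x)"
  shows "AE x in lborel. w x = v x"
proof -
  let ?k = "\<lambda>x y. qs (x - y)"
  have [measurable]: "v \<in> borel_measurable borel" "w \<in> borel_measurable borel"
    using L2ballD(1)[OF v] L2ballD(1)[OF w] by auto
  have km: "(\<lambda>p. qs (fst p - snd p)) \<in> borel_measurable (borel \<Otimes>\<^sub>M borel)" by measurable
  have w_fin: "kenergy ?k w < \<infinity>" using en by (rule le_less_trans) simp
  define ew where "ew = (LINT p|(lborel \<Otimes>\<^sub>M lborel). qs (fst p - snd p) * (w (fst p) - w (snd p))\<^sup>2)"
  define evv where "evv = (LINT p|(lborel \<Otimes>\<^sub>M lborel). qs (fst p - snd p) * (v (fst p) - v (snd p))\<^sup>2)"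
  define evw where "evw = (LINT p|(lborel \<Otimes>\<^sub>M lborel). qs (fst p - snd p) * ((v (fst p) - v (snd p)) * (w (fst p) - w (snd p))))"
  note iw = pair_integral_energy[OF w w_fin] note iv = pair_integral_energy[OF v v_fin]
  have ivw: "integrable (lborel \<Otimes>\<^sub>M lborel) (\<lambda>p. qs (fst p - snd p) * ((v (fst p) - v (snd p)) * (w (fst p) - w (snd p))))"
    using kenergy_bilinear_integrable[of ?k v w] km qs_nonneg v_fin w_fin by simp
  have ew_le: "ew \<le> 4 * (LINT x|lborel. F x * w x) - 2 * (LINT x|lborel. F x * v x) - 2 * (LINT x|lborel. cs x * (w x * w x))"
    using en nn unfolding iw(1) ew_def[symmetric] by (subst (asm) ennreal_le_iff) auto
  define d where "d x = w x - v x" for x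
  have d: "d \<in> L2ball R" unfolding d_def by (rule L2ball_diff[OF w v])
  have [measurable]: "d \<in> borel_measurable borel" using L2ballD(1)[OF d] .
  have split: "qs (fst p - snd p) * (d (fst p) - d (snd p))\<^sup>2 = qs (fst p - snd p) * (w (fst p) - w (snd p))\<^sup>2
    - 2 * (qs (fst p - snd p) * ((v (fst p) - v (snd p)) * (w (fst p) - w (snd p)))) + qs (fst p - snd p) * (v (fst p) - v (snd p))\<^sup>2" for p
    by (simp add: d_def power2_eq_square algebra_simps)
  have id: "integrable (lborel \<Otimes>\<^sub>M lborel) (\<lambda>p. qs (fst p - snd p) * (d (fst p) - d (snd p))\<^sup>2)"
    unfolding split using iw(2) iv(2) ivw by simp
  have ed: "(LINT p|(lborel \<Otimes>\<^sub>M lborel). qs (fst p - snd p) * (d (fst p) - d (snd p))\<^sup>2) = ew - 2 * evw + evv"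
    unfolding split ew_def evv_def evw_def using iw(2) iv(2) ivw by simp
  have c: "integrable lborel (\<lambda>x. cs x * (a x * b x))" if "a \<in> L2ball R" "b \<in> L2ball R" for a b :: "'a \<Rightarrow> real"
    by (rule L2ball_weight[OF that cs_meas cs_abs])
  have cd0: "0 \<le> (LINT x|lborel. cs x * (d x * d x))" using kp(5) by (intro integral_nonneg_AE) simp
  have "(LINT x|lborel. cs x * (d x * d x)) = (LINT x|lborel. cs x * (w x * w x) - 2 * (cs x * (v x * w x)) + cs x * (v x * v x))"
    by (simp add: d_def algebra_simps)
  also have "\<dots> = (LINT x|lborel. cs x * (w x * w x)) - 2 * (LINT x|lborel. cs x * (v x * w x)) + (LINT x|lborel. cs x * (v x * v x))"
    using c[OF w w] c[OF v w] c[OF v v] by simp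
  finally have cd: "(LINT x|lborel. cs x * (d x * d x)) = \<dots>" .
  have "Ev = evv"
    using iv(1) Ev qs_nonneg unfolding evv_def by (auto simp: integral_nonneg_AE)
  then have tv: "evv / 2 + (LINT x|lborel. cs x * (v x * v x)) = (LINT x|lborel. F x * v x)" using v_test_v by simp
  have tw: "1 / 2 * evw + (LINT x|lborel. cs x * (v x * w x)) = (LINT x|lborel. F x * w x)"
    using v_weak[OF w w_fin] by (simp add: evw_def)
  have "(LINT p|(lborel \<Otimes>\<^sub>M lborel). qs (fst p - snd p) * (d (fst p) - d (snd p))\<^sup>2) \<le> 0"
    unfolding ed using ew_le cd cd0 tv tw by argo
  moreover have "kenergy ?k d = ennreal (LINT p|(lborel \<Otimes>\<^sub>M lborel). qs (fst p - snd p) * (d (fst p) - d (snd p))\<^sup>2)"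
    using kenergy_pair[of ?k d] km nn_integral_eq_integral[OF id] qs_nonneg by simp
  ultimately have "kenergy (\<lambda>x y. q 0 (x - y)) d \<le> 0"
    using kenergy_le[of 0 d] by (simp add: ennreal_neg)
  then have "ennreal (2 * \<kappa>) * (\<integral>\<^sup>+x. ennreal ((d x)\<^sup>2) \<partial>lborel) = 0"
    using bounded_kernel.poinc[OF bk d, of 0] unfolding kenergy_def by simp
  then have "AE x in lborel. d x = 0" using kp(1) by (simp add: nn_integral_0_iff_AE)
  then show ?thesis by eventually_elim (simp add: d_def)
qed

lemma limit_comparison: "AE x in lborel. 0 \<le> v x" "conc_le (\<lambda>x. ennreal (U x)) (\<lambda>x. ennreal (v x))"
proof -
  obtain r w where r: "strict_mono r" and w: "w \<in> borel_measurable borel" and w0: "\<forall>x. x \<notin> ball 0 R \<longrightarrow> w x = 0"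
    and lim: "AE x in lborel. (\<lambda>i. W (r i) x) \<longlonglongrightarrow> w x"
    using AE_limit .
  note L = L2_limit[OF r w w0[rule_format] lim]
  have wv: "AE x in lborel. w x = v x" by (rule limit_eq_v[OF L(1) limit_energy[OF r L(1) lim L(2)]])
  have Wv: "AE x in lborel. (\<lambda>i. W (r i) x) \<longlonglongrightarrow> v x"
    using lim wv by eventually_elim simp
  then show "AE x in lborel. 0 \<le> v x"
    by eventually_elim (rule LIMSEQ_le_const, auto intro: rdec_nonneg[OF W_rdec])
  have [measurable]: "v \<in> borel_measurable borel" "U \<in> borel_measurable borel" "W n \<in> borel_measurable borel" for n
    using L2ballD(1)[OF v] L2ballD(1)[OF U(1)] L2ballD(1)[OF W] by auto
  have L2v: "(\<lambda>n. LINT x|lborel. (W n x - v x)\<^sup>2) \<longlonglongrightarrow> 0"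
  proof -
    have "(LINT x|lborel. (W n x - v x)\<^sup>2) = (LINT x|lborel. (W n x - w x)\<^sup>2)" for n
    proof (rule integral_cong_AE)
      show "AE x in lborel. (W n x - v x)\<^sup>2 = (W n x - w x)\<^sup>2" using wv by eventually_elim simp
    qed (use w in measurable)
    then show ?thesis using L(2) by simp
  qed
  show "conc_le (\<lambda>x. ennreal (U x)) (\<lambda>x. ennreal (v x))"
    unfolding conc_le_def
  proof
    fix s
    define k where "k x = (indicator (ball 0 s) x :: real)" for x :: 'a
    have k: "k \<in> borel_measurable borel" "\<bar>k x\<bar> \<le> 1" for x unfolding k_def by (auto simp: indicator_def)
    have kk: "(\<integral>\<^sup>+x. ennreal (z x) * indicator (ball 0 s) x \<partial>lborel) = ennreal (LINT x|lborel. k x * (indicator (ball 0 R) x * z x))"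
      if z: "z \<in> L2ball R" "AE x in lborel. 0 \<le> z x" for z
    proof -
      have "(\<integral>\<^sup>+x. ennreal (z x) * indicator (ball 0 s) x \<partial>lborel) = (\<integral>\<^sup>+x. ennreal (k x * (indicator (ball 0 R) x * z x)) \<partial>lborel)"
        by (intro nn_integral_cong) (use L2ballD(2)[OF z(1)] in \<open>auto simp: k_def indicator_def\<close>)
      also have "\<dots> = ennreal (LINT x|lborel. k x * (indicator (ball 0 R) x * z x))"
      proof (rule nn_integral_eq_integral[OF L2ball_weight[OF L2ball_indicator z(1) k]])
        show "AE x in lborel. 0 \<le> k x * (indicator (ball 0 R) x * z x)"
          using z(2) by eventually_elim (simp add: k_def)
      qed
      finally show ?thesis .
    qed
    have vs: "AE x in lborel. 0 \<le> v x" by fact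
    have "ennreal (LINT x|lborel. k x * (indicator (ball 0 R) x * U x)) \<le> ennreal (LINT x|lborel. k x * (indicator (ball 0 R) x * W n x))" for n
      using UW[of n] kk[OF U(1)] kk[OF W[of n]] rdec_nonneg[OF U(2)] rdec_nonneg[OF W_rdec[of n]]
      unfolding conc_le_def by (metis (no_types, lifting) AE_I2)
    moreover have "0 \<le> (LINT x|lborel. k x * (indicator (ball 0 R) x * W n x))" for n
      using rdec_nonneg[OF W_rdec[of n]] by (intro integral_nonneg_AE) (simp add: k_def)
    ultimately have "(LINT x|lborel. k x * (indicator (ball 0 R) x * U x)) \<le> (LINT x|lborel. k x * (indicator (ball 0 R) x * W n x))" for n
      by (simp add: ennreal_le_iff)
    moreover have "(\<lambda>n. LINT x|lborel. k x * (indicator (ball 0 R) x * W n x)) \<longlonglongrightarrow> (LINT x|lborel. k x * (indicator (ball 0 R) x * v x))"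
      by (rule L2ball_tendsto[OF W v L2ball_indicator L2v k])
    ultimately have "(LINT x|lborel. k x * (indicator (ball 0 R) x * U x)) \<le> (LINT x|lborel. k x * (indicator (ball 0 R) x * v x))"
      by (intro LIMSEQ_le_const) auto
    then show "(\<integral>\<^sup>+x. ennreal (U x) * indicator (ball 0 s) x \<partial>lborel) \<le> (\<integral>\<^sup>+x. ennreal (v x) * indicator (ball 0 s) x \<partial>lborel)"
      using kk[OF U(1)] kk[OF v vs] rdec_nonneg[OF U(2)] by (simp add: ennreal_leI)
  qed
qed

end

lemma comparison: "AE x in lborel. 0 \<le> v x" "conc_le (\<lambda>x. ennreal (U x)) (\<lambda>x. ennreal (v x))"
proof -
  obtain W where W: "\<forall>n. W n \<in> L2ball R \<and> rdec (W n) \<and> conc_le (\<lambda>x. ennreal (U x)) (\<lambda>x. ennreal (W n x))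
    \<and> (\<forall>z\<in>L2ball R. I n (W n) \<le> I n z + 1 / real (Suc n))"
    using minimising_sequence .
  have "W n \<in> L2ball R" "rdec (W n)" "conc_le (\<lambda>x. ennreal (U x)) (\<lambda>x. ennreal (W n x))"
    "z \<in> L2ball R \<Longrightarrow> I n (W n) \<le> I n z + 1 / real (Suc n)" for n z using W by auto
  note * = limit_comparison[OF this]
  show "AE x in lborel. 0 \<le> v x" by (rule *(1))
  show "conc_le (\<lambda>x. ennreal (U x)) (\<lambda>x. ennreal (v x))" by (rule *(2))
qed

end

section \<open>Truncated kernels\<close>

lemma AE_lborel_reflect:
  fixes P :: "'a::euclidean_space \<Rightarrow> bool"
  assumes "AE z in lborel. P z"
  shows "AE y in lborel. P (x - y)"
proof -
  obtain N where N: "{z \<in> space lborel. \<not> P z} \<subseteq> N" "emeasure lborel N = 0" "N \<in> sets lborel"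
    using assms by (rule AE_E)
  have [measurable]: "N \<in> sets borel" using N by simp
  have "(\<integral>\<^sup>+y. indicator N (x - y) \<partial>lborel) = 0"
    using nn_integral_indicator_translate(2)[of N x] N by simp
  then have "AE y in lborel. (indicator N (x - y) :: ennreal) = 0"
    by (subst (asm) nn_integral_0_iff_AE) simp_all
  then show ?thesis
  proof eventually_elim
    case (elim y)
    then have "x - y \<notin> N" by (simp add: indicator_def split: if_splits)
    then show ?case using N(1) by auto
  qed
qed

lemma distr_fun_version:
  fixes f f' :: "'a::euclidean_space \<Rightarrow> real"
  assumes f'[measurable]: "f' \<in> borel_measurable borel" and E[measurable]: "E \<in> sets borel"
    and eq: "AE x in lborel. x \<in> E \<longrightarrow> f x = f' x" and t: "0 \<le> t"
  shows "distr_fun E f t = distr_fun E f' t"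
    and "(\<And>x. x \<notin> E \<Longrightarrow> f' x = 0) \<Longrightarrow> distr_fun E f t = distr_fun UNIV f' t"
proof -
  have m: "{x \<in> E. \<bar>f' x\<bar> > t} \<in> sets borel" by measurable
  have ae: "AE x in lebesgue. x \<in> {x \<in> E. \<bar>f' x\<bar> > t} \<longleftrightarrow> x \<in> {x \<in> E. \<bar>f x\<bar> > t}"
    using AE_completion[OF eq] by eventually_elim auto
  have m': "{x \<in> E. \<bar>f x\<bar> > t} \<in> sets lebesgue"
    by (rule completion.in_sets_AE[OF ae]) (use m in simp_all)
  show 1: "distr_fun E f t = distr_fun E f' t"
    unfolding distr_fun_def
  proof (rule emeasure_eq_AE)
    show "AE x in lebesgue. x \<in> {x \<in> E. t < \<bar>f x\<bar>} \<longleftrightarrow> x \<in> {x \<in> E. t < \<bar>f' x\<bar>}"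
      using ae by eventually_elim blast
  qed (use m m' in simp_all)
  show "distr_fun E f t = distr_fun UNIV f' t" if "\<And>x. x \<notin> E \<Longrightarrow> f' x = 0"
  proof -
    have "{x \<in> E. \<bar>f' x\<bar> > t} = {x \<in> UNIV. \<bar>f' x\<bar> > t}" using that t by force
    then show ?thesis unfolding 1 by (simp add: distr_fun_def)
  qed
qed

lemma decr_rearr_cong:
  assumes "\<And>t. 0 \<le> t \<Longrightarrow> distr_fun E f t = distr_fun E' f' t"
  shows "decr_rearr E f = decr_rearr E' f'"
proof
  fix \<sigma>
  have "{t. t \<ge> 0 \<and> distr_fun E f t > ennreal \<sigma>} = {t. t \<ge> 0 \<and> distr_fun E' f' t > ennreal \<sigma>}"
    using assms by auto
  then show "decr_rearr E f \<sigma> = decr_rearr E' f' \<sigma>" by (simp add: decr_rearr_def)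
qed

lemma schwarz_version:
  fixes f f' :: "'a::euclidean_space \<Rightarrow> real"
  assumes f': "f' \<in> borel_measurable borel" and E: "E \<in> sets borel"
    and eq: "AE x in lborel. x \<in> E \<longrightarrow> f x = f' x" and out: "\<And>x. x \<notin> E \<Longrightarrow> f' x = 0"
  shows "schwarz E f = schwarz UNIV f'" "x \<notin> sym_ball E \<Longrightarrow> schwarz UNIV f' x = 0"
proof -
  have d: "distr_fun E f t = distr_fun UNIV f' t" if "0 \<le> t" for t
    by (rule distr_fun_version(2)[OF f' E eq that out])
  have z: "schwarz UNIV f' x = 0" if "x \<notin> sym_ball E" for x
  proof -
    have "distr_fun UNIV f' t \<le> emeasure lebesgue E" if "0 \<le> t" for t
    proof -
      have "{x. t < \<bar>f' x\<bar>} \<subseteq> E" using out that by force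
      then show ?thesis unfolding distr_fun_def using E by (intro emeasure_mono) auto
    qed
    then have "\<not> ennreal (radial_vol x) < distr_fun UNIV f' t" if "0 \<le> t" for t
      using that \<open>x \<notin> sym_ball E\<close> unfolding sym_ball_iff by (meson not_le order_trans)
    then have e: "{t. t \<ge> 0 \<and> distr_fun UNIV f' t > ennreal (radial_vol x)} = {}" by blast
    have "decr_rearr UNIV f' (radial_vol x) = 0" unfolding decr_rearr_def e by (simp add: bot_ennreal)
    then show ?thesis by (simp add: schwarz_UNIV)
  qed
  then show "x \<notin> sym_ball E \<Longrightarrow> schwarz UNIV f' x = 0" .
  show "schwarz E f = schwarz UNIV f'"
  proof
    fix x
    show "schwarz E f x = schwarz UNIV f' x"
      using z[of x] decr_rearr_cong[OF d] by (cases "x \<in> sym_ball E") (simp_all add: schwarz_def[of E] schwarz_UNIV)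
  qed
qed

lemma schwarz_le:
  assumes g: "g \<in> borel_measurable borel" and C: "\<And>x. \<bar>g x\<bar> \<le> C"
  shows "schwarz UNIV g x \<le> C"
proof -
  have C0: "0 \<le> C" using C[of undefined] by simp
  have [measurable]: "g \<in> borel_measurable borel" by fact
  have "{x \<in> UNIV. \<bar>g x\<bar> > C} = {}" using C by (auto simp: not_less)
  then have "distr_fun UNIV g C = 0" unfolding distr_fun_def by (simp only: emeasure_empty)
  then have "decr_rearr UNIV g (radial_vol x) \<le> ennreal C"
    using C0 by (intro decr_rearr_finite) auto
  then show ?thesis unfolding schwarz_UNIV using C0 by (metis enn2real_ennreal enn2real_mono ennreal_less_top)
qed

lemma schwarz_sq:
  assumes g: "bsupp g" and x: "x \<noteq> 0"
  shows "schwarz UNIV (\<lambda>x. (g x)\<^sup>2) x = (schwarz UNIV g x)\<^sup>2"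
proof -
  have g2: "bsupp (\<lambda>x. (g x)\<^sup>2)" using g by (auto simp: bsupp_def)
  have lv: "s < schwarz UNIV (\<lambda>x. (g x)\<^sup>2) x \<longleftrightarrow> s < (schwarz UNIV g x)\<^sup>2" if s: "0 \<le> s" for s
  proof -
    have "s < \<bar>(g y)\<^sup>2\<bar> \<longleftrightarrow> sqrt s < \<bar>g y\<bar>" for y
      using real_sqrt_less_iff[of s "(g y)\<^sup>2"] by simp
    then have "{y. s < \<bar>(g y)\<^sup>2\<bar>} = {y. sqrt s < \<bar>g y\<bar>}" by blast
    then have "s < schwarz UNIV (\<lambda>x. (g x)\<^sup>2) x \<longleftrightarrow> sqrt s < schwarz UNIV g x"
      using schwarz_level[OF g2 x s] schwarz_level[OF g x, of "sqrt s"] s by simp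
    also have "\<dots> \<longleftrightarrow> s < (schwarz UNIV g x)\<^sup>2"
      using s real_sqrt_less_iff[of s "(schwarz UNIV g x)\<^sup>2"] by (simp add: real_sqrt_abs)
    finally show ?thesis .
  qed
  show ?thesis
    using lv[of "schwarz UNIV (\<lambda>x. (g x)\<^sup>2) x"] lv[of "(schwarz UNIV g x)\<^sup>2"] by simp
qed

lemma schwarz_L2ball:
  fixes f' :: "'a::euclidean_space \<Rightarrow> real"
  assumes f': "f' \<in> borel_measurable borel" and E: "E \<in> sets borel" "bounded E" and out: "\<And>x. x \<notin> E \<Longrightarrow> f' x = 0"
    and int: "integrable lborel (\<lambda>x. (f' x)\<^sup>2)" and R: "sym_ball E = ball 0 R"
  shows "bsupp f'" "schwarz UNIV f' \<in> L2ball R"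
proof -
  have "{x. f' x \<noteq> 0} \<subseteq> E" using out by blast
  then show b: "bsupp f'" using f' E(2) bounded_subset by (auto simp: bsupp_def)
  then have b2: "bsupp (\<lambda>x. (f' x)\<^sup>2)" by (auto simp: bsupp_def)
  have [measurable]: "schwarz UNIV f' \<in> borel_measurable borel" by (rule schwarz_measurable[OF b])
  have "(\<integral>\<^sup>+x. ennreal ((schwarz UNIV f' x)\<^sup>2) \<partial>lborel) = (\<integral>\<^sup>+x. ennreal (schwarz UNIV (\<lambda>x. (f' x)\<^sup>2) x) \<partial>lborel)"
    by (rule nn_integral_cong_AE) (use AE_lborel_singleton[of 0] in eventually_elim, simp add: schwarz_sq[OF b])
  also have "\<dots> = (\<integral>\<^sup>+x. ennreal ((f' x)\<^sup>2) \<partial>lborel)"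
    using nn_integral_schwarz[OF b2] by simp
  also have "\<dots> = ennreal (LINT x|lborel. (f' x)\<^sup>2)" by (rule nn_integral_eq_integral[OF int]) simp
  finally have "integrable lborel (\<lambda>x. (schwarz UNIV f' x)\<^sup>2)"
    by (intro integrableI_nonneg) auto
  moreover have "schwarz UNIV f' x = 0" if "x \<notin> ball 0 R" for x
    using schwarz_version(2)[OF f' E(1) _ out, of f' x] that R by simp
  ultimately show "schwarz UNIV f' \<in> L2ball R" by (simp add: L2ball_def)
qed

lemma levy_integrable:
  fixes J' :: "'a::euclidean_space \<Rightarrow> real"
  assumes levy: "L1_loc_nonneg (\<lambda>x. \<integral>\<^sup>+y. ennreal (K x y * min ((norm (x - y))\<^sup>2) 1) \<partial>lebesgue)"
    and KJ: "\<And>x y. K x y \<ge> J (x - y)" and J': "J' \<in> borel_measurable borel" "AE z in lborel. J z = J' z"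
  shows "(\<integral>\<^sup>+z. ennreal (J' z * min ((norm z)\<^sup>2) 1) \<partial>lborel) < \<infinity>"
proof -
  have [measurable]: "J' \<in> borel_measurable borel" by fact
  define h where "h x = (\<integral>\<^sup>+y. ennreal (K x y * min ((norm (x - y))\<^sup>2) 1) \<partial>lebesgue)" for x :: 'a
  have "\<exists>x. h x < \<infinity>"
  proof (rule ccontr)
    assume "\<nexists>x. h x < \<infinity>"
    then have "h x = \<infinity>" for x by (simp flip: less_top)
    then have "(\<integral>\<^sup>+x\<in>cball 0 1. h x \<partial>lebesgue) = (\<integral>\<^sup>+x\<in>cball (0::'a) 1. \<infinity> \<partial>lborel)"
      by (simp add: nn_integral_completion)
    also have "\<dots> = \<infinity> * emeasure lborel (cball (0::'a) 1)"
      by (rule nn_integral_cmult_indicator) simp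
    also have "\<dots> = \<infinity>"
      by (simp add: emeasure_cball less_imp_neq[OF unit_ball_vol_pos, symmetric] ennreal_top_mult)
    finally have "(\<integral>\<^sup>+x\<in>cball 0 1. h x \<partial>lebesgue) = \<infinity>" .
    moreover have "(\<integral>\<^sup>+x\<in>cball 0 1. h x \<partial>lebesgue) < \<infinity>"
      using levy compact_cball[of "0::'a" 1] unfolding L1_loc_nonneg_def h_def by blast
    ultimately show False by simp
  qed
  then obtain x where x: "h x < \<infinity>" by blast
  have "(\<integral>\<^sup>+z. ennreal (J' z * min ((norm z)\<^sup>2) 1) \<partial>lborel) = (\<integral>\<^sup>+y. ennreal (J' (x - y) * min ((norm (x - y))\<^sup>2) 1) \<partial>lborel)"
    by (rule nn_integral_lborel_reflect[symmetric]) measurable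
  also have "\<dots> \<le> (\<integral>\<^sup>+y. ennreal (K x y * min ((norm (x - y))\<^sup>2) 1) \<partial>lborel)"
  proof (rule nn_integral_mono_AE)
    show "AE y in lborel. ennreal (J' (x - y) * min ((norm (x - y))\<^sup>2) 1) \<le> ennreal (K x y * min ((norm (x - y))\<^sup>2) 1)"
      using AE_lborel_reflect[OF J'(2), of x]
    proof eventually_elim
      case (elim y)
      then have "J' (x - y) \<le> K x y" using KJ[of "x" y] by simp
      then show ?case by (intro ennreal_leI mult_right_mono) auto
    qed
  qed
  also have "\<dots> = h x" by (simp add: h_def nn_integral_completion)
  finally show ?thesis using x by simp
qed

lemma levy_tail:
  fixes J :: "'a::euclidean_space \<Rightarrow> real"
  assumes J[measurable]: "J \<in> borel_measurable borel" and J0: "\<And>z. 0 \<le> J z"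
    and fin: "(\<integral>\<^sup>+z. ennreal (J z * min ((norm z)\<^sup>2) 1) \<partial>lborel) < \<infinity>" and \<sigma>: "0 < \<sigma>"
  obtains t where "0 \<le> t" "distr_fun UNIV J t \<le> ennreal \<sigma>"
proof -
  obtain C where C: "(\<integral>\<^sup>+z. ennreal (J z * min ((norm z)\<^sup>2) 1) \<partial>lborel) = ennreal C" "0 \<le> C"
    using fin by (cases "(\<integral>\<^sup>+z. ennreal (J z * min ((norm z)\<^sup>2) 1) \<partial>lborel)") auto
  obtain \<rho> where \<rho>: "0 < \<rho>" "emeasure lborel (ball (0::'a) \<rho>) \<le> ennreal (\<sigma> / 2)"
    using small_ball_exists[of "\<sigma>/2"] \<sigma> by auto
  define m where "m = min (\<rho>\<^sup>2) 1"
  have m: "0 < m" using \<rho> by (simp add: m_def)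
  define t where "t = 2 * (C + 1) / (m * \<sigma>)"
  have t: "0 < t" using C m \<sigma> by (simp add: t_def add_nonneg_pos)
  define S where "S = {z. t < J z} - ball 0 \<rho>"
  have [measurable]: "S \<in> sets borel" unfolding S_def by measurable
  have "ennreal (t * m) * emeasure lborel S = (\<integral>\<^sup>+z. ennreal (t * m) * indicator S z \<partial>lborel)"
    by (rule nn_integral_cmult_indicator[symmetric]) simp
  also have "\<dots> \<le> (\<integral>\<^sup>+z. ennreal (J z * min ((norm z)\<^sup>2) 1) \<partial>lborel)"
  proof (rule nn_integral_mono)
    fix z
    show "ennreal (t * m) * indicator S z \<le> ennreal (J z * min ((norm z)\<^sup>2) 1)"
    proof (cases "z \<in> S")
      case True
      then have "\<rho> \<le> norm z" "t < J z" by (auto simp: S_def)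
      then have "m \<le> min ((norm z)\<^sup>2) 1" using \<rho> unfolding m_def by (intro min.mono power_mono) auto
      then have "t * m \<le> J z * min ((norm z)\<^sup>2) 1" using \<open>t < J z\<close> t m J0[of z] by (intro mult_mono) auto
      then show ?thesis using True by (simp add: ennreal_leI)
    qed simp
  qed
  also have "\<dots> \<le> ennreal (t * m) * ennreal (\<sigma> / 2)"
  proof -
    have "C \<le> t * m * (\<sigma> / 2)" using m \<sigma> by (simp add: t_def field_simps)
    then show ?thesis unfolding C using t m \<sigma> by (simp add: ennreal_mult[symmetric] ennreal_leI)
  qed
  finally have S: "emeasure lborel S \<le> ennreal (\<sigma> / 2)"
    using t m by (subst (asm) ennreal_mult_le_mult_iff) auto
  have "distr_fun UNIV J t = emeasure lborel {z. t < J z}" using J0 by (simp add: distr_fun_def)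
  also have "\<dots> \<le> emeasure lborel (S \<union> ball 0 \<rho>)" by (rule emeasure_mono) (auto simp: S_def)
  also have "\<dots> \<le> emeasure lborel S + emeasure lborel (ball (0::'a) \<rho>)" by (rule emeasure_subadditive) simp_all
  also have "\<dots> \<le> ennreal (\<sigma> / 2) + ennreal (\<sigma> / 2)" by (intro add_mono S \<rho>)
  also have "\<dots> = ennreal \<sigma>" using \<sigma> by (simp flip: ennreal_plus)
  finally show ?thesis using that[of t] t by simp
qed

locale truncation =
  fixes J :: "'a::euclidean_space \<Rightarrow> real"
  assumes J_meas[measurable]: "J \<in> borel_measurable borel" and J0: "\<And>z. 0 \<le> J z"
    and tail: "\<And>\<sigma>. 0 < \<sigma> \<Longrightarrow> \<exists>t\<ge>0. distr_fun UNIV J t \<le> ennreal \<sigma>"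
    and nonzero: "\<not> (AE z in lborel. J z = 0)"
begin

definition Jn :: "nat \<Rightarrow> 'a \<Rightarrow> real" where
  "Jn n z = min (J z) (real n) * indicator (ball 0 (real n)) z"

lemma Jn_meas [measurable]: "Jn n \<in> borel_measurable borel" unfolding Jn_def by measurable

lemma Jn_bsupp: "bsupp (Jn n)"
proof -
  have "{z. Jn n z \<noteq> 0} \<subseteq> ball 0 (real n)" by (auto simp: Jn_def indicator_def split: if_splits)
  then show ?thesis using bounded_subset[OF bounded_ball] by (auto simp: bsupp_def)
qed

lemma Jn_bounds: "0 \<le> Jn n z" "Jn n z \<le> J z" "Jn n z \<le> real n"
  using J0[of z] by (auto simp: Jn_def indicator_def)

lemma Jn_mono: "n \<le> m \<Longrightarrow> Jn n z \<le> Jn m z"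
  using J0[of z] by (auto simp: Jn_def indicator_def min_def)

lemma Jn_exhaust: assumes "s < J z" shows "\<exists>n. s < Jn n z"
proof -
  obtain n where n: "max (max s (J z)) (norm z) < real n" using reals_Archimedean2 by blast
  then have "Jn n z = J z" by (simp add: Jn_def indicator_def)
  then show ?thesis using assms by (intro exI[of _ n]) simp
qed

lemma distr_J: "distr_fun UNIV J s = emeasure lborel {z. s < J z}" "distr_fun UNIV (Jn n) s = emeasure lborel {z. s < Jn n z}"
  using J0 Jn_bounds(1) by (simp_all add: distr_fun_def)

lemma distr_SUP: "distr_fun UNIV J s = (SUP n. distr_fun UNIV (Jn n) s)"
proof -
  have "{z. s < J z} = (\<Union>n. {z. s < Jn n z})"
    using Jn_exhaust Jn_bounds(2) by (auto intro: less_le_trans)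
  moreover have "(SUP n. emeasure lborel {z. s < Jn n z}) = emeasure lborel (\<Union>n. {z. s < Jn n z})"
  proof (rule SUP_emeasure_incseq)
    show "incseq (\<lambda>n. {z. s < Jn n z})"
      using Jn_mono by (intro incseq_SucI) (auto intro: less_le_trans[OF _ Jn_mono])
  qed auto
  ultimately show ?thesis by (simp add: distr_J)
qed

abbreviation "Js \<equiv> schwarz UNIV J"
abbreviation "q n \<equiv> schwarz UNIV (Jn n)"

lemma Js_level:
  assumes x: "x \<noteq> 0" and s: "0 \<le> s"
  shows "s < Js x \<longleftrightarrow> ennreal (radial_vol x) < distr_fun UNIV J s"
proof -
  have "{x \<in> UNIV. \<bar>J x\<bar> > t} \<in> sets borel" for t by measurable
  then have m: "{x \<in> UNIV. \<bar>J x\<bar> > t} \<in> sets lebesgue" for t by simp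
  obtain t where t: "t \<ge> 0" "distr_fun UNIV J t \<le> ennreal (radial_vol x)" using tail[OF radial_vol_pos[OF x]] by blast
  have "decr_rearr UNIV J (radial_vol x) \<le> ennreal t" by (rule decr_rearr_finite[OF m t])
  then have "decr_rearr UNIV J (radial_vol x) < \<infinity>" by (simp add: le_less_trans)
  then have "s < Js x \<longleftrightarrow> ennreal s < decr_rearr UNIV J (radial_vol x)"
    using s by (cases "decr_rearr UNIV J (radial_vol x)") (auto simp: schwarz_UNIV ennreal_less_iff)
  then show ?thesis using less_decr_rearr_iff[OF m s] by simp
qed

lemma q_level:
  assumes x: "x \<noteq> 0" and s: "0 \<le> s"
  shows "s < q n x \<longleftrightarrow> ennreal (radial_vol x) < distr_fun UNIV (Jn n) s"
  using schwarz_level[OF Jn_bsupp x s] by (simp add: sym_ball_iff distr_fun_def)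

lemma q_le: assumes "x \<noteq> 0" shows "q n x \<le> Js x"
proof (rule ccontr)
  assume "\<not> q n x \<le> Js x"
  then have "ennreal (radial_vol x) < distr_fun UNIV (Jn n) (Js x)"
    using q_level[OF assms, of "Js x" n] by simp
  also have "\<dots> \<le> distr_fun UNIV J (Js x)" unfolding distr_SUP by (rule SUP_upper) simp
  finally show False using Js_level[OF assms, of "Js x"] by simp
qed

lemma q_mono: assumes "n \<le> m" shows "q n x \<le> q m x"
proof -
  have "distr_fun UNIV (Jn n) t \<le> distr_fun UNIV (Jn m) t" for t
    unfolding distr_J using Jn_mono[OF assms] by (intro emeasure_mono) (auto intro: less_le_trans)
  then have "decr_rearr UNIV (Jn n) (radial_vol x) \<le> decr_rearr UNIV (Jn m) (radial_vol x)"
    unfolding decr_rearr_def by (intro Sup_subset_mono image_mono) (auto intro: less_le_trans)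
  moreover have "decr_rearr UNIV (Jn m) (radial_vol x) \<le> ennreal (real m)"
  proof (rule decr_rearr_finite)
    have "{z. real m < Jn m z} = {}" using Jn_bounds(3)[of m] by (auto simp: not_less)
    then show "distr_fun UNIV (Jn m) (real m) \<le> ennreal (radial_vol x)" unfolding distr_J by (simp only: emeasure_empty) simp
  qed auto
  ultimately show ?thesis unfolding schwarz_UNIV by (intro enn2real_mono) (auto simp: le_less_trans)
qed

lemma q_lim: assumes x: "x \<noteq> 0" shows "(\<lambda>n. q n x) \<longlonglongrightarrow> Js x"
proof (rule order_tendstoI)
  fix a assume "Js x < a"
  then show "\<forall>\<^sub>F n in sequentially. q n x < a"
    using q_le[OF x] by (intro always_eventually allI) (auto intro: le_less_trans)
next
  fix a assume a: "a < Js x"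
  show "\<forall>\<^sub>F n in sequentially. a < q n x"
  proof (cases "0 \<le> a")
    case True
    then have "ennreal (radial_vol x) < (SUP n. distr_fun UNIV (Jn n) a)"
      using Js_level[OF x True] a by (simp add: distr_SUP)
    then obtain N where "ennreal (radial_vol x) < distr_fun UNIV (Jn N) a" by (auto simp: less_SUP_iff)
    then have "a < q N x" using q_level[OF x True] by simp
    then show ?thesis unfolding eventually_sequentially using q_mono by (intro exI[of _ N]) (auto intro: less_le_trans)
  next
    case False
    then show ?thesis using schwarz_nonneg[of UNIV _ x] by (intro always_eventually allI) (auto intro: less_le_trans simp: not_le)
  qed
qed

lemma Js_meas [measurable]: "Js \<in> borel_measurable borel"
proof -
  have [measurable]: "q n \<in> borel_measurable borel" for n by (rule schwarz_measurable[OF Jn_bsupp])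
  have "(\<lambda>x. if x = 0 then 0 else Js x) \<in> borel_measurable borel"
  proof (rule borel_measurable_LIMSEQ_real)
    show "(\<lambda>n. if x = 0 then 0 else q n x) \<longlonglongrightarrow> (if x = 0 then 0 else Js x)" for x
      using q_lim[of x] by simp
    show "(\<lambda>x. if x = 0 then 0 else q n x) \<in> borel_measurable borel" for n by measurable
  qed
  then have "(\<lambda>x. if x = 0 then Js 0 else if x = 0 then 0 else Js x) \<in> borel_measurable borel" by measurable
  moreover have "(\<lambda>x. if x = 0 then Js 0 else if x = 0 then 0 else Js x) = Js" by auto
  ultimately show ?thesis by simp
qed

lemma q_lower:
  obtains n0 \<eta> \<delta> where "0 < \<eta>" "0 < \<delta>" "\<forall>x. x \<noteq> 0 \<longrightarrow> norm x < \<delta> \<longrightarrow> \<eta> \<le> q n0 x"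
proof -
  have "\<exists>n. emeasure lborel {z. 1 / real (Suc n) < Jn n z} \<noteq> 0"
  proof (rule ccontr)
    assume "\<not> ?thesis"
    then have "AE z in lborel. z \<notin> {z. 1 / real (Suc n) < Jn n z}" for n
      by (intro AE_not_in null_setsI) auto
    then have "AE z in lborel. \<forall>n. z \<notin> {z. 1 / real (Suc n) < Jn n z}" by (simp add: AE_all_countable)
    then have "AE z in lborel. J z = 0"
    proof eventually_elim
      case (elim z)
      show ?case
      proof (rule ccontr)
        assume "J z \<noteq> 0"
        then have "0 < J z" using J0[of z] by simp
        then obtain n where n: "0 < Jn n z" using Jn_exhaust by blast
        obtain k where k: "inverse (real (Suc k)) < Jn n z" using reals_Archimedean[OF n] by blast
        have "1 / real (Suc (max n k)) \<le> inverse (real (Suc k))" by (simp add: inverse_eq_divide frac_le)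
        also have "\<dots> < Jn (max n k) z" using k Jn_mono[of n "max n k" z] by simp
        finally show False using elim by blast
      qed
    qed
    then show False using nonzero by simp
  qed
  then obtain n where n: "emeasure lborel {z. 1 / real (Suc n) < Jn n z} \<noteq> 0" by blast
  have S: "{z. 1 / real (Suc n) < \<bar>Jn n z\<bar>} = {z. 1 / real (Suc n) < Jn n z}" using Jn_bounds(1) by simp
  obtain \<delta> where \<delta>: "sym_ball {z. 1 / real (Suc n) < Jn n z} = ball 0 \<delta>"
    "emeasure lborel {z. 1 / real (Suc n) < Jn n z} = emeasure lborel (ball (0::'a) \<delta>)"
    using sym_ball_bounded[OF bsupp_levels[OF Jn_bsupp, of "1 / real (Suc n)" n]] unfolding S by auto
  have "0 < \<delta>"
  proof (rule ccontr)
    assume "\<not> 0 < \<delta>"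
    then have "ball (0::'a) \<delta> = {}" by simp
    then have "emeasure lborel (ball (0::'a) \<delta>) = 0" by (simp only: emeasure_empty)
    then show False using n \<delta>(2) by simp
  qed
  moreover have "\<forall>x. x \<noteq> 0 \<longrightarrow> norm x < \<delta> \<longrightarrow> 1 / real (Suc n) \<le> q n x"
    using schwarz_level[OF Jn_bsupp, of _ "1 / real (Suc n)" n] \<delta>(1) unfolding S by (auto intro: less_imp_le)
  ultimately show thesis using that[of "1 / real (Suc n)" \<delta> n] by simp
qed

end

section \<open>The comparison theorem\<close>

lemma comparison_borel:
  fixes \<Omega> :: "'a::euclidean_space set" and K K' :: "'a \<Rightarrow> 'a \<Rightarrow> real"
  assumes sol: "weak_solution \<Omega> K c f u" and \<Omega>: "\<Omega> \<in> sets borel" "bounded \<Omega>"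
    and R: "sym_ball \<Omega> = ball 0 R" "0 < R"
    and K': "(\<lambda>p. K' (fst p) (snd p)) \<in> borel_measurable (borel \<Otimes>\<^sub>M borel)" "\<And>x y. 0 \<le> K' x y"
      "AE x in lborel. AE y in lborel. K x y = K' x y"
    and J': "truncation J'" "AE x in lborel. AE y in lborel. J' (x - y) \<le> K' x y"
    and u': "u' \<in> borel_measurable borel" "AE x in lborel. u x = u' x" "\<And>x. x \<notin> \<Omega> \<Longrightarrow> u' x = 0"
      "integrable lborel (\<lambda>x. (u' x)\<^sup>2)" "kenergy K' u' < \<infinity>"
    and c': "c' \<in> borel_measurable borel" "AE x in lborel. x \<in> \<Omega> \<longrightarrow> c x = c' x"
      "\<And>x. 0 \<le> c' x" "\<And>x. c' x \<le> M" "\<And>x. x \<notin> \<Omega> \<Longrightarrow> c' x = 0"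
    and f': "f' \<in> borel_measurable borel" "AE x in lborel. x \<in> \<Omega> \<longrightarrow> f x = f' x" "\<And>x. x \<notin> \<Omega> \<Longrightarrow> f' x = 0"
      "integrable lborel (\<lambda>x. (f' x)\<^sup>2)"
    and v': "v' \<in> L2ball R" "kenergy (\<lambda>x y. schwarz UNIV J' (x - y)) v' < \<infinity>"
    and v_weak: "\<And>p. p \<in> L2ball R \<Longrightarrow> kenergy (\<lambda>x y. schwarz UNIV J' (x - y)) p < \<infinity> \<Longrightarrow>
        1 / 2 * (LINT z|(lborel \<Otimes>\<^sub>M lborel). schwarz UNIV J' (fst z - snd z)
            * ((v' (fst z) - v' (snd z)) * (p (fst z) - p (snd z))))
          + (LINT x|lborel. incr_schwarz \<Omega> c' x * (v' x * p x)) = (LINT x|lborel. schwarz UNIV f' x * p x)"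
  shows "AE x in lborel. 0 \<le> v' x" "conc_le (\<lambda>x. ennreal (schwarz UNIV u' x)) (\<lambda>x. ennreal (v' x))"
proof -
  interpret truncation J' by fact
  have c_bsupp: "bsupp c'"
  proof -
    have "{x. c' x \<noteq> 0} \<subseteq> \<Omega>" using c'(5) by blast
    then show ?thesis using c'(1) \<Omega>(2) bounded_subset by (auto simp: bsupp_def)
  qed
  interpret ic: incr_coeff \<Omega> c' M
    by (unfold_locales) (use \<Omega> c_bsupp c' in simp_all)
  define F U cs where "F = schwarz UNIV f'" and "U = schwarz UNIV u'" and "cs = incr_schwarz \<Omega> c'"
  have fb: "bsupp f'" "F \<in> L2ball R" using schwarz_L2ball[OF f'(1) \<Omega> f'(3,4) R(1)] by (simp_all add: F_def)
  have ub: "bsupp u'" "U \<in> L2ball R" using schwarz_L2ball[OF u'(1) \<Omega> u'(3,4) R(1)] by (simp_all add: U_def)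
  have F_rdec: "rdec F" and U_rdec: "rdec U" using fb ub by (simp_all add: F_def U_def rdec_schwarz)
  obtain R' where R': "\<Omega> \<subseteq> ball 0 R'" using \<Omega>(2) bounded_subset_ballD by blast
  obtain n0 \<eta> \<delta> where \<eta>: "0 < \<eta>" "0 < \<delta>" "\<forall>x. x \<noteq> 0 \<longrightarrow> norm x < \<delta> \<longrightarrow> \<eta> \<le> q n0 x" using q_lower .
  obtain \<kappa> where \<kappa>: "0 < \<kappa>" and poinc: "\<forall>q z :: 'a \<Rightarrow> real. q \<in> borel_measurable borel \<longrightarrow> z \<in> borel_measurable borel \<longrightarrow>
      (\<forall>x. x \<noteq> 0 \<longrightarrow> norm x < \<delta> \<longrightarrow> \<eta> \<le> q x) \<longrightarrow> (\<forall>x. x \<notin> ball 0 R \<longrightarrow> z x = 0) \<longrightarrow>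
      ennreal (2 * \<kappa>) * (\<integral>\<^sup>+x. ennreal ((z x)\<^sup>2) \<partial>lborel)
        \<le> (\<integral>\<^sup>+x. \<integral>\<^sup>+y. ennreal (q (x - y) * (z x - z y)\<^sup>2) \<partial>lborel \<partial>lborel)"
    by (rule poincare[where 'a='a, OF \<eta>(1,2) R(2)], rule that, assumption, intro allI impI) simp_all
  have q_rdec: "rdec (q n)" for n by (rule rdec_schwarz[OF Jn_bsupp])
  have q_meas: "q n \<in> borel_measurable borel" for n using q_rdec by (rule rdec_measurable)
  have q_bound: "q n x \<le> real n" for n x
    using Jn_bounds[of n] by (intro schwarz_le) auto
  have q_low: "\<eta> \<le> q (n + n0) x" if "x \<noteq> 0" "norm x < \<delta>" for n x
    using \<eta>(3) that q_mono[of n0 "n + n0" x] by fastforce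
  have nn_Jn: "(\<integral>\<^sup>+x. ennreal (Jn n x) \<partial>lborel) = (\<integral>\<^sup>+x. ennreal (q n x) \<partial>lborel)" for n
    using nn_integral_schwarz[OF Jn_bsupp, of n] Jn_bounds(1) by simp
  have q_int: "integrable lborel (q n)" for n
  proof (rule integrableI_nonneg)
    have "(\<integral>\<^sup>+x. ennreal (Jn n x) \<partial>lborel) \<le> (\<integral>\<^sup>+x. ennreal (real n) * indicator (ball (0::'a) (real n)) x \<partial>lborel)"
      by (rule nn_integral_mono) (auto simp: Jn_def indicator_def intro!: ennreal_leI)
    also have "\<dots> = ennreal (real n) * emeasure lborel (ball (0::'a) (real n))"
      by (rule nn_integral_cmult_indicator) simp
    also have "\<dots> < \<infinity>"
      using emeasure_lborel_ball_finite[of "0::'a" "real n"] by (simp add: ennreal_mult_less_top)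
    finally show "(\<integral>\<^sup>+x. ennreal (q n x) \<partial>lborel) < \<infinity>" by (simp add: nn_Jn)
  qed (use q_meas in simp_all)
  have j_pos: "0 < (LINT x|lborel. q (n + n0) x)" for n
  proof -
    have "ball (0::'a) \<delta> \<noteq> {}" using \<eta>(2) by simp
    then have "emeasure lebesgue (ball (0::'a) \<delta>) \<noteq> 0"
      using open_not_negligible[OF open_ball] by (auto simp: negligible_iff_null_sets null_sets_def)
    then have "0 < ennreal \<eta> * emeasure lborel (ball (0::'a) \<delta>)"
      using \<eta>(1) by (simp add: ennreal_zero_less_mult_iff zero_less_iff_neq_zero)
    also have "\<dots> = (\<integral>\<^sup>+x. ennreal \<eta> * indicator (ball (0::'a) \<delta>) x \<partial>lborel)"
      by (rule nn_integral_cmult_indicator[symmetric]) simp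
    also have "\<dots> \<le> (\<integral>\<^sup>+x. ennreal (q (n + n0) x) \<partial>lborel)"
    proof (rule nn_integral_mono_AE)
      show "AE x in lborel. ennreal \<eta> * indicator (ball (0::'a) \<delta>) x \<le> ennreal (q (n + n0) x)"
        using AE_lborel_singleton[of 0]
      proof eventually_elim
        case (elim x)
        then show ?case using q_low[of x n] by (cases "x \<in> ball 0 \<delta>") (auto intro: ennreal_leI)
      qed
    qed
    also have "\<dots> = ennreal (LINT x|lborel. q (n + n0) x)"
      by (rule nn_integral_eq_integral[OF q_int]) simp
    finally show ?thesis by simp
  qed
  have bk: "bounded_kernel (q (n + n0)) F cs (real (n + n0)) R M \<kappa>" for n
  proof (unfold bounded_kernel_def, intro conjI allI impI)
    show "cs x \<le> cs y" if "y \<in> ball 0 R" "norm x \<le> norm y" for x y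
      unfolding cs_def by (rule ic.incr_schwarz_mono(2)) (use that R in simp_all)
    show "q (n + n0) x \<le> real (n + n0)" for x by (rule q_bound)
    show "ennreal (2 * \<kappa>) * (\<integral>\<^sup>+x. ennreal ((z x)\<^sup>2) \<partial>lborel)
        \<le> (\<integral>\<^sup>+x. \<integral>\<^sup>+y. ennreal (q (n + n0) (x - y) * (z x - z y)\<^sup>2) \<partial>lborel \<partial>lborel)" if "z \<in> L2ball R" for z
      using poinc q_meas L2ballD(1,2)[OF that] q_low by simp
  qed (use q_rdec R j_pos \<kappa> F_rdec fb in \<open>simp_all add: cs_def ic.incr_schwarz_nonneg ic.incr_schwarz_le\<close>)
  have D: "conc_le (\<lambda>x. ennreal (indicator (ball 0 R) x * ((bounded_kernel.j (q (n + n0)) + cs x) * U x)))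
        (\<lambda>x. ennreal (indicator (ball 0 R) x * (F x + bounded_kernel.A (q (n + n0)) U x)))" for n
  proof -
    interpret b: bounded_kernel "q (n + n0)" F cs "real (n + n0)" R M \<kappa> by (rule bk)
    have U0: "0 \<le> U x" for x using U_rdec by (rule rdec_nonneg)
    have F0: "0 \<le> F x" for x using F_rdec by (rule rdec_nonneg)
    have A0: "0 \<le> b.A U x" for x by (rule b.A_nn(2)[OF ub(2) U0])
    show ?thesis
    proof (rule conc_from_levels[OF U_rdec L2ballD(2)[OF ub(2)] R(2), where Pm = "b.j + M"])
      show "(\<lambda>x. F x + b.A U x) \<in> borel_measurable borel" using b.A_meas[OF ub(2)] by measurable
      show "F y + b.A U y \<le> F x + b.A U x" if "x \<noteq> 0" "norm x \<le> norm y" for x y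
        using rdecD[OF F_rdec that] b.A_antimono[OF ub(2) U_rdec that(2)] by simp
      show "(\<integral>\<^sup>+x. indicator {x. t < U x} x * ennreal ((b.j + cs x) * U x) \<partial>lborel)
          \<le> (\<integral>\<^sup>+x. indicator {x. t < U x} x * ennreal (F x + b.A U x) \<partial>lborel)" if t: "0 \<le> t" for t
      proof -
        have lv: "(indicator {x. t < U x} x :: ennreal) = indicator (sym_ball {x. t < \<bar>u' x\<bar>}) x" if "x \<noteq> 0" for x
          using schwarz_level[OF ub(1) that t] by (simp add: indicator_def U_def)
        have Jk: "AE x in lborel. AE y in lborel. Jn (n + n0) (x - y) \<le> K' x y"
          using J'(2)
        proof eventually_elim
          case (elim x)
          then show ?case by eventually_elim (use Jn_bounds(2) order_trans in blast)
        qed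
        have "(\<integral>\<^sup>+x. indicator (sym_ball {x. t < \<bar>u' x\<bar>}) x
            * (((\<integral>\<^sup>+z. ennreal (Jn (n + n0) z) \<partial>lborel) + ennreal (incr_schwarz \<Omega> c' x)) * ennreal (schwarz UNIV u' x)) \<partial>lborel)
          \<le> (\<integral>\<^sup>+x. indicator (sym_ball {x. t < \<bar>u' x\<bar>}) x * (ennreal (schwarz UNIV f' x)
            + (\<integral>\<^sup>+y. ennreal (q (n + n0) (x - y)) * ennreal (schwarz UNIV u' y) \<partial>lborel)) \<partial>lborel)"
          by (rule ic.level_inequality[OF ub(1) u'(3) fb(1) Jn_bsupp Jn_bounds(1) t], assumption)
            (rule weak_test[OF sol \<Omega>(1) K' Jn_meas Jk u'(1-5) c'(1-4) f'(1,2,4) R' f'(3) t])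
        also have "(\<integral>\<^sup>+x. indicator (sym_ball {x. t < \<bar>u' x\<bar>}) x
            * (((\<integral>\<^sup>+z. ennreal (Jn (n + n0) z) \<partial>lborel) + ennreal (incr_schwarz \<Omega> c' x)) * ennreal (schwarz UNIV u' x)) \<partial>lborel)
          = (\<integral>\<^sup>+x. indicator {x. t < U x} x * ennreal ((b.j + cs x) * U x) \<partial>lborel)"
        proof (rule nn_integral_cong_AE)
          show "AE x in lborel. indicator (sym_ball {x. t < \<bar>u' x\<bar>}) x
            * (((\<integral>\<^sup>+z. ennreal (Jn (n + n0) z) \<partial>lborel) + ennreal (incr_schwarz \<Omega> c' x)) * ennreal (schwarz UNIV u' x))
            = indicator {x. t < U x} x * ennreal ((b.j + cs x) * U x)"
            using AE_lborel_singleton[of 0]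
          proof eventually_elim
            case (elim x)
            have "ennreal ((b.j + cs x) * U x) = (ennreal b.j + ennreal (cs x)) * ennreal (U x)"
              using b.j b.cs_nonneg[of x] U0[of x] by (simp add: ennreal_mult ennreal_plus)
            then show ?case by (simp only: lv[OF elim, unfolded U_def] nn_Jn b.nn_q cs_def U_def)
          qed
        qed
        also have "(\<integral>\<^sup>+x. indicator (sym_ball {x. t < \<bar>u' x\<bar>}) x * (ennreal (schwarz UNIV f' x)
            + (\<integral>\<^sup>+y. ennreal (q (n + n0) (x - y)) * ennreal (schwarz UNIV u' y) \<partial>lborel)) \<partial>lborel)
          = (\<integral>\<^sup>+x. indicator {x. t < U x} x * ennreal (F x + b.A U x) \<partial>lborel)"
        proof (rule nn_integral_cong_AE)
          show "AE x in lborel. indicator (sym_ball {x. t < \<bar>u' x\<bar>}) x * (ennreal (schwarz UNIV f' x)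
            + (\<integral>\<^sup>+y. ennreal (q (n + n0) (x - y)) * ennreal (schwarz UNIV u' y) \<partial>lborel))
            = indicator {x. t < U x} x * ennreal (F x + b.A U x)"
            using AE_lborel_singleton[of 0]
          proof eventually_elim
            case (elim x)
            have "ennreal (F x + b.A U x) = ennreal (F x) + ennreal (b.A U x)"
              using F0 A0 by (simp add: ennreal_plus)
            then show ?case by (simp only: lv[OF elim, unfolded U_def] b.A_nn(1)[OF ub(2) U0, unfolded U_def] F_def U_def)
          qed
        qed
        finally show ?thesis .
      qed
    qed (use b.j b.cs_nonneg b.cs_le b.cs_mono F0 A0 in \<open>auto simp: add_nonneg_nonneg less_imp_le\<close>)
  qed
  have "kernel_limit (\<lambda>n. q (n + n0)) Js F cs U v' R M \<kappa> (\<lambda>n. real (n + n0))"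
  proof (unfold kernel_limit_def, intro conjI allI impI)
    show "q (n + n0) x \<le> q (m + n0) x" if "n \<le> m" for n m x using that by (intro q_mono) simp
    show "(\<lambda>n. q (n + n0) x) \<longlonglongrightarrow> Js x" if "x \<noteq> 0" for x using q_lim[OF that] by (rule LIMSEQ_ignore_initial_segment)
    show "1 / 2 * (LINT z|(lborel \<Otimes>\<^sub>M lborel). Js (fst z - snd z) * ((v' (fst z) - v' (snd z)) * (p (fst z) - p (snd z))))
          + (LINT x|lborel. cs x * (v' x * p x)) = (LINT x|lborel. F x * p x)"
      if "p \<in> L2ball R" "kenergy (\<lambda>x y. Js (x - y)) p < \<infinity>" for p
      unfolding cs_def F_def by (rule v_weak[OF that])
  qed (use bk q_le Js_meas ub U_rdec D v' in simp_all)
  from kernel_limit.comparison[OF this]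
  show "AE x in lborel. 0 \<le> v' x" "conc_le (\<lambda>x. ennreal (schwarz UNIV u' x)) (\<lambda>x. ennreal (v' x))"
    by (simp_all add: U_def)
qed

lemma weak_solution_energy:
  assumes "weak_solution E k a g u"
  shows "1 / 2 * (LINT x|lebesgue. (LINT y|lebesgue. k x y * (u x - u y)\<^sup>2)) + (LINT x:E|lebesgue. a x * (u x)\<^sup>2)
    = (LINT x:E|lebesgue. g x * u x)"
  using assms by (auto simp: weak_solution_def power2_eq_square mult.assoc)

lemma set_integral_AE:
  fixes f g :: "'a::euclidean_space \<Rightarrow> real"
  assumes E: "E \<in> sets borel" and g: "g \<in> borel_measurable borel" and eq: "AE x in lborel. x \<in> E \<longrightarrow> f x = g x"
  shows "(LINT x:E|lebesgue. f x) = (LINT x|lborel. indicator E x * g x)"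
  unfolding set_lebesgue_integral_def
proof (rule lebesgue_integral_lborel_AE)
  show "(\<lambda>x. indicator E x * g x) \<in> borel_measurable borel" using E g by measurable
  show "AE x in lborel. indicat_real E x *\<^sub>R f x = indicator E x * g x"
    using eq by eventually_elim (auto simp: indicator_def)
qed

lemma L2_on_borel_version:
  fixes f :: "'a::euclidean_space \<Rightarrow> real"
  assumes f: "f \<in> L2_on E" and E: "E \<in> sets borel"
  obtains g where "g \<in> borel_measurable borel" "AE x in lborel. x \<in> E \<longrightarrow> f x = g x" "\<And>x. x \<notin> E \<Longrightarrow> g x = 0"
    "integrable lborel (\<lambda>x. (g x)\<^sup>2)"
proof -
  have fm: "f \<in> borel_measurable (lebesgue_on E)" and fi: "integrable (lebesgue_on E) (\<lambda>x. (f x)\<^sup>2)"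
    using f by (simp_all add: L2_on_def)
  obtain g where g: "g \<in> borel_measurable borel" "AE x in lborel. x \<in> E \<longrightarrow> f x = g x" "\<And>x. x \<notin> E \<Longrightarrow> g x = 0"
    by (rule lebesgue_on_borel_version[OF fm E], rule that, assumption, assumption, blast)
  have "integrable lebesgue (\<lambda>x. indicat_real E x *\<^sub>R (f x)\<^sup>2)"
    using fi E by (subst (asm) integrable_restrict_space) simp_all
  moreover have ae: "AE x in lborel. indicat_real E x *\<^sub>R (f x)\<^sup>2 = (g x)\<^sup>2"
    using g(2) by eventually_elim (use g(3) in \<open>auto simp: indicator_def\<close>)
  moreover have m: "(\<lambda>x. (g x)\<^sup>2) \<in> borel_measurable borel" using g(1) by measurable
  ultimately have "integrable lebesgue (\<lambda>x. (g x)\<^sup>2)"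
    by (subst integrable_cong_AE[where g = "\<lambda>x. indicat_real E x *\<^sub>R (f x)\<^sup>2"])
      (auto dest: AE_completion intro: measurable_completion)
  then have "integrable lborel (\<lambda>x. (g x)\<^sup>2)" using m by (simp add: integrable_completion)
  then show thesis using that[OF g(1,2)] g(3) by blast
qed

theorem theorem1p1:
  fixes \<Omega> :: "'a::euclidean_space set"
    and K :: "'a \<Rightarrow> 'a \<Rightarrow> real"
    and J f c u v :: "'a \<Rightarrow> real"
  assumes "open \<Omega>" and "bounded \<Omega>"
    and K_meas: "(\<lambda>(x, y). K x y) \<in> borel_measurable (lebesgue :: ('a \<times> 'a) measure)"
    and K_nonneg: "\<And>x y. K x y \<ge> 0"
    and J_meas: "J \<in> borel_measurable lebesgue"
    and J_nonneg: "\<And>z. J z \<ge> 0"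
    and J_nonzero: "\<not> (AE z in lebesgue. J z = 0)"
    and K_sym: "\<And>x y. K x y = K y x"
    and K_levy: "L1_loc_nonneg
          (\<lambda>x. \<integral>\<^sup>+y. ennreal (K x y * min ((norm (x - y))\<^sup>2) 1) \<partial>lebesgue)"
    and K_ge_J: "\<And>x y. K x y \<ge> J (x - y)"
    and f_L2: "f \<in> L2_on \<Omega>"
    and c_Linf: "c \<in> Linf_on \<Omega>"
    and c_nonneg: "AE x in lebesgue_on \<Omega>. c x \<ge> 0"
    and u_sol: "weak_solution \<Omega> K c f u"
    and v_sol: "weak_solution (sym_ball \<Omega>) (\<lambda>x y. schwarz UNIV J (x - y))
                  (incr_schwarz \<Omega> c) (schwarz \<Omega> f) v"
  shows "(\<forall>r>0. (LINT x:ball 0 r|lebesgue. schwarz \<Omega> u x) \<le> (LINT x:ball 0 r|lebesgue. v x)) \<and>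
         1 / 2 * (LINT x|lebesgue. (LINT y|lebesgue. K x y * (u x - u y)\<^sup>2))
           + (LINT x:\<Omega>|lebesgue. c x * (u x)\<^sup>2)
         \<le> 1 / 2 * (LINT x|lebesgue. (LINT y|lebesgue. schwarz UNIV J (x - y) * (v x - v y)\<^sup>2))
           + (LINT x:sym_ball \<Omega>|lebesgue. incr_schwarz \<Omega> c x * (v x)\<^sup>2)"
proof -
  have \<Omega>: "\<Omega> \<in> sets borel" "bounded \<Omega>" using assms(1,2) by auto
  note energies = weak_solution_energy[OF u_sol] weak_solution_energy[OF v_sol]
  obtain R where R0: "0 \<le> R" and R: "sym_ball \<Omega> = ball 0 R" and em: "emeasure lborel \<Omega> = emeasure lborel (ball (0::'a) R)"
    using sym_ball_bounded[OF \<Omega>] .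
  show ?thesis
  proof (cases "\<Omega> = {}")
    case True
    have B0: "sym_ball ({} :: 'a set) = {}" by (auto simp: sym_ball_iff)
    then have B: "sym_ball \<Omega> = {}" using True by simp
    then have v0: "AE x in lborel. v x = 0"
      using v_sol by (simp add: weak_solution_def H_dirichlet_def AE_completion_iff)
    have "(LINT x:ball 0 r|lebesgue. v x) = (LINT x|lborel. indicator (ball (0::'a) r) x * (0::real))" for r
      by (rule set_integral_AE) (simp, simp, use v0 in eventually_elim, simp)
    moreover have "schwarz \<Omega> u x = 0" for x by (simp add: schwarz_def B)
    ultimately show ?thesis
      unfolding energies unfolding B True by (simp add: set_lebesgue_integral_def B0)
  next
    case False
    have Rpos: "0 < R"
    proof (rule ccontr)
      assume "\<not> 0 < R"
      then have "ball (0::'a) R = {}" by simp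
      then have "emeasure lborel \<Omega> = 0" unfolding em by (simp only: emeasure_empty)
      then have "negligible \<Omega>" using \<Omega>(1) by (auto simp: negligible_iff_null_sets null_sets_def)
      then show False using open_not_negligible[OF assms(1) False] by blast
    qed
    obtain R' where R': "\<Omega> \<subseteq> ball 0 R'" using \<Omega>(2) bounded_subset_ballD by blast

    obtain K0 where K0: "K0 \<in> borel_measurable borel" "AE p in lborel. (case p of (x, y) \<Rightarrow> K x y) = K0 p"
      using lebesgue_borel_version[OF K_meas] .
    define K' where "K' x y = max 0 (K0 (x, y))" for x y
    have [measurable]: "K0 \<in> borel_measurable (borel \<Otimes>\<^sub>M borel)" using K0(1) by (simp add: borel_prod)
    have K'm: "(\<lambda>p. K' (fst p) (snd p)) \<in> borel_measurable (borel \<Otimes>\<^sub>M borel)"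
      unfolding K'_def by (simp only: prod.collapse) measurable
    have K'0: "0 \<le> K' x y" for x y by (simp add: K'_def)
    have K'eq: "AE x in lborel. AE y in lborel. K x y = K' x y"
    proof -
      have "AE p in lborel \<Otimes>\<^sub>M lborel. (case p of (x, y) \<Rightarrow> K x y) = K0 p" unfolding lborel_prod by (rule K0(2))
      then have "AE x in lborel. AE y in lborel. K x y = K0 (x, y)" by (drule_tac lborel_pair.AE_pair) simp
      then show ?thesis
      proof eventually_elim
        case (elim x)
        then show ?case by eventually_elim (use K_nonneg in \<open>auto simp: K'_def max_def\<close>, metis)
      qed
    qed

    obtain J0 where J0: "J0 \<in> borel_measurable borel" "AE z in lborel. J z = J0 z"
      using lebesgue_borel_version[OF J_meas] .
    define J' where "J' z = max 0 (J0 z)" for z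
    have J'm: "J' \<in> borel_measurable borel" unfolding J'_def using J0(1) by measurable
    have J'0: "0 \<le> J' z" for z by (simp add: J'_def)
    have J'eq: "AE z in lborel. J z = J' z"
      using J0(2) by eventually_elim (metis J_nonneg J'_def max.absorb2)
    have tr: "truncation J'"
    proof
      show "\<exists>t\<ge>0. distr_fun UNIV J' t \<le> ennreal \<sigma>" if "0 < \<sigma>" for \<sigma>
        by (rule levy_tail[OF J'm J'0 levy_integrable[OF K_levy K_ge_J J'm J'eq] that]) blast
      show "\<not> (AE z in lborel. J' z = 0)"
      proof
        assume "AE z in lborel. J' z = 0"
        then have "AE z in lborel. J z = 0" using J'eq by eventually_elim simp
        then show False using J_nonzero by (simp add: AE_completion_iff)
      qed
    qed (use J'm J'0 in auto)
    have J'K': "AE x in lborel. AE y in lborel. J' (x - y) \<le> K' x y"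
      using K'eq
    proof eventually_elim
      case (elim x)
      then show ?case using AE_lborel_reflect[OF J'eq, of x]
      proof eventually_elim
        case (elim y)
        then show ?case using K_ge_J[of x y] by simp
      qed
    qed
    have Js: "schwarz UNIV J = schwarz UNIV J'"
      unfolding schwarz_def
      by (subst decr_rearr_cong[of UNIV J UNIV J']) (rule distr_fun_version(1)[OF J'm], use J'eq in auto)

    obtain f' where f': "f' \<in> borel_measurable borel" "AE x in lborel. x \<in> \<Omega> \<longrightarrow> f x = f' x" "\<And>x. x \<notin> \<Omega> \<Longrightarrow> f' x = 0"
      "integrable lborel (\<lambda>x. (f' x)\<^sup>2)"
      by (rule L2_on_borel_version[OF f_L2 \<Omega>(1)], rule that, assumption, assumption, blast, assumption)

    obtain Mc where Mc: "AE x in lebesgue_on \<Omega>. \<bar>c x\<bar> \<le> Mc" and cm: "c \<in> borel_measurable (lebesgue_on \<Omega>)"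
      using c_Linf by (auto simp: Linf_on_def)
    obtain c0 where c0: "c0 \<in> borel_measurable borel" "AE x in lborel. x \<in> \<Omega> \<longrightarrow> c x = c0 x"
      by (rule lebesgue_on_borel_version[OF cm \<Omega>(1)], rule that, assumption, assumption)
    define M where "M = max 0 Mc"
    define c' where "c' x = indicator \<Omega> x * min M (max 0 (c0 x))" for x
    have c'm: "c' \<in> borel_measurable borel" unfolding c'_def using c0(1) \<Omega>(1) by measurable
    have on: "AE x in lborel. x \<in> \<Omega> \<longrightarrow> P x" if "AE x in lebesgue_on \<Omega>. P x" for P
      using that \<Omega>(1) by (simp add: AE_restrict_space_iff AE_completion_iff)
    have c'eq: "AE x in lborel. x \<in> \<Omega> \<longrightarrow> c x = c' x"
      using c0(2) on[OF Mc] on[OF c_nonneg]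
      by eventually_elim (auto simp: c'_def M_def)
    have c'0: "0 \<le> c' x" and c'M: "c' x \<le> M" and c'out: "x \<notin> \<Omega> \<Longrightarrow> c' x = 0" for x
      by (auto simp: c'_def M_def indicator_def)
    have cs: "incr_schwarz \<Omega> c = incr_schwarz \<Omega> c'"
    proof -
      have "decr_rearr \<Omega> c = decr_rearr \<Omega> c'"
        by (rule decr_rearr_cong) (rule distr_fun_version(1)[OF c'm \<Omega>(1) c'eq])
      then show ?thesis by (simp add: fun_eq_iff incr_schwarz_def incr_rearr_def)
    qed

    have uH: "u \<in> H_dirichlet \<Omega> K" and vH: "v \<in> H_dirichlet (sym_ball \<Omega>) (\<lambda>x y. schwarz UNIV J (x - y))"
      using u_sol v_sol by (simp_all add: weak_solution_def)
    obtain u' where u': "u' \<in> borel_measurable borel" "AE x in lborel. u x = u' x" "\<And>x. x \<notin> \<Omega> \<Longrightarrow> u' x = 0"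
      "integrable lborel (\<lambda>x. (u' x)\<^sup>2)" "kenergy K' u' < \<infinity>"
      by (rule H_dirichlet_borel_version[OF uH K'eq \<Omega>(1)], rule that, assumption, assumption, blast, assumption, assumption)
    have u'ae: "AE x in lborel. x \<in> \<Omega> \<longrightarrow> u x = u' x" using u'(2) by eventually_elim simp
    define U F where "U = schwarz UNIV u'" and "F = schwarz UNIV f'"
    have U: "schwarz \<Omega> u = U" unfolding U_def by (rule schwarz_version(1)[OF u'(1) \<Omega>(1) u'ae u'(3)])
    have F: "schwarz \<Omega> f = F" unfolding F_def by (rule schwarz_version(1)[OF f'(1) \<Omega>(1) f'(2,3)])
    have ub: "bsupp u'" "U \<in> L2ball R" using schwarz_L2ball[OF u'(1) \<Omega> u'(3,4) R] by (simp_all add: U_def)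
    have fb: "bsupp f'" "F \<in> L2ball R" using schwarz_L2ball[OF f'(1) \<Omega> f'(3,4) R] by (simp_all add: F_def)
    have F_rdec: "rdec F" unfolding F_def by (rule rdec_schwarz[OF fb(1)])
    have nonneg: "0 \<le> U x" "0 \<le> F x" for x by (simp_all add: U_def F_def)
    note meas = L2ballD(1)[OF ub(2)] L2ballD(1)[OF fb(2)]

    obtain v' where v': "v' \<in> borel_measurable borel" "AE x in lborel. v x = v' x" "\<And>x. x \<notin> ball 0 R \<Longrightarrow> v' x = 0"
      "integrable lborel (\<lambda>x. (v' x)\<^sup>2)" "kenergy (\<lambda>x y. schwarz UNIV J' (x - y)) v' < \<infinity>"
      by (rule H_dirichlet_borel_version[OF vH[unfolded Js R], of "\<lambda>x y. schwarz UNIV J' (x - y)"], simp, simp,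
        rule that, assumption, assumption, blast, assumption, assumption)
    have v'L: "v' \<in> L2ball R" using v' by (simp add: L2ball_def)
    have Jsm: "schwarz UNIV J' \<in> borel_measurable borel" by (rule truncation.Js_meas[OF tr])
    then have Jspm: "(\<lambda>p. schwarz UNIV J' (fst p - snd p)) \<in> borel_measurable (borel \<Otimes>\<^sub>M borel)" by measurable
    have csm: "incr_schwarz \<Omega> c' \<in> borel_measurable borel"
    proof -
      have "{x. c' x \<noteq> 0} \<subseteq> \<Omega>" using c'out by blast
      then have "bsupp c'" using c'm \<Omega>(2) bounded_subset by (auto simp: bsupp_def)
      then interpret incr_coeff \<Omega> c' M by unfold_locales (use \<Omega> c'0 c'M c'out in auto)
      show ?thesis by (rule incr_schwarz_measurable)
    qed
    have v_weak: "1 / 2 * (LINT z|(lborel \<Otimes>\<^sub>M lborel). schwarz UNIV J' (fst z - snd z)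
            * ((v' (fst z) - v' (snd z)) * (p (fst z) - p (snd z))))
          + (LINT x|lborel. incr_schwarz \<Omega> c' x * (v' x * p x)) = (LINT x|lborel. F x * p x)"
      if p: "p \<in> L2ball R" "kenergy (\<lambda>x y. schwarz UNIV J' (x - y)) p < \<infinity>" for p
      by (rule weak_borel[OF v_sol[unfolded R Js cs F] _ Jspm _ _ v'(1,2,5) csm _ meas(2) _ L2ballD(1,3,2)[OF p(1)] p(2)])
        auto
    have pos: "AE x in lborel. 0 \<le> v' x" and conc: "conc_le (\<lambda>x. ennreal (U x)) (\<lambda>x. ennreal (v' x))"
      unfolding U_def
      using comparison_borel[OF u_sol \<Omega> R Rpos K'm K'0 K'eq tr J'K' u' c'm c'eq c'0 c'M c'out f' v'L v'(5) v_weak[unfolded F_def]]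
      by simp_all

    have part1: "(LINT x:ball 0 r|lebesgue. schwarz \<Omega> u x) \<le> (LINT x:ball 0 r|lebesgue. v x)" for r
    proof -
      have iU: "integrable lborel (\<lambda>x. indicator (ball 0 r) x * U x)" and iv: "integrable lborel (\<lambda>x. indicator (ball 0 r) x * v' x)"
        using L2ball_mult[OF L2ball_indicator ub(2)] L2ball_mult[OF L2ball_indicator v'L] .
      have v'ind: "AE x in lborel. 0 \<le> indicator (ball 0 r) x * v' x" using pos by eventually_elim simp
      have ind: "ennreal (indicator (ball 0 r) x * g x) = ennreal (g x) * indicator (ball 0 r) x" for g :: "'a \<Rightarrow> real" and x
        by (simp add: indicator_def)
      have "ennreal (LINT x|lborel. indicator (ball 0 r) x * U x) = (\<integral>\<^sup>+x. ennreal (indicator (ball 0 r) x * U x) \<partial>lborel)"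
        by (rule nn_integral_eq_integral[symmetric, OF iU]) (simp add: nonneg)
      also have "\<dots> \<le> (\<integral>\<^sup>+x. ennreal (indicator (ball 0 r) x * v' x) \<partial>lborel)"
        using conc unfolding conc_le_def ind by blast
      also have "\<dots> = ennreal (LINT x|lborel. indicator (ball 0 r) x * v' x)"
        by (rule nn_integral_eq_integral[OF iv v'ind])
      finally have "(LINT x|lborel. indicator (ball 0 r) x * U x) \<le> (LINT x|lborel. indicator (ball 0 r) x * v' x)"
        by (subst (asm) ennreal_le_iff) (rule integral_nonneg_AE[OF v'ind])
      moreover have "(LINT x:ball 0 r|lebesgue. schwarz \<Omega> u x) = (LINT x|lborel. indicator (ball 0 r) x * U x)"
        by (rule set_integral_AE) (use meas U in auto)
      moreover have "(LINT x:ball 0 r|lebesgue. v x) = (LINT x|lborel. indicator (ball 0 r) x * v' x)"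
        by (rule set_integral_AE) (use v'(1,2) in auto)
      ultimately show ?thesis by simp
    qed

    have "(LINT x:\<Omega>|lebesgue. f x * u x) \<le> (LINT x:sym_ball \<Omega>|lebesgue. schwarz \<Omega> f x * v x)"
    proof -
      have out: "x \<notin> \<Omega>" if "x \<notin> ball 0 R'" for x using R' that by blast
      have f'L: "f' \<in> L2ball R'" and u'L: "u' \<in> L2ball R'"
        unfolding L2ball_def using f'(1,4) u'(1,4) f'(3)[OF out] u'(3)[OF out] by blast+
      have [measurable]: "f' \<in> borel_measurable borel" "u' \<in> borel_measurable borel" by fact+
      have i: "integrable lborel (\<lambda>x. \<bar>f' x\<bar> * \<bar>u' x\<bar>)"
        using integrable_abs[OF L2ball_mult[OF f'L u'L]] by (simp add: abs_mult)
      have iv: "integrable lborel (\<lambda>x. v' x * F x)" using L2ball_mult[OF v'L fb(2)] .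
      have v'F: "AE x in lborel. 0 \<le> v' x * F x" using pos by eventually_elim (simp add: nonneg)
      have "(LINT x:\<Omega>|lebesgue. f x * u x) = (LINT x|lborel. indicator \<Omega> x * (f' x * u' x))"
      proof (rule set_integral_AE[OF \<Omega>(1)])
        show "AE x in lborel. x \<in> \<Omega> \<longrightarrow> f x * u x = f' x * u' x" using f'(2) u'(2) by eventually_elim simp
      qed measurable
      also have "\<dots> = (LINT x|lborel. f' x * u' x)"
        by (rule Bochner_Integration.integral_cong) (use f'(3) in \<open>auto simp: indicator_def\<close>)
      also have "\<dots> \<le> (LINT x|lborel. \<bar>f' x\<bar> * \<bar>u' x\<bar>)"
        by (rule integral_mono[OF L2ball_mult[OF f'L u'L] i]) (metis abs_ge_self abs_mult)
      also have "\<dots> \<le> (LINT x|lborel. v' x * F x)"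
      proof -
        have "ennreal (LINT x|lborel. \<bar>f' x\<bar> * \<bar>u' x\<bar>) = (\<integral>\<^sup>+x. ennreal (\<bar>f' x\<bar> * \<bar>u' x\<bar>) \<partial>lborel)"
          by (rule nn_integral_eq_integral[symmetric, OF i]) simp
        also have "\<dots> = (\<integral>\<^sup>+x. ennreal \<bar>u' x\<bar> * ennreal \<bar>f' x\<bar> \<partial>lborel)"
          by (simp add: ennreal_mult mult.commute)
        also have "\<dots> \<le> (\<integral>\<^sup>+x. ennreal (U x) * ennreal (F x) \<partial>lborel)"
          unfolding U_def F_def by (rule hardy_littlewood[OF ub(1) fb(1)])
        also have "\<dots> \<le> (\<integral>\<^sup>+x. ennreal (v' x) * ennreal (F x) \<partial>lborel)"
          by (rule conc_le_mult[OF conc _ _ F_rdec]) (use meas v'(1) in measurable)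
        also have "\<dots> = (\<integral>\<^sup>+x. ennreal (v' x * F x) \<partial>lborel)"
          by (simp add: ennreal_mult'' nonneg)
        also have "\<dots> = ennreal (LINT x|lborel. v' x * F x)" by (rule nn_integral_eq_integral[OF iv v'F])
        finally show ?thesis by (subst (asm) ennreal_le_iff) (rule integral_nonneg_AE[OF v'F])
      qed
      also have "\<dots> = (LINT x|lborel. indicator (ball 0 R) x * (F x * v' x))"
        by (rule Bochner_Integration.integral_cong) (use v'(3) in \<open>auto simp: indicator_def\<close>)
      also have "\<dots> = (LINT x:sym_ball \<Omega>|lebesgue. schwarz \<Omega> f x * v x)"
        unfolding F R
      proof (rule set_integral_AE[symmetric])
        show "(\<lambda>x. F x * v' x) \<in> borel_measurable borel" using meas v'(1) by measurable
        show "AE x in lborel. x \<in> ball 0 R \<longrightarrow> F x * v x = F x * v' x" using v'(2) by eventually_elim simp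
      qed simp
      finally show ?thesis .
    qed
    then show ?thesis unfolding energies using part1 by blast
  qed
qed

end
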